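(* Let $Q$ be an open non-degenerate parallelepiped in $\mathbb{R}^N$, $p>1$, $\frac1p+\frac1q=1$, and let $\beta:\mathbb{R}^N\times\mathbb{R}^N\to2^{\mathbb{R}^N}$ belong to the class $M_p$ described in the context and be $Q$-periodic in its first variable. Let $L:\mathbb{R}^N\times\mathbb{R}^N\times\mathbb{R}^N\to\mathbb{R}$ be a measurable family of selfdual Lagrangians, $Q$-periodic in $x$, satisfying the growth condition in the context, with $\beta(x,\cdot)=\bar\partial L(x,\cdot)$ for a.e. $x$. Define $$\beta_{hom}(\xi)=\Big\{\frac1{|Q|}\int_Qg(y)\,dy:\ g\in L^q_{\mathrm{sol}}(Q;\mathbb{R}^N),\ g(y)\in\beta(y,\xi+\nabla\psi(y))\text{ for a.e. }y\in Q\text{ for some }\psi\in W^{1,p}_\#(Q)\Big\},$$ $$L_{hom}(\xi,\eta)=\min_{\substack{\phi\in W^{1,p}_\#(Q)\\ g\in L^q_\#(Q;\mathbb{R}^N)}}\frac1{|Q|}\int_QL\big(x,\xi+\nabla\phi(x),\eta+g(x)\big)\,dx .$$ Then $L_{hom}$ is a selfdual Lagrangian on $\mathbb{R}^N\times\mathbb{R}^N$ and $\beta_{hom}=\bar\partial L_{hom}$.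
   Context: Class $M_p$: possibly multivalued maps $\beta:\mathbb{R}^N\times\mathbb{R}^N\to2^{\mathbb{R}^N}$ with closed values such that (i) $\beta$ is measurable with respect to $\mathcal{L}(\mathbb{R}^N)\otimes\mathcal{B}(\mathbb{R}^N)$ and $\mathcal{B}(\mathbb{R}^N)$ (Lebesgue sets in $x$, Borel sets in $\xi$); (ii) for a.e. $x$, $\beta(x,\cdot)$ is maximal monotone on $\mathbb{R}^N$; (iii) there are constants $m_1,m_2\ge0$ and $c_1,c_2>0$ with $\langle\xi,\eta\rangle\ge\max\{\frac{c_1}{p}|\xi|^p-m_1,\frac{c_2}{q}|\eta|^q-m_2\}$ for a.e. $x$, all $\xi$ and all $\eta\in\beta(x,\xi)$. A selfdual Lagrangian on $\mathbb{R}^N\times\mathbb{R}^N$ is a convex lower semicontinuous $L:\mathbb{R}^N\times\mathbb{R}^N\to\mathbb{R}\cup\{+\infty\}$ with $L^*(b,a)=L(a,b)$ for all $a,b$, where $L^*(b,a)=\sup_{\xi,\eta}\{\langle b,\xi\rangle+\langle a,\eta\rangle-L(\xi,\eta)\}$; $\bar\partial L(a)=\{b:L(a,b)=\langle a,b\rangle\}$. Family $L$: $L(x,a,b)$ is measurable (Lebesgue in $x$, Borel in $(a,b)$), each $L(x,\cdot,\cdot)$ is a selfdual Lagrangian. Growth condition: there are constants $C_0,C_1>0$ and $n_0,n_1\in L^1(Q)$ (extended $Q$-periodically) with $C_0(|a|^p+|b|^q-n_0(x))\le L(x,a,b)\le C_1(|a|^p+|b|^q+n_1(x))$ for all $a,b$.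 $W^{1,p}_\#(Q)$: $Q$-periodic $u\in W^{1,p}(Q)$ with $\int_Qu=0$. $L^q_{\mathrm{sol}}(Q;\mathbb{R}^N)$: all $g\in L^q(Q;\mathbb{R}^N)$ with $\int_Q\langle g,\nabla\phi\rangle\,dx=0$ for all $\phi\in W^{1,p}_\#(Q)$. $L^q_\#(Q;\mathbb{R}^N)$: those $g\in L^q_{\mathrm{sol}}(Q;\mathbb{R}^N)$ with $\int_Qg\,dx=0$. *)

theory Defs
  imports "HOL-Analysis.Analysis"
begin

section \<open>Maximal monotone maps and the class \<open>M\<^sub>p\<close>\<close>

definition monotone_multimap :: "('a::real_inner \<Rightarrow> 'a set) \<Rightarrow> bool" where
  "monotone_multimap B \<longleftrightarrow>
     (\<forall>x y. \<forall>b\<in>B x. \<forall>c\<in>B y. 0 \<le> inner (b - c) (x - y))"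

definition maximal_monotone :: "('a::real_inner \<Rightarrow> 'a set) \<Rightarrow> bool" where
  "maximal_monotone B \<longleftrightarrow> monotone_multimap B \<and>
     (\<forall>B'. monotone_multimap B' \<and> (\<forall>x. B x \<subseteq> B' x) \<longrightarrow> B' = B)"

text \<open>Measurability of a closed-valued multifunction is meant in the usual sense of set-valued
  analysis: preimages of closed sets, i.e. the sets of points whose value meets the given closed
  set, are measurable. For closed values in \<open>\<real>\<^sup>N\<close>, testing with open sets gives the same notion.\<close>

definition class_M :: "real \<Rightarrow> real \<Rightarrow> (real^'n \<Rightarrow> real^'n \<Rightarrow> (real^'n) set) \<Rightarrow> bool" where
  "class_M p q \<beta> \<longleftrightarrow>
     (\<forall>x \<xi>. closed (\<beta> x \<xi>)) \<and>
     (\<forall>C. closed C \<longrightarrow> {(x, \<xi>). \<beta> x \<xi> \<inter> C \<noteq> {}} \<in> sets (lebesgue \<Otimes>\<^sub>M borel)) \<and>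
     (AE x in lebesgue. maximal_monotone (\<beta> x)) \<and>
     (\<exists>m1 m2 c1 c2. 0 \<le> m1 \<and> 0 \<le> m2 \<and> 0 < c1 \<and> 0 < c2 \<and>
        (AE x in lebesgue. \<forall>\<xi>. \<forall>\<eta>\<in>\<beta> x \<xi>.
           inner \<xi> \<eta> \<ge> max (c1 / p * norm \<xi> powr p - m1) (c2 / q * norm \<eta> powr q - m2)))"


section \<open>Selfdual Lagrangians\<close>

definition convex_ereal :: "('b::real_vector \<Rightarrow> ereal) \<Rightarrow> bool" where
  "convex_ereal f \<longleftrightarrow>
     (\<forall>x y u v. 0 \<le> u \<and> 0 \<le> v \<and> u + v = 1 \<longrightarrow>
        f (u *\<^sub>R x + v *\<^sub>R y) \<le> ereal u * f x + ereal v * f y)"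

definition lower_semicontinuous :: "('b::topological_space \<Rightarrow> ereal) \<Rightarrow> bool" where
  "lower_semicontinuous f \<longleftrightarrow> (\<forall>x. f x \<le> Liminf (at x) f)"

text \<open>\<open>lagrangian_dual \<Lambda> (b, a)\<close> is \<open>\<Lambda>\<^sup>*(b, a)\<close>, the Legendre-Fenchel dual in both variables.\<close>

definition lagrangian_dual :: "('a::real_inner \<times> 'a \<Rightarrow> ereal) \<Rightarrow> 'a \<times> 'a \<Rightarrow> ereal" where
  "lagrangian_dual \<Lambda> = (\<lambda>(b, a). SUP (\<xi>, \<eta>). ereal (inner b \<xi> + inner a \<eta>) - \<Lambda> (\<xi>, \<eta>))"

definition selfdual_Lagrangian :: "('a::real_inner \<times> 'a \<Rightarrow> ereal) \<Rightarrow> bool" where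
  "selfdual_Lagrangian \<Lambda> \<longleftrightarrow>
     (\<forall>z. \<Lambda> z \<noteq> -\<infinity>) \<and> convex_ereal \<Lambda> \<and> lower_semicontinuous \<Lambda> \<and>
     (\<forall>a b. lagrangian_dual \<Lambda> (b, a) = \<Lambda> (a, b))"

text \<open>The map \<open>\<partial>\<^sup>-\<Lambda>\<close> (with a bar over the partial sign) generated by a selfdual Lagrangian.\<close>

definition selfdual_subdiff :: "('a::real_inner \<times> 'a \<Rightarrow> ereal) \<Rightarrow> 'a \<Rightarrow> 'a set" where
  "selfdual_subdiff \<Lambda> a = {b. \<Lambda> (a, b) = ereal (inner a b)}"


section \<open>Periodic function spaces on a parallelepiped\<close>

text \<open>The open parallelepiped with vertex \<open>a\<close> and edge vectors \<open>v i\<close>; it is non-degenerate when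
  \<open>v\<close> enumerates a basis.\<close>

definition parallelepiped :: "real^'n \<Rightarrow> ('n \<Rightarrow> real^'n) \<Rightarrow> (real^'n) set" where
  "parallelepiped a v = {a + (\<Sum>i\<in>UNIV. t i *\<^sub>R v i) |t. \<forall>i. 0 < t i \<and> t i < 1}"

definition periodic_wrt :: "('n \<Rightarrow> real^'n) \<Rightarrow> (real^'n \<Rightarrow> 'b) \<Rightarrow> bool" where
  "periodic_wrt v f \<longleftrightarrow> (\<forall>x i. f (x + v i) = f x)"

text \<open>Elements of the Lebesgue and Sobolev spaces below are functions, not equivalence classes.\<close>

definition Lp_on :: "real \<Rightarrow> (real^'n) set \<Rightarrow> (real^'n \<Rightarrow> 'b::euclidean_space) set" where
  "Lp_on p S = {f. f \<in> borel_measurable (lebesgue_on S) \<and>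
                   integrable (lebesgue_on S) (\<lambda>x. norm (f x) powr p)}"

definition locally_integrable :: "(real^'n \<Rightarrow> 'b::euclidean_space) \<Rightarrow> bool" where
  "locally_integrable f \<longleftrightarrow> (\<forall>K. compact K \<longrightarrow> set_integrable lebesgue K f)"

text \<open>\<open>G\<close> is a weak gradient of \<open>u\<close> on the whole space. As in Gilbarg-Trudinger, Section 7.3, first
  order weak derivatives are tested with compactly supported \<open>C\<^sup>1\<close> functions.\<close>

definition has_weak_gradient :: "(real^'n \<Rightarrow> real) \<Rightarrow> (real^'n \<Rightarrow> real^'n) \<Rightarrow> bool" where
  "has_weak_gradient u G \<longleftrightarrow>
     locally_integrable u \<and> locally_integrable G \<and>
     (\<forall>\<phi> D\<phi>. (\<forall>x. GDERIV \<phi> x :> D\<phi> x) \<and> continuous_on UNIV D\<phi> \<and> bounded {x. \<phi> x \<noteq> 0} \<longrightarrow>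
        (LINT x|lebesgue. u x *\<^sub>R D\<phi> x) = - (LINT x|lebesgue. \<phi> x *\<^sub>R G x))"

text \<open>\<open>W\<^sup>1\<^sup>,\<^sup>p\<close> functions on \<open>Q\<close> that are \<open>Q\<close>-periodic in the Sobolev sense, i.e. whose periodic
  extension is still weakly differentiable across the faces of \<open>Q\<close>, with zero mean. This is why the
  weak gradient is taken on the whole space and not just on \<open>Q\<close>. Any two weak gradients agree a.e.,
  so below \<open>\<nabla>u\<close> is rendered by an arbitrary \<open>G\<close> with \<open>has_weak_gradient u G\<close>.\<close>

definition W1p_per :: "real \<Rightarrow> (real^'n) set \<Rightarrow> ('n \<Rightarrow> real^'n) \<Rightarrow> (real^'n \<Rightarrow> real) set" where
  "W1p_per p Q v = {u. periodic_wrt v u \<and> u \<in> Lp_on p Q \<and>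
     (\<exists>G. has_weak_gradient u G \<and> G \<in> Lp_on p Q) \<and>
     (LINT x|lebesgue_on Q. u x) = 0}"

definition Lq_sol ::
  "real \<Rightarrow> real \<Rightarrow> (real^'n) set \<Rightarrow> ('n \<Rightarrow> real^'n) \<Rightarrow> (real^'n \<Rightarrow> real^'n) set" where
  "Lq_sol p q Q v = {g. g \<in> Lp_on q Q \<and>
     (\<forall>\<phi>\<in>W1p_per p Q v. \<forall>G. has_weak_gradient \<phi> G \<longrightarrow>
        (LINT x|lebesgue_on Q. inner (g x) (G x)) = 0)}"

definition Lq_sharp ::
  "real \<Rightarrow> real \<Rightarrow> (real^'n) set \<Rightarrow> ('n \<Rightarrow> real^'n) \<Rightarrow> (real^'n \<Rightarrow> real^'n) set" where
  "Lq_sharp p q Q v = {g \<in> Lq_sol p q Q v. (LINT x|lebesgue_on Q. g x) = 0}"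


section \<open>Homogenized map and Lagrangian\<close>

text \<open>The growth condition is required for a.e. \<open>x\<close>, since \<open>n0\<close> and \<open>n1\<close> are \<open>L\<^sup>1\<close> functions.\<close>

definition growth_condition ::
  "real \<Rightarrow> real \<Rightarrow> (real^'n) set \<Rightarrow> ('n \<Rightarrow> real^'n) \<Rightarrow>
   (real^'n \<Rightarrow> (real^'n) \<times> (real^'n) \<Rightarrow> real) \<Rightarrow> bool" where
  "growth_condition p q Q v L \<longleftrightarrow>
     (\<exists>C0 C1 n0 n1. 0 < C0 \<and> 0 < C1 \<and>
        integrable (lebesgue_on Q) n0 \<and> periodic_wrt v n0 \<and>
        integrable (lebesgue_on Q) n1 \<and> periodic_wrt v n1 \<and>
        (AE x in lebesgue. \<forall>a b.
           C0 * (norm a powr p + norm b powr q - n0 x) \<le> L x (a, b) \<and>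
           L x (a, b) \<le> C1 * (norm a powr p + norm b powr q + n1 x)))"

definition beta_hom ::
  "real \<Rightarrow> real \<Rightarrow> (real^'n) set \<Rightarrow> ('n \<Rightarrow> real^'n) \<Rightarrow>
   (real^'n \<Rightarrow> real^'n \<Rightarrow> (real^'n) set) \<Rightarrow> real^'n \<Rightarrow> (real^'n) set" where
  "beta_hom p q Q v \<beta> \<xi> =
     {(1 / measure lebesgue Q) *\<^sub>R (LINT y|lebesgue_on Q. g y) |g.
        g \<in> Lq_sol p q Q v \<and>
        (\<exists>\<psi>\<in>W1p_per p Q v. \<exists>G. has_weak_gradient \<psi> G \<and>
           (AE y in lebesgue_on Q. g y \<in> \<beta> y (\<xi> + G y)))}"

text \<open>The values over which the minimum defining \<open>L\<^sub>h\<^sub>o\<^sub>m\<close> is taken.\<close>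

definition hom_energies ::
  "real \<Rightarrow> real \<Rightarrow> (real^'n) set \<Rightarrow> ('n \<Rightarrow> real^'n) \<Rightarrow>
   (real^'n \<Rightarrow> (real^'n) \<times> (real^'n) \<Rightarrow> real) \<Rightarrow> real^'n \<Rightarrow> real^'n \<Rightarrow> real set" where
  "hom_energies p q Q v L \<xi> \<eta> =
     {1 / measure lebesgue Q * (LINT x|lebesgue_on Q. L x (\<xi> + G x, \<eta> + g x)) |\<phi> G g.
        \<phi> \<in> W1p_per p Q v \<and> has_weak_gradient \<phi> G \<and> g \<in> Lq_sharp p q Q v}"

text \<open>Defined as an infimum; that it is attained has to be shown separately.\<close>

definition L_hom ::
  "real \<Rightarrow> real \<Rightarrow> (real^'n) set \<Rightarrow> ('n \<Rightarrow> real^'n) \<Rightarrow>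
   (real^'n \<Rightarrow> (real^'n) \<times> (real^'n) \<Rightarrow> real) \<Rightarrow> (real^'n) \<times> (real^'n) \<Rightarrow> ereal" where
  "L_hom p q Q v L = (\<lambda>(\<xi>, \<eta>). INF e\<in>hom_energies p q Q v L \<xi> \<eta>. ereal e)"

end

theory Submission
  imports Defs
begin

text \<open>Write \<open>f\<close> for \<open>L_hom\<close> and \<open>E(u, w)\<close> for the mean of \<open>L(x, u(x), w(x))\<close> over the cell. Minimisers exist by
  a direct method without weak topologies: a nested sequence of convex sets of functions that is bounded
  in \<open>L\<^sup>1\<close> contains a sequence that converges almost everywhere. Integrating the pointwise Fenchel inequality
  gives \<open>\<langle>b, \<xi>\<rangle> + \<langle>a, \<eta>\<rangle> \<le> f(a, b) + f(\<xi>, \<eta>)\<close>, since gradients and solenoidal fields are orthogonal.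

  For the equality in some \<open>(\<xi>, \<eta>)\<close> one minimises \<open>E(u', w') + \<mu> (\<integral>|u - u'|\<^sup>p + |w - w'|\<^sup>q) - \<integral>\<langle>b, u\<rangle> - \<integral>\<langle>a, w\<rangle>\<close>,
  where \<open>u\<close> is a constant plus a periodic gradient, \<open>w\<close> is solenoidal and \<open>u'\<close>, \<open>w'\<close> are arbitrary. The
  gradient \<open>\<zeta>\<close> of the penalty at a minimiser is explicit; it is pointwise a subgradient of \<open>L\<close> at \<open>(u', w')\<close>,
  and \<open>\<zeta> - (b, a)\<close> annihilates the admissible \<open>(u, w)\<close>, so that \<open>\<zeta>\<close>, with its components exchanged, is
  admissible for \<open>f(a, b)\<close>. Selfduality of \<open>L\<close> bounds \<open>f(a, b)\<close> by the dual value, and \<open>\<mu> \<rightarrow> \<infinity>\<close> removes the penalty.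
  Finally \<open>f(\<xi>, \<eta>) = \<langle>\<xi>, \<eta>\<rangle>\<close> means that a minimiser satisfies \<open>L = \<langle>u, w\<rangle>\<close> almost everywhere, which
  is the inclusion defining \<open>beta_hom\<close>.

  The periodic gradients are closed under almost everywhere limits of sequences bounded in \<open>L\<^sup>p\<close> by a
  Poincare inequality, which comes from \<open>u(x + h) - u(x) = \<integral>\<^sub>0\<^sup>1 \<langle>G(x + t h), h\<rangle> dt\<close>; the same formula with
  \<open>h\<close> an edge of the cell shows that the gradients have mean zero.\<close>

section \<open>Powers of norms\<close>

text \<open>Two obstacles shape the proof. The first is to obtain limits from bounded sequences
  without weak compactness. Strict convexity helps: near minimisers of the integral of
  \<open>norm (1, f)\<close> over decreasing convex sets are Cauchy in measure, and almost
  everywhere convergence with an L^p bound suffices to pass to the limit in linear pairings and, by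
  Fatou, in convex energies. Hence constraint sets are asked to be stable under midpoints and under
  such limits.

  The second is that a minimiser over constrained pairs yields an optimality condition only against
  gradients and solenoidal fields, whereas selfduality of L(x, .) calls for a pointwise subgradient.
  Doubling the variables separates the roles: (u, w) carries the constraint, (u', w') the integrand.
  The penalty has exponents p and q because its gradient then lies in L^q x L^p, the spaces of the
  exchanged pair. That its second component is, up to a constant, again a periodic gradient is a
  bipolar statement, proved by projection in L^p.\<close>

lemma conjugate_exponent_props:
  fixes p q :: real
  assumes "1 < p" "1 / p + 1 / q = 1"
  shows "1 < q" "(p - 1) * q = p" "1 / q + 1 / p = 1" "q = p / (p - 1)"
proof -
  have q: "1 / q = (p - 1) / p" using assms by (simp add: field_simps)
  then have q0: "q \<noteq> 0" using assms by auto
  show *: "q = p / (p - 1)" using q q0 assms by (simp add: field_simps)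
  show "1 < q" unfolding * using assms by (simp add: field_simps)
  show "(p - 1) * q = p" unfolding * using assms by simp
  show "1 / q + 1 / p = 1" using assms by simp
qed

lemma powr_add_le_two_powr:
  fixes a b p :: real
  assumes "0 \<le> a" "0 \<le> b" "0 < p"
  shows "(a + b) powr p \<le> 2 powr p * (a powr p + b powr p)"
proof -
  have "(a + b) powr p \<le> (2 * max a b) powr p"
    using assms by (intro powr_mono2) auto
  also have "\<dots> = 2 powr p * (max a b) powr p"
    using assms by (simp add: powr_mult)
  also have "(max a b) powr p \<le> a powr p + b powr p"
    by (auto simp: max_def)
  finally show ?thesis by simp
qed

lemma norm_add_powr_le:
  fixes a b :: "'a::real_normed_vector"
  assumes "0 < p"
  shows "norm (a + b) powr p \<le> 2 powr p * (norm a powr p + norm b powr p)"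
proof -
  have "norm (a + b) powr p \<le> (norm a + norm b) powr p"
    using assms by (intro powr_mono2 norm_triangle_ineq) auto
  also have "\<dots> \<le> 2 powr p * (norm a powr p + norm b powr p)"
    using assms by (intro powr_add_le_two_powr) auto
  finally show ?thesis .
qed

lemma norm_diff_powr_le:
  fixes a b :: "'a::real_normed_vector"
  assumes "0 < p"
  shows "norm (a - b) powr p \<le> 2 powr p * (norm a powr p + norm b powr p)"
  using norm_add_powr_le[of p a "- b"] assms by simp

lemma Young_mult_le:
  fixes a b p q :: real
  assumes "1 < p" "1 / p + 1 / q = 1" "0 \<le> a" "0 \<le> b"
  shows "a * b \<le> a powr p + b powr q"
proof -
  have q: "1 < q" using conjugate_exponent_props assms by blast
  have "a * b \<le> a powr p / p + b powr q / q"
    using Youngs_inequality[of p q a b] assms q by auto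
  also have "a powr p / p \<le> a powr p"
    using assms by (simp add: divide_le_eq mult_le_cancel_left1)
  also have "b powr q / q \<le> b powr q"
    using q by (simp add: divide_le_eq mult_le_cancel_left1)
  finally show ?thesis by simp
qed

lemma linear_le_powr:
  fixes b \<delta> p :: real
  assumes "1 < p" "0 < \<delta>"
  obtains C where "0 \<le> C" "\<And>s. 0 \<le> s \<Longrightarrow> b * s \<le> \<delta> * s powr p + C"
proof -
  define q where "q = p / (p - 1)"
  have pq: "1 / p + 1 / q = 1" using assms by (simp add: q_def field_simps)
  \<comment> \<open>With this scaling the first term of Young's inequality has exactly the
    coefficient \<open>\<delta>\<close>.\<close>
  define k where "k = \<delta> powr (1 / p)"
  have k: "0 < k" "k powr p = \<delta>" using assms by (auto simp: k_def powr_powr)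
  show ?thesis
  proof (rule that[of "(\<bar>b\<bar> / k) powr q"])
    fix s :: real assume s: "0 \<le> s"
    have "b * s \<le> \<bar>b\<bar> * s" using s by (simp add: mult_right_mono)
    also have "\<dots> = (k * s) * (\<bar>b\<bar> / k)" using k by simp
    also have "\<dots> \<le> (k * s) powr p + (\<bar>b\<bar> / k) powr q"
      using assms pq k s by (intro Young_mult_le) auto
    also have "(k * s) powr p = \<delta> * s powr p" using k s by (simp add: powr_mult)
    finally show "b * s \<le> \<delta> * s powr p + (\<bar>b\<bar> / k) powr q" .
  qed simp
qed

text \<open>The gradient of \<open>norm y powr p / p\<close>. At the origin it is 0 for every p,
  also when the exponent \<open>p - 2\<close> is negative, because the scalar multiplies the zero
  vector.\<close>

definition duality_map :: "real \<Rightarrow> 'a::real_inner \<Rightarrow> 'a" where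
  "duality_map p y = (norm y powr (p - 2)) *\<^sub>R y"

lemma norm_duality_map: "norm (duality_map p y) = norm y powr (p - 1)"
proof (cases "y = 0")
  case False
  then have "norm (duality_map p y) = norm y powr (p - 2) * norm y powr 1"
    by (simp add: duality_map_def)
  also have "\<dots> = norm y powr (p - 1)" unfolding powr_add[symmetric] by simp
  finally show ?thesis .
qed (simp add: duality_map_def)

lemma inner_duality_map: "inner (duality_map p y) y = norm y powr p"
proof (cases "y = 0")
  case False
  then have "inner (duality_map p y) y = norm y powr (p - 2) * norm y powr 2"
    by (simp add: duality_map_def power2_norm_eq_inner)
  also have "\<dots> = norm y powr p" unfolding powr_add[symmetric] by simp
  finally show ?thesis .
qed (simp add: duality_map_def)

lemma norm_duality_map_powr:
  assumes "1 < p" "1 / p + 1 / q = 1"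
  shows "norm (duality_map p y) powr q = norm y powr p"
  using conjugate_exponent_props[OF assms] by (simp add: norm_duality_map powr_powr)

text \<open>Only the origin needs care, since \<open>norm y powr (p - 2)\<close> may blow up near
  it; the norm of the product is \<open>norm y powr (p - 1)\<close>, which tends to 0.\<close>

lemma continuous_on_duality_map:
  assumes "1 < p"
  shows "continuous_on UNIV (duality_map p :: 'a::real_inner \<Rightarrow> 'a)"
proof -
  have "isCont (duality_map p) (y :: 'a)" for y
  proof (cases "y = 0")
    case True
    have "((\<lambda>z::'a. norm z powr (p - 1)) \<longlongrightarrow> 0) (at 0)"
      using assms by (auto intro!: tendsto_eq_intros tendsto_zero_powrI)
    then have "((\<lambda>z::'a. norm (duality_map p z)) \<longlongrightarrow> 0) (at 0)"
      by (simp add: norm_duality_map)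
    then have "(duality_map p \<longlongrightarrow> (0::'a)) (at 0)"
      by (rule tendsto_norm_zero_cancel)
    then show ?thesis using True by (simp add: isCont_def duality_map_def)
  next
    case False
    then show ?thesis unfolding duality_map_def
      by (intro continuous_intros) auto
  qed
  then show ?thesis by (simp add: continuous_on_eq_continuous_at)
qed

lemma borel_measurable_duality_map:
  assumes "1 < p"
  shows "duality_map p \<in> borel_measurable (borel :: 'a::euclidean_space measure)"
  using continuous_on_duality_map[OF assms] by (rule borel_measurable_continuous_onI)

text \<open>Young's inequality for \<open>norm b\<close> and \<open>norm (duality_map p a)\<close>,
  whose q-th power is \<open>norm a powr p\<close>, bounds \<open>inner (duality_map p a) b\<close>.
  No derivative of the norm is taken.\<close>

lemma norm_powr_subgradient:
  fixes a b :: "'a::real_inner"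
  assumes "1 < p"
  shows "norm a powr p + p * inner (duality_map p a) (b - a) \<le> norm b powr p"
proof -
  define q where "q = p / (p - 1)"
  have pq: "1 / p + 1 / q = 1" using assms by (simp add: q_def field_simps)
  have q: "1 < q" using conjugate_exponent_props assms pq by blast
  have "inner (duality_map p a) b \<le> norm (duality_map p a) * norm b"
    by (rule norm_cauchy_schwarz)
  also have "\<dots> = norm b * norm (duality_map p a)" by simp
  also have "\<dots> \<le> norm b powr p / p + norm (duality_map p a) powr q / q"
    using assms pq q by (intro Youngs_inequality) auto
  also have "norm (duality_map p a) powr q = norm a powr p"
    using norm_duality_map_powr[OF assms pq] .
  finally have "p * inner (duality_map p a) b \<le> p * (norm b powr p / p + norm a powr p / q)"
    using assms by simp
  also have "\<dots> = norm b powr p + (p - 1) * norm a powr p"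
    using assms by (simp add: q_def field_simps)
  finally show ?thesis using assms
    by (simp add: inner_diff_right inner_duality_map algebra_simps)
qed

text \<open>The subgradient inequalities at the midpoint, tested with \<open>a\<close> and with
  \<open>b\<close>, have opposite linear terms, so their mean is the claim.\<close>

lemma norm_powr_midpoint:
  fixes a b :: "'a::real_inner"
  assumes "1 < p"
  shows "norm ((1/2) *\<^sub>R (a + b)) powr p \<le> (norm a powr p + norm b powr p) / 2"
proof -
  define m where "m = (1/2) *\<^sub>R (a + b)"
  have "(a - m) + (b - m) = (a + b) - (m + m)" by (simp only: add_diff_add)
  also have "m + m = a + b" unfolding m_def scaleR_add_left[symmetric] by simp
  finally have "inner (duality_map p m) (a - m) + inner (duality_map p m) (b - m) = 0"
    by (simp flip: inner_add_right)
  then have "p * inner (duality_map p m) (a - m) + p * inner (duality_map p m) (b - m) = 0"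
    by (metis distrib_left mult_zero_right)
  then have "norm m powr p \<le> (norm a powr p + norm b powr p) / 2"
    using norm_powr_subgradient[OF assms, of m a] norm_powr_subgradient[OF assms, of m b] by simp
  then show ?thesis unfolding m_def .
qed

section \<open>Lebesgue spaces over a finite measure\<close>

text \<open>An analogue of \<open>Lp_on\<close> over an arbitrary measure, so that the variational
  argument is independent of the cell.\<close>

definition Lebesgue_space :: "'a measure \<Rightarrow> real \<Rightarrow> ('a \<Rightarrow> 'b::euclidean_space) set" where
  "Lebesgue_space M p = {f \<in> borel_measurable M. integrable M (\<lambda>x. norm (f x) powr p)}"

lemma Lebesgue_spaceI:
  "f \<in> borel_measurable M \<Longrightarrow> integrable M (\<lambda>x. norm (f x) powr p) \<Longrightarrow> f \<in> Lebesgue_space M p"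
  by (simp add: Lebesgue_space_def)

lemma Lebesgue_space_measurable: "f \<in> Lebesgue_space M p \<Longrightarrow> f \<in> borel_measurable M"
  by (simp add: Lebesgue_space_def)

lemma Lebesgue_space_integrable:
  "f \<in> Lebesgue_space M p \<Longrightarrow> integrable M (\<lambda>x. norm (f x) powr p)"
  by (simp add: Lebesgue_space_def)

lemma Lebesgue_space_zero: "(\<lambda>x. 0) \<in> Lebesgue_space M p"
  by (simp add: Lebesgue_space_def)

lemma Lebesgue_space_cong_AE:
  assumes "f \<in> Lebesgue_space M p" "g \<in> borel_measurable M" "AE x in M. f x = g x"
  shows "g \<in> Lebesgue_space M p"
proof (rule Lebesgue_spaceI)
  have [measurable]: "f \<in> borel_measurable M" "g \<in> borel_measurable M"
    using assms Lebesgue_space_measurable by auto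
  show "integrable M (\<lambda>x. norm (g x) powr p)"
    by (rule integrable_cong_AE_imp[OF Lebesgue_space_integrable[OF assms(1)]])
      (use assms(3) in auto)
qed fact

lemma Lebesgue_space_scaleR:
  assumes "f \<in> Lebesgue_space M p"
  shows "(\<lambda>x. c *\<^sub>R f x) \<in> Lebesgue_space M p"
proof (rule Lebesgue_spaceI)
  have [measurable]: "f \<in> borel_measurable M" using assms by (rule Lebesgue_space_measurable)
  show "(\<lambda>x. c *\<^sub>R f x) \<in> borel_measurable M" by measurable
  show "integrable M (\<lambda>x. norm (c *\<^sub>R f x) powr p)"
    using Lebesgue_space_integrable[OF assms] by (simp add: powr_mult)
qed

lemma Lebesgue_space_add:
  assumes "0 < p" "f \<in> Lebesgue_space M p" "g \<in> Lebesgue_space M p"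
  shows "(\<lambda>x. f x + g x) \<in> Lebesgue_space M p"
proof (rule Lebesgue_spaceI)
  have [measurable]: "f \<in> borel_measurable M" "g \<in> borel_measurable M"
    using assms by (auto dest: Lebesgue_space_measurable)
  show "(\<lambda>x. f x + g x) \<in> borel_measurable M" by measurable
  show "integrable M (\<lambda>x. norm (f x + g x) powr p)"
  proof (rule Bochner_Integration.integrable_bound)
    show "integrable M (\<lambda>x. 2 powr p * (norm (f x) powr p + norm (g x) powr p))"
      using assms by (auto dest: Lebesgue_space_integrable)
    show "AE x in M. norm (norm (f x + g x) powr p)
        \<le> norm (2 powr p * (norm (f x) powr p + norm (g x) powr p))"
      using norm_add_powr_le[OF assms(1)] by auto
  qed measurable
qed

lemma Lebesgue_space_diff:
  assumes "0 < p" "f \<in> Lebesgue_space M p" "g \<in> Lebesgue_space M p"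
  shows "(\<lambda>x. f x - g x) \<in> Lebesgue_space M p"
  using Lebesgue_space_add[OF assms(1,2) Lebesgue_space_scaleR[OF assms(3), of "-1"]] by simp

lemma Lebesgue_space_dual_norm:
  assumes "1 < p" "1 / p + 1 / q = 1" "f \<in> Lebesgue_space M p" "g \<in> Lebesgue_space M q"
  shows "integrable M (\<lambda>x. norm (f x) * norm (g x))"
proof -
  have [measurable]: "f \<in> borel_measurable M" "g \<in> borel_measurable M"
    using assms by (auto dest: Lebesgue_space_measurable)
  show ?thesis
  proof (rule Bochner_Integration.integrable_bound)
    show "integrable M (\<lambda>x. norm (f x) powr p + norm (g x) powr q)"
      using assms by (auto dest: Lebesgue_space_integrable)
    show "AE x in M. norm (norm (f x) * norm (g x)) \<le> norm (norm (f x) powr p + norm (g x) powr q)"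
      using Young_mult_le[OF assms(1,2)] by auto
  qed measurable
qed

lemma Lebesgue_space_dual_inner:
  assumes "1 < p" "1 / p + 1 / q = 1" "f \<in> Lebesgue_space M p" "g \<in> Lebesgue_space M q"
  shows "integrable M (\<lambda>x. inner (f x) (g x))"
proof (rule Bochner_Integration.integrable_bound[OF Lebesgue_space_dual_norm[OF assms]])
  have [measurable]: "f \<in> borel_measurable M" "g \<in> borel_measurable M"
    using assms by (auto dest: Lebesgue_space_measurable)
  show "(\<lambda>x. inner (f x) (g x)) \<in> borel_measurable M" by measurable
qed (auto simp: Cauchy_Schwarz_ineq2)

context finite_measure
begin

lemma Lebesgue_space_const: "(\<lambda>x. c) \<in> Lebesgue_space M p"
  by (simp add: Lebesgue_space_def)

lemma Lebesgue_space_integrable_norm: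
  assumes "1 < p" "f \<in> Lebesgue_space M p"
  shows "integrable M (\<lambda>x. norm (f x))" "integrable M f"
proof -
  have [measurable]: "f \<in> borel_measurable M"
    using assms by (auto dest: Lebesgue_space_measurable)
  show *: "integrable M (\<lambda>x. norm (f x))"
    using Lebesgue_space_dual_norm[of p "p / (p - 1)" f M "\<lambda>x. 1 :: real"]
      assms Lebesgue_space_const by (auto simp: field_simps)
  show "integrable M f"
    by (rule Bochner_Integration.integrable_bound[OF *]) auto
qed

end

section \<open>Passage to the limit under almost everywhere convergence\<close>

lemma nn_integral_le_imp_integral_le:
  fixes f :: "'a \<Rightarrow> real"
  assumes "f \<in> borel_measurable M" "AE x in M. 0 \<le> f x"
    "(\<integral>\<^sup>+x. ennreal (f x) \<partial>M) \<le> ennreal c" "0 \<le> c"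
  shows "integrable M f" "(\<integral>x. f x \<partial>M) \<le> c"
proof -
  show i: "integrable M f"
    using assms by (intro integrableI_nonneg) (auto intro: le_less_trans)
  have "ennreal (\<integral>x. f x \<partial>M) \<le> ennreal c"
    using nn_integral_eq_integral[OF i assms(2)] assms(3) by simp
  then show "(\<integral>x. f x \<partial>M) \<le> c" using assms(4) by simp
qed

text \<open>Subtracting the integrable minorant \<open>h\<close> reduces this to Fatou's lemma for
  nonnegative functions. The bounds \<open>c n\<close> vary with \<open>n\<close> because minimising
  sequences come with values \<open>m + 1 / real (Suc n)\<close>.\<close>

lemma Fatou_integral_le:
  fixes f :: "nat \<Rightarrow> 'a \<Rightarrow> real"
  assumes int: "\<And>n. integrable M (f n)" and h: "integrable M h"
    and ge: "\<And>n. AE x in M. h x \<le> f n x"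
    and [measurable]: "g \<in> borel_measurable M"
    and lim: "AE x in M. (\<lambda>n. f n x) \<longlonglongrightarrow> g x"
    and le: "\<And>n. (\<integral>x. f n x \<partial>M) \<le> c n" and c: "c \<longlonglongrightarrow> c'"
  shows "integrable M g" "(\<integral>x. g x \<partial>M) \<le> c'"
proof -
  have [measurable]: "\<And>n. f n \<in> borel_measurable M" "h \<in> borel_measurable M"
    using int h by auto
  have ge': "AE x in M. \<forall>n. h x \<le> f n x" using ge by (simp add: AE_all_countable)
  have g0: "AE x in M. 0 \<le> g x - h x"
    using ge' lim by eventually_elim (auto intro: LIMSEQ_le_const)
  have I: "0 \<le> (\<integral>x. f n x - h x \<partial>M)" for n
    using ge' by (intro integral_nonneg_AE) auto
  then have cn: "0 \<le> c n - (\<integral>x. h x \<partial>M)" for n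
    using le[of n] int h by (simp add: le_diff_eq) (smt (verit))
  then have c0: "0 \<le> c' - (\<integral>x. h x \<partial>M)"
    using c by (intro LIMSEQ_le_const[OF tendsto_diff[OF c tendsto_const]]) auto
  have "(\<integral>\<^sup>+x. ennreal (g x - h x) \<partial>M) \<le> (\<integral>\<^sup>+x. liminf (\<lambda>n. ennreal (f n x - h x)) \<partial>M)"
  proof (rule nn_integral_mono_AE)
    show "AE x in M. ennreal (g x - h x) \<le> liminf (\<lambda>n. ennreal (f n x - h x))"
      using lim
    proof eventually_elim
      case (elim x)
      have "(\<lambda>n. ennreal (f n x - h x)) \<longlonglongrightarrow> ennreal (g x - h x)"
        using elim by (intro tendsto_intros) auto
      then show ?case by (simp add: lim_imp_Liminf)
    qed
  qed
  also have "\<dots> \<le> liminf (\<lambda>n. \<integral>\<^sup>+x. ennreal (f n x - h x) \<partial>M)"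
    by (intro nn_integral_liminf) auto
  also have "\<dots> \<le> liminf (\<lambda>n. ennreal (c n - (\<integral>x. h x \<partial>M)))"
  proof (rule Liminf_mono, rule always_eventually, rule allI)
    fix n
    have "(\<integral>\<^sup>+x. ennreal (f n x - h x) \<partial>M) = ennreal (\<integral>x. f n x - h x \<partial>M)"
      using ge' int h by (intro nn_integral_eq_integral) auto
    also have "\<dots> \<le> ennreal (c n - (\<integral>x. h x \<partial>M))"
      using le[of n] int h by (intro ennreal_leI) auto
    finally show "(\<integral>\<^sup>+x. ennreal (f n x - h x) \<partial>M) \<le> ennreal (c n - (\<integral>x. h x \<partial>M))" .
  qed
  also have "\<dots> = ennreal (c' - (\<integral>x. h x \<partial>M))"
    using c by (intro lim_imp_Liminf tendsto_intros) auto
  finally have *: "(\<integral>\<^sup>+x. ennreal (g x - h x) \<partial>M) \<le> ennreal (c' - (\<integral>x. h x \<partial>M))" .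
  have i: "integrable M (\<lambda>x. g x - h x)" and l: "(\<integral>x. g x - h x \<partial>M) \<le> c' - (\<integral>x. h x \<partial>M)"
    using nn_integral_le_imp_integral_le[OF _ g0 * c0] by auto
  from Bochner_Integration.integrable_add[OF i h] show "integrable M g" by simp
  with l h show "(\<integral>x. g x \<partial>M) \<le> c'" by simp
qed

lemma Lebesgue_space_Fatou:
  fixes F :: "nat \<Rightarrow> 'a \<Rightarrow> 'b::euclidean_space"
  assumes "0 < p" "\<And>n. F n \<in> Lebesgue_space M p"
    "\<And>n. (\<integral>x. norm (F n x) powr p \<partial>M) \<le> c n" "c \<longlonglongrightarrow> C"
    "G \<in> borel_measurable M" "AE x in M. (\<lambda>n. F n x) \<longlonglongrightarrow> G x"
  shows "G \<in> Lebesgue_space M p" "(\<integral>x. norm (G x) powr p \<partial>M) \<le> C"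
proof -
  have [measurable]: "G \<in> borel_measurable M" by fact
  have lim: "AE x in M. (\<lambda>n. norm (F n x) powr p) \<longlonglongrightarrow> norm (G x) powr p"
    using assms(6)
  proof eventually_elim
    case (elim x)
    then show ?case using assms(1) by (intro tendsto_powr2 tendsto_intros) auto
  qed
  have *: "integrable M (\<lambda>x. norm (G x) powr p)" "(\<integral>x. norm (G x) powr p \<partial>M) \<le> C"
    by (rule Fatou_integral_le[where h = "\<lambda>x. 0" and c = c and f = "\<lambda>n x. norm (F n x) powr p"];
        use assms lim in \<open>auto dest: Lebesgue_space_integrable\<close>)+
  show "G \<in> Lebesgue_space M p" "(\<integral>x. norm (G x) powr p \<partial>M) \<le> C"
    using * assms by (auto intro: Lebesgue_spaceI)
qed

text \<open>Write \<open>s\<close> for \<open>norm (F n x - G x)\<close>. Where \<open>s\<close>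
  exceeds \<open>K * norm (h x) powr (q - 1)\<close>, its product with \<open>norm (h x)\<close> is
  at most \<open>s powr p / K powr (p - 1)\<close>, whose integral is small uniformly in
  \<open>n\<close> for large \<open>K\<close>. Elsewhere \<open>K * norm (h x) powr q\<close>
  dominates and dominated convergence applies.\<close>

lemma bounded_in_Lp_pairing_tendsto:
  fixes F :: "nat \<Rightarrow> 'a \<Rightarrow> 'b::euclidean_space" and h :: "'a \<Rightarrow> 'c::euclidean_space"
  assumes pq: "1 < p" "1 / p + 1 / q = 1" and F: "\<And>n. F n \<in> Lebesgue_space M p"
    and C: "\<And>n. (\<integral>x. norm (F n x) powr p \<partial>M) \<le> C"
    and G: "G \<in> borel_measurable M" and lim: "AE x in M. (\<lambda>n. F n x) \<longlonglongrightarrow> G x"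
    and h: "h \<in> Lebesgue_space M q"
  shows "(\<lambda>n. \<integral>x. norm (F n x - G x) * norm (h x) \<partial>M) \<longlonglongrightarrow> 0"
proof -
  have p0: "0 < p" using pq by simp
  note pqs = conjugate_exponent_props[OF pq]
  have [measurable]: "\<And>n. F n \<in> borel_measurable M" "G \<in> borel_measurable M" "h \<in> borel_measurable M"
    using F G h by (auto dest: Lebesgue_space_measurable)
  have GL: "G \<in> Lebesgue_space M p" and GC: "(\<integral>x. norm (G x) powr p \<partial>M) \<le> C"
    using Lebesgue_space_Fatou[OF p0 F C tendsto_const G lim] by auto
  define s where "s n x = norm (F n x - G x)" for n x
  have [measurable]: "\<And>n. s n \<in> borel_measurable M" unfolding s_def by measurable
  have dL: "(\<lambda>x. F n x - G x) \<in> Lebesgue_space M p" for n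
    using Lebesgue_space_diff[OF p0 F GL] .
  have C0: "0 \<le> C" using C[of 0] by (smt (verit) integral_nonneg_AE AE_I2 powr_ge_zero)
  define D where "D = 2 powr p * (C + C)"
  have D0: "0 \<le> D" using C0 by (simp add: D_def)
  have sD: "(\<integral>x. s n x powr p \<partial>M) \<le> D" for n
  proof -
    have "(\<integral>x. s n x powr p \<partial>M) \<le> (\<integral>x. 2 powr p * (norm (F n x) powr p + norm (G x) powr p) \<partial>M)"
      unfolding s_def using dL[of n] F[of n] GL p0
      by (intro integral_mono norm_diff_powr_le) (auto dest: Lebesgue_space_integrable)
    also have "\<dots> \<le> D" unfolding D_def using F[of n] GL C[of n] GC
      by (simp add: Lebesgue_space_integrable)
    finally show ?thesis .
  qed
  have si: "integrable M (\<lambda>x. s n x powr p)" for n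
    using dL[of n] unfolding s_def by (rule Lebesgue_space_integrable)
  have hi: "integrable M (\<lambda>x. norm (h x) powr q)" using h by (rule Lebesgue_space_integrable)
  have shi: "integrable M (\<lambda>x. s n x * norm (h x))" for n
    using Lebesgue_space_dual_norm[OF pq dL h] unfolding s_def .
  have main: "\<exists>N. \<forall>n\<ge>N. (\<integral>x. s n x * norm (h x) \<partial>M) < e" if e: "0 < e" for e
  proof -
    \<comment> \<open>This makes \<open>D / K powr (p - 1)\<close> at most \<open>e / 2\<close>; the
      summand 1 keeps \<open>K\<close> positive when \<open>D = 0\<close>.\<close>
    define K where "K = (2 * D / e + 1) powr (1 / (p - 1))"
    have K: "0 < K" "K powr (p - 1) = 2 * D / e + 1"
      using pq D0 e by (auto simp: K_def powr_powr add_nonneg_pos)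
        (smt (verit) divide_nonneg_pos)+
    define m where "m n x = min (s n x) (K * norm (h x) powr (q - 1)) * norm (h x)" for n x
    have split: "s n x * norm (h x) \<le> m n x + s n x powr p / K powr (p - 1)" for n x
    proof (cases "s n x \<le> K * norm (h x) powr (q - 1)")
      case False
      then have "norm (h x) powr (q - 1) < s n x / K" using K by (simp add: field_simps)
      then have "(norm (h x) powr (q - 1)) powr (p - 1) \<le> (s n x / K) powr (p - 1)"
        using pq by (intro powr_mono2) auto
      moreover have "(q - 1) * (p - 1) = 1" using pqs(2) by (simp add: algebra_simps)
      ultimately have hx: "norm (h x) \<le> (s n x / K) powr (p - 1)" by (simp add: powr_powr)
      have s0: "0 < s n x" using False by (smt (verit, best) K(1) mult_nonneg_nonneg powr_ge_zero)
      have "s n x * norm (h x) \<le> s n x powr 1 * (s n x powr (p - 1) / K powr (p - 1))"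
        using mult_left_mono[OF hx, of "s n x"] s0 K(1) by (simp add: powr_divide)
      also have "\<dots> = s n x powr p / K powr (p - 1)"
        unfolding times_divide_eq_right powr_add[symmetric] by simp
      finally show ?thesis using s0 K unfolding m_def
        by (smt (verit) mult_nonneg_nonneg norm_ge_zero powr_ge_zero)
    qed (simp add: m_def)
    have mlim: "(\<lambda>n. \<integral>x. m n x \<partial>M) \<longlonglongrightarrow> (\<integral>x. 0 \<partial>M)"
    proof (rule integral_dominated_convergence)
      show "integrable M (\<lambda>x. K * norm (h x) powr q)" using hi by simp
      show "AE x in M. (\<lambda>n. m n x) \<longlonglongrightarrow> 0"
        using lim
      proof eventually_elim
        case (elim x)
        have "(\<lambda>n. s n x) \<longlonglongrightarrow> norm (G x - G x)" unfolding s_def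
          using elim by (intro tendsto_intros)
        then have "(\<lambda>n. m n x) \<longlonglongrightarrow> min 0 (K * norm (h x) powr (q - 1)) * norm (h x)"
          unfolding m_def by (intro tendsto_intros) auto
        then show ?case using K by (simp add: min_def)
      qed
      show "AE x in M. norm (m n x) \<le> K * norm (h x) powr q" for n
      proof (intro AE_I2)
        fix x
        have m0: "0 \<le> m n x" unfolding m_def s_def using K by simp
        have "m n x \<le> (K * norm (h x) powr (q - 1)) * norm (h x)"
          unfolding m_def by (intro mult_right_mono) auto
        also have "\<dots> = K * norm (h x) powr q"
          by (cases "h x = 0") (auto simp: powr_diff)
        finally show "norm (m n x) \<le> K * norm (h x) powr q" using m0 by simp
      qed
      show "\<And>n. m n \<in> borel_measurable M" unfolding m_def by measurable
    qed simp
    then have "eventually (\<lambda>n. (\<integral>x. m n x \<partial>M) < e / 2) sequentially"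
      using e by (intro order_tendstoD) auto
    then obtain N where N: "\<And>n. n \<ge> N \<Longrightarrow> (\<integral>x. m n x \<partial>M) < e / 2"
      by (auto simp: eventually_sequentially)
    have "(\<integral>x. s n x * norm (h x) \<partial>M) < e" if n: "n \<ge> N" for n
    proof -
      have mi: "integrable M (m n)"
      proof (rule Bochner_Integration.integrable_bound[OF shi[of n]])
        show "AE x in M. norm (m n x) \<le> norm (s n x * norm (h x))"
          unfolding m_def s_def using K by (intro AE_I2) (auto simp: abs_mult intro!: mult_right_mono)
      qed (unfold m_def, measurable)
      have "(\<integral>x. s n x * norm (h x) \<partial>M) \<le> (\<integral>x. m n x + s n x powr p / K powr (p - 1) \<partial>M)"
        using shi mi si split by (intro integral_mono) auto
      also have "\<dots> = (\<integral>x. m n x \<partial>M) + (\<integral>x. s n x powr p \<partial>M) / K powr (p - 1)"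
        using mi si by simp
      also have "(\<integral>x. s n x powr p \<partial>M) / K powr (p - 1) \<le> D / (2 * D / e + 1)"
        unfolding K using sD[of n] D0 e by (intro divide_right_mono) auto
      also have "D / (2 * D / e + 1) \<le> e / 2"
        using D0 e by (simp add: field_simps add_nonneg_pos)
      finally show ?thesis using N[OF n] by simp
    qed
    then show ?thesis by blast
  qed
  have nn: "0 \<le> (\<integral>x. s n x * norm (h x) \<partial>M)" for n
    by (intro integral_nonneg_AE) (auto simp: s_def)
  show ?thesis unfolding s_def[symmetric]
  proof (rule LIMSEQ_I)
    fix e :: real assume "0 < e"
    then obtain N where "\<forall>n\<ge>N. (\<integral>x. s n x * norm (h x) \<partial>M) < e" using main by blast
    then show "\<exists>N. \<forall>n\<ge>N. norm ((\<integral>x. s n x * norm (h x) \<partial>M) - 0) < e" using nn by auto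
  qed
qed

lemma bounded_in_Lp_inner_tendsto:
  fixes F :: "nat \<Rightarrow> 'a \<Rightarrow> 'b::euclidean_space"
  assumes pq: "1 < p" "1 / p + 1 / q = 1" and F: "\<And>n. F n \<in> Lebesgue_space M p"
    and C: "\<And>n. (\<integral>x. norm (F n x) powr p \<partial>M) \<le> C"
    and G: "G \<in> borel_measurable M" and lim: "AE x in M. (\<lambda>n. F n x) \<longlonglongrightarrow> G x"
    and h: "h \<in> Lebesgue_space M q"
  shows "(\<lambda>n. \<integral>x. inner (F n x) (h x) \<partial>M) \<longlonglongrightarrow> (\<integral>x. inner (G x) (h x) \<partial>M)"
proof -
  have p0: "0 < p" using pq by simp
  have GL: "G \<in> Lebesgue_space M p"
    using Lebesgue_space_Fatou[OF p0 F C tendsto_const G lim] by auto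
  note i = Lebesgue_space_dual_inner[OF pq _ h]
  note d = Lebesgue_space_diff[OF p0 F GL]
  have "(\<lambda>n. (\<integral>x. inner (F n x) (h x) \<partial>M) - (\<integral>x. inner (G x) (h x) \<partial>M)) \<longlonglongrightarrow> 0"
  proof (rule Lim_null_comparison[OF _ bounded_in_Lp_pairing_tendsto[OF assms]],
      rule always_eventually, rule allI)
    fix n
    have "(\<integral>x. inner (F n x) (h x) \<partial>M) - (\<integral>x. inner (G x) (h x) \<partial>M)
        = (\<integral>x. inner (F n x - G x) (h x) \<partial>M)"
      using i[OF F] i[OF GL] by (simp add: inner_diff_left)
    also have "norm \<dots> \<le> (\<integral>x. norm (inner (F n x - G x) (h x)) \<partial>M)"
      by (rule integral_norm_bound)
    also have "\<dots> \<le> (\<integral>x. norm (F n x - G x) * norm (h x) \<partial>M)"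
      using i[OF d] Lebesgue_space_dual_norm[OF pq d h]
      by (intro integral_mono) (auto simp: Cauchy_Schwarz_ineq2)
    finally show "norm ((\<integral>x. inner (F n x) (h x) \<partial>M) - (\<integral>x. inner (G x) (h x) \<partial>M))
        \<le> (\<integral>x. norm (F n x - G x) * norm (h x) \<partial>M)" .
  qed
  then show ?thesis by (simp add: LIM_zero_iff)
qed

section \<open>Extracting convergent sequences by convexity\<close>

text \<open>Strict convexity of \<open>norm (1, y)\<close> in quantitative form, \<open>d\<close>
  being the defect at the midpoint. For A = (1, a) and B = (1, b), Cauchy-Schwarz for a and b gives
  |a - b|^2 \<le> |A|^2 |B|^2 - (A . B)^2, and factoring the right side yields |a - b|^2 \<le> d
  W^3. The square root is taken so that the final bound is linear in \<open>d\<close> and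
  \<open>W\<close>, whose integrals are under control.\<close>

lemma sqrt_norm_diff_le_convexity_defect:
  fixes a b :: "'b::real_inner" and \<epsilon> :: real
  assumes \<epsilon>: "0 < \<epsilon>"
  defines "W \<equiv> norm (1::real, a) + norm (1::real, b)"
    and "d \<equiv> (norm (1::real, a) + norm (1::real, b)) / 2 - norm (1::real, (1/2) *\<^sub>R (a + b))"
  shows "0 \<le> d" and "sqrt (norm (a - b)) \<le> d / \<epsilon> ^ 3 + \<epsilon> * W"
proof -
  define A where "A = (1::real, a)"
  define B where "B = (1::real, b)"
  define P where "P = norm A * norm B"
  define S where "S = inner A B"
  have sum: "(1::real, (1/2) *\<^sub>R (a + b)) = (1/2) *\<^sub>R (A + B)" by (simp add: A_def B_def)
  have d: "2 * d = W - norm (A + B)" unfolding d_def sum W_def A_def[symmetric] B_def[symmetric] by simp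
  have W: "W = norm A + norm B" by (simp add: W_def A_def B_def)
  show d0: "0 \<le> d" using d norm_triangle_ineq[of A B] W by simp
  have W0: "0 \<le> W" unfolding W by simp
  have PS: "S \<le> P" unfolding S_def P_def by (rule norm_cauchy_schwarz)
  have S': "- S \<le> P" using norm_cauchy_schwarz[of "-A" B] by (simp add: S_def P_def)
  have P0: "0 \<le> P" by (simp add: P_def)
  have nAB: "norm (A + B) ^ 2 = norm A ^ 2 + norm B ^ 2 + 2 * S"
    unfolding S_def power2_norm_eq_inner by (simp add: inner_add_left inner_add_right inner_commute)
  have "W\<^sup>2 - norm (A + B) ^ 2 = 2 * (P - S)"
    unfolding W nAB P_def by (simp add: power2_eq_square algebra_simps)
  then have "2 * (P - S) = (W - norm (A + B)) * (W + norm (A + B))"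
    by (simp add: power2_eq_square algebra_simps)
  also have "\<dots> \<le> (2 * d) * (2 * W)"
    unfolding d using norm_triangle_ineq[of A B] W by (intro mult_left_mono) auto
  finally have PSd: "P - S \<le> 2 * d * W" by simp
  have PW: "2 * P \<le> W\<^sup>2 / 2"
  proof -
    have "0 \<le> (norm A - norm B)\<^sup>2" by simp
    then show ?thesis unfolding P_def W by (simp add: power2_eq_square algebra_simps)
  qed
  have "(norm (a - b))\<^sup>2 \<le> P\<^sup>2 - S\<^sup>2"
  proof -
    have "(inner a b)\<^sup>2 \<le> (inner a a) * (inner b b)" by (rule Cauchy_Schwarz_ineq)
    moreover have "P\<^sup>2 = (1 + inner a a) * (1 + inner b b)"
      unfolding P_def power_mult_distrib power2_norm_eq_inner by (simp add: A_def B_def)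
    moreover have "S = 1 + inner a b" by (simp add: S_def A_def B_def)
    ultimately show ?thesis
      unfolding power2_norm_eq_inner
      by (simp add: inner_diff_left inner_diff_right inner_commute power2_eq_square algebra_simps)
  qed
  also have "\<dots> = (P - S) * (P + S)" by (simp add: power2_eq_square algebra_simps)
  also have "\<dots> \<le> (P - S) * (2 * P)" using PS by (intro mult_left_mono) auto
  also have "\<dots> \<le> (2 * d * W) * (W\<^sup>2 / 2)"
    using PSd PW PS P0 d0 W0 by (intro mult_mono) auto
  \<comment> \<open>With x = d / \<epsilon>^3 and y = \<epsilon> W the product x y^3 is at most (x +
    y)^4; the free \<epsilon> later balances a vanishing defect against a bounded
    \<open>W\<close>.\<close>
  also have "\<dots> = (d / \<epsilon> ^ 3) * (\<epsilon> * W) ^ 3"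
    using \<epsilon> by (simp add: power_mult_distrib power2_eq_square power3_eq_cube)
  also have "\<dots> \<le> (d / \<epsilon> ^ 3 + \<epsilon> * W) * (d / \<epsilon> ^ 3 + \<epsilon> * W) ^ 3"
    using d0 \<epsilon> W0 by (intro mult_mono power_mono) auto
  also have "\<dots> = ((d / \<epsilon> ^ 3 + \<epsilon> * W)\<^sup>2)\<^sup>2" by (simp add: power2_eq_square power3_eq_cube mult.assoc)
  finally have "norm (a - b) \<le> (d / \<epsilon> ^ 3 + \<epsilon> * W)\<^sup>2"
    by (rule power2_le_imp_le) simp
  then show "sqrt (norm (a - b)) \<le> d / \<epsilon> ^ 3 + \<epsilon> * W"
    using d0 \<epsilon> W0 by (intro real_le_lsqrt) auto
qed

text \<open>The square roots have summable integrals, hence a convergent sum at almost every point.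
  Once a square root is below 1 it dominates the increment itself, so the telescoping series
  converges absolutely.\<close>

lemma AE_convergent_of_summable_sqrt:
  fixes f :: "nat \<Rightarrow> 'a \<Rightarrow> 'f::euclidean_space"
  assumes [measurable]: "\<And>n. f n \<in> borel_measurable M"
    and int: "\<And>n. integrable M (\<lambda>x. sqrt (norm (f n x - f (Suc n) x)))"
    and le: "\<And>n. (\<integral>x. sqrt (norm (f n x - f (Suc n) x)) \<partial>M) \<le> (1/2) ^ n"
  shows "AE x in M. convergent (\<lambda>n. f n x)"
proof -
  define D where "D n x = sqrt (norm (f n x - f (Suc n) x))" for n x
  have [measurable]: "\<And>n. D n \<in> borel_measurable M" unfolding D_def by measurable
  have "(\<integral>\<^sup>+x. (\<Sum>n. ennreal (D n x)) \<partial>M) = (\<Sum>n. \<integral>\<^sup>+x. ennreal (D n x) \<partial>M)"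
    by (rule nn_integral_suminf) measurable
  also have "\<dots> \<le> (\<Sum>n. ennreal ((1/2) ^ n))"
  proof (intro suminf_le)
    fix n
    have "(\<integral>\<^sup>+x. ennreal (D n x) \<partial>M) = ennreal (\<integral>x. D n x \<partial>M)"
      using int[of n] by (intro nn_integral_eq_integral) (auto simp: D_def)
    also have "\<dots> \<le> ennreal ((1/2) ^ n)" using le[of n] by (intro ennreal_leI) (simp add: D_def)
    finally show "(\<integral>\<^sup>+x. ennreal (D n x) \<partial>M) \<le> ennreal ((1/2) ^ n)" .
  qed auto
  also have "\<dots> = ennreal (\<Sum>n. (1/2) ^ n)"
    by (intro suminf_ennreal2) (auto intro: summable_geometric)
  finally have "(\<integral>\<^sup>+x. (\<Sum>n. ennreal (D n x)) \<partial>M) \<noteq> \<infinity>"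
    by (auto simp: top_unique)
  then have "AE x in M. (\<Sum>n. ennreal (D n x)) \<noteq> \<infinity>"
    by (intro nn_integral_noteq_infinite) auto
  then show ?thesis
  proof eventually_elim
    case (elim x)
    have sD: "summable (\<lambda>n. D n x)"
      by (rule summable_suminf_not_top) (use elim in \<open>auto simp: D_def\<close>)
    have "eventually (\<lambda>n. D n x < 1) sequentially"
      using summable_LIMSEQ_zero[OF sD] by (intro order_tendstoD) auto
    then have "eventually (\<lambda>n. norm (f (Suc n) x - f n x) \<le> D n x) sequentially"
    proof eventually_elim
      case (elim n)
      have "norm (f (Suc n) x - f n x) = D n x * D n x" by (simp add: D_def norm_minus_commute)
      also have "\<dots> \<le> D n x" using elim by (intro mult_left_le) (auto simp: D_def)
      finally show ?case .
    qed
    then have "summable (\<lambda>n. f (Suc n) x - f n x)"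
      by (rule summable_comparison_test_ev) (rule sD)
    then have "(\<lambda>n. \<Sum>k<n. f (Suc k) x - f k x) \<longlonglongrightarrow> (\<Sum>k. f (Suc k) x - f k x)"
      by (rule summable_LIMSEQ)
    then have "(\<lambda>n. (f n x - f 0 x) + f 0 x) \<longlonglongrightarrow> (\<Sum>k. f (Suc k) x - f k x) + f 0 x"
      unfolding sum_lessThan_telescope[of "\<lambda>k. f k x"] by (intro tendsto_intros)
    then show ?case by (auto simp: convergent_def)
  qed
qed

text \<open>Choose near minimisers of the integral \<open>\<Phi>\<close> of
  \<open>norm (1, ev i x)\<close> over the sets \<open>K n\<close>. The infima \<open>I n\<close>
  increase to a finite limit. The midpoint of two chosen elements of \<open>K N\<close> still lies
  in \<open>K N\<close>, so its value is at least \<open>I N\<close> and the integrated convexity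
  defect tends to 0. By \<open>sqrt_norm_diff_le_convexity_defect\<close> the chosen sequence is
  then Cauchy, and a subsequence converges almost everywhere.\<close>

lemma (in finite_measure) convex_extraction:
  fixes K :: "nat \<Rightarrow> 'i set" and ev :: "'i \<Rightarrow> 'a \<Rightarrow> 'f::euclidean_space"
  assumes ne: "\<And>n. K n \<noteq> {}" and dec: "\<And>n. K (Suc n) \<subseteq> K n"
    and int: "\<And>i. i \<in> K 0 \<Longrightarrow> integrable M (ev i)"
    and C: "\<And>i. i \<in> K 0 \<Longrightarrow> (\<integral>x. norm (ev i x) \<partial>M) \<le> C"
    and mid: "\<And>n i j. i \<in> K n \<Longrightarrow> j \<in> K n \<Longrightarrow>
        \<exists>k\<in>K n. \<forall>x\<in>space M. ev k x = (1/2) *\<^sub>R (ev i x + ev j x)"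
  obtains s g where "\<And>n. s n \<in> K n" "g \<in> borel_measurable M"
    "AE x in M. (\<lambda>n. ev (s n) x) \<longlonglongrightarrow> g x"
proof -
  have decle: "K n \<subseteq> K m" if "m \<le> n" for m n
    using that by (induction n rule: dec_induct) (use dec in auto)
  \<comment> \<open>The extra coordinate 1 removes the directions in which the norm is not strictly
    convex.\<close>
  define w where "w i x = norm (1::real, ev i x)" for i x
  define \<Phi> where "\<Phi> i = (\<integral>x. w i x \<partial>M)" for i
  define B where "B = measure M (space M) + C"
  have w_le: "w i x \<le> 1 + norm (ev i x)" for i x
    unfolding w_def using norm_Pair_le[of "1::real" "ev i x"] by simp
  have w0: "0 \<le> w i x" for i x by (simp add: w_def)
  have wi: "integrable M (w i)" if "i \<in> K 0" for i
  proof (rule Bochner_Integration.integrable_bound)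
    show "integrable M (\<lambda>x. 1 + norm (ev i x))" using int[OF that] by auto
    have [measurable]: "ev i \<in> borel_measurable M" using int[OF that] by auto
    show "w i \<in> borel_measurable M" unfolding w_def norm_Pair by measurable
    show "AE x in M. norm (w i x) \<le> norm (1 + norm (ev i x))"
      using w_le[of i] w0[of i] by (intro AE_I2) (smt (verit) real_norm_def)
  qed
  have \<Phi>B: "\<Phi> i \<le> B" if "i \<in> K 0" for i
  proof -
    have "\<Phi> i \<le> (\<integral>x. 1 + norm (ev i x) \<partial>M)"
      unfolding \<Phi>_def using wi[OF that] int[OF that] w_le by (intro integral_mono) auto
    also have "\<dots> = measure M (space M) + (\<integral>x. norm (ev i x) \<partial>M)"
      using int[OF that] by simp
    finally show ?thesis using C[OF that] by (simp add: B_def)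
  qed
  have \<Phi>0: "0 \<le> \<Phi> i" for i unfolding \<Phi>_def using w0 by (intro integral_nonneg_AE) auto
  have K0: "i \<in> K n \<Longrightarrow> i \<in> K 0" for i n using decle[of 0 n] by auto
  define I where "I n = Inf (\<Phi> ` K n)" for n
  have bdd: "bdd_below (\<Phi> ` K n)" for n using \<Phi>0 by (intro bdd_belowI[of _ 0]) auto
  have I_le: "I n \<le> \<Phi> i" if "i \<in> K n" for n i
    unfolding I_def using that bdd by (intro cInf_lower) auto
  have I_mono: "incseq I"
    by (rule incseq_SucI) (unfold I_def, intro cInf_superset_mono image_mono dec bdd, use ne in auto)
  have IB: "I n \<le> B" for n
    using ne[of n] I_le \<Phi>B K0 by (meson ex_in_conv order_trans)
  obtain Il where Il: "I \<longlonglongrightarrow> Il" "\<And>n. I n \<le> Il"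
    using incseq_convergent[OF I_mono, of B] IB by blast
  have "\<exists>i\<in>K n. \<Phi> i < I n + 1 / real (Suc n)" for n
    using cInf_lessD[of "\<Phi> ` K n" "I n + 1 / real (Suc n)"] ne[of n] by (auto simp: I_def)
  then obtain s where s: "\<And>n. s n \<in> K n" "\<And>n. \<Phi> (s n) < I n + 1 / real (Suc n)"
    by metis
  \<comment> \<open>Bounds the integrated defect of two chosen elements with indices at least
    \<open>N\<close>: their values are below \<open>Il + 1 / real (Suc N)\<close>, that of the
    midpoint is at least \<open>I N\<close>.\<close>
  define \<delta> where "\<delta> N = Il + 1 / real (Suc N) - I N" for N
  have \<delta>: "\<delta> \<longlonglongrightarrow> 0"
    unfolding \<delta>_def using tendsto_diff[OF tendsto_add[OF tendsto_const[of Il] LIMSEQ_inverse_real_of_nat] Il(1)]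
    by (auto simp: inverse_eq_divide)
  define R where "R m n = (\<integral>x. sqrt (norm (ev (s m) x - ev (s n) x)) \<partial>M)" for m n
  have Ri: "integrable M (\<lambda>x. sqrt (norm (ev (s m) x - ev (s n) x)))" for m n
  proof (rule Bochner_Integration.integrable_bound)
    have i: "integrable M (ev (s m))" "integrable M (ev (s n))" using s(1) int K0 by auto
    then have [measurable]: "ev (s m) \<in> borel_measurable M" "ev (s n) \<in> borel_measurable M" by auto
    show "integrable M (\<lambda>x. 1 + norm (ev (s m) x - ev (s n) x))" using i by auto
    show "(\<lambda>x. sqrt (norm (ev (s m) x - ev (s n) x))) \<in> borel_measurable M" by measurable
    have "sqrt t \<le> 1 + t" if "0 \<le> t" for t :: real
      using that by (intro real_le_lsqrt) (auto simp: power2_eq_square algebra_simps)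
    then show "AE x in M. norm (sqrt (norm (ev (s m) x - ev (s n) x))) \<le> norm (1 + norm (ev (s m) x - ev (s n) x))"
      by auto
  qed
  have R_le: "R m n \<le> \<delta> N / \<epsilon> ^ 3 + \<epsilon> * (2 * B)" if mn: "N \<le> m" "N \<le> n" and \<epsilon>: "0 < \<epsilon>" for m n N \<epsilon>
  proof -
    have sN: "s m \<in> K N" "s n \<in> K N" using s(1) mn decle by blast+
    obtain k where k: "k \<in> K N" "\<And>x. x \<in> space M \<Longrightarrow> ev k x = (1/2) *\<^sub>R (ev (s m) x + ev (s n) x)"
      using mid[OF sN] by blast
    have wi': "integrable M (w (s m))" "integrable M (w (s n))" "integrable M (w k)"
      using wi K0 sN k(1) by blast+
    have "R m n \<le> (\<integral>x. ((w (s m) x + w (s n) x) / 2 - w k x) / \<epsilon> ^ 3 + \<epsilon> * (w (s m) x + w (s n) x) \<partial>M)"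
      unfolding R_def
    proof (rule integral_mono[OF Ri])
      show "integrable M (\<lambda>x. ((w (s m) x + w (s n) x) / 2 - w k x) / \<epsilon> ^ 3 + \<epsilon> * (w (s m) x + w (s n) x))"
        using wi' by auto
      fix x assume x: "x \<in> space M"
      show "sqrt (norm (ev (s m) x - ev (s n) x))
          \<le> ((w (s m) x + w (s n) x) / 2 - w k x) / \<epsilon> ^ 3 + \<epsilon> * (w (s m) x + w (s n) x)"
        unfolding w_def k(2)[OF x] by (rule sqrt_norm_diff_le_convexity_defect(2)[OF \<epsilon>])
    qed
    also have "\<dots> = ((\<Phi> (s m) + \<Phi> (s n)) / 2 - \<Phi> k) / \<epsilon> ^ 3 + \<epsilon> * (\<Phi> (s m) + \<Phi> (s n))"
      unfolding \<Phi>_def using wi' by simp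
    also have "\<dots> \<le> \<delta> N / \<epsilon> ^ 3 + \<epsilon> * (2 * B)"
    proof -
      have *: "\<Phi> (s j) \<le> Il + 1 / real (Suc N)" if "N \<le> j" for j
      proof -
        have "1 / real (Suc j) \<le> 1 / real (Suc N)" using that by (simp add: field_simps)
        then show ?thesis using s(2)[of j] Il(2)[of j] by linarith
      qed
      have "(\<Phi> (s m) + \<Phi> (s n)) / 2 - \<Phi> k \<le> \<delta> N"
      proof -
        have "(a + b) / 2 - c \<le> l - d" if "a \<le> l" "b \<le> l" "d \<le> c" for a b c d l :: real
          using that by (simp add: field_simps)
        then show ?thesis unfolding \<delta>_def using *[OF mn(1)] *[OF mn(2)] I_le[OF k(1)] by blast
      qed
      moreover have "\<Phi> (s m) + \<Phi> (s n) \<le> 2 * B" using \<Phi>B[OF K0[OF sN(1)]] \<Phi>B[OF K0[OF sN(2)]] by simp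
      ultimately show ?thesis using \<epsilon> by (intro add_mono divide_right_mono mult_left_mono) auto
    qed
    finally show ?thesis .
  qed
  have B0: "0 \<le> B" using \<Phi>0[of "s 0"] \<Phi>B[OF s(1)] by simp
  have Cauchy: "\<exists>N. \<forall>m\<ge>N. \<forall>n\<ge>N. R m n \<le> e" if e: "0 < e" for e
  proof -
    \<comment> \<open>\<open>\<epsilon>\<close> is fixed first so that the term with
      \<open>B\<close> is at most \<open>e / 2\<close>; then \<open>N\<close> is chosen to beat the
      factor \<open>\<epsilon> ^ 3\<close>. The summand 1 covers \<open>B = 0\<close>.\<close>
    define \<epsilon> where "\<epsilon> = e / (4 * B + 1)"
    have \<epsilon>: "0 < \<epsilon>" "\<epsilon> * (2 * B) \<le> e / 2" using e B0 by (auto simp: \<epsilon>_def field_simps add_nonneg_pos)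
    have "eventually (\<lambda>N. \<delta> N < (e / 2) * \<epsilon> ^ 3) sequentially"
      using \<delta> e \<epsilon> by (intro order_tendstoD) auto
    then obtain N where "\<delta> N < (e / 2) * \<epsilon> ^ 3" by (auto simp: eventually_sequentially)
    then have "\<delta> N / \<epsilon> ^ 3 \<le> e / 2" using \<epsilon> by (simp add: divide_le_eq)
    then have "R m n \<le> e" if "N \<le> m" "N \<le> n" for m n
      using R_le[OF that \<epsilon>(1)] \<epsilon>(2) by linarith
    then show ?thesis by blast
  qed
  have "\<forall>k. \<exists>N. \<forall>m\<ge>N. \<forall>n\<ge>N. R m n \<le> (1/2) ^ k" using Cauchy by simp
  then obtain N where N: "\<And>k m n. N k \<le> m \<Longrightarrow> N k \<le> n \<Longrightarrow> R m n \<le> (1/2) ^ k" by metis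
  \<comment> \<open>Adding up the thresholds makes both \<open>r k\<close> and
    \<open>r (Suc k)\<close> at least \<open>N k\<close>; the summand \<open>k\<close> places
    \<open>s (r k)\<close> in \<open>K k\<close>.\<close>
  define r where "r k = k + (\<Sum>j\<le>k. N j)" for k
  have r: "k \<le> r k" "N k \<le> r k" "N k \<le> r (Suc k)" for k
    unfolding r_def by (auto simp: lessThan_Suc_atMost[symmetric])
  have meas: "ev (s (r k)) \<in> borel_measurable M" for k
    by (rule borel_measurable_integrable[OF int[OF K0[OF s(1)]]])
  have conv: "AE x in M. convergent (\<lambda>k. ev (s (r k)) x)"
    by (rule AE_convergent_of_summable_sqrt[OF meas Ri]) (use N r in \<open>auto simp: R_def\<close>)
  show thesis
  proof (rule that)
    show "s (r n) \<in> K n" for n using s(1) decle[OF r(1)] by blast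
    show "(\<lambda>x. lim (\<lambda>n. ev (s (r n)) x)) \<in> borel_measurable M"
      using meas by (intro borel_measurable_lim_metric)
    show "AE x in M. (\<lambda>n. ev (s (r n)) x) \<longlonglongrightarrow> lim (\<lambda>n. ev (s (r n)) x)"
      using conv by eventually_elim (simp add: convergent_LIMSEQ_iff)
  qed
qed

text \<open>\<open>convex_extraction\<close> is applied to the sublevel sets of \<open>J\<close> at
  heights \<open>m + 1 / real (Suc n)\<close>. The premise \<open>closed\<close> merges closedness
  of \<open>X\<close> with lower semicontinuity of \<open>J\<close>: an almost everywhere limit of a
  minimising sequence must supply a competitor of value at most \<open>m\<close>.\<close>

lemma (in finite_measure) direct_method:
  fixes X :: "'i set" and ev :: "'i \<Rightarrow> 'a \<Rightarrow> 'f::euclidean_space" and J :: "'i \<Rightarrow> real"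
  assumes ne: "X \<noteq> {}" and lower: "\<And>i. i \<in> X \<Longrightarrow> b \<le> J i"
    and int: "\<And>i. i \<in> X \<Longrightarrow> integrable M (ev i)"
    and coercive: "\<And>c. \<exists>C. \<forall>i\<in>X. J i \<le> c \<longrightarrow> (\<integral>x. norm (ev i x) \<partial>M) \<le> C"
    and mid: "\<And>i j. i \<in> X \<Longrightarrow> j \<in> X \<Longrightarrow>
        \<exists>k\<in>X. (\<forall>x\<in>space M. ev k x = (1/2) *\<^sub>R (ev i x + ev j x)) \<and> J k \<le> (J i + J j) / 2"
    and closed: "\<And>s g m. (\<And>n. s n \<in> X) \<Longrightarrow> (\<And>n. J (s n) \<le> m + 1 / real (Suc n)) \<Longrightarrow>
        g \<in> borel_measurable M \<Longrightarrow> AE x in M. (\<lambda>n. ev (s n) x) \<longlonglongrightarrow> g x \<Longrightarrow> \<exists>i\<in>X. J i \<le> m"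
  obtains i where "i \<in> X" "\<And>j. j \<in> X \<Longrightarrow> J i \<le> J j"
proof -
  define m where "m = Inf (J ` X)"
  have bdd: "bdd_below (J ` X)" using lower by (intro bdd_belowI[of _ b]) auto
  have m_le: "m \<le> J i" if "i \<in> X" for i unfolding m_def using that bdd by (intro cInf_lower) auto
  define K where "K n = {i \<in> X. J i \<le> m + 1 / real (Suc n)}" for n
  obtain C where C: "\<forall>i\<in>X. J i \<le> m + 1 \<longrightarrow> (\<integral>x. norm (ev i x) \<partial>M) \<le> C"
    using coercive by blast
  obtain s g where "\<And>n. s n \<in> K n" "g \<in> borel_measurable M" "AE x in M. (\<lambda>n. ev (s n) x) \<longlonglongrightarrow> g x"
  proof (rule convex_extraction[of K ev C])
    fix n
    have "\<exists>i\<in>X. J i < m + 1 / real (Suc n)"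
      using cInf_lessD[of "J ` X" "m + 1 / real (Suc n)"] ne by (auto simp: m_def)
    then show "K n \<noteq> {}" unfolding K_def by (auto intro: less_imp_le)
    have "m + 1 / real (Suc (Suc n)) \<le> m + 1 / real (Suc n)" by (simp add: field_simps)
    then show "K (Suc n) \<subseteq> K n" unfolding K_def by (smt (verit, best) Collect_mono)
    fix i j assume ij: "i \<in> K n" "j \<in> K n"
    then obtain k where k: "k \<in> X" "\<forall>x\<in>space M. ev k x = (1/2) *\<^sub>R (ev i x + ev j x)"
      "J k \<le> (J i + J j) / 2"
      using mid[of i j] unfolding K_def by blast
    then have "k \<in> K n" using ij unfolding K_def by auto
    with k show "\<exists>k\<in>K n. \<forall>x\<in>space M. ev k x = (1/2) *\<^sub>R (ev i x + ev j x)" by blast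
  qed (use C int in \<open>auto simp: K_def\<close>)
  then obtain i where "i \<in> X" "J i \<le> m" using closed[of s m g] unfolding K_def by blast
  with that m_le show thesis by (meson order_trans)
qed

section \<open>Closed subspaces, annihilators and the bipolar theorem\<close>

text \<open>The p-th power of the L^p norm. Its use avoids roots; the triangle inequality is
  replaced by one with the factor \<open>2 powr p\<close>.\<close>

definition power_mass :: "'a measure \<Rightarrow> real \<Rightarrow> ('a \<Rightarrow> 'b::euclidean_space) \<Rightarrow> real" where
  "power_mass M p f = (\<integral>x. norm (f x) powr p \<partial>M)"

lemma power_mass_nonneg: "0 \<le> power_mass M p f"
  by (simp add: power_mass_def)

lemma power_mass_add_le:
  assumes "0 < p" "f \<in> Lebesgue_space M p" "g \<in> Lebesgue_space M p"
  shows "power_mass M p (\<lambda>x. f x + g x) \<le> 2 powr p * (power_mass M p f + power_mass M p g)"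
proof -
  have "power_mass M p (\<lambda>x. f x + g x)
      \<le> (\<integral>x. 2 powr p * (norm (f x) powr p + norm (g x) powr p) \<partial>M)"
    unfolding power_mass_def
    using assms Lebesgue_space_add[OF assms] norm_add_powr_le[OF assms(1)]
    by (intro integral_mono) (auto dest: Lebesgue_space_integrable)
  then show ?thesis using assms by (simp add: power_mass_def Lebesgue_space_integrable)
qed

lemma power_mass_midpoint_le:
  assumes "1 < p" "f \<in> Lebesgue_space M p" "g \<in> Lebesgue_space M p"
  shows "power_mass M p (\<lambda>x. (1/2) *\<^sub>R (f x + g x)) \<le> (power_mass M p f + power_mass M p g) / 2"
proof -
  have p0: "0 < p" using assms by simp
  have "power_mass M p (\<lambda>x. (1/2) *\<^sub>R (f x + g x))
      \<le> (\<integral>x. (norm (f x) powr p + norm (g x) powr p) / 2 \<partial>M)"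
    unfolding power_mass_def
  proof (rule integral_mono)
    show "integrable M (\<lambda>x. norm ((1/2) *\<^sub>R (f x + g x)) powr p)"
      by (rule Lebesgue_space_integrable[OF Lebesgue_space_scaleR[OF Lebesgue_space_add[OF p0 assms(2,3)]]])
    show "integrable M (\<lambda>x. (norm (f x) powr p + norm (g x) powr p) / 2)"
      using assms by (simp add: Lebesgue_space_integrable)
    show "norm ((1/2) *\<^sub>R (f x + g x)) powr p \<le> (norm (f x) powr p + norm (g x) powr p) / 2" for x
      by (rule norm_powr_midpoint[OF assms(1)])
  qed
  then show ?thesis using assms by (simp add: power_mass_def Lebesgue_space_integrable)
qed

lemma power_mass_eq_0_AE:
  assumes "f \<in> Lebesgue_space M p" "power_mass M p f \<le> 0"
  shows "AE x in M. f x = 0"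
proof -
  have "power_mass M p f = 0" using assms(2) power_mass_nonneg by (rule antisym)
  then have "AE x in M. norm (f x) powr p = 0"
    unfolding power_mass_def
    using integral_nonneg_eq_0_iff_AE[OF Lebesgue_space_integrable[OF assms(1)]] by simp
  then show ?thesis by simp
qed

lemma duality_map_Lebesgue_space:
  assumes "1 < p" "1 / p + 1 / q = 1" "f \<in> Lebesgue_space M p"
  shows "(\<lambda>x. duality_map p (f x)) \<in> Lebesgue_space M q"
proof (rule Lebesgue_spaceI)
  show "(\<lambda>x. duality_map p (f x)) \<in> borel_measurable M"
    using measurable_compose[OF Lebesgue_space_measurable[OF assms(3)]
        borel_measurable_duality_map[OF assms(1)]] .
  show "integrable M (\<lambda>x. norm (duality_map p (f x)) powr q)"
    using Lebesgue_space_integrable[OF assms(3)] by (simp add: norm_duality_map_powr[OF assms(1,2)])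
qed

text \<open>The subgradient inequality is taken at the displaced point, which bounds the increment
  from above by a derivative there. At a minimiser the increment is nonnegative, so this direction
  is the useful one.\<close>

lemma power_mass_variation:
  fixes y H :: "'a \<Rightarrow> 'b::euclidean_space"
  assumes p: "1 < p" and y: "y \<in> Lebesgue_space M p" and H: "H \<in> Lebesgue_space M p"
  shows "power_mass M p (\<lambda>x. y x + t *\<^sub>R H x) - power_mass M p y
      \<le> t * (p * (\<integral>x. inner (duality_map p (y x + t *\<^sub>R H x)) (H x) \<partial>M))"
proof -
  define q where "q = p / (p - 1)"
  have pq: "1 / p + 1 / q = 1" using p by (simp add: q_def field_simps)
  have p0: "0 < p" using p by simp
  define z where "z x = y x + t *\<^sub>R H x" for x
  have zL: "z \<in> Lebesgue_space M p"
    unfolding z_def by (intro Lebesgue_space_add Lebesgue_space_scaleR p0 y H)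
  have dL: "(\<lambda>x. duality_map p (z x)) \<in> Lebesgue_space M q"
    by (rule duality_map_Lebesgue_space[OF p pq zL])
  have i: "integrable M (\<lambda>x. inner (duality_map p (z x)) (H x))"
    using Lebesgue_space_dual_inner[OF p pq H dL] by (simp add: inner_commute)
  have "(\<integral>x. norm (z x) powr p - t * (p * inner (duality_map p (z x)) (H x)) \<partial>M) \<le> power_mass M p y"
    unfolding power_mass_def
  proof (rule integral_mono)
    show "integrable M (\<lambda>x. norm (z x) powr p - t * (p * inner (duality_map p (z x)) (H x)))"
      using Lebesgue_space_integrable[OF zL] i by auto
    show "integrable M (\<lambda>x. norm (y x) powr p)" using y by (rule Lebesgue_space_integrable)
    show "norm (z x) powr p - t * (p * inner (duality_map p (z x)) (H x)) \<le> norm (y x) powr p" for x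
      using norm_powr_subgradient[OF p, of "z x" "y x"] by (simp add: z_def mult.left_commute)
  qed
  then show ?thesis
    using Lebesgue_space_integrable[OF zL] i by (simp add: power_mass_def z_def)
qed

text \<open>Since the step \<open>1 / real (Suc n)\<close> is at most 1, all integrands are
  dominated by \<open>(norm (y x) + norm (H x)) powr p\<close>.\<close>

lemma duality_map_variation_tendsto:
  fixes y H :: "'a \<Rightarrow> 'b::euclidean_space"
  assumes p: "1 < p" and y: "y \<in> Lebesgue_space M p" and H: "H \<in> Lebesgue_space M p"
  shows "(\<lambda>n. \<integral>x. inner (duality_map p (y x + (1 / real (Suc n)) *\<^sub>R H x)) (H x) \<partial>M)
    \<longlonglongrightarrow> (\<integral>x. inner (duality_map p (y x)) (H x) \<partial>M)"
proof -
  define q where "q = p / (p - 1)"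
  have pq: "1 / p + 1 / q = 1" using p by (simp add: q_def field_simps)
  have p0: "0 < p" using p by simp
  have [measurable]: "y \<in> borel_measurable M" "H \<in> borel_measurable M"
    using y H by (auto dest: Lebesgue_space_measurable)
  have [measurable]: "duality_map p \<in> borel_measurable (borel :: 'b measure)"
    by (rule borel_measurable_duality_map[OF p])
  define W where "W x = (norm (y x) + norm (H x)) powr p" for x
  show ?thesis
  proof (rule integral_dominated_convergence)
    show "integrable M W"
    proof (rule Bochner_Integration.integrable_bound)
      show "integrable M (\<lambda>x. 2 powr p * (norm (y x) powr p + norm (H x) powr p))"
        using y H by (auto dest: Lebesgue_space_integrable)
      show "AE x in M. norm (W x) \<le> norm (2 powr p * (norm (y x) powr p + norm (H x) powr p))"
        unfolding W_def using powr_add_le_two_powr[OF _ _ p0] by auto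
      show "W \<in> borel_measurable M" unfolding W_def by measurable
    qed
    show "AE x in M. (\<lambda>n. inner (duality_map p (y x + (1 / real (Suc n)) *\<^sub>R H x)) (H x))
        \<longlonglongrightarrow> inner (duality_map p (y x)) (H x)"
    proof (rule AE_I2)
      fix x
      have "(\<lambda>n. y x + (1 / real (Suc n)) *\<^sub>R H x) \<longlonglongrightarrow> y x + 0 *\<^sub>R H x"
        using LIMSEQ_inverse_real_of_nat by (intro tendsto_intros) (simp add: inverse_eq_divide)
      then have lim: "(\<lambda>n. y x + (1 / real (Suc n)) *\<^sub>R H x) \<longlonglongrightarrow> y x" by simp
      have "(\<lambda>n. duality_map p (y x + (1 / real (Suc n)) *\<^sub>R H x)) \<longlonglongrightarrow> duality_map p (y x)"
        by (rule continuous_on_tendsto_compose[OF continuous_on_duality_map[OF p] lim]) auto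
      then show "(\<lambda>n. inner (duality_map p (y x + (1 / real (Suc n)) *\<^sub>R H x)) (H x))
          \<longlonglongrightarrow> inner (duality_map p (y x)) (H x)"
        by (intro tendsto_intros)
    qed
    show "AE x in M. norm (inner (duality_map p (y x + (1 / real (Suc n)) *\<^sub>R H x)) (H x)) \<le> W x" for n
    proof (rule AE_I2)
      fix x
      let ?z = "y x + (1 / real (Suc n)) *\<^sub>R H x" and ?s = "norm (y x) + norm (H x)"
      have "norm ?z \<le> norm (y x) + (1 / real (Suc n)) * norm (H x)"
        by (rule order_trans[OF norm_triangle_ineq]) simp
      also have "\<dots> \<le> ?s" by (simp add: divide_le_eq mult_le_cancel_left1)
      finally have z: "norm ?z \<le> ?s" .
      have "norm (inner (duality_map p ?z) (H x)) \<le> norm (duality_map p ?z) * norm (H x)"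
        by (simp add: Cauchy_Schwarz_ineq2)
      also have "\<dots> \<le> ?s powr (p - 1) * ?s"
        unfolding norm_duality_map using z p by (intro mult_mono powr_mono2) auto
      also have "\<dots> = W x"
        unfolding W_def by (cases "?s = 0") (auto simp: powr_diff)
      finally show "norm (inner (duality_map p ?z) (H x)) \<le> W x" .
    qed
  qed measurable
qed

definition closed_subspace :: "'a measure \<Rightarrow> real \<Rightarrow> ('a \<Rightarrow> 'b::euclidean_space) set \<Rightarrow> bool" where
  "closed_subspace M p V \<longleftrightarrow> V \<subseteq> Lebesgue_space M p \<and> (\<lambda>x. 0) \<in> V \<and>
     (\<forall>F\<in>V. \<forall>G\<in>V. (\<lambda>x. F x + G x) \<in> V) \<and> (\<forall>c. \<forall>F\<in>V. (\<lambda>x. c *\<^sub>R F x) \<in> V) \<and>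
     (\<forall>F G C. (\<forall>n. F n \<in> V \<and> power_mass M p (F n) \<le> C) \<longrightarrow> G \<in> borel_measurable M \<longrightarrow>
       (AE x in M. (\<lambda>n. F n x) \<longlonglongrightarrow> G x) \<longrightarrow> (\<exists>G'\<in>V. AE x in M. G x = G' x))"

text \<open>Members are functions, not classes, and closedness refers to almost everywhere convergence
  of sequences bounded in \<open>L\<^sup>p\<close>. For convex sets and \<open>p > 1\<close> this is weak closedness.\<close>

lemma closed_subspaceD:
  assumes "closed_subspace M p V"
  shows closed_subspace_Lp: "F \<in> V \<Longrightarrow> F \<in> Lebesgue_space M p"
    and closed_subspace_zero: "(\<lambda>x. 0) \<in> V"
    and closed_subspace_add: "F \<in> V \<Longrightarrow> G \<in> V \<Longrightarrow> (\<lambda>x. F x + G x) \<in> V"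
    and closed_subspace_scaleR: "F \<in> V \<Longrightarrow> (\<lambda>x. c *\<^sub>R F x) \<in> V"
  using assms by (auto simp: closed_subspace_def)

lemma closed_subspace_midpoint:
  assumes "closed_subspace M p V" "F \<in> V" "G \<in> V"
  shows "(\<lambda>x. (1/2) *\<^sub>R (F x + G x)) \<in> V"
  using closed_subspaceD[OF assms(1)] assms(2,3) by blast

lemma closed_subspace_closed:
  assumes "closed_subspace M p V" "\<And>n. F n \<in> V" "\<And>n. power_mass M p (F n) \<le> C"
    "G \<in> borel_measurable M" "AE x in M. (\<lambda>n. F n x) \<longlonglongrightarrow> G x"
  shows "\<exists>G'\<in>V. AE x in M. G x = G' x"
proof -
  have "\<forall>F G C. (\<forall>n. F n \<in> V \<and> power_mass M p (F n) \<le> C) \<longrightarrow> G \<in> borel_measurable M \<longrightarrow>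
       (AE x in M. (\<lambda>n. F n x) \<longlonglongrightarrow> G x) \<longrightarrow> (\<exists>G'\<in>V. AE x in M. G x = G' x)"
    using assms(1) unfolding closed_subspace_def by blast
  then show ?thesis using assms(2-5) by blast
qed

lemma closed_subspace_Lebesgue_space:
  assumes "1 < p"
  shows "closed_subspace M p (Lebesgue_space M p)"
proof -
  have p0: "0 < p" using assms by simp
  show ?thesis
    unfolding closed_subspace_def
  proof (intro conjI ballI allI impI)
    fix F and G :: "'a \<Rightarrow> 'b" and C
    assume *: "\<forall>n. F n \<in> Lebesgue_space M p \<and> power_mass M p (F n) \<le> C"
      "G \<in> borel_measurable M" "AE x in M. (\<lambda>n. F n x) \<longlonglongrightarrow> G x"
    have "G \<in> Lebesgue_space M p"
      by (rule Lebesgue_space_Fatou(1)[OF p0, of F M "\<lambda>n. C" C]) (use * in \<open>auto simp: power_mass_def\<close>)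
    then show "\<exists>G'\<in>Lebesgue_space M p. AE x in M. G x = G' x" by auto
  qed (use p0 in \<open>auto intro: Lebesgue_space_zero Lebesgue_space_add Lebesgue_space_scaleR\<close>)
qed

definition annihilator :: "'a measure \<Rightarrow> real \<Rightarrow> ('a \<Rightarrow> 'b::euclidean_space) set \<Rightarrow> ('a \<Rightarrow> 'b) set" where
  "annihilator M q V = {g \<in> Lebesgue_space M q. \<forall>G\<in>V. (\<integral>x. inner (g x) (G x) \<partial>M) = 0}"

text \<open>Pairing with a fixed member of \<open>V\<close> is continuous along L^q-bounded
  sequences that converge almost everywhere, so a vanishing pairing survives.\<close>

lemma closed_subspace_annihilator:
  assumes pq: "1 < p" "1 / p + 1 / q = 1" and V: "V \<subseteq> Lebesgue_space M p"
  shows "closed_subspace M q (annihilator M q V)"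
proof -
  note pqs = conjugate_exponent_props[OF pq]
  have q0: "0 < q" using pqs(1) by simp
  have i: "integrable M (\<lambda>x. inner (g x) (G x))" if "g \<in> Lebesgue_space M q" "G \<in> V" for g G
    using Lebesgue_space_dual_inner[OF pqs(1,3)] that V by blast
  show ?thesis
    unfolding closed_subspace_def
  proof (intro conjI ballI allI impI)
    show "annihilator M q V \<subseteq> Lebesgue_space M q" by (auto simp: annihilator_def)
    show "(\<lambda>x. 0) \<in> annihilator M q V" by (simp add: annihilator_def Lebesgue_space_zero)
    show "(\<lambda>x. F x + G x) \<in> annihilator M q V"
      if "F \<in> annihilator M q V" "G \<in> annihilator M q V" for F G
      using that i by (auto simp: annihilator_def inner_add_left intro!: Lebesgue_space_add[OF q0])
    show "(\<lambda>x. c *\<^sub>R F x) \<in> annihilator M q V" if "F \<in> annihilator M q V" for F c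
      using that i by (auto simp: annihilator_def intro!: Lebesgue_space_scaleR)
  next
    fix F and G :: "'a \<Rightarrow> 'b" and C
    assume F: "\<forall>n. F n \<in> annihilator M q V \<and> power_mass M q (F n) \<le> C"
      and G: "G \<in> borel_measurable M" "AE x in M. (\<lambda>n. F n x) \<longlonglongrightarrow> G x"
    have F': "F n \<in> Lebesgue_space M q" "(\<integral>x. norm (F n x) powr q \<partial>M) \<le> C" for n
      using F by (auto simp: annihilator_def power_mass_def)
    have "G \<in> Lebesgue_space M q"
      by (rule Lebesgue_space_Fatou(1)[OF q0 F' tendsto_const G])
    moreover have "(\<integral>x. inner (G x) (H x) \<partial>M) = 0" if H: "H \<in> V" for H
    proof -
      have "(\<lambda>n. \<integral>x. inner (F n x) (H x) \<partial>M) \<longlonglongrightarrow> (\<integral>x. inner (G x) (H x) \<partial>M)"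
        using H V by (intro bounded_in_Lp_inner_tendsto[OF pqs(1,3) F' G]) auto
      moreover have "(\<integral>x. inner (F n x) (H x) \<partial>M) = 0" for n
        using F H by (auto simp: annihilator_def)
      ultimately show ?thesis by (simp add: LIMSEQ_const_iff)
    qed
    ultimately have "G \<in> annihilator M q V" by (auto simp: annihilator_def)
    then show "\<exists>G'\<in>annihilator M q V. AE x in M. G x = G' x" by auto
  qed
qed

section \<open>Projection onto closed subspaces, and adjunction of constants\<close>

context finite_measure
begin

lemma integral_norm_le_power_mass:
  assumes p: "1 < p" and f: "f \<in> Lebesgue_space M p"
  shows "(\<integral>x. norm (f x) \<partial>M) \<le> power_mass M p f + measure M (space M)"
proof -
  have "(\<integral>x. norm (f x) \<partial>M) \<le> (\<integral>x. norm (f x) powr p + 1 \<partial>M)"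
  proof (rule integral_mono)
    show "integrable M (\<lambda>x. norm (f x))" by (rule Lebesgue_space_integrable_norm(1)[OF p f])
    show "integrable M (\<lambda>x. norm (f x) powr p + 1)" using Lebesgue_space_integrable[OF f] by auto
    show "norm (f x) \<le> norm (f x) powr p + 1" for x
    proof (cases "norm (f x) \<le> 1")
      case False
      then have "norm (f x) powr 1 \<le> norm (f x) powr p" using p by (intro powr_mono) auto
      then show ?thesis using False by simp
    qed (smt (verit) powr_ge_zero)
  qed
  then show ?thesis using Lebesgue_space_integrable[OF f] by (simp add: power_mass_def)
qed

lemma bounded_in_Lp_integral_tendsto:
  fixes F :: "nat \<Rightarrow> 'a \<Rightarrow> 'b::euclidean_space"
  assumes p: "1 < p" and F: "\<And>n. F n \<in> Lebesgue_space M p" "\<And>n. power_mass M p (F n) \<le> C"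
    and G: "G \<in> Lebesgue_space M p" and lim: "AE x in M. (\<lambda>n. F n x) \<longlonglongrightarrow> G x"
  shows "(\<lambda>n. \<integral>x. norm (F n x - G x) \<partial>M) \<longlonglongrightarrow> 0"
    and "(\<lambda>n. \<integral>x. F n x \<partial>M) \<longlonglongrightarrow> (\<integral>x. G x \<partial>M)"
proof -
  define q where "q = p / (p - 1)"
  have pq: "1 / p + 1 / q = 1" using p by (simp add: q_def field_simps)
  have "(\<lambda>n. \<integral>x. norm (F n x - G x) * norm (1 :: real) \<partial>M) \<longlonglongrightarrow> 0"
    by (rule bounded_in_Lp_pairing_tendsto[OF p pq F(1) F(2)[unfolded power_mass_def]
          Lebesgue_space_measurable[OF G] lim Lebesgue_space_const])
  then show l: "(\<lambda>n. \<integral>x. norm (F n x - G x) \<partial>M) \<longlonglongrightarrow> 0" by simp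
  have "(\<lambda>n. (\<integral>x. F n x \<partial>M) - (\<integral>x. G x \<partial>M)) \<longlonglongrightarrow> 0"
  proof (rule Lim_null_comparison[OF _ l], rule always_eventually, rule allI)
    fix n
    have "(\<integral>x. F n x \<partial>M) - (\<integral>x. G x \<partial>M) = (\<integral>x. F n x - G x \<partial>M)"
      by (rule Bochner_Integration.integral_diff[symmetric])
        (intro Lebesgue_space_integrable_norm(2)[OF p] F G)+
    then show "norm ((\<integral>x. F n x \<partial>M) - (\<integral>x. G x \<partial>M)) \<le> (\<integral>x. norm (F n x - G x) \<partial>M)"
      using integral_norm_bound by metis
  qed
  then show "(\<lambda>n. \<integral>x. F n x \<partial>M) \<longlonglongrightarrow> (\<integral>x. G x \<partial>M)" by (simp add: LIM_zero_iff)
qed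

text \<open>Replaces the limit by an actual member of \<open>V\<close> and keeps track of its mean,
  on which the later constraints depend.\<close>

lemma closed_subspace_limit:
  fixes F :: "nat \<Rightarrow> 'a \<Rightarrow> 'b::euclidean_space"
  assumes p: "1 < p" and V: "closed_subspace M p V"
    and F: "\<And>n. F n \<in> V" "\<And>n. power_mass M p (F n) \<le> C"
    and G: "G \<in> borel_measurable M" and lim: "AE x in M. (\<lambda>n. F n x) \<longlonglongrightarrow> G x"
  obtains u where "u \<in> V" "AE x in M. (\<lambda>n. F n x) \<longlonglongrightarrow> u x"
    "(\<lambda>n. \<integral>x. F n x \<partial>M) \<longlonglongrightarrow> (\<integral>x. u x \<partial>M)"
proof -
  obtain u where u: "u \<in> V" "AE x in M. G x = u x"
    using closed_subspace_closed[OF V F G lim] by blast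
  have l: "AE x in M. (\<lambda>n. F n x) \<longlonglongrightarrow> u x" using lim u(2) by eventually_elim simp
  show thesis
    using that[OF u(1) l bounded_in_Lp_integral_tendsto(2)[OF p _ F(2) _ l]]
      closed_subspace_Lp[OF V] u(1) F(1) by blast
qed

text \<open>If \<open>u\<close> is not in \<open>V\<close> and \<open>G\<close> minimises \<open>\<integral>|u - G|\<^sup>p\<close> over \<open>V\<close>, then the duality map
  at \<open>u - G\<close> annihilates \<open>V\<close> but not \<open>u\<close>.\<close>

lemma annihilator_bipolar:
  fixes u :: "'a \<Rightarrow> 'b::euclidean_space"
  assumes pq: "1 < p" "1 / p + 1 / q = 1" and V: "closed_subspace M p V"
    and u: "u \<in> Lebesgue_space M p"
    and ann: "\<And>g. g \<in> annihilator M q V \<Longrightarrow> (\<integral>x. inner (g x) (u x) \<partial>M) = 0"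
  obtains G where "G \<in> V" "AE x in M. u x = G x"
proof -
  have p0: "0 < p" using pq by simp
  note pqs = conjugate_exponent_props[OF pq]
  note VL = closed_subspace_Lp[OF V]
  define J where "J G = power_mass M p (\<lambda>x. G x - u x)" for G
  have bound: "power_mass M p G \<le> 2 powr p * (J G + power_mass M p u)" if "G \<in> V" for G
    using power_mass_add_le[OF p0 Lebesgue_space_diff[OF p0 VL[OF that] u] u] by (simp add: J_def)
  obtain G where G: "G \<in> V" and Gmin: "\<And>H. H \<in> V \<Longrightarrow> J G \<le> J H"
  proof (rule direct_method[of V 0 J "\<lambda>G. G"])
    show "V \<noteq> {}" using closed_subspace_zero[OF V] by auto
    show "0 \<le> J G" for G by (simp add: J_def power_mass_nonneg)
    show "integrable M G" if "G \<in> V" for G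
      using Lebesgue_space_integrable_norm(2)[OF pq(1) VL[OF that]] .
    show "\<exists>C. \<forall>G\<in>V. J G \<le> c \<longrightarrow> (\<integral>x. norm (G x) \<partial>M) \<le> C" for c
    proof (intro exI ballI impI)
      fix G assume G: "G \<in> V" "J G \<le> c"
      have "2 powr p * (J G + power_mass M p u) \<le> 2 powr p * (c + power_mass M p u)"
        using G by simp
      then show "(\<integral>x. norm (G x) \<partial>M) \<le> 2 powr p * (c + power_mass M p u) + measure M (space M)"
        using integral_norm_le_power_mass[OF pq(1) VL[OF G(1)]] bound[OF G(1)] by linarith
    qed
    show "\<exists>k\<in>V. (\<forall>x\<in>space M. k x = (1/2) *\<^sub>R (i x + j x)) \<and> J k \<le> (J i + J j) / 2"
      if ij: "i \<in> V" "j \<in> V" for i j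
    proof (intro bexI conjI ballI)
      have "J (\<lambda>x. (1/2) *\<^sub>R (i x + j x))
          = power_mass M p (\<lambda>x. (1/2) *\<^sub>R ((i x - u x) + (j x - u x)))"
      proof -
        have "(1/2) *\<^sub>R (i x + j x) - u x = (1/2) *\<^sub>R ((i x - u x) + (j x - u x))" for x
          by (simp add: algebra_simps flip: scaleR_add_left)
        then show ?thesis by (simp add: J_def)
      qed
      also have "\<dots> \<le> (J i + J j) / 2"
        unfolding J_def by (intro power_mass_midpoint_le pq Lebesgue_space_diff p0 VL ij u)
      finally show "J (\<lambda>x. (1/2) *\<^sub>R (i x + j x)) \<le> (J i + J j) / 2" .
    qed (use closed_subspace_midpoint[OF V ij] in auto)
    fix s g m
    assume s: "\<And>n. s n \<in> V" "\<And>n. J (s n) \<le> m + 1 / real (Suc n)"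
      and g: "g \<in> borel_measurable M" "AE x in M. (\<lambda>n. s n x) \<longlonglongrightarrow> g x"
    have "power_mass M p (s n) \<le> 2 powr p * (m + 1 + power_mass M p u)" for n
    proof -
      have "1 / real (Suc n) \<le> 1" by simp
      then have "J (s n) \<le> m + 1" using s(2)[of n] by linarith
      then have "2 powr p * (J (s n) + power_mass M p u) \<le> 2 powr p * (m + 1 + power_mass M p u)"
        by simp
      then show ?thesis using bound[OF s(1)[of n]] by linarith
    qed
    then obtain v where v: "v \<in> V" "AE x in M. (\<lambda>n. s n x) \<longlonglongrightarrow> v x"
      using closed_subspace_limit[OF pq(1) V s(1) _ g] by metis
    have "J v \<le> m"
      unfolding J_def power_mass_def
    proof (rule Lebesgue_space_Fatou(2)[OF p0, of "\<lambda>n x. s n x - u x"])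
      show "(\<lambda>x. s n x - u x) \<in> Lebesgue_space M p" for n
        by (intro Lebesgue_space_diff p0 VL s u)
      show "(\<integral>x. norm (s n x - u x) powr p \<partial>M) \<le> m + 1 / real (Suc n)" for n
        using s(2)[of n] by (simp add: J_def power_mass_def)
      show "(\<lambda>n. m + 1 / real (Suc n)) \<longlonglongrightarrow> m"
        using LIMSEQ_inverse_real_of_nat_add[of m] by (simp add: inverse_eq_divide)
      show "(\<lambda>x. v x - u x) \<in> borel_measurable M"
        by (rule Lebesgue_space_measurable[OF Lebesgue_space_diff[OF p0 VL[OF v(1)] u]])
      show "AE x in M. (\<lambda>n. s n x - u x) \<longlonglongrightarrow> v x - u x"
        using v(2) by eventually_elim (intro tendsto_intros)
    qed
    with v(1) show "\<exists>i\<in>V. J i \<le> m" by blast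
  qed (rule that)
  define y where "y x = G x - u x" for x
  have yL: "y \<in> Lebesgue_space M p" unfolding y_def by (intro Lebesgue_space_diff p0 VL G u)
  define g where "g x = duality_map p (y x)" for x
  have gL: "g \<in> Lebesgue_space M q"
    unfolding g_def by (rule duality_map_Lebesgue_space[OF pq yL])
  \<comment> \<open>Minimality along G + t H, divided by t > 0 and passed to t = 0, gives one sign
    only; applying it to -H as well gives equality.\<close>
  have ge: "0 \<le> (\<integral>x. inner (g x) (H x) \<partial>M)" if H: "H \<in> V" for H
  proof -
    define S where "S n = (\<integral>x. inner (duality_map p (y x + (1 / real (Suc n)) *\<^sub>R H x)) (H x) \<partial>M)" for n
    have "0 \<le> S n" for n
    proof -
      define t where "t = 1 / real (Suc n)"
      have t: "0 < t" by (simp add: t_def)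
      have "(\<lambda>x. G x + t *\<^sub>R H x) \<in> V"
        using closed_subspace_add[OF V G closed_subspace_scaleR[OF V H]] .
      then have "J G \<le> J (\<lambda>x. G x + t *\<^sub>R H x)" by (rule Gmin)
      then have "0 \<le> power_mass M p (\<lambda>x. y x + t *\<^sub>R H x) - power_mass M p y"
        by (simp add: J_def y_def[abs_def] algebra_simps)
      also have "\<dots> \<le> t * (p * S n)"
        unfolding S_def t_def[symmetric] by (rule power_mass_variation[OF pq(1) yL VL[OF H]])
      finally show "0 \<le> S n" using t p0 by (simp add: zero_le_mult_iff)
    qed
    moreover have "S \<longlonglongrightarrow> (\<integral>x. inner (g x) (H x) \<partial>M)"
      unfolding S_def g_def by (rule duality_map_variation_tendsto[OF pq(1) yL VL[OF H]])
    ultimately show ?thesis by (intro LIMSEQ_le_const) auto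
  qed
  have gz: "(\<integral>x. inner (g x) (H x) \<partial>M) = 0" if H: "H \<in> V" for H
    using ge[OF H] ge[OF closed_subspace_scaleR[OF V H, of "-1"]] by simp
  then have "g \<in> annihilator M q V" using gL by (simp add: annihilator_def)
  \<comment> \<open>Testing \<open>g\<close> with \<open>y\<close>, which is \<open>G\<close> minus
    \<open>u\<close>, gives the mass of \<open>y\<close>. Both parts vanish: one because
    \<open>G\<close> is in \<open>V\<close>, the other by the assumption on
    \<open>u\<close>.\<close>
  then have "(\<integral>x. inner (g x) (u x) \<partial>M) = 0" by (rule ann)
  moreover have "power_mass M p y = (\<integral>x. inner (g x) (G x) - inner (g x) (u x) \<partial>M)"
    unfolding power_mass_def g_def y_def by (simp flip: inner_diff_right add: inner_duality_map)
  moreover have "integrable M (\<lambda>x. inner (g x) (G x))" "integrable M (\<lambda>x. inner (g x) (u x))"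
    using Lebesgue_space_dual_inner[OF pqs(1,3) gL] VL[OF G] u by auto
  ultimately have "power_mass M p y \<le> 0" using gz[OF G] by simp
  then have "AE x in M. y x = 0" by (rule power_mass_eq_0_AE[OF yL])
  then show thesis by (intro that[OF G]) (auto simp: y_def)
qed

definition adjoin_constants :: "('a \<Rightarrow> 'b::euclidean_space) set \<Rightarrow> ('a \<Rightarrow> 'b) set" where
  "adjoin_constants V = {(\<lambda>x. \<xi> + G x) | \<xi> G. G \<in> V}"

text \<open>Members of \<open>V\<close> have mean zero, so the constant part is the mean of the
  whole function and converges with it; the remainder is then bounded and converges to a member of
  \<open>V\<close>.\<close>

lemma closed_subspace_adjoin_constants:
  fixes V :: "('a \<Rightarrow> 'b::euclidean_space) set"
  assumes p: "1 < p" and V: "closed_subspace M p V"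
    and mean: "\<And>G. G \<in> V \<Longrightarrow> (\<integral>x. G x \<partial>M) = 0" and pos: "0 < measure M (space M)"
  shows "closed_subspace M p (adjoin_constants V)"
  unfolding closed_subspace_def
proof (intro conjI ballI allI impI)
  have p0: "0 < p" using p by simp
  note VL = closed_subspace_Lp[OF V]
  show sub: "adjoin_constants V \<subseteq> Lebesgue_space M p"
    unfolding adjoin_constants_def
    by (clarify, rule Lebesgue_space_add[OF p0 Lebesgue_space_const VL])
  show "(\<lambda>x. 0) \<in> adjoin_constants V"
    unfolding adjoin_constants_def mem_Collect_eq
    by (intro exI[of _ 0] exI[of _ "\<lambda>x. 0"]) (use closed_subspace_zero[OF V] in auto)
  show "(\<lambda>x. F x + G x) \<in> adjoin_constants V"
    if FG: "F \<in> adjoin_constants V" "G \<in> adjoin_constants V" for F G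
  proof -
    obtain \<xi> F' where F: "F = (\<lambda>x. \<xi> + F' x)" "F' \<in> V" using FG(1) by (auto simp: adjoin_constants_def)
    obtain \<eta> G' where G: "G = (\<lambda>x. \<eta> + G' x)" "G' \<in> V" using FG(2) by (auto simp: adjoin_constants_def)
    show ?thesis unfolding adjoin_constants_def mem_Collect_eq
      by (intro exI[of _ "\<xi> + \<eta>"] exI[of _ "\<lambda>x. F' x + G' x"])
        (use F G closed_subspace_add[OF V] in \<open>auto simp: algebra_simps\<close>)
  qed
  show "(\<lambda>x. c *\<^sub>R F x) \<in> adjoin_constants V" if FG: "F \<in> adjoin_constants V" for F c
  proof -
    obtain \<xi> F' where F: "F = (\<lambda>x. \<xi> + F' x)" "F' \<in> V" using FG(1) by (auto simp: adjoin_constants_def)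
    show ?thesis unfolding adjoin_constants_def mem_Collect_eq
      by (intro exI[of _ "c *\<^sub>R \<xi>"] exI[of _ "\<lambda>x. c *\<^sub>R F' x"])
        (use F closed_subspace_scaleR[OF V] in \<open>auto simp: algebra_simps\<close>)
  qed
  fix F and G :: "'a \<Rightarrow> 'b" and C
  assume F: "\<forall>n. F n \<in> adjoin_constants V \<and> power_mass M p (F n) \<le> C"
    and G: "G \<in> borel_measurable M" "AE x in M. (\<lambda>n. F n x) \<longlonglongrightarrow> G x"
  have FL: "F n \<in> Lebesgue_space M p" for n using F sub by blast
  have FC: "power_mass M p (F n) \<le> C" for n using F by blast
  have "\<forall>n. \<exists>\<xi> H. F n = (\<lambda>x. \<xi> + H x) \<and> H \<in> V"
    using F unfolding adjoin_constants_def by blast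
  then obtain \<xi> H where FH: "\<And>n. F n = (\<lambda>x. \<xi> n + H n x)" and H: "\<And>n. H n \<in> V" by metis
  have GL: "G \<in> Lebesgue_space M p"
    by (rule Lebesgue_space_Fatou(1)[OF p0 FL _ tendsto_const G]) (use FC in \<open>simp add: power_mass_def\<close>)
  have Fint: "(\<integral>x. F n x \<partial>M) = measure M (space M) *\<^sub>R \<xi> n" for n
    unfolding FH using Lebesgue_space_integrable_norm(2)[OF p VL[OF H]] mean[OF H] by simp
  define \<eta> where "\<eta> = (1 / measure M (space M)) *\<^sub>R (\<integral>x. G x \<partial>M)"
  have "(\<lambda>n. (1 / measure M (space M)) *\<^sub>R (\<integral>x. F n x \<partial>M)) \<longlonglongrightarrow> \<eta>"
    unfolding \<eta>_def by (intro tendsto_intros bounded_in_Lp_integral_tendsto(2)[OF p FL FC GL G(2)])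
  then have \<xi>: "\<xi> \<longlonglongrightarrow> \<eta>" unfolding Fint using pos by simp
  then have "Bseq \<xi>" by (rule convergent_imp_Bseq[OF convergentI])
  then obtain K where K: "\<And>n. norm (\<xi> n) \<le> K" by (auto simp: Bseq_def)
  have HB: "power_mass M p (H n) \<le> 2 powr p * (C + measure M (space M) * K powr p)" for n
  proof -
    have "power_mass M p (\<lambda>x. F n x + - \<xi> n)
        \<le> 2 powr p * (power_mass M p (F n) + power_mass M p (\<lambda>x. - \<xi> n))"
      by (intro power_mass_add_le p0 FL Lebesgue_space_const)
    also have "power_mass M p (\<lambda>x. - \<xi> n) \<le> measure M (space M) * K powr p"
      unfolding power_mass_def using K[of n] p0 by (auto intro!: mult_left_mono powr_mono2)
    finally show ?thesis using FC[of n] by (simp add: FH) (smt (verit) powr_gt_zero mult_left_mono)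
  qed
  have "AE x in M. (\<lambda>n. H n x) \<longlonglongrightarrow> G x - \<eta>"
    using G(2)
  proof eventually_elim
    case (elim x)
    have "(\<lambda>n. F n x - \<xi> n) \<longlonglongrightarrow> G x - \<eta>" using elim \<xi> by (intro tendsto_intros)
    then show ?case by (simp add: FH)
  qed
  then obtain H' where H': "H' \<in> V" "AE x in M. G x - \<eta> = H' x"
    using closed_subspace_closed[of M p V H _ "\<lambda>x. G x - \<eta>", OF V H HB] G(1) by auto
  show "\<exists>G'\<in>adjoin_constants V. AE x in M. G x = G' x"
  proof (rule bexI[of _ "\<lambda>x. \<eta> + H' x"])
    show "AE x in M. G x = \<eta> + H' x" using H'(2) by eventually_elim (simp add: algebra_simps)
    show "(\<lambda>x. \<eta> + H' x) \<in> adjoin_constants V" using H'(1) by (auto simp: adjoin_constants_def)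
  qed
qed

end

lemma integrable_Pair:
  fixes f :: "'a \<Rightarrow> 'b::euclidean_space" and g :: "'a \<Rightarrow> 'c::euclidean_space"
  assumes "integrable M f" "integrable M g"
  shows "integrable M (\<lambda>x. (f x, g x))"
proof (rule Bochner_Integration.integrable_bound)
  show "integrable M (\<lambda>x. norm (f x) + norm (g x))" using assms by auto
  show "(\<lambda>x. (f x, g x)) \<in> borel_measurable M" using assms by (intro borel_measurable_Pair) auto
  show "AE x in M. norm (f x, g x) \<le> norm (norm (f x) + norm (g x))" by (simp add: norm_Pair_le)
qed

section \<open>Finite selfdual Lagrangians\<close>

lemma selfdual_convex_on:
  fixes \<Lambda> :: "'e::euclidean_space \<times> 'e \<Rightarrow> real"
  assumes "selfdual_Lagrangian (\<lambda>z. ereal (\<Lambda> z))"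
  shows "convex_on UNIV \<Lambda>"
proof (rule convex_onI)
  fix t :: real and x y :: "'e \<times> 'e"
  assume t: "0 < t" "t < 1"
  have "convex_ereal (\<lambda>z. ereal (\<Lambda> z))" using assms by (simp add: selfdual_Lagrangian_def)
  then have "ereal (\<Lambda> ((1 - t) *\<^sub>R x + t *\<^sub>R y)) \<le> ereal (1 - t) * ereal (\<Lambda> x) + ereal t * ereal (\<Lambda> y)"
    using t unfolding convex_ereal_def
    by (elim allE[of _ x] allE[of _ y] allE[of _ "1 - t"] allE[of _ t]) auto
  then show "\<Lambda> ((1 - t) *\<^sub>R x + t *\<^sub>R y) \<le> (1 - t) * \<Lambda> x + t * \<Lambda> y" by simp
qed simp

lemma selfdual_continuous_on:
  fixes \<Lambda> :: "'e::euclidean_space \<times> 'e \<Rightarrow> real"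
  assumes "selfdual_Lagrangian (\<lambda>z. ereal (\<Lambda> z))"
  shows "continuous_on UNIV \<Lambda>"
  by (rule convex_on_continuous[OF open_UNIV selfdual_convex_on[OF assms]])

lemma selfdual_Fenchel:
  fixes \<Lambda> :: "'e::euclidean_space \<times> 'e \<Rightarrow> real"
  assumes "selfdual_Lagrangian (\<lambda>z. ereal (\<Lambda> z))"
  shows "inner b \<xi> + inner a \<eta> \<le> \<Lambda> (a, b) + \<Lambda> (\<xi>, \<eta>)"
proof -
  have "ereal (inner b \<xi> + inner a \<eta>) - ereal (\<Lambda> (\<xi>, \<eta>)) \<le> lagrangian_dual (\<lambda>z. ereal (\<Lambda> z)) (b, a)"
    unfolding lagrangian_dual_def by (auto intro: SUP_upper2[of "(\<xi>, \<eta>)"])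
  also have "\<dots> = ereal (\<Lambda> (a, b))" using assms by (simp add: selfdual_Lagrangian_def)
  finally show ?thesis by simp
qed

lemma selfdual_ge_inner:
  fixes \<Lambda> :: "'e::euclidean_space \<times> 'e \<Rightarrow> real"
  assumes "selfdual_Lagrangian (\<lambda>z. ereal (\<Lambda> z))"
  shows "inner a b \<le> \<Lambda> (a, b)"
  using selfdual_Fenchel[OF assms, of b a a b] by (simp add: inner_commute)

text \<open>A subgradient (b, a) at \<open>z\<close> makes \<open>z\<close> a maximiser in the
  supremum defining the dual at (b, a), and selfduality reads this dual value as
  \<open>\<Lambda> (a, b)\<close>. This is where the two components change places.\<close>

lemma selfdual_subgradient_eq:
  fixes \<Lambda> :: "'e::euclidean_space \<times> 'e \<Rightarrow> real"
  assumes "selfdual_Lagrangian (\<lambda>z. ereal (\<Lambda> z))"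
    and "\<And>r. \<Lambda> z + inner (b, a) (r - z) \<le> \<Lambda> r"
  shows "\<Lambda> (a, b) \<le> inner (b, a) z - \<Lambda> z"
proof -
  have "ereal (\<Lambda> (a, b)) = lagrangian_dual (\<lambda>z. ereal (\<Lambda> z)) (b, a)"
    using assms(1) by (simp add: selfdual_Lagrangian_def)
  also have "\<dots> \<le> ereal (inner (b, a) z - \<Lambda> z)"
    unfolding lagrangian_dual_def prod.case
  proof (rule SUP_least, clarify)
    fix \<xi> \<eta>
    show "ereal (inner b \<xi> + inner a \<eta>) - ereal (\<Lambda> (\<xi>, \<eta>)) \<le> ereal (inner (b, a) z - \<Lambda> z)"
      using assms(2)[of "(\<xi>, \<eta>)"] by (cases z) (simp add: inner_diff_right)
  qed
  finally show ?thesis by simp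
qed

section \<open>The cell problem\<close>

text \<open>\<open>M\<close> stands for Lebesgue measure on the cell and \<open>V\<close> for the
  periodic gradients. Of the latter only closedness and mean zero enter, which separates the
  variational argument from the geometry of the lattice.\<close>

locale selfdual_cell_problem = finite_measure M
  for M :: "'a measure" +
  fixes p q :: real
    and L :: "'a \<Rightarrow> 'e::euclidean_space \<times> 'e \<Rightarrow> real"
    and V :: "('a \<Rightarrow> 'e) set"
    and C\<^sub>0 C\<^sub>1 :: real and n\<^sub>0 n\<^sub>1 :: "'a \<Rightarrow> real"
  assumes pq: "1 < p" "1 / p + 1 / q = 1"
    and L_measurable: "(\<lambda>(x, z). L x z) \<in> borel_measurable (M \<Otimes>\<^sub>M borel)"
    and L_selfdual: "\<And>x. selfdual_Lagrangian (\<lambda>z. ereal (L x z))"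
    and C\<^sub>0: "0 < C\<^sub>0" and C\<^sub>1: "0 < C\<^sub>1" and n\<^sub>0: "integrable M n\<^sub>0" and n\<^sub>1: "integrable M n\<^sub>1"
    and growth: "AE x in M. \<forall>a b. C\<^sub>0 * (norm a powr p + norm b powr q - n\<^sub>0 x) \<le> L x (a, b) \<and>
        L x (a, b) \<le> C\<^sub>1 * (norm a powr p + norm b powr q + n\<^sub>1 x)"
    and mass_pos: "0 < measure M (space M)"
    and V: "closed_subspace M p V"
    and V_mean: "\<And>G. G \<in> V \<Longrightarrow> (\<integral>x. G x \<partial>M) = 0"
begin

abbreviation "mass \<equiv> measure M (space M)"

lemma p0: "0 < p" and q1: "1 < q" and q0: "0 < q" and qp: "1 / q + 1 / p = 1"
  using pq conjugate_exponent_props[OF pq] by auto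

definition energy :: "('a \<Rightarrow> 'e) \<Rightarrow> ('a \<Rightarrow> 'e) \<Rightarrow> real" where
  "energy u w = (\<integral>x. L x (u x, w x) \<partial>M)"

abbreviation "VC \<equiv> adjoin_constants V"
abbreviation "Sol \<equiv> annihilator M q V"

lemma VC: "closed_subspace M p VC"
  by (rule closed_subspace_adjoin_constants[OF pq(1) V V_mean mass_pos])

lemma Sol: "closed_subspace M q Sol"
  by (rule closed_subspace_annihilator[OF pq]) (use closed_subspace_Lp[OF V] in auto)

lemma const_in_VC: "(\<lambda>x. \<xi>) \<in> VC"
  using closed_subspace_zero[OF V] by (force simp: adjoin_constants_def)

lemma const_in_Sol: "(\<lambda>x. \<eta>) \<in> Sol"
  using V_mean Lebesgue_space_integrable_norm(2)[OF pq(1) closed_subspace_Lp[OF V]]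
  by (auto simp: annihilator_def Lebesgue_space_const)

lemma integrable_Lp: "u \<in> Lebesgue_space M p \<Longrightarrow> integrable M u"
  and integrable_Lq: "w \<in> Lebesgue_space M q \<Longrightarrow> integrable M w"
  using Lebesgue_space_integrable_norm(2)[OF pq(1)] Lebesgue_space_integrable_norm(2)[OF q1] by blast+

lemma L_comp_measurable:
  assumes "u \<in> borel_measurable M" "w \<in> borel_measurable M"
  shows "(\<lambda>x. L x (u x, w x)) \<in> borel_measurable M"
proof -
  have "(\<lambda>x. (x, (u x, w x))) \<in> M \<rightarrow>\<^sub>M M \<Otimes>\<^sub>M borel"
    using assms by (intro measurable_Pair borel_measurable_Pair) auto
  from measurable_compose[OF this L_measurable] show ?thesis by simp
qed

lemma L_integrable:
  assumes u: "u \<in> Lebesgue_space M p" and w: "w \<in> Lebesgue_space M q"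
  shows "integrable M (\<lambda>x. L x (u x, w x))"
proof (rule Bochner_Integration.integrable_bound)
  show "integrable M (\<lambda>x. C\<^sub>0 * (norm (u x) powr p + norm (w x) powr q + \<bar>n\<^sub>0 x\<bar>)
      + C\<^sub>1 * (norm (u x) powr p + norm (w x) powr q + \<bar>n\<^sub>1 x\<bar>))"
    using Lebesgue_space_integrable[OF u] Lebesgue_space_integrable[OF w] n\<^sub>0 n\<^sub>1 by simp
  show "(\<lambda>x. L x (u x, w x)) \<in> borel_measurable M"
    using u w by (intro L_comp_measurable) (auto dest: Lebesgue_space_measurable)
  show "AE x in M. norm (L x (u x, w x)) \<le> norm (C\<^sub>0 * (norm (u x) powr p + norm (w x) powr q + \<bar>n\<^sub>0 x\<bar>)
      + C\<^sub>1 * (norm (u x) powr p + norm (w x) powr q + \<bar>n\<^sub>1 x\<bar>))"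
    using growth
  proof eventually_elim
    case (elim x)
    define N where "N = norm (u x) powr p + norm (w x) powr q"
    have N0: "0 \<le> N" by (simp add: N_def)
    have *: "C\<^sub>0 * (N - n\<^sub>0 x) \<le> L x (u x, w x)" "L x (u x, w x) \<le> C\<^sub>1 * (N + n\<^sub>1 x)"
      using elim by (auto simp: N_def)
    have a: "C\<^sub>1 * (N + n\<^sub>1 x) \<le> C\<^sub>1 * (N + \<bar>n\<^sub>1 x\<bar>)" using C\<^sub>1 by (intro mult_left_mono) auto
    have b: "- (C\<^sub>0 * (N + \<bar>n\<^sub>0 x\<bar>)) \<le> C\<^sub>0 * (N - n\<^sub>0 x)"
    proof -
      have "C\<^sub>0 * (- (N + \<bar>n\<^sub>0 x\<bar>)) \<le> C\<^sub>0 * (N - n\<^sub>0 x)" using C\<^sub>0 N0 by (intro mult_left_mono) auto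
      then show ?thesis by (simp only: mult_minus_right)
    qed
    have "0 \<le> C\<^sub>0 * (N + \<bar>n\<^sub>0 x\<bar>)" "0 \<le> C\<^sub>1 * (N + \<bar>n\<^sub>1 x\<bar>)" using C\<^sub>0 C\<^sub>1 N0 by auto
    then have "\<bar>L x (u x, w x)\<bar> \<le> C\<^sub>0 * (N + \<bar>n\<^sub>0 x\<bar>) + C\<^sub>1 * (N + \<bar>n\<^sub>1 x\<bar>)"
      using * a b by linarith
    then show ?case unfolding N_def real_norm_def by linarith
  qed
qed

lemma energy_convex:
  assumes u: "u \<in> Lebesgue_space M p" "u' \<in> Lebesgue_space M p"
    and w: "w \<in> Lebesgue_space M q" "w' \<in> Lebesgue_space M q"
    and t: "0 \<le> t" "t \<le> 1"
  shows "energy (\<lambda>x. (1 - t) *\<^sub>R u x + t *\<^sub>R u' x) (\<lambda>x. (1 - t) *\<^sub>R w x + t *\<^sub>R w' x)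
      \<le> (1 - t) * energy u w + t * energy u' w'"
proof -
  have "energy (\<lambda>x. (1 - t) *\<^sub>R u x + t *\<^sub>R u' x) (\<lambda>x. (1 - t) *\<^sub>R w x + t *\<^sub>R w' x)
      \<le> (\<integral>x. (1 - t) * L x (u x, w x) + t * L x (u' x, w' x) \<partial>M)"
    unfolding energy_def
  proof (rule integral_mono)
    show "integrable M (\<lambda>x. L x ((1 - t) *\<^sub>R u x + t *\<^sub>R u' x, (1 - t) *\<^sub>R w x + t *\<^sub>R w' x))"
      by (intro L_integrable Lebesgue_space_add Lebesgue_space_scaleR p0 q0 u w)
    show "integrable M (\<lambda>x. (1 - t) * L x (u x, w x) + t * L x (u' x, w' x))"
      using L_integrable u w by auto
    fix x
    show "L x ((1 - t) *\<^sub>R u x + t *\<^sub>R u' x, (1 - t) *\<^sub>R w x + t *\<^sub>R w' x)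
        \<le> (1 - t) * L x (u x, w x) + t * L x (u' x, w' x)"
      using convex_onD[OF selfdual_convex_on[OF L_selfdual], of t "(u x, w x)" "(u' x, w' x)" x] t by simp
  qed
  then show ?thesis using L_integrable u w by (simp add: energy_def)
qed

lemma energy_midpoint:
  assumes u: "u \<in> Lebesgue_space M p" "u' \<in> Lebesgue_space M p"
    and w: "w \<in> Lebesgue_space M q" "w' \<in> Lebesgue_space M q"
  shows "energy (\<lambda>x. (1/2) *\<^sub>R (u x + u' x)) (\<lambda>x. (1/2) *\<^sub>R (w x + w' x)) \<le> (energy u w + energy u' w') / 2"
  using energy_convex[OF assms, of "1/2"] by (simp add: scaleR_add_right)

lemma energy_coercive:
  assumes u: "u \<in> Lebesgue_space M p" and w: "w \<in> Lebesgue_space M q"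
  shows "C\<^sub>0 * (power_mass M p u + power_mass M q w) - C\<^sub>0 * (\<integral>x. n\<^sub>0 x \<partial>M) \<le> energy u w"
proof -
  have i: "integrable M (\<lambda>x. norm (u x) powr p)" "integrable M (\<lambda>x. norm (w x) powr q)"
    using u w by (auto dest: Lebesgue_space_integrable)
  have "(\<integral>x. C\<^sub>0 * (norm (u x) powr p + norm (w x) powr q - n\<^sub>0 x) \<partial>M) \<le> energy u w"
    unfolding energy_def
  proof (rule integral_mono_AE)
    show "integrable M (\<lambda>x. C\<^sub>0 * (norm (u x) powr p + norm (w x) powr q - n\<^sub>0 x))" using i n\<^sub>0 by auto
    show "integrable M (\<lambda>x. L x (u x, w x))" by (rule L_integrable[OF u w])
    show "AE x in M. C\<^sub>0 * (norm (u x) powr p + norm (w x) powr q - n\<^sub>0 x) \<le> L x (u x, w x)"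
      using growth by eventually_elim auto
  qed
  then show ?thesis using i n\<^sub>0 by (simp add: power_mass_def algebra_simps)
qed

definition gap :: "('a \<Rightarrow> 'e) \<Rightarrow> ('a \<Rightarrow> 'e) \<Rightarrow> ('a \<Rightarrow> 'e) \<Rightarrow> ('a \<Rightarrow> 'e) \<Rightarrow> real" where
  "gap u w u' w' = power_mass M p (\<lambda>x. u x - u' x) + power_mass M q (\<lambda>x. w x - w' x)"

text \<open>A finite convex function is continuous, so the integrands converge pointwise, and the
  lower growth bound provides the integrable minorant. The case \<mu> = 0 is lower semicontinuity of
  the energy itself.\<close>

lemma perturbed_energy_Fatou:
  assumes u: "\<And>n. us n \<in> Lebesgue_space M p" "u \<in> Lebesgue_space M p"
      "\<And>n. us' n \<in> Lebesgue_space M p" "u' \<in> Lebesgue_space M p"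
    and w: "\<And>n. ws n \<in> Lebesgue_space M q" "w \<in> Lebesgue_space M q"
      "\<And>n. ws' n \<in> Lebesgue_space M q" "w' \<in> Lebesgue_space M q"
    and lim: "AE x in M. (\<lambda>n. us n x) \<longlonglongrightarrow> u x" "AE x in M. (\<lambda>n. ws n x) \<longlonglongrightarrow> w x"
      "AE x in M. (\<lambda>n. us' n x) \<longlonglongrightarrow> u' x" "AE x in M. (\<lambda>n. ws' n x) \<longlonglongrightarrow> w' x"
    and \<mu>: "0 \<le> \<mu>"
    and le: "\<And>n. energy (us' n) (ws' n) + \<mu> * gap (us n) (ws n) (us' n) (ws' n) \<le> c n"
    and c: "c \<longlonglongrightarrow> c'"
  shows "energy u' w' + \<mu> * gap u w u' w' \<le> c'"
proof -
  define f where "f v z v' z' x = L x (v' x, z' x)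
      + \<mu> * (norm (v x - v' x) powr p + norm (z x - z' x) powr q)"
    for v z v' z' :: "'a \<Rightarrow> 'e" and x
  have f: "integrable M (f v z v' z')" "(\<integral>x. f v z v' z' x \<partial>M) = energy v' z' + \<mu> * gap v z v' z'"
    if "v \<in> Lebesgue_space M p" "z \<in> Lebesgue_space M q" "v' \<in> Lebesgue_space M p" "z' \<in> Lebesgue_space M q"
    for v z v' z'
  proof -
    have i: "integrable M (\<lambda>x. norm (v x - v' x) powr p)" "integrable M (\<lambda>x. norm (z x - z' x) powr q)"
      using Lebesgue_space_integrable[OF Lebesgue_space_diff[OF p0 that(1,3)]]
        Lebesgue_space_integrable[OF Lebesgue_space_diff[OF q0 that(2,4)]] by auto
    show "integrable M (f v z v' z')"
      unfolding f_def[abs_def] using i L_integrable[OF that(3,4)] by simp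
    show "(\<integral>x. f v z v' z' x \<partial>M) = energy v' z' + \<mu> * gap v z v' z'"
      unfolding f_def gap_def power_mass_def energy_def using i L_integrable[OF that(3,4)] by simp
  qed
  have "(\<integral>x. f u w u' w' x \<partial>M) \<le> c'"
  proof (rule Fatou_integral_le(2)[where h = "\<lambda>x. - C\<^sub>0 * n\<^sub>0 x"
        and f = "\<lambda>n. f (us n) (ws n) (us' n) (ws' n)"])
    show "integrable M (f (us n) (ws n) (us' n) (ws' n))" for n by (intro f u w)
    show "integrable M (\<lambda>x. - C\<^sub>0 * n\<^sub>0 x)" using n\<^sub>0 by auto
    show "AE x in M. - C\<^sub>0 * n\<^sub>0 x \<le> f (us n) (ws n) (us' n) (ws' n) x" for n
      using growth
    proof eventually_elim
      case (elim x)
      have "- C\<^sub>0 * n\<^sub>0 x = C\<^sub>0 * (- n\<^sub>0 x)" by simp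
      also have "\<dots> \<le> C\<^sub>0 * (norm (us' n x) powr p + norm (ws' n x) powr q - n\<^sub>0 x)"
        using C\<^sub>0 by (intro mult_left_mono) auto
      also have "\<dots> \<le> L x (us' n x, ws' n x)" using elim by blast
      also have "\<dots> \<le> f (us n) (ws n) (us' n) (ws' n) x" using \<mu> by (simp add: f_def)
      finally show ?case .
    qed
    show "f u w u' w' \<in> borel_measurable M"
      using f(1)[OF u(2) w(2) u(4) w(4)] by (rule borel_measurable_integrable)
    show "AE x in M. (\<lambda>n. f (us n) (ws n) (us' n) (ws' n) x) \<longlonglongrightarrow> f u w u' w' x"
      using lim
    proof eventually_elim
      case (elim x)
      then have "(\<lambda>n. (us' n x, ws' n x)) \<longlonglongrightarrow> (u' x, w' x)" by (intro tendsto_intros)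
      then have "(\<lambda>n. L x (us' n x, ws' n x)) \<longlonglongrightarrow> L x (u' x, w' x)"
        by (rule continuous_on_tendsto_compose[OF selfdual_continuous_on[OF L_selfdual]]) auto
      then show ?case
        unfolding f_def using elim p0 q0 by (intro tendsto_intros tendsto_powr2) auto
    qed
    show "(\<integral>x. f (us n) (ws n) (us' n) (ws' n) x \<partial>M) \<le> c n" for n
      using le[of n] f(2)[OF u(1) w(1) u(3) w(3)] by simp
  qed (rule c)
  then show ?thesis using f(2)[OF u(2) w(2) u(4) w(4)] by simp
qed

lemma energy_Fatou:
  assumes u: "\<And>n. us n \<in> Lebesgue_space M p" "u \<in> Lebesgue_space M p"
    and w: "\<And>n. ws n \<in> Lebesgue_space M q" "w \<in> Lebesgue_space M q"
    and lim: "AE x in M. (\<lambda>n. us n x) \<longlonglongrightarrow> u x" "AE x in M. (\<lambda>n. ws n x) \<longlonglongrightarrow> w x"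
    and le: "\<And>n. energy (us n) (ws n) \<le> c n" and c: "c \<longlonglongrightarrow> c'"
  shows "energy u w \<le> c'"
  using perturbed_energy_Fatou[OF u u w w lim lim order_refl _ c] le by simp

text \<open>The means are prescribed instead of the constant parts, which treats \<open>u\<close>
  and \<open>w\<close> alike and passes to limits; \<open>energies_eq\<close> recovers the form with
  added constants.\<close>

definition admissible :: "'e \<Rightarrow> 'e \<Rightarrow> (('a \<Rightarrow> 'e) \<times> ('a \<Rightarrow> 'e)) set" where
  "admissible \<xi> \<eta> = {(u, w). u \<in> VC \<and> w \<in> Sol \<and>
      (\<integral>x. u x \<partial>M) = mass *\<^sub>R \<xi> \<and> (\<integral>x. w x \<partial>M) = mass *\<^sub>R \<eta>}"

lemma admissible_Lp:
  assumes "(u, w) \<in> admissible \<xi> \<eta>"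
  shows "u \<in> Lebesgue_space M p" "w \<in> Lebesgue_space M q"
  using assms closed_subspace_Lp[OF VC] closed_subspace_Lp[OF Sol] by (auto simp: admissible_def)

lemma admissible_const: "((\<lambda>x. \<xi>), (\<lambda>x. \<eta>)) \<in> admissible \<xi> \<eta>"
  using const_in_VC const_in_Sol by (simp add: admissible_def)

lemma admissible_midpoint:
  assumes "(u, w) \<in> admissible \<xi> \<eta>" "(u', w') \<in> admissible \<xi>' \<eta>'"
  shows "((\<lambda>x. (1/2) *\<^sub>R (u x + u' x)), (\<lambda>x. (1/2) *\<^sub>R (w x + w' x)))
    \<in> admissible ((1/2) *\<^sub>R (\<xi> + \<xi>')) ((1/2) *\<^sub>R (\<eta> + \<eta>'))"
proof -
  note i = integrable_Lp[OF admissible_Lp(1)[OF assms(1)]] integrable_Lp[OF admissible_Lp(1)[OF assms(2)]]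
    integrable_Lq[OF admissible_Lp(2)[OF assms(1)]] integrable_Lq[OF admissible_Lp(2)[OF assms(2)]]
  show ?thesis using assms closed_subspace_midpoint[OF VC] closed_subspace_midpoint[OF Sol] i
    by (auto simp: admissible_def scaleR_add_right)
qed

text \<open>The lower growth bound controls both masses on sublevel sets; closedness of
  \<open>VC\<close> and \<open>Sol\<close> supplies the limit pair, and convergence of the means
  keeps it admissible.\<close>

lemma minimizer_exists:
  obtains u w where "(u, w) \<in> admissible \<xi> \<eta>"
    "\<And>u' w'. (u', w') \<in> admissible \<xi> \<eta> \<Longrightarrow> energy u w \<le> energy u' w'"
proof -
  define K where "K = C\<^sub>0 * (\<integral>x. n\<^sub>0 x \<partial>M)"
  define B where "B c = (c + K) / C\<^sub>0" for c
  define J where "J z = energy (fst z) (snd z)" for z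
  note A = admissible_Lp[of _ _ \<xi> \<eta>]
  have bound: "power_mass M p u + power_mass M q w \<le> B c"
    if "(u, w) \<in> admissible \<xi> \<eta>" "J (u, w) \<le> c" for u w c
  proof -
    have "C\<^sub>0 * (power_mass M p u + power_mass M q w) \<le> c + K"
      using energy_coercive[OF A[OF that(1)]] that(2) by (simp add: J_def K_def)
    then show ?thesis using C\<^sub>0 by (simp add: B_def field_simps)
  qed
  obtain z where z: "z \<in> admissible \<xi> \<eta>" "\<And>z'. z' \<in> admissible \<xi> \<eta> \<Longrightarrow> J z \<le> J z'"
  proof (rule direct_method[of "admissible \<xi> \<eta>" "- K" J "\<lambda>z x. (fst z x, snd z x)"])
    show "admissible \<xi> \<eta> \<noteq> {}" using admissible_const by blast
    show "- K \<le> J z" if "z \<in> admissible \<xi> \<eta>" for z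
    proof -
      obtain u w where z: "z = (u, w)" by (cases z)
      have "0 \<le> C\<^sub>0 * (power_mass M p u + power_mass M q w)"
        using C\<^sub>0 by (intro mult_nonneg_nonneg add_nonneg_nonneg power_mass_nonneg) auto
      then show ?thesis using energy_coercive[OF A[of u w]] that by (auto simp: J_def K_def z)
    qed
    show int: "integrable M (\<lambda>x. (fst z x, snd z x))" if "z \<in> admissible \<xi> \<eta>" for z
      using that A by (cases z) (simp add: integrable_Pair integrable_Lp integrable_Lq)
    show "\<exists>C. \<forall>z\<in>admissible \<xi> \<eta>. J z \<le> c \<longrightarrow> (\<integral>x. norm (fst z x, snd z x) \<partial>M) \<le> C" for c
    proof (intro exI ballI impI)
      fix z assume z: "z \<in> admissible \<xi> \<eta>" "J z \<le> c"
      obtain u w where uw: "z = (u, w)" by (cases z)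
      have L: "u \<in> Lebesgue_space M p" "w \<in> Lebesgue_space M q" using A z uw by auto
      have "(\<integral>x. norm (fst z x, snd z x) \<partial>M) \<le> (\<integral>x. norm (u x) + norm (w x) \<partial>M)"
        using int[OF z(1)] integrable_Lp[OF L(1)] integrable_Lq[OF L(2)]
        by (intro integral_mono) (auto simp: uw norm_Pair_le)
      also have "\<dots> = (\<integral>x. norm (u x) \<partial>M) + (\<integral>x. norm (w x) \<partial>M)"
        using integrable_Lp[OF L(1)] integrable_Lq[OF L(2)] by simp
      also have "\<dots> \<le> (power_mass M p u + mass) + (power_mass M q w + mass)"
        using L by (intro add_mono integral_norm_le_power_mass pq q1)
      also have "\<dots> \<le> B c + 2 * mass" using bound[of u w c] z by (simp add: uw)
      finally show "(\<integral>x. norm (fst z x, snd z x) \<partial>M) \<le> B c + 2 * mass" .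
    qed
    show "\<exists>k\<in>admissible \<xi> \<eta>. (\<forall>x\<in>space M. (fst k x, snd k x) = (1/2) *\<^sub>R ((fst i x, snd i x) + (fst j x, snd j x)))
        \<and> J k \<le> (J i + J j) / 2" if ij: "i \<in> admissible \<xi> \<eta>" "j \<in> admissible \<xi> \<eta>" for i j
    proof -
      obtain u w u' w' where uw: "i = (u, w)" "j = (u', w')" by (cases i, cases j)
      show ?thesis
        using admissible_midpoint[of u w \<xi> \<eta> u' w' \<xi> \<eta>] energy_midpoint[of u u' w w'] A ij
        by (intro bexI[of _ "((\<lambda>x. (1/2) *\<^sub>R (u x + u' x)), (\<lambda>x. (1/2) *\<^sub>R (w x + w' x)))"])
          (auto simp: uw J_def simp flip: scaleR_add_left)
    qed
    fix s g m
    assume s: "\<And>n. s n \<in> admissible \<xi> \<eta>" "\<And>n. J (s n) \<le> m + 1 / real (Suc n)"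
      and g: "g \<in> borel_measurable M" "AE x in M. (\<lambda>n. (fst (s n) x, snd (s n) x)) \<longlonglongrightarrow> g x"
    have s': "(fst (s n), snd (s n)) \<in> admissible \<xi> \<eta>" for n using s(1)[of n] by simp
    have sv: "fst (s n) \<in> VC" "snd (s n) \<in> Sol" for n using s'[of n] by (auto simp: admissible_def)
    have J1: "J (s n) \<le> m + 1" for n
    proof -
      have "1 / real (Suc n) \<le> 1" by simp
      with s(2)[of n] show ?thesis by linarith
    qed
    have b: "power_mass M p (fst (s n)) \<le> B (m + 1)" "power_mass M q (snd (s n)) \<le> B (m + 1)" for n
      using bound[OF s'[of n], of "m + 1"] J1[of n] power_mass_nonneg[of M p "fst (s n)"]
        power_mass_nonneg[of M q "snd (s n)"] by auto
    have gm: "(\<lambda>x. fst (g x)) \<in> borel_measurable M" "(\<lambda>x. snd (g x)) \<in> borel_measurable M"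
      by (rule measurable_compose[OF g(1)], intro borel_measurable_continuous_onI continuous_intros)+
    have l: "AE x in M. (\<lambda>n. fst (s n) x) \<longlonglongrightarrow> fst (g x)" "AE x in M. (\<lambda>n. snd (s n) x) \<longlonglongrightarrow> snd (g x)"
      using g(2) by (auto elim!: eventually_mono dest: tendsto_fst tendsto_snd)
    obtain u where u: "u \<in> VC" "AE x in M. (\<lambda>n. fst (s n) x) \<longlonglongrightarrow> u x"
      "(\<lambda>n. \<integral>x. fst (s n) x \<partial>M) \<longlonglongrightarrow> (\<integral>x. u x \<partial>M)"
      using closed_subspace_limit[OF pq(1) VC sv(1) b(1) gm(1) l(1)] by blast
    obtain w where w: "w \<in> Sol" "AE x in M. (\<lambda>n. snd (s n) x) \<longlonglongrightarrow> w x"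
      "(\<lambda>n. \<integral>x. snd (s n) x \<partial>M) \<longlonglongrightarrow> (\<integral>x. w x \<partial>M)"
      using closed_subspace_limit[OF q1 Sol sv(2) b(2) gm(2) l(2)] by blast
    have "(u, w) \<in> admissible \<xi> \<eta>"
    proof -
      have "(\<integral>x. fst (s n) x \<partial>M) = mass *\<^sub>R \<xi>" "(\<integral>x. snd (s n) x \<partial>M) = mass *\<^sub>R \<eta>" for n
        using s'[of n] unfolding admissible_def by blast+
      then show ?thesis using u w by (simp add: admissible_def LIMSEQ_const_iff)
    qed
    moreover have "J (u, w) \<le> m"
      unfolding J_def fst_conv snd_conv
    proof (rule energy_Fatou)
      show "(\<lambda>n. m + 1 / real (Suc n)) \<longlonglongrightarrow> m"
        using LIMSEQ_inverse_real_of_nat_add[of m] by (simp add: inverse_eq_divide)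
      show "energy (fst (s n)) (snd (s n)) \<le> m + 1 / real (Suc n)" for n
        using s(2)[of n] by (simp add: J_def)
    qed (use u w sv closed_subspace_Lp[OF VC] closed_subspace_Lp[OF Sol] in auto)
    ultimately show "\<exists>i\<in>admissible \<xi> \<eta>. J i \<le> m" by blast
  qed (rule that)
  obtain u w where "z = (u, w)" by (cases z)
  with that[of u w] z show thesis by (auto simp: J_def)
qed

end

section \<open>The penalised problem: coercivity, minimisers, optimality\<close>

lemma Lebesgue_space_bounded_by:
  assumes "0 < p" "f \<in> Lebesgue_space M p" "g \<in> borel_measurable M" "\<And>x. norm (g x) \<le> norm (f x)"
  shows "g \<in> Lebesgue_space M p"
proof (rule Lebesgue_spaceI)
  show "integrable M (\<lambda>x. norm (g x) powr p)"
  proof (rule Bochner_Integration.integrable_bound[OF Lebesgue_space_integrable[OF assms(2)]])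
    show "AE x in M. norm (norm (g x) powr p) \<le> norm (norm (f x) powr p)"
      using assms(1,4) by (auto intro!: powr_mono2)
  qed (use assms(3) in measurable)
qed fact

text \<open>Serves to absorb the linear load into an arbitrarily small multiple of a mass of order r
  > 1.\<close>

lemma (in selfdual_cell_problem) linear_le_power_mass:
  fixes c :: real
  assumes "1 < r" "0 < \<delta>"
  obtains K where "\<And>f :: 'a \<Rightarrow> 'e. f \<in> Lebesgue_space M r \<Longrightarrow> c * (\<integral>x. norm (f x) \<partial>M) \<le> \<delta> * power_mass M r f + K"
proof -
  obtain C where C: "\<And>s. 0 \<le> s \<Longrightarrow> c * s \<le> \<delta> * s powr r + C"
    using linear_le_powr[OF assms] by metis
  show thesis
  proof (rule that[of "C * mass"])
    fix f :: "'a \<Rightarrow> 'e" assume f: "f \<in> Lebesgue_space M r"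
    have "(\<integral>x. c * norm (f x) \<partial>M) \<le> (\<integral>x. \<delta> * norm (f x) powr r + C \<partial>M)"
      using Lebesgue_space_integrable_norm(1)[OF assms(1) f] Lebesgue_space_integrable[OF f] C
      by (intro integral_mono) auto
    then show "c * (\<integral>x. norm (f x) \<partial>M) \<le> \<delta> * power_mass M r f + C * mass"
      using Lebesgue_space_integrable[OF f] by (simp add: power_mass_def mult.commute)
  qed
qed

context selfdual_cell_problem
begin

text \<open>For \<open>u \<in> VC\<close>, \<open>w \<in> Sol\<close> and arbitrary \<open>u'\<close>, \<open>w'\<close> the functional
  \<open>energy u' w' + \<mu> * gap u w u' w' - load b a u w\<close> is minimised. At a minimiser the gradient of the gap
  is simultaneously a subgradient of the energy at \<open>(u', w')\<close> and, up to \<open>(b, a)\<close>, an element of the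
  annihilator of \<open>VC \<times> Sol\<close>. This replaces a subdifferential sum rule.\<close>

definition split_pairs :: "(('a \<Rightarrow> 'e) \<times> ('a \<Rightarrow> 'e) \<times> ('a \<Rightarrow> 'e) \<times> ('a \<Rightarrow> 'e)) set" where
  "split_pairs = {(u, w, u', w'). u \<in> VC \<and> w \<in> Sol \<and> u' \<in> Lebesgue_space M p \<and> w' \<in> Lebesgue_space M q}"

definition load :: "'e \<Rightarrow> 'e \<Rightarrow> ('a \<Rightarrow> 'e) \<Rightarrow> ('a \<Rightarrow> 'e) \<Rightarrow> real" where
  "load b a u w = inner b (\<integral>x. u x \<partial>M) + inner a (\<integral>x. w x \<partial>M)"

fun quad_eval :: "('a \<Rightarrow> 'e) \<times> ('a \<Rightarrow> 'e) \<times> ('a \<Rightarrow> 'e) \<times> ('a \<Rightarrow> 'e) \<Rightarrow> 'a \<Rightarrow> 'e \<times> 'e \<times> 'e \<times> 'e" where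
  "quad_eval (u, w, u', w') x = (u x, w x, u' x, w' x)"

text \<open>\<open>u\<close> and \<open>w\<close> enter only through the gap, since growth of the
  energy controls \<open>u'\<close> and \<open>w'\<close> alone.\<close>

fun quad_size :: "('a \<Rightarrow> 'e) \<times> ('a \<Rightarrow> 'e) \<times> ('a \<Rightarrow> 'e) \<times> ('a \<Rightarrow> 'e) \<Rightarrow> real" where
  "quad_size (u, w, u', w') = power_mass M p u' + power_mass M q w' + gap u w u' w'"

fun quad_mid where
  "quad_mid (u, w, u', w') (v, z, v', z') =
    ((\<lambda>x. (1/2) *\<^sub>R (u x + v x)), (\<lambda>x. (1/2) *\<^sub>R (w x + z x)),
     (\<lambda>x. (1/2) *\<^sub>R (u' x + v' x)), (\<lambda>x. (1/2) *\<^sub>R (w' x + z' x)))"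

lemma split_pairs_Lp:
  assumes "(u, w, u', w') \<in> split_pairs"
  shows "u \<in> Lebesgue_space M p" "w \<in> Lebesgue_space M q"
    "u' \<in> Lebesgue_space M p" "w' \<in> Lebesgue_space M q"
  using assms closed_subspace_Lp[OF VC] closed_subspace_Lp[OF Sol] by (auto simp: split_pairs_def)

lemma gap_nonneg: "0 \<le> gap u w u' w'"
  by (simp add: gap_def power_mass_nonneg)

lemma quad_size_nonneg: "0 \<le> quad_size s"
  by (cases s) (simp add: gap_nonneg power_mass_nonneg)

lemma quad_eval_integrable:
  assumes "s \<in> split_pairs"
  shows "integrable M (quad_eval s)"
proof -
  obtain u w u' w' where s: "s = (u, w, u', w')" by (cases s)
  note L = split_pairs_Lp[OF assms[unfolded s]]
  have "quad_eval s = (\<lambda>x. (u x, w x, u' x, w' x))" by (simp add: s fun_eq_iff)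
  then show ?thesis by (simp add: integrable_Pair integrable_Lp integrable_Lq L)
qed

lemma quad_eval_mid: "quad_eval (quad_mid s s') x = (1/2) *\<^sub>R (quad_eval s x + quad_eval s' x)"
  by (cases s, cases s') simp

lemma quad_mid_in:
  assumes "s \<in> split_pairs" "s' \<in> split_pairs"
  shows "quad_mid s s' \<in> split_pairs"
proof -
  obtain u w u' w' v z v' z' where s: "s = (u, w, u', w')" "s' = (v, z, v', z')"
    by (cases s, cases s')
  show ?thesis
    using assms unfolding s quad_mid.simps split_pairs_def mem_Collect_eq prod.case
    by (intro conjI closed_subspace_midpoint[OF VC] closed_subspace_midpoint[OF Sol]
        closed_subspace_midpoint[OF closed_subspace_Lebesgue_space[OF pq(1)]]
        closed_subspace_midpoint[OF closed_subspace_Lebesgue_space[OF q1]]) auto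
qed

lemma gap_midpoint:
  assumes "(u, w, u', w') \<in> split_pairs" "(v, z, v', z') \<in> split_pairs"
  shows "gap (\<lambda>x. (1/2) *\<^sub>R (u x + v x)) (\<lambda>x. (1/2) *\<^sub>R (w x + z x))
     (\<lambda>x. (1/2) *\<^sub>R (u' x + v' x)) (\<lambda>x. (1/2) *\<^sub>R (w' x + z' x))
    \<le> (gap u w u' w' + gap v z v' z') / 2"
proof -
  note L = split_pairs_Lp[OF assms(1)] split_pairs_Lp[OF assms(2)]
  have e: "(1/2) *\<^sub>R (f x + g x) - (1/2) *\<^sub>R (f' x + g' x) = (1/2) *\<^sub>R ((f x - f' x) + (g x - g' x))"
    for f g f' g' :: "'a \<Rightarrow> 'e" and x by (simp add: algebra_simps)
  show ?thesis unfolding gap_def e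
    using power_mass_midpoint_le[OF pq(1) Lebesgue_space_diff[OF p0 L(1,3)] Lebesgue_space_diff[OF p0 L(5,7)]]
      power_mass_midpoint_le[OF q1 Lebesgue_space_diff[OF q0 L(2,4)] Lebesgue_space_diff[OF q0 L(6,8)]]
    by (simp add: add_divide_distrib)
qed

lemma load_midpoint:
  assumes "(u, w, u', w') \<in> split_pairs" "(v, z, v', z') \<in> split_pairs"
  shows "load b a (\<lambda>x. (1/2) *\<^sub>R (u x + v x)) (\<lambda>x. (1/2) *\<^sub>R (w x + z x)) = (load b a u w + load b a v z) / 2"
  using integrable_Lp[OF split_pairs_Lp(1)] integrable_Lq[OF split_pairs_Lp(2)] assms
  by (simp add: load_def inner_add_right add_divide_distrib)

text \<open>Through u = (u - u') + u', and likewise for w, the gap and the masses of the primed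
  functions control all four components.\<close>

lemma quad_norm_bound:
  obtains C where "\<And>s. s \<in> split_pairs \<Longrightarrow> (\<integral>x. norm (quad_eval s x) \<partial>M) \<le> C * quad_size s + C"
    "\<And>u w u' w'. (u, w, u', w') \<in> split_pairs \<Longrightarrow>
      power_mass M p u \<le> C * quad_size (u, w, u', w') \<and> power_mass M q w \<le> C * quad_size (u, w, u', w')"
    "0 \<le> C"
proof -
  define D where "D = 2 powr p + 2 powr q"
  have D1: "1 \<le> 2 powr p" "1 \<le> 2 powr q" using p0 q0 by (auto simp: ge_one_powr_ge_zero)
  have pm: "power_mass M p u \<le> D * quad_size (u, w, u', w') \<and> power_mass M q w \<le> D * quad_size (u, w, u', w')"
    if s: "(u, w, u', w') \<in> split_pairs" for u w u' w'
  proof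
    note L = split_pairs_Lp[OF s]
    let ?S = "quad_size (u, w, u', w')"
    note nn = power_mass_nonneg[of M p u'] power_mass_nonneg[of M q w']
      power_mass_nonneg[of M p "\<lambda>x. u x - u' x"] power_mass_nonneg[of M q "\<lambda>x. w x - w' x"]
    have "power_mass M p u \<le> 2 powr p * (power_mass M p (\<lambda>x. u x - u' x) + power_mass M p u')"
      using power_mass_add_le[OF p0 Lebesgue_space_diff[OF p0 L(1,3)] L(3)] by simp
    also have "\<dots> \<le> D * ?S" using nn D1 by (intro mult_mono) (auto simp: D_def gap_def)
    finally show "power_mass M p u \<le> D * ?S" .
    have "power_mass M q w \<le> 2 powr q * (power_mass M q (\<lambda>x. w x - w' x) + power_mass M q w')"
      using power_mass_add_le[OF q0 Lebesgue_space_diff[OF q0 L(2,4)] L(4)] by simp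
    also have "\<dots> \<le> D * ?S" using nn D1 by (intro mult_mono) (auto simp: D_def gap_def)
    finally show "power_mass M q w \<le> D * ?S" .
  qed
  have D0: "0 \<le> D" by (simp add: D_def)
  \<comment> \<open>\<open>2 * D\<close> pays for \<open>u\<close> and \<open>w\<close>, at most 1
    more for the primed functions, and \<open>4 * mass\<close> for bounding four norms by their
    powers plus 1. One constant serves as slope and as offset.\<close>
  define C where "C = 2 * D + 2 + 4 * mass"
  have int: "(\<integral>x. norm (quad_eval s x) \<partial>M) \<le> C * quad_size s + C" if s: "s \<in> split_pairs" for s
  proof -
    obtain u w u' w' where s': "s = (u, w, u', w')" by (cases s)
    note L = split_pairs_Lp[OF s[unfolded s']]
    note i = integrable_Lp[OF L(1)] integrable_Lq[OF L(2)] integrable_Lp[OF L(3)] integrable_Lq[OF L(4)]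
    have "(\<integral>x. norm (quad_eval s x) \<partial>M) \<le> (\<integral>x. norm (u x) + (norm (w x) + (norm (u' x) + norm (w' x))) \<partial>M)"
    proof (rule integral_mono)
      show "integrable M (\<lambda>x. norm (quad_eval s x))" using quad_eval_integrable[OF s] by simp
      show "integrable M (\<lambda>x. norm (u x) + (norm (w x) + (norm (u' x) + norm (w' x))))" using i by simp
      show "norm (quad_eval s x) \<le> norm (u x) + (norm (w x) + (norm (u' x) + norm (w' x)))" for x
        unfolding s' quad_eval.simps
        by (intro order_trans[OF norm_Pair_le] add_left_mono order_refl)
    qed
    also have "\<dots> = (\<integral>x. norm (u x) \<partial>M) + ((\<integral>x. norm (w x) \<partial>M) + ((\<integral>x. norm (u' x) \<partial>M) + (\<integral>x. norm (w' x) \<partial>M)))"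
      using i by simp
    also have "\<dots> \<le> (power_mass M p u + mass) + ((power_mass M q w + mass)
        + ((power_mass M p u' + mass) + (power_mass M q w' + mass)))"
      using L by (intro add_mono integral_norm_le_power_mass pq q1)
    also have "\<dots> \<le> 2 * D * quad_size s + quad_size s + 4 * mass"
      using pm[OF s[unfolded s']] gap_nonneg[of u w u' w'] by (simp add: s')
    also have "\<dots> \<le> C * quad_size s + C"
    proof -
      have "(2 * D + 1) * quad_size s \<le> C * quad_size s"
        using quad_size_nonneg by (intro mult_right_mono) (auto simp: C_def)
      moreover have "4 * mass \<le> C" using D0 by (simp add: C_def)
      ultimately show ?thesis by (simp add: algebra_simps)
    qed
    finally show ?thesis .
  qed
  have "D * quad_size s \<le> C * quad_size s" for s
    using quad_size_nonneg D0 by (intro mult_right_mono) (auto simp: C_def)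
  then have "power_mass M p u \<le> C * quad_size (u, w, u', w') \<and> power_mass M q w \<le> C * quad_size (u, w, u', w')"
    if "(u, w, u', w') \<in> split_pairs" for u w u' w'
    using pm[OF that] by (blast intro: order_trans)
  then show thesis using that[OF int] D0 by (simp add: C_def)
qed

lemma split_pairs_limit:
  assumes s: "\<And>n. s n \<in> split_pairs" and B: "\<And>n. quad_size (s n) \<le> B"
    and g: "g \<in> borel_measurable M" and lim: "AE x in M. (\<lambda>n. quad_eval (s n) x) \<longlonglongrightarrow> g x"
  obtains u w u' w' where "(u, w, u', w') \<in> split_pairs"
    "AE x in M. (\<lambda>n. quad_eval (s n) x) \<longlonglongrightarrow> (u x, w x, u' x, w' x)"
    "(\<lambda>n. load b a (fst (s n)) (fst (snd (s n)))) \<longlonglongrightarrow> load b a u w"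
proof -
  define us where "us n = fst (s n)" for n
  define ws where "ws n = fst (snd (s n))" for n
  define us' where "us' n = fst (snd (snd (s n)))" for n
  define ws' where "ws' n = snd (snd (snd (s n)))" for n
  have sn: "s n = (us n, ws n, us' n, ws' n)" for n by (simp add: us_def ws_def us'_def ws'_def)
  obtain C where C: "0 \<le> C" "\<And>u w u' w'. (u, w, u', w') \<in> split_pairs \<Longrightarrow>
      power_mass M p u \<le> C * quad_size (u, w, u', w') \<and> power_mass M q w \<le> C * quad_size (u, w, u', w')"
    using quad_norm_bound by metis
  have in_V: "us n \<in> VC" "ws n \<in> Sol" "us' n \<in> Lebesgue_space M p" "ws' n \<in> Lebesgue_space M q" for n
    using s[of n] unfolding sn split_pairs_def by auto
  have CB: "C * quad_size (s n) \<le> C * B" for n using B C(1) by (intro mult_left_mono) auto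
  have b: "power_mass M p (us n) \<le> C * B" "power_mass M q (ws n) \<le> C * B"
    "power_mass M p (us' n) \<le> B" "power_mass M q (ws' n) \<le> B" for n
  proof -
    show "power_mass M p (us n) \<le> C * B" "power_mass M q (ws n) \<le> C * B"
      using C(2)[OF s[of n, unfolded sn]] CB[of n] unfolding sn by auto
    show "power_mass M p (us' n) \<le> B" "power_mass M q (ws' n) \<le> B"
      using B[of n] gap_nonneg[of "us n" "ws n" "us' n" "ws' n"]
        power_mass_nonneg[of M p "us' n"] power_mass_nonneg[of M q "ws' n"] unfolding sn by auto
  qed
  have gm: "(\<lambda>x. fst (g x)) \<in> borel_measurable M" "(\<lambda>x. fst (snd (g x))) \<in> borel_measurable M"
    "(\<lambda>x. fst (snd (snd (g x)))) \<in> borel_measurable M" "(\<lambda>x. snd (snd (snd (g x)))) \<in> borel_measurable M"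
    by (rule measurable_compose[OF g], intro borel_measurable_continuous_onI continuous_intros)+
  have l: "AE x in M. (\<lambda>n. us n x) \<longlonglongrightarrow> fst (g x)" "AE x in M. (\<lambda>n. ws n x) \<longlonglongrightarrow> fst (snd (g x))"
    "AE x in M. (\<lambda>n. us' n x) \<longlonglongrightarrow> fst (snd (snd (g x)))" "AE x in M. (\<lambda>n. ws' n x) \<longlonglongrightarrow> snd (snd (snd (g x)))"
  proof -
    have "AE x in M. (\<lambda>n. us n x) \<longlonglongrightarrow> fst (g x) \<and> (\<lambda>n. ws n x) \<longlonglongrightarrow> fst (snd (g x)) \<and>
      (\<lambda>n. us' n x) \<longlonglongrightarrow> fst (snd (snd (g x))) \<and> (\<lambda>n. ws' n x) \<longlonglongrightarrow> snd (snd (snd (g x)))"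
      using lim
    proof eventually_elim
      case (elim x)
      note t = tendsto_snd[OF elim]
      show ?case
        using tendsto_fst[OF elim] tendsto_fst[OF t] tendsto_fst[OF tendsto_snd[OF t]]
          tendsto_snd[OF tendsto_snd[OF t]] by (simp add: sn)
    qed
    then show "AE x in M. (\<lambda>n. us n x) \<longlonglongrightarrow> fst (g x)" "AE x in M. (\<lambda>n. ws n x) \<longlonglongrightarrow> fst (snd (g x))"
      "AE x in M. (\<lambda>n. us' n x) \<longlonglongrightarrow> fst (snd (snd (g x)))" "AE x in M. (\<lambda>n. ws' n x) \<longlonglongrightarrow> snd (snd (snd (g x)))"
      by (auto elim: eventually_mono)
  qed
  obtain u where u: "u \<in> VC" "AE x in M. (\<lambda>n. us n x) \<longlonglongrightarrow> u x" "(\<lambda>n. \<integral>x. us n x \<partial>M) \<longlonglongrightarrow> (\<integral>x. u x \<partial>M)"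
    using closed_subspace_limit[OF pq(1) VC in_V(1) b(1) gm(1) l(1)] by blast
  obtain w where w: "w \<in> Sol" "AE x in M. (\<lambda>n. ws n x) \<longlonglongrightarrow> w x" "(\<lambda>n. \<integral>x. ws n x \<partial>M) \<longlonglongrightarrow> (\<integral>x. w x \<partial>M)"
    using closed_subspace_limit[OF q1 Sol in_V(2) b(2) gm(2) l(2)] by blast
  obtain u' where u': "u' \<in> Lebesgue_space M p" "AE x in M. (\<lambda>n. us' n x) \<longlonglongrightarrow> u' x"
    using closed_subspace_limit[OF pq(1) closed_subspace_Lebesgue_space[OF pq(1)] in_V(3) b(3) gm(3) l(3)] by blast
  obtain w' where w': "w' \<in> Lebesgue_space M q" "AE x in M. (\<lambda>n. ws' n x) \<longlonglongrightarrow> w' x"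
    using closed_subspace_limit[OF q1 closed_subspace_Lebesgue_space[OF q1] in_V(4) b(4) gm(4) l(4)] by blast
  show thesis
  proof (rule that)
    show "(u, w, u', w') \<in> split_pairs" using u w u' w' by (simp add: split_pairs_def)
    show "AE x in M. (\<lambda>n. quad_eval (s n) x) \<longlonglongrightarrow> (u x, w x, u' x, w' x)"
      using u(2) w(2) u'(2) w'(2) by eventually_elim (auto simp: sn intro!: tendsto_intros)
    show "(\<lambda>n. load b a (fst (s n)) (fst (snd (s n)))) \<longlonglongrightarrow> load b a u w"
      unfolding load_def sn fst_conv snd_conv using u(3) w(3) by (intro tendsto_intros)
  qed
qed

text \<open>Splitting u as u' + (u - u') lets the growth of the energy absorb one part of the load
  and the gap the other. The penalty has weight 1 here, so that the constants serve every \<mu>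
  \<ge> 1.\<close>

lemma quad_coercive:
  obtains \<delta> K where "0 < \<delta>" "\<And>u w u' w'. (u, w, u', w') \<in> split_pairs \<Longrightarrow>
      \<delta> * quad_size (u, w, u', w') - K \<le> energy u' w' + gap u w u' w' - load b a u w"
proof -
  \<comment> \<open>Half of the smaller of the two available rates, \<open>C\<^sub>0\<close> for the
    energy and 1 for the gap: the load consumes \<open>\<delta>\<close> of each, and at least
    \<open>\<delta>\<close> remains.\<close>
  define \<delta> where "\<delta> = min C\<^sub>0 1 / 2"
  have \<delta>: "0 < \<delta>" "2 * \<delta> \<le> C\<^sub>0" "2 * \<delta> \<le> 1" using C\<^sub>0 by (auto simp: \<delta>_def)
  obtain K1 where K1: "\<And>f :: 'a \<Rightarrow> 'e. f \<in> Lebesgue_space M p \<Longrightarrow> norm b * (\<integral>x. norm (f x) \<partial>M) \<le> \<delta> * power_mass M p f + K1"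
    using linear_le_power_mass[OF pq(1) \<delta>(1)] by metis
  obtain K2 where K2: "\<And>f :: 'a \<Rightarrow> 'e. f \<in> Lebesgue_space M q \<Longrightarrow> norm a * (\<integral>x. norm (f x) \<partial>M) \<le> \<delta> * power_mass M q f + K2"
    using linear_le_power_mass[OF q1 \<delta>(1)] by metis
  have split: "inner c (\<integral>x. f x \<partial>M) \<le> norm c * (\<integral>x. norm (f' x) \<partial>M) + norm c * (\<integral>x. norm (f x - f' x) \<partial>M)"
    if "integrable M f" "integrable M f'" for c :: 'e and f f' :: "'a \<Rightarrow> 'e"
  proof -
    have "inner c (\<integral>x. f x \<partial>M) \<le> norm c * norm (\<integral>x. f x \<partial>M)" by (rule norm_cauchy_schwarz)
    also have "\<dots> \<le> norm c * (\<integral>x. norm (f' x) + norm (f x - f' x) \<partial>M)"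
    proof (rule mult_left_mono)
      have "norm (\<integral>x. f x \<partial>M) \<le> (\<integral>x. norm (f x) \<partial>M)" by (rule integral_norm_bound)
      also have "\<dots> \<le> (\<integral>x. norm (f' x) + norm (f x - f' x) \<partial>M)"
      proof (rule integral_mono)
        show "norm (f x) \<le> norm (f' x) + norm (f x - f' x)" for x
          using norm_triangle_ineq[of "f' x" "f x - f' x"] by simp
      qed (use that in auto)
      finally show "norm (\<integral>x. f x \<partial>M) \<le> (\<integral>x. norm (f' x) + norm (f x - f' x) \<partial>M)" .
    qed simp
    finally show ?thesis using that by (simp add: distrib_left)
  qed
  show thesis
  proof (rule that[of \<delta> "C\<^sub>0 * (\<integral>x. n\<^sub>0 x \<partial>M) + 2 * K1 + 2 * K2"])
    fix u w u' w' assume s: "(u, w, u', w') \<in> split_pairs"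
    note L = split_pairs_Lp[OF s]
    define P where "P = power_mass M p u' + power_mass M q w'"
    define Y where "Y = gap u w u' w'"
    have PY: "0 \<le> P" "0 \<le> Y" by (auto simp: P_def Y_def gap_nonneg power_mass_nonneg)
    have "inner b (\<integral>x. u x \<partial>M) \<le> (\<delta> * power_mass M p u' + K1) + (\<delta> * power_mass M p (\<lambda>x. u x - u' x) + K1)"
      using split[OF integrable_Lp[OF L(1)] integrable_Lp[OF L(3)], of b] K1[OF L(3)]
        K1[OF Lebesgue_space_diff[OF p0 L(1,3)]] by linarith
    moreover have "inner a (\<integral>x. w x \<partial>M) \<le> (\<delta> * power_mass M q w' + K2) + (\<delta> * power_mass M q (\<lambda>x. w x - w' x) + K2)"
      using split[OF integrable_Lq[OF L(2)] integrable_Lq[OF L(4)], of a] K2[OF L(4)]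
        K2[OF Lebesgue_space_diff[OF q0 L(2,4)]] by linarith
    ultimately have l: "load b a u w \<le> \<delta> * P + \<delta> * Y + 2 * K1 + 2 * K2"
      unfolding load_def P_def Y_def gap_def by (simp add: algebra_simps)
    have e: "C\<^sub>0 * P - C\<^sub>0 * (\<integral>x. n\<^sub>0 x \<partial>M) \<le> energy u' w'"
      unfolding P_def by (rule energy_coercive[OF L(3,4)])
    have "2 * \<delta> * P \<le> C\<^sub>0 * P" "2 * \<delta> * Y \<le> 1 * Y" using \<delta> PY by (intro mult_right_mono; simp)+
    then have "\<delta> * (P + Y) - (C\<^sub>0 * (\<integral>x. n\<^sub>0 x \<partial>M) + 2 * K1 + 2 * K2) \<le> energy u' w' + Y - load b a u w"
      using l e by (simp add: algebra_simps)
    then show "\<delta> * quad_size (u, w, u', w') - (C\<^sub>0 * (\<integral>x. n\<^sub>0 x \<partial>M) + 2 * K1 + 2 * K2)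
        \<le> energy u' w' + gap u w u' w' - load b a u w"
      by (simp add: P_def Y_def)
  qed (rule \<delta>)
qed

end

lemma tendsto_Pair_iff:
  "((\<lambda>n. (f n, g n)) \<longlongrightarrow> (a, b)) F \<longleftrightarrow> (f \<longlongrightarrow> a) F \<and> (g \<longlongrightarrow> b) F"
  using tendsto_fst[of "\<lambda>n. (f n, g n)" "(a, b)"] tendsto_snd[of "\<lambda>n. (f n, g n)" "(a, b)"]
  by (auto intro: tendsto_Pair)

context selfdual_cell_problem
begin

text \<open>Coercivity at weight 1 carries over to \<mu> \<ge> 1 because the gap is nonnegative; the
  load is continuous along the extracted sequence, so it may be moved into the right side of the
  Fatou bound.\<close>

lemma split_minimizer_exists:
  assumes \<mu>: "1 \<le> \<mu>"
  obtains u w u' w' where "(u, w, u', w') \<in> split_pairs"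
    "\<And>v z v' z'. (v, z, v', z') \<in> split_pairs \<Longrightarrow>
      energy u' w' + \<mu> * gap u w u' w' - load b a u w \<le> energy v' z' + \<mu> * gap v z v' z' - load b a v z"
proof -
  define J where "J s = (case s of (u, w, u', w') \<Rightarrow> energy u' w' + \<mu> * gap u w u' w' - load b a u w)" for s
  obtain \<delta> K where \<delta>: "0 < \<delta>" and coer0: "\<And>u w u' w'. (u, w, u', w') \<in> split_pairs \<Longrightarrow>
      \<delta> * quad_size (u, w, u', w') - K \<le> energy u' w' + gap u w u' w' - load b a u w"
    using quad_coercive by metis
  have coer: "\<delta> * quad_size s - K \<le> J s" if "s \<in> split_pairs" for s
  proof -
    obtain u w u' w' where s: "s = (u, w, u', w')" by (cases s)
    have "1 * gap u w u' w' \<le> \<mu> * gap u w u' w'" using \<mu> gap_nonneg by (rule mult_right_mono)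
    then show ?thesis using coer0[OF that[unfolded s]] by (simp add: J_def s)
  qed
  have size: "quad_size s \<le> (c + K) / \<delta>" if "s \<in> split_pairs" "J s \<le> c" for s c
    using coer[OF that(1)] that(2) \<delta> by (simp add: field_simps)
  obtain C where C: "0 \<le> C" "\<And>s. s \<in> split_pairs \<Longrightarrow> (\<integral>x. norm (quad_eval s x) \<partial>M) \<le> C * quad_size s + C"
    using quad_norm_bound by metis
  obtain s where s: "s \<in> split_pairs" "\<And>s'. s' \<in> split_pairs \<Longrightarrow> J s \<le> J s'"
  proof (rule direct_method[of split_pairs "- K" J quad_eval])
    show "split_pairs \<noteq> {}"
      using const_in_VC[of 0] const_in_Sol[of 0]
        Lebesgue_space_zero[of M p, where ?'b = 'e] Lebesgue_space_zero[of M q, where ?'b = 'e]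
      unfolding split_pairs_def by blast
    show "- K \<le> J s" if "s \<in> split_pairs" for s
      using coer[OF that] mult_nonneg_nonneg[OF less_imp_le[OF \<delta>] quad_size_nonneg[of s]] by linarith
    show "integrable M (quad_eval s)" if "s \<in> split_pairs" for s by (rule quad_eval_integrable[OF that])
    show "\<exists>B. \<forall>s\<in>split_pairs. J s \<le> c \<longrightarrow> (\<integral>x. norm (quad_eval s x) \<partial>M) \<le> B" for c
    proof (intro exI ballI impI)
      fix s assume "s \<in> split_pairs" "J s \<le> c"
      then show "(\<integral>x. norm (quad_eval s x) \<partial>M) \<le> C * ((c + K) / \<delta>) + C"
        using C(2)[of s] mult_left_mono[OF size C(1), of s c] by linarith
    qed
    show "\<exists>k\<in>split_pairs. (\<forall>x\<in>space M. quad_eval k x = (1/2) *\<^sub>R (quad_eval i x + quad_eval j x))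
        \<and> J k \<le> (J i + J j) / 2" if ij: "i \<in> split_pairs" "j \<in> split_pairs" for i j
    proof (intro bexI conjI ballI)
      show "quad_mid i j \<in> split_pairs" by (rule quad_mid_in[OF ij])
      show "quad_eval (quad_mid i j) x = (1/2) *\<^sub>R (quad_eval i x + quad_eval j x)" for x
        by (rule quad_eval_mid)
      obtain u w u' w' where i: "i = (u, w, u', w')" by (cases i)
      obtain v z v' z' where j: "j = (v, z, v', z')" by (cases j)
      note L = split_pairs_Lp[OF ij(1)[unfolded i]] split_pairs_Lp[OF ij(2)[unfolded j]]
      have "\<mu> * gap (\<lambda>x. (1/2) *\<^sub>R (u x + v x)) (\<lambda>x. (1/2) *\<^sub>R (w x + z x))
          (\<lambda>x. (1/2) *\<^sub>R (u' x + v' x)) (\<lambda>x. (1/2) *\<^sub>R (w' x + z' x))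
          \<le> \<mu> * ((gap u w u' w' + gap v z v' z') / 2)"
        using gap_midpoint[OF ij[unfolded i j]] \<mu> by (intro mult_left_mono) auto
      then show "J (quad_mid i j) \<le> (J i + J j) / 2"
        using energy_midpoint[OF L(3,7,4,8)] load_midpoint[OF ij[unfolded i j], of b a]
        unfolding J_def i j quad_mid.simps prod.case by (simp add: field_simps)
    qed
    fix s g m
    assume s: "\<And>n. s n \<in> split_pairs" "\<And>n. J (s n) \<le> m + 1 / real (Suc n)"
      and g: "g \<in> borel_measurable M" "AE x in M. (\<lambda>n. quad_eval (s n) x) \<longlonglongrightarrow> g x"
    have B: "quad_size (s n) \<le> (m + 1 + K) / \<delta>" for n
    proof (rule size[OF s(1)])
      have "1 / real (Suc n) \<le> 1" by simp
      with s(2)[of n] show "J (s n) \<le> m + 1" by linarith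
    qed
    obtain u w u' w' where u: "(u, w, u', w') \<in> split_pairs"
      and lim: "AE x in M. (\<lambda>n. quad_eval (s n) x) \<longlonglongrightarrow> (u x, w x, u' x, w' x)"
      and ll: "(\<lambda>n. load b a (fst (s n)) (fst (snd (s n)))) \<longlonglongrightarrow> load b a u w"
      using split_pairs_limit[OF s(1) B g, of b a] by blast
    define us ws us' ws' where
      "us n = fst (s n)" and "ws n = fst (snd (s n))" and "us' n = fst (snd (snd (s n)))"
      and "ws' n = snd (snd (snd (s n)))" for n
    have sn: "s n = (us n, ws n, us' n, ws' n)" for n by (simp add: us_def ws_def us'_def ws'_def)
    have lims: "AE x in M. (\<lambda>n. us n x) \<longlonglongrightarrow> u x" "AE x in M. (\<lambda>n. ws n x) \<longlonglongrightarrow> w x"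
      "AE x in M. (\<lambda>n. us' n x) \<longlonglongrightarrow> u' x" "AE x in M. (\<lambda>n. ws' n x) \<longlonglongrightarrow> w' x"
      by (rule eventually_mono[OF lim], simp add: sn tendsto_Pair_iff)+
    have "energy u' w' + \<mu> * gap u w u' w' \<le> m + load b a u w"
    proof (rule perturbed_energy_Fatou[OF _ _ _ _ _ _ _ _ lims])
      show "us n \<in> Lebesgue_space M p" "us' n \<in> Lebesgue_space M p"
        "ws n \<in> Lebesgue_space M q" "ws' n \<in> Lebesgue_space M q" for n
        using split_pairs_Lp[OF s(1)[of n, unfolded sn]] by auto
      show "u \<in> Lebesgue_space M p" "u' \<in> Lebesgue_space M p" "w \<in> Lebesgue_space M q" "w' \<in> Lebesgue_space M q"
        using split_pairs_Lp[OF u] by auto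
      show "0 \<le> \<mu>" using \<mu> by simp
      show "energy (us' n) (ws' n) + \<mu> * gap (us n) (ws n) (us' n) (ws' n)
          \<le> m + 1 / real (Suc n) + load b a (us n) (ws n)" for n
        using s(2)[of n] by (simp add: J_def sn)
      have "(\<lambda>n. m + 1 / real (Suc n)) \<longlonglongrightarrow> m"
        using LIMSEQ_inverse_real_of_nat_add[of m] by (simp add: inverse_eq_divide)
      moreover have "(\<lambda>n. load b a (us n) (ws n)) \<longlonglongrightarrow> load b a u w" using ll by (simp add: sn)
      ultimately show "(\<lambda>n. m + 1 / real (Suc n) + load b a (us n) (ws n)) \<longlonglongrightarrow> m + load b a u w"
        by (intro tendsto_intros)
    qed
    then have "J (u, w, u', w') \<le> m" by (simp add: J_def)
    with u show "\<exists>i\<in>split_pairs. J i \<le> m" by blast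
  qed (rule that)
  obtain u w u' w' where s': "s = (u, w, u', w')" by (cases s)
  show thesis by (rule that[of u w u' w']) (use s s' in \<open>auto simp: J_def\<close>)
qed

text \<open>Varying the pointwise values on the set where the subgradient inequality fails shows that it
  holds almost everywhere.\<close>

lemma subgradient_localize:
  assumes u: "u \<in> Lebesgue_space M p" and w: "w \<in> Lebesgue_space M q"
    and \<zeta>: "\<zeta>\<^sub>1 \<in> Lebesgue_space M q" "\<zeta>\<^sub>2 \<in> Lebesgue_space M p"
    and sub: "\<And>h k. h \<in> Lebesgue_space M p \<Longrightarrow> k \<in> Lebesgue_space M q \<Longrightarrow>
        energy u w + (\<integral>x. inner (\<zeta>\<^sub>1 x) (h x) \<partial>M) + (\<integral>x. inner (\<zeta>\<^sub>2 x) (k x) \<partial>M)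
        \<le> energy (\<lambda>x. u x + h x) (\<lambda>x. w x + k x)"
  shows "AE x in M. \<forall>r. L x (u x, w x) + inner (\<zeta>\<^sub>1 x, \<zeta>\<^sub>2 x) (r - (u x, w x)) \<le> L x r"
proof -
  have [measurable]: "u \<in> borel_measurable M" "w \<in> borel_measurable M"
    "\<zeta>\<^sub>1 \<in> borel_measurable M" "\<zeta>\<^sub>2 \<in> borel_measurable M"
    using u w \<zeta> by (auto dest: Lebesgue_space_measurable)
  have fixed: "AE x in M. L x (u x, w x) + inner (\<zeta>\<^sub>1 x, \<zeta>\<^sub>2 x) (r - (u x, w x)) \<le> L x r" for r
  proof -
    define D where "D x = L x r - L x (u x, w x) - inner (\<zeta>\<^sub>1 x, \<zeta>\<^sub>2 x) (r - (u x, w x))" for x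
    have Lm: "(\<lambda>x. L x r) \<in> borel_measurable M"
      using L_comp_measurable[of "\<lambda>x. fst r" "\<lambda>x. snd r"] by simp
    have D[measurable]: "D \<in> borel_measurable M"
      unfolding D_def inner_prod_def fst_diff snd_diff fst_conv snd_conv using Lm L_comp_measurable[of u w] by measurable
    \<comment> \<open>The perturbation moves the pair to \<open>r\<close> exactly where the
      inequality for \<open>r\<close> fails; the assumption then bounds the integral of the negative
      part of \<open>D\<close> by 0.\<close>
    define h where "h x = (if D x < 0 then fst r - u x else 0)" for x
    define k where "k x = (if D x < 0 then snd r - w x else 0)" for x
    have hL: "h \<in> Lebesgue_space M p"
    proof (rule Lebesgue_space_bounded_by[OF p0 Lebesgue_space_diff[OF p0 Lebesgue_space_const u]])
      show "h \<in> borel_measurable M" unfolding h_def by measurable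
      show "norm (h x) \<le> norm (fst r - u x)" for x by (simp add: h_def)
    qed
    have kL: "k \<in> Lebesgue_space M q"
    proof (rule Lebesgue_space_bounded_by[OF q0 Lebesgue_space_diff[OF q0 Lebesgue_space_const w]])
      show "k \<in> borel_measurable M" unfolding k_def by measurable
      show "norm (k x) \<le> norm (snd r - w x)" for x by (simp add: k_def)
    qed
    have uh: "(\<lambda>x. u x + h x) \<in> Lebesgue_space M p" and wk: "(\<lambda>x. w x + k x) \<in> Lebesgue_space M q"
      by (intro Lebesgue_space_add p0 q0 u w hL kL)+
    note i = L_integrable[OF uh wk] L_integrable[OF u w]
      Lebesgue_space_dual_inner[OF q1 qp \<zeta>(1) hL] Lebesgue_space_dual_inner[OF pq \<zeta>(2) kL]
    have eq: "L x (u x + h x, w x + k x) - L x (u x, w x) - inner (\<zeta>\<^sub>1 x) (h x) - inner (\<zeta>\<^sub>2 x) (k x)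
        = - max 0 (- D x)" for x
      by (auto simp: h_def k_def D_def inner_prod_def max_def)
    have "integrable M (\<lambda>x. L x (u x + h x, w x + k x) - L x (u x, w x)
        - inner (\<zeta>\<^sub>1 x) (h x) - inner (\<zeta>\<^sub>2 x) (k x))"
      using i by simp
    then have mi: "integrable M (\<lambda>x. max 0 (- D x))" unfolding eq by simp
    have "0 \<le> (\<integral>x. L x (u x + h x, w x + k x) - L x (u x, w x)
        - inner (\<zeta>\<^sub>1 x) (h x) - inner (\<zeta>\<^sub>2 x) (k x) \<partial>M)"
      using sub[OF hL kL] i by (simp add: energy_def)
    then have "(\<integral>x. max 0 (- D x) \<partial>M) \<le> 0" unfolding eq by simp
    then have "(\<integral>x. max 0 (- D x) \<partial>M) = 0" by (intro antisym integral_nonneg_AE) auto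
    then have "AE x in M. max 0 (- D x) = 0"
      using integral_nonneg_eq_0_iff_AE[OF mi] by simp
    then show ?thesis by eventually_elim (auto simp: D_def max_def split: if_splits)
  qed
  \<comment> \<open>Each fixed \<open>r\<close> has its own null set. Countably many
    \<open>r\<close> share one, and continuity of L(x, .) extends the inequality from a dense set to
    all \<open>r\<close>.\<close>
  obtain S :: "('e \<times> 'e) set" where S: "countable S" "\<And>X. open X \<Longrightarrow> X \<noteq> {} \<Longrightarrow> \<exists>d\<in>S. d \<in> X"
    using countable_dense_exists[where ?'a = "'e \<times> 'e"] by blast
  have "AE x in M. \<forall>r\<in>S. L x (u x, w x) + inner (\<zeta>\<^sub>1 x, \<zeta>\<^sub>2 x) (r - (u x, w x)) \<le> L x r"
    using fixed S(1) by (simp add: AE_ball_countable)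
  then show ?thesis
  proof eventually_elim
    case (elim x)
    define T where "T = {r. L x (u x, w x) + inner (\<zeta>\<^sub>1 x, \<zeta>\<^sub>2 x) (r - (u x, w x)) \<le> L x r}"
    have "closed T" unfolding T_def
      by (intro closed_Collect_le continuous_intros selfdual_continuous_on[OF L_selfdual])
    moreover have "S \<subseteq> T" using elim by (auto simp: T_def)
    ultimately have "- T = {}" using S(2)[of "- T"] by (auto simp: open_closed)
    then have "r \<in> T" for r by blast
    then show ?case unfolding T_def by blast
  qed
qed

text \<open>The pair (v, z) consists of the penalty gradients with their places exchanged, one of
  them changed on a null set so that it lies in \<open>VC\<close> as a function. The last bound uses
  the equality case of the Fenchel inequality pointwise and then replaces the primed functions by
  \<open>u\<close> and \<open>w\<close>, which turns the pairings into the load.\<close>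

lemma dual_candidate:
  assumes \<mu>: "1 \<le> \<mu>"
  obtains u w u' w' v z where "(u, w, u', w') \<in> split_pairs" "(v, z) \<in> admissible a b"
    "energy u' w' + \<mu> * gap u w u' w' - load b a u w \<le> energy (\<lambda>x. 0) (\<lambda>x. 0)"
    "energy v z \<le> load b a u w - energy u' w'"
proof -
  obtain u w u' w' where s: "(u, w, u', w') \<in> split_pairs"
    and smin: "\<And>v z v' z'. (v, z, v', z') \<in> split_pairs \<Longrightarrow>
      energy u' w' + \<mu> * gap u w u' w' - load b a u w \<le> energy v' z' + \<mu> * gap v z v' z' - load b a v z"
    using split_minimizer_exists[OF \<mu>] by metis
  note L = split_pairs_Lp[OF s]
  have uV: "u \<in> VC" "w \<in> Sol" using s by (auto simp: split_pairs_def)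
  define y\<^sub>1 where "y\<^sub>1 x = u x - u' x" for x
  define y\<^sub>2 where "y\<^sub>2 x = w x - w' x" for x
  have yL: "y\<^sub>1 \<in> Lebesgue_space M p" "y\<^sub>2 \<in> Lebesgue_space M q"
    unfolding y\<^sub>1_def[abs_def] y\<^sub>2_def[abs_def] by (intro Lebesgue_space_diff p0 q0 L)+
  define \<zeta>\<^sub>1 where "\<zeta>\<^sub>1 x = (\<mu> * p) *\<^sub>R duality_map p (y\<^sub>1 x)" for x
  define \<zeta>\<^sub>2 where "\<zeta>\<^sub>2 x = (\<mu> * q) *\<^sub>R duality_map q (y\<^sub>2 x)" for x
  have \<zeta>L: "\<zeta>\<^sub>1 \<in> Lebesgue_space M q" "\<zeta>\<^sub>2 \<in> Lebesgue_space M p"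
    unfolding \<zeta>\<^sub>1_def[abs_def] \<zeta>\<^sub>2_def[abs_def]
    by (intro Lebesgue_space_scaleR duality_map_Lebesgue_space[OF pq yL(1)] duality_map_Lebesgue_space[OF q1 qp yL(2)])+
  \<comment> \<open>The first order condition in all directions at once: \<open>m\<close> and
    \<open>k\<close> stay in the subspaces, \<open>h\<close> and \<open>l\<close> are free. The
    energy is merely convex, so its increment is estimated by a chord; only the gap is
    differentiated.\<close>
  have vi: "load b a m k + energy u' w'
      \<le> energy (\<lambda>x. u' x + h x) (\<lambda>x. w' x + l x)
        + (\<integral>x. inner (\<zeta>\<^sub>1 x) (m x - h x) \<partial>M) + (\<integral>x. inner (\<zeta>\<^sub>2 x) (k x - l x) \<partial>M)"
    if m: "m \<in> VC" "k \<in> Sol" and h: "h \<in> Lebesgue_space M p" "l \<in> Lebesgue_space M q" for m k h l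
  proof -
    define H\<^sub>1 where "H\<^sub>1 x = m x - h x" for x
    define H\<^sub>2 where "H\<^sub>2 x = k x - l x" for x
    have mL: "m \<in> Lebesgue_space M p" "k \<in> Lebesgue_space M q"
      using m closed_subspace_Lp[OF VC] closed_subspace_Lp[OF Sol] by auto
    have HL: "H\<^sub>1 \<in> Lebesgue_space M p" "H\<^sub>2 \<in> Lebesgue_space M q"
      unfolding H\<^sub>1_def[abs_def] H\<^sub>2_def[abs_def] by (intro Lebesgue_space_diff p0 q0 mL h)+
    have hL: "(\<lambda>x. u' x + h x) \<in> Lebesgue_space M p" "(\<lambda>x. w' x + l x) \<in> Lebesgue_space M q"
      by (intro Lebesgue_space_add p0 q0 L h)+
    define S\<^sub>1 where "S\<^sub>1 n = (\<integral>x. inner (duality_map p (y\<^sub>1 x + (1 / real (Suc n)) *\<^sub>R H\<^sub>1 x)) (H\<^sub>1 x) \<partial>M)" for n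
    define S\<^sub>2 where "S\<^sub>2 n = (\<integral>x. inner (duality_map q (y\<^sub>2 x + (1 / real (Suc n)) *\<^sub>R H\<^sub>2 x)) (H\<^sub>2 x) \<partial>M)" for n
    define E where "E = energy (\<lambda>x. u' x + h x) (\<lambda>x. w' x + l x)"
    have ineq: "load b a m k + energy u' w' \<le> E + \<mu> * (p * S\<^sub>1 n + q * S\<^sub>2 n)" for n
    proof -
      define t where "t = 1 / real (Suc n)"
      have t: "0 < t" "t \<le> 1" by (auto simp: t_def)
      \<comment> \<open>The primed functions are displaced along \<open>h\<close> and
        \<open>l\<close> in the form of a convex combination, ready for
        \<open>energy_convex\<close>.\<close>
      have sp: "((\<lambda>x. u x + t *\<^sub>R m x), (\<lambda>x. w x + t *\<^sub>R k x),
          (\<lambda>x. (1 - t) *\<^sub>R u' x + t *\<^sub>R (u' x + h x)), (\<lambda>x. (1 - t) *\<^sub>R w' x + t *\<^sub>R (w' x + l x))) \<in> split_pairs"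
        unfolding split_pairs_def mem_Collect_eq prod.case
        by (intro conjI closed_subspace_add[OF VC] closed_subspace_scaleR[OF VC] closed_subspace_add[OF Sol]
            closed_subspace_scaleR[OF Sol] Lebesgue_space_add Lebesgue_space_scaleR p0 q0 uV m L h)
      have g: "gap (\<lambda>x. u x + t *\<^sub>R m x) (\<lambda>x. w x + t *\<^sub>R k x)
          (\<lambda>x. (1 - t) *\<^sub>R u' x + t *\<^sub>R (u' x + h x)) (\<lambda>x. (1 - t) *\<^sub>R w' x + t *\<^sub>R (w' x + l x))
          = power_mass M p (\<lambda>x. y\<^sub>1 x + t *\<^sub>R H\<^sub>1 x) + power_mass M q (\<lambda>x. y\<^sub>2 x + t *\<^sub>R H\<^sub>2 x)"
        unfolding gap_def y\<^sub>1_def y\<^sub>2_def H\<^sub>1_def H\<^sub>2_def by (simp add: algebra_simps)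
      have g0: "gap u w u' w' = power_mass M p y\<^sub>1 + power_mass M q y\<^sub>2"
        unfolding gap_def y\<^sub>1_def[abs_def] y\<^sub>2_def[abs_def] ..
      have gd: "(power_mass M p (\<lambda>x. y\<^sub>1 x + t *\<^sub>R H\<^sub>1 x) + power_mass M q (\<lambda>x. y\<^sub>2 x + t *\<^sub>R H\<^sub>2 x)) - gap u w u' w'
          \<le> t * (p * S\<^sub>1 n + q * S\<^sub>2 n)"
        using power_mass_variation[OF pq(1) yL(1) HL(1), of t] power_mass_variation[OF q1 yL(2) HL(2), of t]
        unfolding g0 S\<^sub>1_def S\<^sub>2_def t_def[symmetric] by (simp add: algebra_simps)
      have ld: "load b a (\<lambda>x. u x + t *\<^sub>R m x) (\<lambda>x. w x + t *\<^sub>R k x) = load b a u w + t * load b a m k"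
        using integrable_Lp[OF L(1)] integrable_Lp[OF mL(1)] integrable_Lq[OF L(2)] integrable_Lq[OF mL(2)]
        by (simp add: load_def inner_add_right algebra_simps)
      have en: "energy (\<lambda>x. (1 - t) *\<^sub>R u' x + t *\<^sub>R (u' x + h x)) (\<lambda>x. (1 - t) *\<^sub>R w' x + t *\<^sub>R (w' x + l x))
          \<le> (1 - t) * energy u' w' + t * E"
        unfolding E_def using t by (intro energy_convex L hL) auto
      define G where "G = power_mass M p (\<lambda>x. y\<^sub>1 x + t *\<^sub>R H\<^sub>1 x) + power_mass M q (\<lambda>x. y\<^sub>2 x + t *\<^sub>R H\<^sub>2 x)"
      have "energy u' w' + \<mu> * gap u w u' w' - load b a u w
          \<le> ((1 - t) * energy u' w' + t * E) + \<mu> * G - (load b a u w + t * load b a m k)"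
        using smin[OF sp] en unfolding g ld G_def by linarith
      then have "t * (load b a m k + energy u' w') \<le> t * E + \<mu> * (G - gap u w u' w')"
        by (simp add: algebra_simps)
      also have "\<mu> * (G - gap u w u' w') \<le> \<mu> * (t * (p * S\<^sub>1 n + q * S\<^sub>2 n))"
        using gd \<mu> unfolding G_def by (intro mult_left_mono) auto
      finally have "t * (load b a m k + energy u' w') \<le> t * (E + \<mu> * (p * S\<^sub>1 n + q * S\<^sub>2 n))"
        by (simp add: algebra_simps)
      then show ?thesis using t by simp
    qed
    have l1: "S\<^sub>1 \<longlonglongrightarrow> (\<integral>x. inner (duality_map p (y\<^sub>1 x)) (H\<^sub>1 x) \<partial>M)"
      unfolding S\<^sub>1_def by (rule duality_map_variation_tendsto[OF pq(1) yL(1) HL(1)])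
    have l2: "S\<^sub>2 \<longlonglongrightarrow> (\<integral>x. inner (duality_map q (y\<^sub>2 x)) (H\<^sub>2 x) \<partial>M)"
      unfolding S\<^sub>2_def by (rule duality_map_variation_tendsto[OF q1 yL(2) HL(2)])
    have "(\<lambda>n. E + \<mu> * (p * S\<^sub>1 n + q * S\<^sub>2 n)) \<longlonglongrightarrow> E + \<mu> * (p * (\<integral>x. inner (duality_map p (y\<^sub>1 x)) (H\<^sub>1 x) \<partial>M)
        + q * (\<integral>x. inner (duality_map q (y\<^sub>2 x)) (H\<^sub>2 x) \<partial>M))"
      using l1 l2 by (intro tendsto_intros)
    then have "load b a m k + energy u' w' \<le> E + \<mu> * (p * (\<integral>x. inner (duality_map p (y\<^sub>1 x)) (H\<^sub>1 x) \<partial>M)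
        + q * (\<integral>x. inner (duality_map q (y\<^sub>2 x)) (H\<^sub>2 x) \<partial>M))"
      using ineq by (intro LIMSEQ_le_const) auto
    moreover have "(\<integral>x. inner (\<zeta>\<^sub>1 x) (m x - h x) \<partial>M) = (\<mu> * p) * (\<integral>x. inner (duality_map p (y\<^sub>1 x)) (H\<^sub>1 x) \<partial>M)"
      by (simp add: \<zeta>\<^sub>1_def H\<^sub>1_def mult.assoc del: inner_diff_right)
    moreover have "(\<integral>x. inner (\<zeta>\<^sub>2 x) (k x - l x) \<partial>M) = (\<mu> * q) * (\<integral>x. inner (duality_map q (y\<^sub>2 x)) (H\<^sub>2 x) \<partial>M)"
      by (simp add: \<zeta>\<^sub>2_def H\<^sub>2_def mult.assoc del: inner_diff_right)
    ultimately show ?thesis by (simp add: E_def distrib_left mult.assoc)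
  qed
  have z: "(\<lambda>x. 0) \<in> VC" "(\<lambda>x. 0) \<in> Sol" "(\<lambda>x. 0) \<in> Lebesgue_space M p" "(\<lambda>x. 0) \<in> Lebesgue_space M q"
    using closed_subspace_zero[OF VC] closed_subspace_zero[OF Sol] Lebesgue_space_zero by auto
  have load0: "load b a m (\<lambda>x. 0) = inner b (\<integral>x. m x \<partial>M)" "load b a (\<lambda>x. 0) k = inner a (\<integral>x. k x \<partial>M)" for m k
    by (auto simp: load_def)
  \<comment> \<open>With all other directions zero the inequality holds for \<open>m\<close> and for
    its negative, hence as an equation.\<close>
  have eq1: "(\<integral>x. inner (\<zeta>\<^sub>1 x) (m x) \<partial>M) = inner b (\<integral>x. m x \<partial>M)" if m: "m \<in> VC" for m
    using vi[OF m z(2,3,4)] vi[OF closed_subspace_scaleR[OF VC m, of "-1"] z(2,3,4)] by (simp add: load0)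
  have eq2: "(\<integral>x. inner (\<zeta>\<^sub>2 x) (m x) \<partial>M) = inner a (\<integral>x. m x \<partial>M)" if m: "m \<in> Sol" for m
    using vi[OF z(1) m z(3,4)] vi[OF z(1) closed_subspace_scaleR[OF Sol m, of "-1"] z(3,4)] by (simp add: load0)
  have sub: "AE x in M. \<forall>r. L x (u' x, w' x) + inner (\<zeta>\<^sub>1 x, \<zeta>\<^sub>2 x) (r - (u' x, w' x)) \<le> L x r"
  proof (rule subgradient_localize[OF L(3,4) \<zeta>L])
    fix h k :: "'a \<Rightarrow> 'e" assume h: "h \<in> Lebesgue_space M p" "k \<in> Lebesgue_space M q"
    show "energy u' w' + (\<integral>x. inner (\<zeta>\<^sub>1 x) (h x) \<partial>M) + (\<integral>x. inner (\<zeta>\<^sub>2 x) (k x) \<partial>M)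
        \<le> energy (\<lambda>x. u' x + h x) (\<lambda>x. w' x + k x)"
      using vi[OF z(1,2) h] by (simp add: load0)
  qed
  have \<zeta>\<^sub>1Sol: "\<zeta>\<^sub>1 \<in> Sol"
    unfolding annihilator_def
  proof (intro CollectI conjI ballI \<zeta>L)
    fix G assume G: "G \<in> V"
    have "(\<lambda>x. 0 + G x) \<in> VC" using G unfolding adjoin_constants_def by blast
    then show "(\<integral>x. inner (\<zeta>\<^sub>1 x) (G x) \<partial>M) = 0" using eq1[of G] V_mean[OF G] by simp
  qed
  \<comment> \<open>Testing with gradients showed that \<open>\<zeta>\<^sub>1\<close> is solenoidal;
    testing with constants identifies its mean.\<close>
  have mean1: "(\<integral>x. \<zeta>\<^sub>1 x \<partial>M) = mass *\<^sub>R b"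
  proof (rule vector_eq_rdot[THEN iffD1], rule allI)
    fix \<xi>
    show "inner (\<integral>x. \<zeta>\<^sub>1 x \<partial>M) \<xi> = inner (mass *\<^sub>R b) \<xi>"
      using eq1[OF const_in_VC[of \<xi>]] integrable_Lq[OF \<zeta>L(1)] by simp
  qed
  \<comment> \<open>After subtraction of \<open>a\<close> the second penalty gradient annihilates
    every solenoidal field; the bipolar theorem makes it a gradient up to a null set.\<close>
  obtain G where G: "G \<in> V" "AE x in M. \<zeta>\<^sub>2 x - a = G x"
  proof (rule annihilator_bipolar[OF pq V])
    show "(\<lambda>x. \<zeta>\<^sub>2 x - a) \<in> Lebesgue_space M p"
      by (intro Lebesgue_space_diff p0 \<zeta>L Lebesgue_space_const)
    fix g assume g: "g \<in> Sol"
    have gL: "g \<in> Lebesgue_space M q" using g closed_subspace_Lp[OF Sol] by auto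
    have "(\<integral>x. inner (g x) (\<zeta>\<^sub>2 x - a) \<partial>M) = (\<integral>x. inner (\<zeta>\<^sub>2 x) (g x) \<partial>M) - (\<integral>x. inner (g x) a \<partial>M)"
      using Lebesgue_space_dual_inner[OF pq \<zeta>L(2) gL] integrable_Lq[OF gL]
      by (simp add: inner_diff_right inner_commute)
    also have "\<dots> = 0" using eq2[OF g] integrable_Lq[OF gL] by (simp add: inner_commute)
    finally show "(\<integral>x. inner (g x) (\<zeta>\<^sub>2 x - a) \<partial>M) = 0" .
  qed (rule that)
  define v where "v x = a + G x" for x
  have v\<zeta>: "AE x in M. v x = \<zeta>\<^sub>2 x" using G(2) by eventually_elim (simp add: v_def algebra_simps)
  have GL: "G \<in> Lebesgue_space M p" using G(1) closed_subspace_Lp[OF V] by auto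
  have adm: "(v, \<zeta>\<^sub>1) \<in> admissible a b"
    using G(1) \<zeta>\<^sub>1Sol mean1 V_mean[OF G(1)] integrable_Lp[OF GL]
    unfolding admissible_def v_def[abs_def] adjoin_constants_def by auto
  have "energy v \<zeta>\<^sub>1 \<le> (\<integral>x. inner (\<zeta>\<^sub>1 x) (u' x) + inner (\<zeta>\<^sub>2 x) (w' x) - L x (u' x, w' x) \<partial>M)"
    unfolding energy_def
  proof (rule integral_mono_AE)
    show "integrable M (\<lambda>x. L x (v x, \<zeta>\<^sub>1 x))" by (rule L_integrable[OF admissible_Lp[OF adm]])
    show "integrable M (\<lambda>x. inner (\<zeta>\<^sub>1 x) (u' x) + inner (\<zeta>\<^sub>2 x) (w' x) - L x (u' x, w' x))"
      using Lebesgue_space_dual_inner[OF q1 qp \<zeta>L(1) L(3)] Lebesgue_space_dual_inner[OF pq \<zeta>L(2) L(4)]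
        L_integrable[OF L(3,4)] by simp
    show "AE x in M. L x (v x, \<zeta>\<^sub>1 x) \<le> inner (\<zeta>\<^sub>1 x) (u' x) + inner (\<zeta>\<^sub>2 x) (w' x) - L x (u' x, w' x)"
      using sub v\<zeta>
    proof eventually_elim
      case (elim x)
      then have "L x (\<zeta>\<^sub>2 x, \<zeta>\<^sub>1 x) \<le> inner (\<zeta>\<^sub>1 x, \<zeta>\<^sub>2 x) (u' x, w' x) - L x (u' x, w' x)"
        by (intro selfdual_subgradient_eq[OF L_selfdual]) blast
      then show ?case using elim(2) by simp
    qed
  qed
  also have "\<dots> = (\<integral>x. inner (\<zeta>\<^sub>1 x) (u' x) \<partial>M) + (\<integral>x. inner (\<zeta>\<^sub>2 x) (w' x) \<partial>M) - energy u' w'"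
    using Lebesgue_space_dual_inner[OF q1 qp \<zeta>L(1) L(3)] Lebesgue_space_dual_inner[OF pq \<zeta>L(2) L(4)]
      L_integrable[OF L(3,4)] by (simp add: energy_def)
  \<comment> \<open>The penalty gradient at u - u' has a nonnegative inner product with u - u' at
    every point.\<close>
  also have "(\<integral>x. inner (\<zeta>\<^sub>1 x) (u' x) \<partial>M) \<le> (\<integral>x. inner (\<zeta>\<^sub>1 x) (u x) \<partial>M)"
  proof (rule integral_mono)
    show "inner (\<zeta>\<^sub>1 x) (u' x) \<le> inner (\<zeta>\<^sub>1 x) (u x)" for x
    proof -
      have "0 \<le> inner (\<zeta>\<^sub>1 x) (y\<^sub>1 x)" using \<mu> p0 by (simp add: \<zeta>\<^sub>1_def inner_duality_map)
      then show ?thesis by (simp add: y\<^sub>1_def inner_diff_right)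
    qed
  qed (intro Lebesgue_space_dual_inner[OF q1 qp \<zeta>L(1)] L)+
  also have "(\<integral>x. inner (\<zeta>\<^sub>2 x) (w' x) \<partial>M) \<le> (\<integral>x. inner (\<zeta>\<^sub>2 x) (w x) \<partial>M)"
  proof (rule integral_mono)
    show "inner (\<zeta>\<^sub>2 x) (w' x) \<le> inner (\<zeta>\<^sub>2 x) (w x)" for x
    proof -
      have "0 \<le> inner (\<zeta>\<^sub>2 x) (y\<^sub>2 x)" using \<mu> q0 by (simp add: \<zeta>\<^sub>2_def inner_duality_map)
      then show ?thesis by (simp add: y\<^sub>2_def inner_diff_right)
    qed
  qed (intro Lebesgue_space_dual_inner[OF pq \<zeta>L(2)] L)+
  also have "(\<integral>x. inner (\<zeta>\<^sub>1 x) (u x) \<partial>M) + (\<integral>x. inner (\<zeta>\<^sub>2 x) (w x) \<partial>M) - energy u' w' = load b a u w - energy u' w'"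
    using eq1[OF uV(1)] eq2[OF uV(2)] by (simp add: load_def)
  finally have fin: "energy v \<zeta>\<^sub>1 \<le> load b a u w - energy u' w'" by simp
  \<comment> \<open>Comparison with the zero quadruple, whose gap and load vanish, bounds the
    minimum independently of \<mu>.\<close>
  have "((\<lambda>x. 0), (\<lambda>x. 0), (\<lambda>x. 0), (\<lambda>x. 0)) \<in> split_pairs" using z by (simp add: split_pairs_def)
  from smin[OF this] have "energy u' w' + \<mu> * gap u w u' w' - load b a u w \<le> energy (\<lambda>x. 0) (\<lambda>x. 0)"
    by (simp add: gap_def load_def power_mass_def)
  then show thesis using that[OF s adm _ fin] by simp
qed

text \<open>For \<open>F = mass * hom (a, b)\<close> the means of the pair obtained attain the
  supremum in the dual of \<open>hom\<close> at (b, a). Minimisers for different penalties are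
  unrelated, so the limit \<mu> \<rightarrow> \<infinity> is taken within decreasing convex sets
  that contain them, again by \<open>convex_extraction\<close>.\<close>

proposition duality_attained:
  assumes F: "\<And>v z. (v, z) \<in> admissible a b \<Longrightarrow> F \<le> energy v z"
  obtains u w where "u \<in> VC" "w \<in> Sol" "energy u w \<le> load b a u w - F"
proof -
  define E\<^sub>0 where "E\<^sub>0 = energy (\<lambda>x. 0) (\<lambda>x. 0)"
  obtain \<delta> K where \<delta>: "0 < \<delta>" and coer: "\<And>u w u' w'. (u, w, u', w') \<in> split_pairs \<Longrightarrow>
      \<delta> * quad_size (u, w, u', w') - K \<le> energy u' w' + gap u w u' w' - load b a u w"
    using quad_coercive by metis
  obtain C where C: "0 \<le> C" "\<And>s. s \<in> split_pairs \<Longrightarrow> (\<integral>x. norm (quad_eval s x) \<partial>M) \<le> C * quad_size s + C"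
    using quad_norm_bound by metis
  define B where "B = (E\<^sub>0 + K) / \<delta>"
  \<comment> \<open>The bound on the minimum together with coercivity gives (\<mu> - 1) gap \<le> E0
    + K; adding gap \<le> B turns this into \<mu> gap \<le> D.\<close>
  define D where "D = E\<^sub>0 + K + B"
  \<comment> \<open>Each condition is stable under midpoints, and the minimiser for \<mu> = n + 1
    satisfies all of them. The last one is the duality bound that is to survive the limit; the one
    before forces the gap to vanish.\<close>
  define X where "X n = {(u, w, u', w'). (u, w, u', w') \<in> split_pairs \<and> quad_size (u, w, u', w') \<le> B \<and>
      real (Suc n) * gap u w u' w' \<le> D \<and> energy u' w' + F \<le> load b a u w}" for n
  have XD: "s \<in> split_pairs \<and> quad_size s \<le> B" if "s \<in> X n" for s n
    using that by (auto simp: X_def)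
  obtain s g where sX: "\<And>n. s n \<in> X n" and g: "g \<in> borel_measurable M" "AE x in M. (\<lambda>n. quad_eval (s n) x) \<longlonglongrightarrow> g x"
  proof (rule convex_extraction[of X quad_eval "C * B + C"])
    fix n
    have "1 \<le> real (Suc n)" by simp
    then obtain u w u' w' v z where s: "(u, w, u', w') \<in> split_pairs" and vz: "(v, z) \<in> admissible a b"
      and low: "energy u' w' + real (Suc n) * gap u w u' w' - load b a u w \<le> E\<^sub>0"
      and dual: "energy v z \<le> load b a u w - energy u' w'"
      unfolding E\<^sub>0_def by (rule dual_candidate)
    have "1 * gap u w u' w' \<le> real (Suc n) * gap u w u' w'" by (intro mult_right_mono gap_nonneg) simp
    then have "\<delta> * quad_size (u, w, u', w') \<le> E\<^sub>0 + K" using coer[OF s] low by linarith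
    then have sz: "quad_size (u, w, u', w') \<le> B" using \<delta> by (simp add: B_def field_simps)
    have "0 \<le> \<delta> * quad_size (u, w, u', w')" by (intro mult_nonneg_nonneg quad_size_nonneg less_imp_le \<delta>)
    moreover have "gap u w u' w' \<le> B"
      using sz power_mass_nonneg[of M p u'] power_mass_nonneg[of M q w'] by simp
    ultimately have "real (Suc n) * gap u w u' w' \<le> D"
      using coer[OF s] low unfolding D_def by linarith
    then have "(u, w, u', w') \<in> X n" using s sz F[OF vz] dual by (simp add: X_def)
    then show "X n \<noteq> {}" by blast
    show "X (Suc n) \<subseteq> X n"
    proof
      fix s assume s: "s \<in> X (Suc n)"
      obtain u w u' w' where u: "s = (u, w, u', w')" by (cases s)
      have "real (Suc n) * gap u w u' w' \<le> real (Suc (Suc n)) * gap u w u' w'"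
        by (intro mult_right_mono gap_nonneg) simp
      then show "s \<in> X n" using s unfolding u X_def by simp
    qed
  next
    fix s assume s: "s \<in> X 0"
    show "integrable M (quad_eval s)" using XD[OF s] quad_eval_integrable by blast
    show "(\<integral>x. norm (quad_eval s x) \<partial>M) \<le> C * B + C"
      using C(2)[of s] XD[OF s] mult_left_mono[of "quad_size s" B C] C(1) by linarith
  next
    fix n i j assume ij: "i \<in> X n" "j \<in> X n"
    obtain u w u' w' where i: "i = (u, w, u', w')" by (cases i)
    obtain v z v' z' where j: "j = (v, z, v', z')" by (cases j)
    have s: "i \<in> split_pairs" "j \<in> split_pairs" using ij XD by auto
    note L = split_pairs_Lp[OF s(1)[unfolded i]] split_pairs_Lp[OF s(2)[unfolded j]]
    have g: "gap (\<lambda>x. (1/2) *\<^sub>R (u x + v x)) (\<lambda>x. (1/2) *\<^sub>R (w x + z x))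
        (\<lambda>x. (1/2) *\<^sub>R (u' x + v' x)) (\<lambda>x. (1/2) *\<^sub>R (w' x + z' x))
        \<le> (gap u w u' w' + gap v z v' z') / 2"
      by (rule gap_midpoint[OF s[unfolded i j]])
    have "real (Suc n) * gap (\<lambda>x. (1/2) *\<^sub>R (u x + v x)) (\<lambda>x. (1/2) *\<^sub>R (w x + z x))
        (\<lambda>x. (1/2) *\<^sub>R (u' x + v' x)) (\<lambda>x. (1/2) *\<^sub>R (w' x + z' x))
        \<le> real (Suc n) * ((gap u w u' w' + gap v z v' z') / 2)"
      using g by (intro mult_left_mono) auto
    also have "\<dots> = (real (Suc n) * gap u w u' w' + real (Suc n) * gap v z v' z') / 2"
      by (simp add: field_simps)
    also have "\<dots> \<le> D" using ij by (simp add: X_def i j)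
    finally have g': "real (Suc n) * gap (\<lambda>x. (1/2) *\<^sub>R (u x + v x)) (\<lambda>x. (1/2) *\<^sub>R (w x + z x))
        (\<lambda>x. (1/2) *\<^sub>R (u' x + v' x)) (\<lambda>x. (1/2) *\<^sub>R (w' x + z' x)) \<le> D" .
    have "quad_size (quad_mid i j) \<le> (quad_size i + quad_size j) / 2"
      using g power_mass_midpoint_le[OF pq(1) L(3,7)] power_mass_midpoint_le[OF q1 L(4,8)]
      by (simp add: i j field_simps)
    then have "quad_size (quad_mid i j) \<le> B" using XD[OF ij(1)] XD[OF ij(2)] by simp
    moreover have "energy (\<lambda>x. (1/2) *\<^sub>R (u' x + v' x)) (\<lambda>x. (1/2) *\<^sub>R (w' x + z' x)) + F
        \<le> load b a (\<lambda>x. (1/2) *\<^sub>R (u x + v x)) (\<lambda>x. (1/2) *\<^sub>R (w x + z x))"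
      using energy_midpoint[OF L(3,7,4,8)] load_midpoint[OF s[unfolded i j], of b a] ij
      by (simp add: X_def i j)
    ultimately have "quad_mid i j \<in> X n"
      using quad_mid_in[OF s] g' by (simp add: X_def i j)
    then show "\<exists>k\<in>X n. \<forall>x\<in>space M. quad_eval k x = (1/2) *\<^sub>R (quad_eval i x + quad_eval j x)"
      using quad_eval_mid by blast
  qed (rule that)
  have sP: "s n \<in> split_pairs" "quad_size (s n) \<le> B" for n using XD[OF sX] by auto
  obtain u w u' w' where u: "(u, w, u', w') \<in> split_pairs"
    and lim: "AE x in M. (\<lambda>n. quad_eval (s n) x) \<longlonglongrightarrow> (u x, w x, u' x, w' x)"
    and ll: "(\<lambda>n. load b a (fst (s n)) (fst (snd (s n)))) \<longlonglongrightarrow> load b a u w"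
    using split_pairs_limit[OF sP g, of b a] by blast
  define us ws us' ws' where
    "us n = fst (s n)" and "ws n = fst (snd (s n))" and "us' n = fst (snd (snd (s n)))"
    and "ws' n = snd (snd (snd (s n)))" for n
  have sn: "s n = (us n, ws n, us' n, ws' n)" for n by (simp add: us_def ws_def us'_def ws'_def)
  have lims: "AE x in M. (\<lambda>n. us n x) \<longlonglongrightarrow> u x" "AE x in M. (\<lambda>n. ws n x) \<longlonglongrightarrow> w x"
    "AE x in M. (\<lambda>n. us' n x) \<longlonglongrightarrow> u' x" "AE x in M. (\<lambda>n. ws' n x) \<longlonglongrightarrow> w' x"
    by (rule eventually_mono[OF lim], simp add: sn tendsto_Pair_iff)+
  note L = split_pairs_Lp[OF u] and Ln = split_pairs_Lp[OF sP(1)[unfolded sn]]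
  have "energy u' w' \<le> load b a u w - F"
  proof (rule energy_Fatou[OF Ln(3) L(3) Ln(4) L(4) lims(3,4)])
    show "energy (us' n) (ws' n) \<le> load b a (us n) (ws n) - F" for n
      using sX[of n] by (simp add: X_def sn)
    show "(\<lambda>n. load b a (us n) (ws n) - F) \<longlonglongrightarrow> load b a u w - F"
      using ll by (intro tendsto_intros) (simp add: sn)
  qed
  moreover have gn: "gap (us n) (ws n) (us' n) (ws' n) \<le> D * (1 / real (Suc n))" for n
    using sX[of n] by (simp add: X_def sn field_simps)
  have D0: "(\<lambda>n. D * (1 / real (Suc n))) \<longlonglongrightarrow> 0"
    using tendsto_mult[OF tendsto_const[of D] LIMSEQ_inverse_real_of_nat] by (simp add: inverse_eq_divide)
  have "AE x in M. u x - u' x = 0"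
  proof (rule power_mass_eq_0_AE[OF Lebesgue_space_diff[OF p0 L(1,3)]])
    show "power_mass M p (\<lambda>x. u x - u' x) \<le> 0"
      unfolding power_mass_def
    proof (rule Lebesgue_space_Fatou(2)[OF p0 Lebesgue_space_diff[OF p0 Ln(1,3)] _ D0])
      show "(\<integral>x. norm (us n x - us' n x) powr p \<partial>M) \<le> D * (1 / real (Suc n))" for n
        using gn[of n] power_mass_nonneg[of M q "\<lambda>x. ws n x - ws' n x"]
        unfolding gap_def power_mass_def by linarith
      show "(\<lambda>x. u x - u' x) \<in> borel_measurable M"
        by (rule Lebesgue_space_measurable[OF Lebesgue_space_diff[OF p0 L(1,3)]])
      show "AE x in M. (\<lambda>n. us n x - us' n x) \<longlonglongrightarrow> u x - u' x"
        using lims(1,3) by eventually_elim (intro tendsto_intros)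
    qed
  qed
  moreover have "AE x in M. w x - w' x = 0"
  proof (rule power_mass_eq_0_AE[OF Lebesgue_space_diff[OF q0 L(2,4)]])
    show "power_mass M q (\<lambda>x. w x - w' x) \<le> 0"
      unfolding power_mass_def
    proof (rule Lebesgue_space_Fatou(2)[OF q0 Lebesgue_space_diff[OF q0 Ln(2,4)] _ D0])
      show "(\<integral>x. norm (ws n x - ws' n x) powr q \<partial>M) \<le> D * (1 / real (Suc n))" for n
        using gn[of n] power_mass_nonneg[of M p "\<lambda>x. us n x - us' n x"]
        unfolding gap_def power_mass_def by linarith
      show "(\<lambda>x. w x - w' x) \<in> borel_measurable M"
        by (rule Lebesgue_space_measurable[OF Lebesgue_space_diff[OF q0 L(2,4)]])
      show "AE x in M. (\<lambda>n. ws n x - ws' n x) \<longlonglongrightarrow> w x - w' x"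
        using lims(2,4) by eventually_elim (intro tendsto_intros)
    qed
  qed
  ultimately have "AE x in M. L x (u x, w x) = L x (u' x, w' x)"
    by (auto elim: eventually_elim2)
  then have "energy u w = energy u' w'"
    unfolding energy_def by (intro integral_cong_AE L_comp_measurable) (use L in \<open>auto dest: Lebesgue_space_measurable\<close>)
  with \<open>energy u' w' \<le> load b a u w - F\<close> show thesis
    using u by (intro that[of u w]) (auto simp: split_pairs_def)
qed

end

section \<open>The homogenized Lagrangian of a cell problem\<close>

text \<open>Equality at a point (a, b) exhibits an affine minorant of \<open>\<Lambda>\<close> that
  touches it there. A function with such a support at every point is convex and lower
  semicontinuous, and the same equality makes the supremum in the dual attained.\<close>

lemma selfdual_LagrangianI:
  fixes \<Lambda> :: "'e::euclidean_space \<times> 'e \<Rightarrow> real"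
  assumes Fenchel: "\<And>a b \<xi> \<eta>. inner b \<xi> + inner a \<eta> \<le> \<Lambda> (a, b) + \<Lambda> (\<xi>, \<eta>)"
    and attained: "\<And>a b. \<exists>\<xi> \<eta>. \<Lambda> (a, b) + \<Lambda> (\<xi>, \<eta>) \<le> inner b \<xi> + inner a \<eta>"
  shows "selfdual_Lagrangian (\<lambda>z. ereal (\<Lambda> z))"
proof -
  have support: "\<exists>c k. \<Lambda> z = inner c z - k \<and> (\<forall>z'. inner c z' - k \<le> \<Lambda> z')" for z
  proof -
    obtain a b where z: "z = (a, b)" by (cases z)
    obtain \<xi> \<eta> where e: "\<Lambda> (a, b) + \<Lambda> (\<xi>, \<eta>) \<le> inner b \<xi> + inner a \<eta>" using attained by blast
    have "inner (\<eta>, \<xi>) z' - \<Lambda> (\<xi>, \<eta>) \<le> \<Lambda> z'" for z'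
      using Fenchel[of "snd z'" \<xi> "fst z'" \<eta>] by (cases z') (simp add: inner_commute)
    moreover have "\<Lambda> z = inner (\<eta>, \<xi>) z - \<Lambda> (\<xi>, \<eta>)"
      using e Fenchel[of b \<xi> a \<eta>] by (simp add: z inner_commute)
    ultimately show ?thesis by blast
  qed
  have "convex_ereal (\<lambda>z. ereal (\<Lambda> z))"
    unfolding convex_ereal_def
  proof (intro allI impI)
    fix x y :: "'e \<times> 'e" and u v :: real assume uv: "0 \<le> u \<and> 0 \<le> v \<and> u + v = 1"
    obtain c k where c: "\<Lambda> (u *\<^sub>R x + v *\<^sub>R y) = inner c (u *\<^sub>R x + v *\<^sub>R y) - k"
      "\<And>z. inner c z - k \<le> \<Lambda> z" using support by blast
    have "k = u * k + v * k" using uv by (simp flip: distrib_right)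
    then have "\<Lambda> (u *\<^sub>R x + v *\<^sub>R y) = u * (inner c x - k) + v * (inner c y - k)"
      unfolding c(1) by (simp add: inner_add_right algebra_simps)
    also have "\<dots> \<le> u * \<Lambda> x + v * \<Lambda> y" using uv c(2) by (intro add_mono mult_left_mono) auto
    finally show "ereal (\<Lambda> (u *\<^sub>R x + v *\<^sub>R y)) \<le> ereal u * ereal (\<Lambda> x) + ereal v * ereal (\<Lambda> y)"
      by simp
  qed
  moreover have "lower_semicontinuous (\<lambda>z. ereal (\<Lambda> z))"
    unfolding lower_semicontinuous_def
  proof
    fix z :: "'e \<times> 'e"
    obtain c k where c: "\<Lambda> z = inner c z - k" "\<And>z. inner c z - k \<le> \<Lambda> z" using support by blast
    have "((\<lambda>y. ereal (inner c y - k)) \<longlongrightarrow> ereal (inner c z - k)) (at z)"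
      by (intro tendsto_intros)
    then have "ereal (\<Lambda> z) = Liminf (at z) (\<lambda>y. ereal (inner c y - k))"
      unfolding c(1) by (intro lim_imp_Liminf[symmetric]) auto
    also have "\<dots> \<le> Liminf (at z) (\<lambda>y. ereal (\<Lambda> y))"
      using c(2) by (intro Liminf_mono always_eventually) auto
    finally show "ereal (\<Lambda> z) \<le> Liminf (at z) (\<lambda>y. ereal (\<Lambda> y))" .
  qed
  moreover have "lagrangian_dual (\<lambda>z. ereal (\<Lambda> z)) (b, a) = ereal (\<Lambda> (a, b))" for a b
  proof (rule antisym)
    show "lagrangian_dual (\<lambda>z. ereal (\<Lambda> z)) (b, a) \<le> ereal (\<Lambda> (a, b))"
      unfolding lagrangian_dual_def prod.case
    proof (rule SUP_least, clarify)
      fix \<xi> \<eta>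
      show "ereal (inner b \<xi> + inner a \<eta>) - ereal (\<Lambda> (\<xi>, \<eta>)) \<le> ereal (\<Lambda> (a, b))"
        using Fenchel[of b \<xi> a \<eta>] by simp
    qed
    obtain \<xi> \<eta> where "\<Lambda> (a, b) + \<Lambda> (\<xi>, \<eta>) \<le> inner b \<xi> + inner a \<eta>" using attained by blast
    then have "ereal (\<Lambda> (a, b)) \<le> ereal (inner b \<xi> + inner a \<eta>) - ereal (\<Lambda> (\<xi>, \<eta>))" by simp
    also have "\<dots> \<le> lagrangian_dual (\<lambda>z. ereal (\<Lambda> z)) (b, a)"
      unfolding lagrangian_dual_def by (auto intro: SUP_upper2[of "(\<xi>, \<eta>)"])
    finally show "ereal (\<Lambda> (a, b)) \<le> lagrangian_dual (\<lambda>z. ereal (\<Lambda> z)) (b, a)" .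
  qed
  ultimately show ?thesis by (simp add: selfdual_Lagrangian_def)
qed

section \<open>Selfduality of the minimal energy and the map it generates\<close>

context selfdual_cell_problem
begin

definition energies :: "'e \<Rightarrow> 'e \<Rightarrow> real set" where
  "energies \<xi> \<eta> = {1 / mass * (\<integral>x. L x (\<xi> + G x, \<eta> + g x) \<partial>M) |G g.
     G \<in> V \<and> g \<in> Sol \<and> (\<integral>x. g x \<partial>M) = 0}"

text \<open>Since gradients have mean zero, prescribing the mean of a member of \<open>VC\<close>
  fixes its constant part; on the solenoidal side constants may be added and removed freely.\<close>

lemma energies_eq: "energies \<xi> \<eta> = (\<lambda>(u, w). 1 / mass * energy u w) ` admissible \<xi> \<eta>"
proof (intro equalityI subsetI)
  fix e assume "e \<in> energies \<xi> \<eta>"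
  then obtain G g where e: "e = 1 / mass * (\<integral>x. L x (\<xi> + G x, \<eta> + g x) \<partial>M)"
    and G: "G \<in> V" and g: "g \<in> Sol" "(\<integral>x. g x \<partial>M) = 0"
    unfolding energies_def by blast
  have i: "integrable M G" "integrable M g"
    using G g integrable_Lp integrable_Lq closed_subspace_Lp[OF V] closed_subspace_Lp[OF Sol] by auto
  have "((\<lambda>x. \<xi> + G x), (\<lambda>x. \<eta> + g x)) \<in> admissible \<xi> \<eta>"
    unfolding admissible_def mem_Collect_eq prod.case
  proof (intro conjI)
    show "(\<lambda>x. \<xi> + G x) \<in> VC" using G by (auto simp: adjoin_constants_def)
    show "(\<lambda>x. \<eta> + g x) \<in> Sol" by (rule closed_subspace_add[OF Sol const_in_Sol g(1)])
  qed (use i V_mean[OF G] g in auto)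
  then show "e \<in> (\<lambda>(u, w). 1 / mass * energy u w) ` admissible \<xi> \<eta>"
    unfolding e by (intro image_eqI[rotated]) (auto simp: energy_def)
next
  fix e assume "e \<in> (\<lambda>(u, w). 1 / mass * energy u w) ` admissible \<xi> \<eta>"
  then obtain u w where e: "e = 1 / mass * energy u w" and uw: "(u, w) \<in> admissible \<xi> \<eta>" by auto
  obtain \<xi>' G where u: "u = (\<lambda>x. \<xi>' + G x)" and G: "G \<in> V"
    using uw unfolding admissible_def adjoin_constants_def by blast
  have iG: "integrable M G" using G integrable_Lp closed_subspace_Lp[OF V] by auto
  have "mass *\<^sub>R \<xi>' = mass *\<^sub>R \<xi>" using uw iG V_mean[OF G] by (simp add: admissible_def u)
  then have \<xi>: "\<xi>' = \<xi>" using mass_pos by simp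
  define g where "g x = w x - \<eta>" for x
  have w: "w = (\<lambda>x. \<eta> + g x)" by (simp add: g_def)
  have "(\<lambda>x. w x + -1 *\<^sub>R \<eta>) \<in> Sol"
    using uw by (intro closed_subspace_add[OF Sol] closed_subspace_scaleR[OF Sol] const_in_Sol) (auto simp: admissible_def)
  then have g: "g \<in> Sol" by (simp add: g_def[abs_def])
  have "(\<integral>x. g x \<partial>M) = 0"
    using uw integrable_Lq[OF admissible_Lp(2)[OF uw]] by (simp add: g_def admissible_def)
  then show "e \<in> energies \<xi> \<eta>" using G g unfolding energies_def e u w energy_def \<xi> by blast
qed

text \<open>Real-valued, unlike \<open>L_hom\<close>; \<open>Inf\<close> is meaningful here because
  \<open>hom_minimum\<close> shows that the infimum is attained.\<close>

definition hom :: "'e \<times> 'e \<Rightarrow> real" where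
  "hom z = Inf (energies (fst z) (snd z))"

lemma hom_minimum:
  obtains u w where "(u, w) \<in> admissible \<xi> \<eta>" "mass * hom (\<xi>, \<eta>) = energy u w"
    and "\<And>u' w'. (u', w') \<in> admissible \<xi> \<eta> \<Longrightarrow> mass * hom (\<xi>, \<eta>) \<le> energy u' w'"
    and "hom (\<xi>, \<eta>) \<in> energies \<xi> \<eta>" "\<And>e. e \<in> energies \<xi> \<eta> \<Longrightarrow> hom (\<xi>, \<eta>) \<le> e"
proof -
  obtain u w where uw: "(u, w) \<in> admissible \<xi> \<eta>"
    "\<And>u' w'. (u', w') \<in> admissible \<xi> \<eta> \<Longrightarrow> energy u w \<le> energy u' w'"
    by (rule minimizer_exists[of \<xi> \<eta>]) (rule that, blast+)
  have m: "1 / mass * energy u w \<in> energies \<xi> \<eta>" unfolding energies_eq using uw(1) by force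
  have le: "1 / mass * energy u w \<le> e" if "e \<in> energies \<xi> \<eta>" for e
    using that uw(2) mass_pos unfolding energies_eq by (auto intro!: divide_right_mono)
  have h: "hom (\<xi>, \<eta>) = 1 / mass * energy u w"
    unfolding hom_def fst_conv snd_conv using m le by (intro cInf_eq_minimum)
  show thesis by (rule that[OF uw(1)]) (use h m le uw(2) mass_pos in auto)
qed

lemma hom_le:
  assumes "(u, w) \<in> admissible \<xi> \<eta>"
  shows "mass * hom (\<xi>, \<eta>) \<le> energy u w"
  by (rule hom_minimum[of \<xi> \<eta>]) (use assms in blast)

text \<open>Only the constant part of \<open>u\<close> contributes, because its gradient part is
  orthogonal to \<open>z\<close>; it meets the mean of \<open>z\<close>.\<close>

lemma VC_Sol_pairing:
  assumes u: "u \<in> VC" "(\<integral>x. u x \<partial>M) = mass *\<^sub>R \<xi>" and z: "z \<in> Sol" "(\<integral>x. z x \<partial>M) = mass *\<^sub>R b"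
  shows "(\<integral>x. inner (u x) (z x) \<partial>M) = mass * inner \<xi> b"
proof -
  obtain \<xi>' G where u': "u = (\<lambda>x. \<xi>' + G x)" and G: "G \<in> V"
    using u(1) unfolding adjoin_constants_def by blast
  have GL: "G \<in> Lebesgue_space M p" and zL: "z \<in> Lebesgue_space M q"
    using G z closed_subspace_Lp[OF V] closed_subspace_Lp[OF Sol] by auto
  have "mass *\<^sub>R \<xi>' = mass *\<^sub>R \<xi>" using u(2) integrable_Lp[OF GL] V_mean[OF G] by (simp add: u')
  then have \<xi>: "\<xi>' = \<xi>" using mass_pos by simp
  have "(\<integral>x. inner (G x) (z x) \<partial>M) = 0"
    using z(1) G by (auto simp: annihilator_def inner_commute)
  then have "(\<integral>x. inner (u x) (z x) \<partial>M) = (\<integral>x. inner \<xi> (z x) \<partial>M)"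
    using Lebesgue_space_dual_inner[OF pq GL zL] integrable_Lq[OF zL] by (simp add: u' \<xi> inner_add_left)
  then show ?thesis using integrable_Lq[OF zL] z(2) by simp
qed

lemma admissible_pairing:
  assumes "(u, w) \<in> admissible \<xi> \<eta>" "(v, z) \<in> admissible a b"
  shows "(\<integral>x. inner (u x) (z x) \<partial>M) = mass * inner \<xi> b"
  using assms VC_Sol_pairing by (auto simp: admissible_def)

proposition hom_selfdual: "selfdual_Lagrangian (\<lambda>z. ereal (hom z))"
proof (rule selfdual_LagrangianI)
  fix a b \<xi> \<eta> :: 'e
  obtain u w where uw: "(u, w) \<in> admissible \<xi> \<eta>" "mass * hom (\<xi>, \<eta>) = energy u w"
    by (rule hom_minimum)
  obtain v z where vz: "(v, z) \<in> admissible a b" "mass * hom (a, b) = energy v z"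
    by (rule hom_minimum)
  note L = admissible_Lp[OF uw(1)] admissible_Lp[OF vz(1)]
  have "mass * (inner b \<xi> + inner a \<eta>) = (\<integral>x. inner (u x) (z x) + inner (v x) (w x) \<partial>M)"
    using admissible_pairing[OF uw(1) vz(1)] admissible_pairing[OF vz(1) uw(1)]
      Lebesgue_space_dual_inner[OF pq L(1,4)] Lebesgue_space_dual_inner[OF pq L(3,2)]
    by (simp add: inner_commute distrib_left)
  also have "\<dots> \<le> (\<integral>x. L x (v x, z x) + L x (u x, w x) \<partial>M)"
  proof (rule integral_mono)
    show "inner (u x) (z x) + inner (v x) (w x) \<le> L x (v x, z x) + L x (u x, w x)" for x
      using selfdual_Fenchel[OF L_selfdual, of "z x" "u x" "v x" "w x" x] by (simp add: inner_commute)
  qed (use Lebesgue_space_dual_inner[OF pq L(1,4)] Lebesgue_space_dual_inner[OF pq L(3,2)]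
      L_integrable[OF L(1,2)] L_integrable[OF L(3,4)] in auto)
  also have "\<dots> = mass * (hom (a, b) + hom (\<xi>, \<eta>))"
    using L_integrable[OF L(1,2)] L_integrable[OF L(3,4)] uw(2) vz(2)
    by (simp add: energy_def distrib_left)
  finally show "inner b \<xi> + inner a \<eta> \<le> hom (a, b) + hom (\<xi>, \<eta>)" using mass_pos by simp
next
  fix a b :: 'e
  \<comment> \<open>Minimality of \<open>hom\<close> at (a, b) is the hypothesis on \<open>F\<close>
    in \<open>duality_attained\<close>; the means of the resulting pair are the point where equality
    holds.\<close>
  have "mass * hom (a, b) \<le> energy v z" if "(v, z) \<in> admissible a b" for v z
    using that by (rule hom_le)
  then obtain u w where uw: "u \<in> VC" "w \<in> Sol" "energy u w \<le> load b a u w - mass * hom (a, b)"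
    by (rule duality_attained)
  define \<xi> where "\<xi> = (1 / mass) *\<^sub>R (\<integral>x. u x \<partial>M)"
  define \<eta> where "\<eta> = (1 / mass) *\<^sub>R (\<integral>x. w x \<partial>M)"
  have m: "(\<integral>x. u x \<partial>M) = mass *\<^sub>R \<xi>" "(\<integral>x. w x \<partial>M) = mass *\<^sub>R \<eta>"
    using mass_pos by (auto simp: \<xi>_def \<eta>_def)
  have "(u, w) \<in> admissible \<xi> \<eta>" using uw m by (simp add: admissible_def)
  then have "mass * hom (\<xi>, \<eta>) \<le> energy u w" by (rule hom_le)
  then have "mass * (hom (a, b) + hom (\<xi>, \<eta>)) \<le> mass * (inner b \<xi> + inner a \<eta>)"
    using uw(3) by (simp add: load_def m distrib_left)
  then show "\<exists>\<xi> \<eta>. hom (a, b) + hom (\<xi>, \<eta>) \<le> inner b \<xi> + inner a \<eta>" using mass_pos by auto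
qed

proposition hom_subdiff:
  "selfdual_subdiff (\<lambda>z. ereal (hom z)) \<xi> = {(1 / mass) *\<^sub>R (\<integral>x. g x \<partial>M) |g. g \<in> Sol \<and>
     (\<exists>G\<in>V. AE x in M. L x (\<xi> + G x, g x) = inner (\<xi> + G x) (g x))}"
proof (intro equalityI subsetI)
  fix \<eta> assume "\<eta> \<in> selfdual_subdiff (\<lambda>z. ereal (hom z)) \<xi>"
  then have h: "hom (\<xi>, \<eta>) = inner \<xi> \<eta>" by (simp add: selfdual_subdiff_def)
  obtain u w where uw: "(u, w) \<in> admissible \<xi> \<eta>" "mass * hom (\<xi>, \<eta>) = energy u w"
    by (rule hom_minimum)
  note L = admissible_Lp[OF uw(1)]
  obtain \<xi>' G where u: "u = (\<lambda>x. \<xi>' + G x)" and G: "G \<in> V"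
    using uw(1) unfolding admissible_def adjoin_constants_def by blast
  have iG: "integrable M G" using G integrable_Lp closed_subspace_Lp[OF V] by auto
  have "mass *\<^sub>R \<xi>' = mass *\<^sub>R \<xi>" using uw iG V_mean[OF G] by (simp add: admissible_def u)
  then have \<xi>: "\<xi>' = \<xi>" using mass_pos by simp
  note i = L_integrable[OF L] Lebesgue_space_dual_inner[OF pq L]
  \<comment> \<open>The pairing identity evaluates the integral of the inner product from the means
    alone, so a nonnegative integrand has integral zero.\<close>
  have "(\<integral>x. L x (u x, w x) - inner (u x) (w x) \<partial>M) = 0"
    using i uw(2) h admissible_pairing[OF uw(1) uw(1)] by (simp add: energy_def)
  then have "AE x in M. L x (u x, w x) - inner (u x) (w x) = 0"
    using i by (subst (asm) integral_nonneg_eq_0_iff_AE) (auto simp: selfdual_ge_inner[OF L_selfdual])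
  then have "AE x in M. L x (\<xi> + G x, w x) = inner (\<xi> + G x) (w x)" by (simp add: u \<xi>)
  moreover have "\<eta> = (1 / mass) *\<^sub>R (\<integral>x. w x \<partial>M)" "w \<in> Sol"
    using uw(1) mass_pos by (auto simp: admissible_def)
  ultimately show "\<eta> \<in> {(1 / mass) *\<^sub>R (\<integral>x. g x \<partial>M) |g. g \<in> Sol \<and>
     (\<exists>G\<in>V. AE x in M. L x (\<xi> + G x, g x) = inner (\<xi> + G x) (g x))}"
    using G by blast
next
  fix \<eta> assume "\<eta> \<in> {(1 / mass) *\<^sub>R (\<integral>x. g x \<partial>M) |g. g \<in> Sol \<and>
     (\<exists>G\<in>V. AE x in M. L x (\<xi> + G x, g x) = inner (\<xi> + G x) (g x))}"
  then obtain g G where \<eta>: "\<eta> = (1 / mass) *\<^sub>R (\<integral>x. g x \<partial>M)" and g: "g \<in> Sol" and G: "G \<in> V"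
    and eq: "AE x in M. L x (\<xi> + G x, g x) = inner (\<xi> + G x) (g x)" by blast
  have iG: "integrable M G" using G integrable_Lp closed_subspace_Lp[OF V] by auto
  have adm: "((\<lambda>x. \<xi> + G x), g) \<in> admissible \<xi> \<eta>"
    unfolding admissible_def adjoin_constants_def mem_Collect_eq prod.case
  proof (intro conjI)
    show "\<exists>\<xi>' G'. (\<lambda>x. \<xi> + G x) = (\<lambda>x. \<xi>' + G' x) \<and> G' \<in> V" using G by blast
  qed (use g iG V_mean[OF G] mass_pos in \<open>auto simp: \<eta>\<close>)
  note L = admissible_Lp[OF adm]
  have "mass * hom (\<xi>, \<eta>) \<le> energy (\<lambda>x. \<xi> + G x) g"
    using adm by (rule hom_le)
  also have "\<dots> = (\<integral>x. inner (\<xi> + G x) (g x) \<partial>M)"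
    unfolding energy_def using eq L_integrable[OF L] Lebesgue_space_dual_inner[OF pq L]
    by (intro integral_cong_AE) auto
  also have "\<dots> = mass * inner \<xi> \<eta>" by (rule admissible_pairing[OF adm adm])
  finally have "hom (\<xi>, \<eta>) \<le> inner \<xi> \<eta>" using mass_pos by simp
  moreover have "inner \<xi> \<eta> \<le> hom (\<xi>, \<eta>)" by (rule selfdual_ge_inner[OF hom_selfdual])
  ultimately show "\<eta> \<in> selfdual_subdiff (\<lambda>z. ereal (hom z)) \<xi>" by (simp add: selfdual_subdiff_def)
qed

end

section \<open>Test functions\<close>

definition test_function :: "(real^'n \<Rightarrow> real) \<Rightarrow> (real^'n \<Rightarrow> real^'n) \<Rightarrow> bool" where
  "test_function \<phi> D \<longleftrightarrow> (\<forall>x. GDERIV \<phi> x :> D x) \<and> continuous_on UNIV D \<and> bounded {x. \<phi> x \<noteq> 0}"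

text \<open>The derivative vanishes outside a large ball because the function is zero on the open
  exterior; compactness of the ball gives the bounds.\<close>

lemma test_function_bounds:
  assumes "test_function \<phi> D"
  obtains R K where "continuous_on UNIV \<phi>" "continuous_on UNIV D" "0 \<le> K"
    "\<And>x. R < norm x \<Longrightarrow> \<phi> x = 0" "\<And>x. R < norm x \<Longrightarrow> D x = 0"
    "\<And>x. \<bar>\<phi> x\<bar> \<le> K" "\<And>x. norm (D x) \<le> K"
proof -
  have D: "continuous_on UNIV D" and der: "\<And>x. GDERIV \<phi> x :> D x" and b: "bounded {x. \<phi> x \<noteq> 0}"
    using assms by (auto simp: test_function_def)
  have \<phi>: "continuous_on UNIV \<phi>"
    using der unfolding gderiv_def by (intro has_derivative_continuous_on) auto
  obtain R where R: "\<And>x. \<phi> x \<noteq> 0 \<Longrightarrow> norm x \<le> R" using b by (auto simp: bounded_iff)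
  have \<phi>0: "\<phi> x = 0" if "R < norm x" for x using R[of x] that by force
  have D0: "D x = 0" if x: "R < norm x" for x
  proof -
    have "open {y :: real^'n. R < norm y}" by (intro open_Collect_less continuous_intros)
    have "((\<lambda>y. 0) has_derivative (\<lambda>h. inner h (D x))) (at x)"
    proof (rule has_derivative_transform_within_open)
      show "(\<phi> has_derivative (\<lambda>h. inner h (D x))) (at x)" using der[of x] by (simp add: gderiv_def)
    qed (use x \<phi>0 \<open>open _\<close> in auto)
    moreover have "((\<lambda>y. 0) has_derivative (\<lambda>h. 0)) (at x)" by simp
    ultimately have "(\<lambda>h. inner h (D x)) = (\<lambda>h. 0)" by (rule has_derivative_unique)
    then have "inner (D x) (D x) = 0" by (rule fun_cong)
    then show ?thesis by simp
  qed
  have "compact (\<phi> ` cball 0 R)" "compact (D ` cball 0 R)"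
    by (rule compact_continuous_image[OF continuous_on_subset[OF \<phi> subset_UNIV] compact_cball])
      (rule compact_continuous_image[OF continuous_on_subset[OF D subset_UNIV] compact_cball])
  then have "bounded (\<phi> ` cball 0 R)" "bounded (D ` cball 0 R)" by (auto dest: compact_imp_bounded)
  then obtain K1 K2 where "\<forall>y\<in>\<phi> ` cball 0 R. norm y \<le> K1" "\<forall>y\<in>D ` cball 0 R. norm y \<le> K2"
    unfolding bounded_iff by blast
  then have K: "\<bar>\<phi> x\<bar> \<le> K1" "norm (D x) \<le> K2" if "norm x \<le> R" for x
    using that by auto
  define K where "K = \<bar>K1\<bar> + \<bar>K2\<bar>"
  have "\<bar>\<phi> x\<bar> \<le> K \<and> norm (D x) \<le> K" for x
  proof (cases "norm x \<le> R")
    case True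
    then show ?thesis using K[of x] unfolding K_def by linarith
  next
    case False
    then show ?thesis using \<phi>0[of x] D0[of x] by (simp add: K_def)
  qed
  then show thesis using that[OF \<phi> D _ \<phi>0 D0, of K] by (simp add: K_def)
qed

lemma test_function_translate:
  fixes \<phi> :: "real^'n \<Rightarrow> real"
  assumes "test_function \<phi> D"
  shows "test_function (\<lambda>x. \<phi> (x - h)) (\<lambda>x. D (x - h))"
  unfolding test_function_def
proof (intro conjI allI)
  have D: "continuous_on UNIV D" and der: "\<And>x. GDERIV \<phi> x :> D x" and b: "bounded {x. \<phi> x \<noteq> 0}"
    using assms by (auto simp: test_function_def)
  show "GDERIV (\<lambda>x. \<phi> (x - h)) x :> D (x - h)" for x
  proof -
    have "((\<lambda>x. x - h) has_derivative (\<lambda>k. k)) (at x)" by (auto intro!: derivative_eq_intros)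
    from has_derivative_compose[OF this der[of "x - h", unfolded gderiv_def]]
    show ?thesis by (simp add: gderiv_def)
  qed
  show "continuous_on UNIV (\<lambda>x. D (x - h))"
    by (rule continuous_on_compose2[OF D]) (auto intro!: continuous_intros)
  obtain R where R: "\<And>x. \<phi> x \<noteq> 0 \<Longrightarrow> norm x \<le> R" using b unfolding bounded_iff by blast
  have "norm x \<le> R + norm h" if "\<phi> (x - h) \<noteq> 0" for x
    using R[OF that] norm_triangle_ineq[of "x - h" h] by simp
  then show "bounded {x. \<phi> (x - h) \<noteq> 0}" unfolding bounded_iff by blast
qed

text \<open>The square of the positive part serves as a continuously differentiable cutoff; weak
  gradients are tested with C^1 functions.\<close>

lemma DERIV_max_0_power2: "((\<lambda>t::real. (max 0 t)\<^sup>2) has_field_derivative 2 * max 0 t) (at t)"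
proof -
  consider "0 < t" | "t < 0" | "t = 0" by linarith
  then show ?thesis
  proof cases
    case 1
    have "((\<lambda>t::real. t\<^sup>2) has_field_derivative 2 * max 0 t) (at t)"
      using 1 by (auto intro!: derivative_eq_intros)
    then show ?thesis
      by (rule has_field_derivative_transform_within_open[where S = "{0<..}"]) (use 1 in auto)
  next
    case 2
    have "((\<lambda>t::real. 0) has_field_derivative 2 * max 0 t) (at t)"
      using 2 by (auto intro!: derivative_eq_intros)
    then show ?thesis
      by (rule has_field_derivative_transform_within_open[where S = "{..<0}"]) (use 2 in auto)
  next
    case 3
    have "((\<lambda>h::real. (max 0 h)\<^sup>2 / h) \<longlongrightarrow> 0) (at 0)"
    proof (rule Lim_null_comparison)
      show "\<forall>\<^sub>F h in at (0::real). norm ((max 0 h)\<^sup>2 / h) \<le> \<bar>h\<bar>"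
        by (intro always_eventually) (auto simp: max_def power2_eq_square)
      show "((\<lambda>h::real. \<bar>h\<bar>) \<longlongrightarrow> 0) (at 0)" by (auto intro!: tendsto_eq_intros)
    qed
    then show ?thesis by (simp add: 3 DERIV_def)
  qed
qed

text \<open>The squares of the positive parts of \<open>1 - k dist(x, [a, b])\<^sup>2\<close> are continuously differentiable and
  decrease to the indicator function of the box as \<open>k \<rightarrow> \<infinity>\<close>.\<close>

lemma box_test_functions:
  fixes a b :: "real^'n"
  obtains \<phi> :: "nat \<Rightarrow> real^'n \<Rightarrow> real" and D R where "\<And>k. test_function (\<phi> k) (D k)"
    "\<And>k x. \<bar>\<phi> k x\<bar> \<le> 1" "\<And>k x. R < norm x \<Longrightarrow> \<phi> k x = 0"
    "\<And>x. (\<lambda>k. \<phi> k x) \<longlonglongrightarrow> indicator (cbox a b) x"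
proof -
  define m :: "real \<Rightarrow> real" where "m t = (max 0 t)\<^sup>2" for t
  have m: "(m has_field_derivative 2 * max 0 t) (at t)" for t
    unfolding m_def[abs_def] by (rule DERIV_max_0_power2)
  have m0: "0 \<le> m t" "m t = 0 \<longleftrightarrow> t \<le> 0" for t by (auto simp: m_def max_def)
  define d where "d x = (\<Sum>i\<in>UNIV. m (a $ i - x $ i) + m (x $ i - b $ i))" for x
  define d' where "d' x = (\<Sum>i\<in>UNIV. (2 * max 0 (a $ i - x $ i)) *\<^sub>R (- axis i 1)
      + (2 * max 0 (x $ i - b $ i)) *\<^sub>R (axis i 1 :: real^'n))" for x
  have co: "GDERIV (\<lambda>x. x $ i) x :> axis i 1" for i and x :: "real^'n"
    unfolding gderiv_def
    by (rule has_derivative_eq_rhs[OF bounded_linear_imp_has_derivative[OF bounded_linear_vec_nth]])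
      (simp add: inner_axis)
  have dm: "GDERIV (\<lambda>x. m (a $ i - x $ i) + m (x $ i - b $ i)) x :>
      (2 * max 0 (a $ i - x $ i)) *\<^sub>R (- axis i 1) + (2 * max 0 (x $ i - b $ i)) *\<^sub>R axis i 1" for i x
  proof -
    have "GDERIV (\<lambda>x. a $ i - x $ i) x :> - axis i 1" "GDERIV (\<lambda>x. x $ i - b $ i) x :> axis i 1"
      using GDERIV_diff[OF GDERIV_const co[of i x], of "a $ i"]
        GDERIV_diff[OF co[of i x] GDERIV_const, of "b $ i"] by simp_all
    from GDERIV_add[OF GDERIV_DERIV_compose[where g = m, OF this(1) m]
        GDERIV_DERIV_compose[where g = m, OF this(2) m]] show ?thesis .
  qed
  have dd: "GDERIV d x :> d' x" for x
    unfolding gderiv_def d_def[abs_def] d'_def inner_sum_right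
    by (rule has_derivative_sum) (rule dm[unfolded gderiv_def])
  have dc: "continuous_on UNIV d" "continuous_on UNIV d'"
  proof -
    show "continuous_on UNIV d"
      using dd unfolding gderiv_def by (intro has_derivative_continuous_on) auto
    show "continuous_on UNIV d'" unfolding d'_def[abs_def] by (intro continuous_intros)
  qed
  have d0: "0 \<le> d x" "d x = 0 \<longleftrightarrow> x \<in> cbox a b" for x
  proof -
    show "0 \<le> d x" unfolding d_def by (intro sum_nonneg add_nonneg_nonneg m0)
    have "d x = 0 \<longleftrightarrow> (\<forall>i. m (a $ i - x $ i) + m (x $ i - b $ i) = 0)"
      unfolding d_def by (subst sum_nonneg_eq_0_iff) (auto intro: add_nonneg_nonneg m0)
    also have "\<dots> \<longleftrightarrow> (\<forall>i. m (a $ i - x $ i) = 0 \<and> m (x $ i - b $ i) = 0)"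
      by (simp add: add_nonneg_eq_0_iff m0(1))
    also have "\<dots> \<longleftrightarrow> x \<in> cbox a b" by (auto simp: m0 mem_box_cart)
    finally show "d x = 0 \<longleftrightarrow> x \<in> cbox a b" .
  qed
  \<comment> \<open>The factor \<open>real (Suc k)\<close> is at least 1, so one ball contains all
    supports.\<close>
  define \<phi> where "\<phi> k x = m (1 - real (Suc k) * d x)" for k x
  define D where "D k x = (2 * max 0 (1 - real (Suc k) * d x)) *\<^sub>R (- (real (Suc k) *\<^sub>R d' x))" for k x
  \<comment> \<open>If \<open>d x < 1\<close>, no coordinate leaves the box by more than 1, and the
    norm is at most the sum of the absolute coordinates.\<close>
  define R where "R = (\<Sum>i\<in>UNIV. \<bar>a $ i\<bar> + \<bar>b $ i\<bar> + 1)"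
  have big: "1 \<le> d x" if x: "R < norm x" for x
  proof (rule ccontr)
    assume "\<not> 1 \<le> d x"
    have each: "\<bar>x $ i\<bar> \<le> \<bar>a $ i\<bar> + \<bar>b $ i\<bar> + 1" for i
    proof -
      have "m (a $ i - x $ i) + m (x $ i - b $ i) \<le> d x"
        unfolding d_def by (rule member_le_sum) (auto intro: add_nonneg_nonneg m0)
      then have *: "m (a $ i - x $ i) < 1" "m (x $ i - b $ i) < 1"
        using \<open>\<not> 1 \<le> d x\<close> m0(1)[of "a $ i - x $ i"] m0(1)[of "x $ i - b $ i"] by linarith+
      have lt1: "t \<le> 1" if "m t < 1" for t
      proof (rule ccontr)
        assume "\<not> t \<le> 1"
        then have "1 \<le> t\<^sup>2" "m t = t\<^sup>2" by (simp_all add: one_le_power m_def)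
        then show False using that by linarith
      qed
      show ?thesis using lt1[OF *(1)] lt1[OF *(2)] by linarith
    qed
    have "norm x \<le> (\<Sum>i\<in>UNIV. \<bar>x $ i\<bar>)" by (rule norm_le_l1_cart)
    also have "\<dots> \<le> R" unfolding R_def by (intro sum_mono each)
    finally show False using x by simp
  qed
  have \<phi>0: "\<phi> k x = 0" if "R < norm x" for k x
  proof -
    have "1 * 1 \<le> real (Suc k) * d x" using big[OF that] by (intro mult_mono) auto
    then show ?thesis unfolding \<phi>_def m0(2) by simp
  qed
  show thesis
  proof (rule that[of \<phi> D R])
    show "test_function (\<phi> k) (D k)" for k
      unfolding test_function_def
    proof (intro conjI allI)
      show "GDERIV (\<phi> k) x :> D k x" for x
      proof -
        have "GDERIV (\<lambda>x. 1 - real (Suc k) * d x) x :> - (real (Suc k) *\<^sub>R d' x)"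
          using dd[of x] unfolding gderiv_def by (auto intro!: derivative_eq_intros)
        then show ?thesis unfolding \<phi>_def[abs_def] D_def by (rule GDERIV_DERIV_compose[where g = m, OF _ m])
      qed
      show "continuous_on UNIV (D k)" unfolding D_def[abs_def] by (intro continuous_intros dc)
      show "bounded {x. \<phi> k x \<noteq> 0}"
        unfolding bounded_iff using \<phi>0[of _ k] by (intro exI[of _ R]) (auto simp: not_less[symmetric])
    qed
    show "\<bar>\<phi> k x\<bar> \<le> 1" for k x
    proof -
      have "max 0 (1 - real (Suc k) * d x) \<le> 1" using d0(1)[of x] by simp
      then have "\<phi> k x \<le> 1" unfolding \<phi>_def m_def by (intro power_le_one) auto
      then show ?thesis using m0(1) by (simp add: \<phi>_def)
    qed
    show "R < norm x \<Longrightarrow> \<phi> k x = 0" for k x by (rule \<phi>0)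
    show "(\<lambda>k. \<phi> k x) \<longlonglongrightarrow> indicator (cbox a b) x" for x
    proof (cases "x \<in> cbox a b")
      case True
      then have "\<phi> k x = 1" for k using d0(2)[of x] by (simp add: \<phi>_def m_def)
      then show ?thesis using True by simp
    next
      case False
      then have "0 < d x" using d0[of x] by (auto simp: less_le)
      then obtain N where N: "1 < real N * d x" using reals_Archimedean3 by blast
      have "\<phi> k x = 0" if "N \<le> k" for k
      proof -
        have "real N * d x \<le> real (Suc k) * d x" using that d0(1) by (intro mult_right_mono) auto
        then show ?thesis unfolding \<phi>_def m0(2) using N by linarith
      qed
      then have "\<forall>\<^sub>F k in sequentially. \<phi> k x = 0" by (auto simp: eventually_sequentially)
      then show ?thesis using False by (auto intro: tendsto_eventually)
    qed
  qed
qed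

section \<open>Locally integrable Borel functions\<close>

text \<open>The Borel counterpart of \<open>locally_integrable\<close>, tested on balls;
  translations and Fubini are then available for \<open>lborel\<close>.\<close>

definition loc_integrable :: "(real^'n \<Rightarrow> 'b::euclidean_space) \<Rightarrow> bool" where
  "loc_integrable f \<longleftrightarrow> f \<in> borel_measurable borel \<and>
     (\<forall>R. integrable lborel (\<lambda>x. indicator (cball 0 R) x *\<^sub>R f x))"

lemma loc_integrable_measurable: "loc_integrable f \<Longrightarrow> f \<in> borel_measurable borel"
  by (simp add: loc_integrable_def)

lemma loc_integrable_dominated:
  fixes f :: "real^'n \<Rightarrow> 'b::euclidean_space" and g :: "real^'n \<Rightarrow> 'c::euclidean_space"
  assumes f: "loc_integrable f" and [measurable]: "g \<in> borel_measurable borel"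
    and le: "\<And>x. norm (g x) \<le> K * norm (f x)" and 0: "\<And>x. R < norm x \<Longrightarrow> g x = 0"
  shows "integrable lborel g"
proof (rule Bochner_Integration.integrable_bound)
  have "integrable lborel (\<lambda>x. indicator (cball 0 R) x *\<^sub>R f x)" using f by (simp add: loc_integrable_def)
  then show "integrable lborel (\<lambda>x. \<bar>K\<bar> * norm (indicator (cball 0 R) x *\<^sub>R f x))"
    by (intro integrable_mult_right integrable_norm)
  show "AE x in lborel. norm (g x) \<le> norm (\<bar>K\<bar> * norm (indicator (cball 0 R) x *\<^sub>R f x))"
  proof (rule AE_I2)
    fix x :: "real^'n"
    show "norm (g x) \<le> norm (\<bar>K\<bar> * norm (indicator (cball 0 R) x *\<^sub>R f x))"
    proof (cases "norm x \<le> R")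
      case True
      have "norm (g x) \<le> \<bar>K\<bar> * norm (f x)"
        using le[of x] by (rule order_trans) (intro mult_right_mono, auto)
      then show ?thesis using True by (simp add: abs_mult)
    qed (use 0[of x] in simp)
  qed
qed measurable

lemma loc_integrable_inner:
  assumes "loc_integrable G"
  shows "loc_integrable (\<lambda>x. inner (G x) h)"
  unfolding loc_integrable_def
proof (intro conjI allI)
  show "(\<lambda>x. inner (G x) h) \<in> borel_measurable borel"
    using loc_integrable_measurable[OF assms] by measurable
  fix R
  have "integrable lborel (\<lambda>x. inner (indicator (cball 0 R) x *\<^sub>R G x) h)"
    using assms unfolding loc_integrable_def by (intro integrable_inner_left) blast
  then show "integrable lborel (\<lambda>x. indicator (cball 0 R) x *\<^sub>R inner (G x) h)" by simp
qed

text \<open>Box indicators are bounded limits of test functions, so \<open>f\<close> has integral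
  zero over every box. Hence the measures with densities the positive and the negative part agree on
  an intersection-stable generator of the Borel sets.\<close>

lemma loc_integrable_eq_0_AE:
  fixes f :: "real^'n \<Rightarrow> real"
  assumes f: "loc_integrable f" and 0: "\<And>\<phi> D. test_function \<phi> D \<Longrightarrow> (\<integral>x. \<phi> x * f x \<partial>lborel) = 0"
  shows "AE x in lborel. f x = 0"
proof -
  have [measurable]: "f \<in> borel_measurable borel" using f by (rule loc_integrable_measurable)
  have box_int: "integrable lborel (\<lambda>x. indicator (cbox a b) x * f x)" for a b
  proof -
    obtain R where R: "cbox a b \<subseteq> cball 0 R" using bounded_cbox[of a b] unfolding bounded_iff by (auto simp: subset_iff)
    show ?thesis
    proof (rule loc_integrable_dominated[OF f, of _ 1 R])
      show "norm (indicator (cbox a b) x * f x) \<le> 1 * norm (f x)" for x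
        by (simp add: indicator_def)
      show "indicator (cbox a b) x * f x = 0" if "R < norm x" for x
        using R that by (force simp: indicator_def)
    qed measurable
  qed
  have box0: "(\<integral>x. indicator (cbox a b) x * f x \<partial>lborel) = 0" for a b
  proof -
    obtain \<phi> D R where \<phi>: "\<And>k. test_function (\<phi> k) (D k)"
      "\<And>k x. \<bar>\<phi> k x\<bar> \<le> 1" "\<And>k x. R < norm x \<Longrightarrow> \<phi> k x = 0"
      "\<And>x. (\<lambda>k. \<phi> k x) \<longlonglongrightarrow> indicator (cbox a b) x"
      using box_test_functions[of a b] by metis
    have \<phi>m[measurable]: "\<phi> k \<in> borel_measurable borel" for k
      using \<phi>(1)[of k] by (auto elim!: test_function_bounds intro: borel_measurable_continuous_onI)
    have "(\<lambda>k. \<integral>x. \<phi> k x * f x \<partial>lborel) \<longlonglongrightarrow> (\<integral>x. indicator (cbox a b) x * f x \<partial>lborel)"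
    proof (rule integral_dominated_convergence)
      show "integrable lborel (\<lambda>x. norm (indicator (cball 0 R) x *\<^sub>R f x))"
        using f by (auto simp: loc_integrable_def)
      show "AE x in lborel. (\<lambda>k. \<phi> k x * f x) \<longlonglongrightarrow> indicator (cbox a b) x * f x"
        using \<phi>(4) by (intro AE_I2 tendsto_intros) auto
      show "AE x in lborel. norm (\<phi> k x * f x) \<le> norm (indicator (cball 0 R) x *\<^sub>R f x)" for k
      proof (rule AE_I2)
        fix x show "norm (\<phi> k x * f x) \<le> norm (indicator (cball 0 R) x *\<^sub>R f x)"
          using \<phi>(2)[of k x] \<phi>(3)[of x k] by (cases "norm x \<le> R") (auto simp: abs_mult mult_left_le_one_le)
      qed
    qed measurable
    then show ?thesis using 0[OF \<phi>(1)] by (simp add: LIMSEQ_const_iff)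
  qed
  \<comment> \<open>\<open>ennreal\<close> cuts negative values off at 0, so the densities are the
    positive and the negative part of \<open>f\<close>.\<close>
  define P where "P = density lborel (\<lambda>x. ennreal (f x))"
  define N where "N = density lborel (\<lambda>x. ennreal (- f x))"
  have em: "emeasure P (cbox a b) = emeasure N (cbox a b)" "emeasure P (cbox a b) \<noteq> \<infinity>" for a b
  proof -
    let ?p = "\<lambda>x. indicator (cbox a b) x * max 0 (f x)" and ?n = "\<lambda>x. indicator (cbox a b) x * max 0 (- f x)"
    have i: "integrable lborel ?p" "integrable lborel ?n"
      by (rule Bochner_Integration.integrable_bound[OF box_int[of a b]]; auto simp: indicator_def)+
    have "(\<integral>x. ?p x - ?n x \<partial>lborel) = (\<integral>x. indicator (cbox a b) x * f x \<partial>lborel)"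
      by (intro Bochner_Integration.integral_cong) (auto simp: indicator_def max_def)
    then have eq: "(\<integral>x. ?p x \<partial>lborel) = (\<integral>x. ?n x \<partial>lborel)" using i box0 by simp
    have P: "emeasure P (cbox a b) = ennreal (\<integral>x. ?p x \<partial>lborel)"
    proof -
      have "emeasure P (cbox a b) = (\<integral>\<^sup>+x. ennreal (?p x) \<partial>lborel)"
        unfolding P_def by (subst emeasure_density) (auto intro!: nn_integral_cong simp: indicator_def max_def ennreal_neg)
      also have "\<dots> = ennreal (\<integral>x. ?p x \<partial>lborel)" by (rule nn_integral_eq_integral[OF i(1)]) auto
      finally show ?thesis .
    qed
    have N: "emeasure N (cbox a b) = ennreal (\<integral>x. ?n x \<partial>lborel)"
    proof -
      have "emeasure N (cbox a b) = (\<integral>\<^sup>+x. ennreal (?n x) \<partial>lborel)"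
        unfolding N_def by (subst emeasure_density) (auto intro!: nn_integral_cong simp: indicator_def max_def ennreal_neg)
      also have "\<dots> = ennreal (\<integral>x. ?n x \<partial>lborel)" by (rule nn_integral_eq_integral[OF i(2)]) auto
      finally show ?thesis .
    qed
    show "emeasure P (cbox a b) = emeasure N (cbox a b)" "emeasure P (cbox a b) \<noteq> \<infinity>"
      using P N eq by auto
  qed
  have "P = N"
  proof (rule measure_eqI_generator_eq[where E = "range (\<lambda>(a, b). cbox a b :: (real^'n) set)"
        and \<Omega> = UNIV and A = "\<lambda>n. cbox (\<chi> i. - real n) (\<chi> i. real n)"])
    show "Int_stable (range (\<lambda>(a, b). cbox a b :: (real^'n) set))"
      unfolding Int_stable_def by (auto simp: Int_interval image_iff)
    have "sets (borel :: (real^'n) measure) = sigma_sets UNIV (range (\<lambda>(a, b). cbox a b))"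
      by (subst borel_eq_atLeastAtMost) (simp add: interval_cbox_cart split_def)
    then show "sets P = sigma_sets UNIV (range (\<lambda>(a, b). cbox a b))"
      "sets N = sigma_sets UNIV (range (\<lambda>(a, b). cbox a b))"
      by (auto simp: P_def N_def)
    show "(\<Union>n. cbox (\<chi> i. - real n) (\<chi> i. real n)) = (UNIV :: (real^'n) set)"
    proof (intro equalityI subsetI UNIV_I)
      fix x :: "real^'n"
      obtain n where "norm x \<le> real n" using real_arch_simple by blast
      then have "\<bar>x $ i\<bar> \<le> real n" for i using component_le_norm_cart[of x i] by linarith
      then have "x \<in> cbox (\<chi> i. - real n) (\<chi> i. real n)" by (auto simp: mem_box_cart abs_le_iff) (smt (verit) abs_le_iff)
      then show "x \<in> (\<Union>n. cbox (\<chi> i. - real n) (\<chi> i. real n))" by blast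
    qed
  qed (use em in auto)
  then have "AE x in lborel. ennreal (f x) = ennreal (- f x)"
    unfolding P_def N_def by (subst (asm) sigma_finite_measure.density_unique_iff[OF sigma_finite_lborel]) auto
  \<comment> \<open>One of \<open>f x\<close> and \<open>- f x\<close> is nonpositive, so the common
    truncation is 0.\<close>
  then show ?thesis by eventually_elim (metis ennreal_eq_0_iff ennreal_neg le_cases neg_le_0_iff_le antisym)
qed

section \<open>Integrals along segments\<close>

definition unit_interval :: "real measure" where
  "unit_interval = restrict_space lborel {0..1}"

lemma space_unit_interval [simp]: "space unit_interval = {0..1}"
  by (simp add: unit_interval_def)

lemma emeasure_unit_interval: "emeasure unit_interval (space unit_interval) = 1"
  by (simp add: unit_interval_def emeasure_restrict_space)

lemma measure_unit_interval [simp]: "measure unit_interval {0..1} = 1"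
  using emeasure_unit_interval by (simp add: measure_def)

interpretation unit_interval: finite_measure unit_interval
  by standard (use emeasure_unit_interval in simp)

interpretation unit_interval_lborel: pair_sigma_finite unit_interval "lborel :: (real^'n) measure" ..

lemma unit_interval_id: "(\<lambda>t. t) \<in> unit_interval \<rightarrow>\<^sub>M borel"
  unfolding unit_interval_def by (intro measurable_restrict_space1) simp

text \<open>A bound on the slices uniform in t gives joint integrability, since the unit interval
  has finite measure.\<close>

lemma segment_Fubini:
  fixes F :: "real \<Rightarrow> real^'n \<Rightarrow> real"
  assumes meas: "(\<lambda>(t, x). F t x) \<in> borel_measurable (unit_interval \<Otimes>\<^sub>M lborel)"
    and int: "\<And>t. integrable lborel (F t)" and C: "\<And>t. t \<in> {0..1} \<Longrightarrow> (\<integral>x. \<bar>F t x\<bar> \<partial>lborel) \<le> C"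
  shows "integrable lborel (\<lambda>x. \<integral>t. F t x \<partial>unit_interval)"
    and "(\<integral>x. (\<integral>t. F t x \<partial>unit_interval) \<partial>lborel) = (\<integral>t. (\<integral>x. F t x \<partial>lborel) \<partial>unit_interval)"
    and "AE x in lborel. integrable unit_interval (\<lambda>t. F t x)"
proof -
  have i: "integrable (unit_interval \<Otimes>\<^sub>M lborel) (\<lambda>(t, x). F t x)"
  proof (rule unit_interval_lborel.Fubini_integrable[OF meas])
    have "(\<lambda>t. \<integral>x. norm ((\<lambda>(t, x). F t x) (t, x)) \<partial>lborel) \<in> borel_measurable unit_interval"
      using meas by (intro lborel.borel_measurable_lebesgue_integral) simp
    then show "integrable unit_interval (\<lambda>t. \<integral>x. norm ((\<lambda>(t, x). F t x) (t, x)) \<partial>lborel)"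
      by (rule unit_interval.integrable_const_bound[rotated, of _ C])
        (use C in \<open>auto intro!: AE_I2\<close>)
  qed (use int in auto)
  show "integrable lborel (\<lambda>x. \<integral>t. F t x \<partial>unit_interval)"
    using unit_interval_lborel.integrable_snd[OF i] by simp
  show "(\<integral>x. (\<integral>t. F t x \<partial>unit_interval) \<partial>lborel) = (\<integral>t. (\<integral>x. F t x \<partial>lborel) \<partial>unit_interval)"
    by (rule unit_interval_lborel.Fubini_integral[OF i])
  show "AE x in lborel. integrable unit_interval (\<lambda>t. F t x)"
    using unit_interval_lborel.AE_integrable_snd[OF i] .
qed

lemma lborel_translation:
  fixes f :: "real^'n \<Rightarrow> 'b::euclidean_space"
  assumes "f \<in> borel_measurable borel"
  shows "(\<integral>x. f (x + h) \<partial>lborel) = (\<integral>x. f x \<partial>lborel)"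
    and "integrable lborel (\<lambda>x. f (x + h)) \<longleftrightarrow> integrable lborel f"
proof -
  have "(\<integral>x. f x \<partial>lborel) = (\<integral>x. f x \<partial>distr lborel borel ((+) h))" by (simp only: lborel_distr_plus)
  also have "\<dots> = (\<integral>x. f (h + x) \<partial>lborel)" using assms by (intro integral_distr) auto
  finally show "(\<integral>x. f (x + h) \<partial>lborel) = (\<integral>x. f x \<partial>lborel)" by (simp add: add.commute)
  have "integrable lborel f \<longleftrightarrow> integrable (distr lborel borel ((+) h)) f" by (simp only: lborel_distr_plus)
  also have "\<dots> \<longleftrightarrow> integrable lborel (\<lambda>x. f (h + x))" using assms by (intro integrable_distr_eq) auto
  finally show "integrable lborel (\<lambda>x. f (x + h)) \<longleftrightarrow> integrable lborel f" by (simp add: add.commute)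
qed

lemma lborel_nn_translation:
  fixes f :: "real^'n \<Rightarrow> ennreal"
  assumes "f \<in> borel_measurable borel"
  shows "(\<integral>\<^sup>+x. f (x + h) \<partial>lborel) = (\<integral>\<^sup>+x. f x \<partial>lborel)"
proof -
  have "(\<integral>\<^sup>+x. f x \<partial>lborel) = (\<integral>\<^sup>+x. f x \<partial>distr lborel borel ((+) h))" by (simp only: lborel_distr_plus)
  also have "\<dots> = (\<integral>\<^sup>+x. f (h + x) \<partial>lborel)" using assms by (intro nn_integral_distr) auto
  finally show ?thesis by (simp add: add.commute)
qed

section \<open>Periodic functions on a parallelepiped\<close>

locale parallelepiped_lattice =
  fixes a :: "real^'n" and v :: "'n \<Rightarrow> real^'n"
  assumes inj_v: "inj v" and independent_v: "independent (range v)"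
begin

definition combination :: "real^'n \<Rightarrow> real^'n" where
  "combination t = (\<Sum>i\<in>UNIV. t $ i *\<^sub>R v i)"

definition coord :: "real^'n \<Rightarrow> real^'n" where
  "coord = inv combination"

lemma linear_combination: "linear combination"
  by (rule linearI) (simp_all add: combination_def scaleR_add_left sum.distrib scaleR_sum_right)

lemma inj_combination: "inj combination"
  unfolding linear_injective_0[OF linear_combination]
proof (intro allI impI)
  fix t assume t: "combination t = 0"
  have "(\<Sum>w\<in>range v. t $ (inv v w) *\<^sub>R w) = (\<Sum>i\<in>UNIV. t $ i *\<^sub>R v i)"
    using inj_v by (subst sum.reindex) auto
  then have s: "(\<Sum>w\<in>range v. t $ (inv v w) *\<^sub>R w) = 0" using t by (simp add: combination_def)
  have "t $ i = 0" for i
    using independentD[OF independent_v _ order_refl s, of "v i"] inj_v by simp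
  then show "t = 0" by (simp add: vec_eq_iff)
qed

lemma bij_combination: "bij combination"
  using inj_combination linear_injective_imp_surjective[OF linear_combination] by (simp add: bij_def)

lemma linear_coord: "linear coord"
  unfolding coord_def using linear_combination inj_combination by (simp add: inj_linear_imp_inv_linear linear_linear)

lemma coord_combination [simp]: "coord (combination t) = t"
  unfolding coord_def by (simp add: inj_combination)

lemma combination_coord [simp]: "combination (coord x) = x"
  unfolding coord_def using bij_combination by (simp add: bij_is_surj surj_f_inv_f)

lemma continuous_on_coord: "continuous_on S coord"
  using linear_coord by (intro linear_continuous_on) (simp add: linear_conv_bounded_linear)

lemma coord_measurable [measurable]: "coord \<in> borel_measurable borel"
  by (rule borel_measurable_continuous_onI[OF continuous_on_coord])

lemma coord_nth_measurable [measurable]: "(\<lambda>x. coord (f x) $ i) \<in> borel_measurable M"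
  if [measurable]: "f \<in> borel_measurable M"
proof -
  have [measurable]: "(\<lambda>y :: real^'n. y $ i) \<in> borel_measurable borel"
    by (intro borel_measurable_continuous_onI continuous_intros)
  show ?thesis by measurable
qed

text \<open>Half open, so that its lattice translates tile the space without overlap; it differs
  from the open parallelepiped by a null set.\<close>

definition cell :: "(real^'n) set" where
  "cell = {x. \<forall>i. 0 \<le> coord (x - a) $ i \<and> coord (x - a) $ i < 1}"

lemma cell_sets [measurable]: "cell \<in> sets borel"
proof -
  have "cell = (\<Inter>i. {x. 0 \<le> coord (x - a) $ i \<and> coord (x - a) $ i < 1})" by (auto simp: cell_def)
  then show ?thesis by simp
qed

lemma parallelepiped_eq: "parallelepiped a v = {x. \<forall>i. 0 < coord (x - a) $ i \<and> coord (x - a) $ i < 1}"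
proof (intro equalityI subsetI)
  fix x assume "x \<in> parallelepiped a v"
  then obtain t where t: "x = a + (\<Sum>i\<in>UNIV. t i *\<^sub>R v i)" "\<forall>i. 0 < t i \<and> t i < 1"
    by (auto simp: parallelepiped_def)
  then have "x - a = combination (\<chi> i. t i)" by (simp add: combination_def)
  then show "x \<in> {x. \<forall>i. 0 < coord (x - a) $ i \<and> coord (x - a) $ i < 1}" using t(2) by simp
next
  fix x assume x: "x \<in> {x. \<forall>i. 0 < coord (x - a) $ i \<and> coord (x - a) $ i < 1}"
  have "x = a + combination (coord (x - a))" by simp
  then have "x = a + (\<Sum>i\<in>UNIV. coord (x - a) $ i *\<^sub>R v i)" by (simp only: combination_def)
  then show "x \<in> parallelepiped a v"
    using x unfolding parallelepiped_def by (auto intro!: exI[of _ "\<lambda>i. coord (x - a) $ i"])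
qed

lemma open_parallelepiped: "open (parallelepiped a v)"
proof -
  have c: "continuous_on UNIV (\<lambda>x. coord (x - a) $ i)" for i
    by (intro continuous_intros continuous_on_compose2[OF continuous_on_coord]) auto
  have "parallelepiped a v = (\<Inter>i. {x. 0 < coord (x - a) $ i} \<inter> {x. coord (x - a) $ i < 1})"
    unfolding parallelepiped_eq by auto
  also have "open \<dots>" by (intro open_INT ballI open_Int open_Collect_less c continuous_on_const) simp
  finally show ?thesis .
qed

lemma AE_cell: "AE x in lborel. x \<in> cell \<longleftrightarrow> x \<in> parallelepiped a v"
proof -
  have "AE x in lborel. coord (x - a) $ i \<noteq> 0" for i
  proof -
    \<comment> \<open>Represents the i-th coordinate as an inner product, which places the face in a
      hyperplane.\<close>
    define d where "d = adjoint coord (axis i 1)"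
    have d: "coord x $ i = inner d x" for x
      using adjoint_works[OF linear_coord, of x "axis i 1"]
      by (simp add: d_def inner_axis inner_commute[of "adjoint coord (axis i 1)"])
    have "coord (combination (axis i 1)) $ i = 1" by simp
    then have "d \<noteq> 0" unfolding d by auto
    then have "negligible {x. inner d x = inner d a}" by (intro negligible_hyperplane) simp
    moreover have "{x. inner d x = inner d a} \<in> sets lborel"
      by (simp add: borel_closed closed_hyperplane)
    ultimately have "{x. inner d x = inner d a} \<in> null_sets lborel"
      unfolding negligible_iff_null_sets null_sets_completion_iff[symmetric] by (simp add: null_sets_completion_iff)
    then show ?thesis by (rule AE_I') (auto simp: d inner_diff_right)
  qed
  then have "AE x in lborel. \<forall>i\<in>UNIV. coord (x - a) $ i \<noteq> 0" by (intro AE_finite_allI) auto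
  then show ?thesis
  proof eventually_elim
    case (elim x)
    then have "0 \<le> coord (x - a) $ i \<longleftrightarrow> 0 < coord (x - a) $ i" for i
      by (metis UNIV_I less_le)
    then show ?case by (simp add: cell_def parallelepiped_eq)
  qed
qed

section \<open>Lattice translations and folding into the cell\<close>

definition lat :: "('n \<Rightarrow> int) \<Rightarrow> real^'n" where
  "lat k = (\<Sum>i\<in>UNIV. of_int (k i) *\<^sub>R v i)"

lemma lat_eq: "lat k = combination (\<chi> i. of_int (k i))"
  by (simp add: lat_def combination_def)

lemma coord_add_lat [simp]: "coord (x + lat k) = coord x + (\<chi> i. of_int (k i))"
  by (simp add: lat_eq linear_add[OF linear_coord])

text \<open>Names the tile that contains \<open>x\<close>; subtracting the corresponding lattice
  vector, as \<open>fold\<close> does, leads into \<open>cell\<close>.\<close>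

definition index :: "real^'n \<Rightarrow> 'n \<Rightarrow> int" where
  "index x = (\<lambda>i. \<lfloor>coord (x - a) $ i\<rfloor>)"

definition fold :: "real^'n \<Rightarrow> real^'n" where
  "fold x = x + lat (\<lambda>i. - index x i)"

lemma cell_iff_index: "x \<in> cell \<longleftrightarrow> index x = (\<lambda>i. 0)"
  by (auto simp: cell_def index_def fun_eq_iff floor_eq_iff)

lemma index_add_lat: "index (x + lat k) = (\<lambda>i. index x i + k i)"
proof -
  have "x + lat k - a = (x - a) + lat k" by simp
  then show ?thesis unfolding index_def by (simp only: coord_add_lat) (simp add: fun_eq_iff)
qed

lemma fold_in_cell: "fold x \<in> cell"
  by (simp add: cell_iff_index fold_def index_add_lat)

lemma fold_cell: "x \<in> cell \<Longrightarrow> fold x = x"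
  by (simp add: cell_iff_index fold_def lat_def)

lemma lat_add: "lat (\<lambda>i. k i + l i) = lat k + lat l"
  by (simp add: lat_def scaleR_add_left sum.distrib)

lemma lat_uminus: "lat (\<lambda>i. - k i) = - lat k"
  by (simp add: lat_def sum_negf)

lemma fold_add_lat: "fold (x + lat k) = fold x"
  unfolding fold_def index_add_lat lat_uminus lat_add by simp

lemma index_nth_measurable [measurable]:
  "(\<lambda>x. index x i) \<in> borel \<rightarrow>\<^sub>M count_space UNIV"
  unfolding index_def by measurable

lemma fold_measurable [measurable]: "fold \<in> borel_measurable borel"
  unfolding fold_def lat_def by measurable

lemma index_eq_sets [measurable]: "{x. index x = k} \<in> sets borel"
proof -
  have "{x. index x = k} = (\<Inter>i. {x. index x i = k i})" by auto
  also have "\<dots> \<in> sets borel" by (intro sets.countable_INT' countable_finite) auto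
  finally show ?thesis .
qed

definition lat_periodic :: "(real^'n \<Rightarrow> 'b) \<Rightarrow> bool" where
  "lat_periodic f \<longleftrightarrow> (\<forall>x k. f (x + lat k) = f x)"

lemma lat_periodicD: "lat_periodic f \<Longrightarrow> f (x + lat k) = f x"
  by (simp add: lat_periodic_def)

lemma lat_periodic_comp_fold: "lat_periodic (\<lambda>x. f (fold x))"
  by (simp add: lat_periodic_def fold_add_lat)

text \<open>Integer multiples of one edge are treated by induction in both directions, sums over
  several edges by a second induction.\<close>

lemma periodic_wrt_iff_lat_periodic: "periodic_wrt v f \<longleftrightarrow> lat_periodic f"
proof
  assume f: "periodic_wrt v f"
  have one: "f (x + of_int m *\<^sub>R v i) = f x" for x m i
  proof (induction m arbitrary: x rule: int_induct[where k = 0])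
    case base
    then show ?case by simp
  next
    case (step1 m)
    have "x + of_int (m + 1) *\<^sub>R v i = (x + of_int m *\<^sub>R v i) + v i" by (simp add: scaleR_add_left)
    then have "f (x + of_int (m + 1) *\<^sub>R v i) = f (x + of_int m *\<^sub>R v i)"
      using f unfolding periodic_wrt_def by metis
    then show ?case using step1 by simp
  next
    case (step2 m)
    have "(x + of_int (m - 1) *\<^sub>R v i) + v i = x + of_int m *\<^sub>R v i" by (simp add: scaleR_diff_left)
    then have "f (x + of_int (m - 1) *\<^sub>R v i) = f (x + of_int m *\<^sub>R v i)"
      using f unfolding periodic_wrt_def by metis
    then show ?case using step2 by simp
  qed
  have "f (x + (\<Sum>i\<in>S. of_int (k i) *\<^sub>R v i)) = f x" if "finite S" for S x k
    using that
  proof (induction S arbitrary: x)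
    case (insert i S)
    then have "f (x + (\<Sum>i\<in>insert i S. of_int (k i) *\<^sub>R v i))
        = f ((x + of_int (k i) *\<^sub>R v i) + (\<Sum>i\<in>S. of_int (k i) *\<^sub>R v i))" by (simp add: add.assoc)
    then show ?case using insert.IH one by simp
  qed simp
  then show "lat_periodic f" by (simp add: lat_periodic_def lat_def)
next
  assume f: "lat_periodic f"
  have "lat (\<lambda>j. if j = i then 1 else 0) = v i" for i
    by (simp add: lat_def if_distrib[of of_int] if_distrib[of "\<lambda>c. c *\<^sub>R _"] cong: if_cong)
  then show "periodic_wrt v f"
    using f unfolding periodic_wrt_def lat_periodic_def by metis
qed

text \<open>Both sides are sums over the lattice of integrals over the pieces in which a translate of the
  cell meets the tiling by cells.\<close>

lemma nn_integral_translated_cell: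
  fixes f :: "real^'n \<Rightarrow> ennreal"
  assumes f[measurable]: "f \<in> borel_measurable borel" and per: "lat_periodic f"
  shows "(\<integral>\<^sup>+x. f (x + h) * indicator cell x \<partial>lborel) = (\<integral>\<^sup>+x. f x * indicator cell x \<partial>lborel)"
proof -
  \<comment> \<open>Lattice indices are numbered by \<open>to_nat\<close>, which makes the
    decomposition a series; numbers that are not codes contribute 0.\<close>
  define e where "e n k = (if n = to_nat (k :: 'n \<Rightarrow> int) then 1 else 0 :: ennreal)" for n k
  have esum: "(\<Sum>n. e n k) = 1" for k
    using sums_unique[OF sums_single[of "to_nat k" "\<lambda>_. 1 :: ennreal"]] by (simp add: e_def)
  have e0: "e n k = 0" if "\<not> (\<exists>k :: 'n \<Rightarrow> int. to_nat k = n)" for n k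
    using that by (auto simp: e_def)
  have em: "(\<lambda>x. e n (index x)) \<in> borel_measurable borel" for n
  proof (cases "\<exists>k :: 'n \<Rightarrow> int. to_nat k = n")
    case True
    then obtain k :: "'n \<Rightarrow> int" where k: "to_nat k = n" by blast
    have "(\<lambda>x. e n (index x)) = indicator {x. index x = k}"
    proof
      fix x show "e n (index x) = indicator {x. index x = k} x"
        using k by (cases "index x = k") (auto simp: e_def)
    qed
    then show ?thesis by simp
  next
    case False
    then show ?thesis by (simp add: e0)
  qed
  have em': "(\<lambda>x. e n (\<lambda>i. - index (x - h) i)) \<in> borel_measurable borel" for n
  proof (cases "\<exists>k :: 'n \<Rightarrow> int. to_nat k = n")
    case True
    then obtain k :: "'n \<Rightarrow> int" where k: "to_nat k = n" by blast
    have "(\<lambda>x. e n (\<lambda>i. - index (x - h) i)) = (\<lambda>x. indicator {x. index x = (\<lambda>i. - k i)} (x - h))"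
    proof
      fix x
      have "k = (\<lambda>i. - index (x - h) i) \<longleftrightarrow> index (x - h) = (\<lambda>i. - k i)"
        unfolding fun_eq_iff by (metis minus_minus)
      then show "e n (\<lambda>i. - index (x - h) i) = indicator {x. index x = (\<lambda>i. - k i)} (x - h)"
        using k by (auto simp: e_def)
    qed
    then show ?thesis by simp
  next
    case False
    then show ?thesis by (simp add: e0)
  qed
  note [measurable] = em em'
  \<comment> \<open>Shifting by the lattice vector of index k carries the part of the translated
    cell inside tile k back into \<open>cell\<close>; periodicity leaves \<open>f\<close>
    unchanged.\<close>
  have piece: "(\<integral>\<^sup>+x. f x * indicator cell (x - h) * e n (index x) \<partial>lborel)
      = (\<integral>\<^sup>+x. f x * indicator cell x * e n (\<lambda>i. - index (x - h) i) \<partial>lborel)" for n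
  proof (cases "\<exists>k :: 'n \<Rightarrow> int. to_nat k = n")
    case True
    then obtain k :: "'n \<Rightarrow> int" where k: "to_nat k = n" by blast
    have "(\<integral>\<^sup>+x. f x * indicator cell (x - h) * e n (index x) \<partial>lborel)
      = (\<integral>\<^sup>+x. f (x + lat k) * indicator cell (x + lat k - h) * e n (index (x + lat k)) \<partial>lborel)"
      by (rule lborel_nn_translation[symmetric]) measurable
    also have "\<dots> = (\<integral>\<^sup>+x. f x * indicator cell x * e n (\<lambda>i. - index (x - h) i) \<partial>lborel)"
    proof (rule nn_integral_cong)
      fix x
      have 1: "x + lat k - h = (x - h) + lat k" by simp
      have "(\<lambda>i. index (x - h) i + k i) = (\<lambda>i. 0) \<longleftrightarrow> k = (\<lambda>i. - index (x - h) i)"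
        unfolding fun_eq_iff by (metis add.commute add_eq_0_iff)
      then have 2: "indicator cell (x + lat k - h) = e n (\<lambda>i. - index (x - h) i)"
        unfolding 1 indicator_def cell_iff_index index_add_lat using k by (auto simp: e_def)
      have "k = (\<lambda>i. index x i + k i) \<longleftrightarrow> index x = (\<lambda>i. 0)"
        unfolding fun_eq_iff by (metis add_cancel_right_left)
      then have 3: "e n (index (x + lat k)) = indicator cell x"
        unfolding index_add_lat indicator_def cell_iff_index using k by (auto simp: e_def)
      show "f (x + lat k) * indicator cell (x + lat k - h) * e n (index (x + lat k))
          = f x * indicator cell x * e n (\<lambda>i. - index (x - h) i)"
        unfolding 2 3 lat_periodicD[OF per] by (simp add: mult_ac)
    qed
    finally show ?thesis .
  next
    case False
    then show ?thesis by (simp add: e0)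
  qed
  have "(\<integral>\<^sup>+x. f (x + h) * indicator cell x \<partial>lborel) = (\<integral>\<^sup>+x. f x * indicator cell (x - h) \<partial>lborel)"
    using lborel_nn_translation[of "\<lambda>x. f x * indicator cell (x - h)" h] by simp
  also have "\<dots> = (\<integral>\<^sup>+x. (\<Sum>n. f x * indicator cell (x - h) * e n (index x)) \<partial>lborel)"
    by (intro nn_integral_cong) (simp add: ennreal_suminf_cmult esum)
  also have "\<dots> = (\<Sum>n. \<integral>\<^sup>+x. f x * indicator cell (x - h) * e n (index x) \<partial>lborel)"
    by (rule nn_integral_suminf) measurable
  also have "\<dots> = (\<Sum>n. \<integral>\<^sup>+x. f x * indicator cell x * e n (\<lambda>i. - index (x - h) i) \<partial>lborel)"
    by (simp only: piece)
  also have "\<dots> = (\<integral>\<^sup>+x. (\<Sum>n. f x * indicator cell x * e n (\<lambda>i. - index (x - h) i)) \<partial>lborel)"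
    by (rule nn_integral_suminf[symmetric]) measurable
  also have "\<dots> = (\<integral>\<^sup>+x. f x * indicator cell x \<partial>lborel)"
    by (intro nn_integral_cong) (simp add: ennreal_suminf_cmult esum)
  finally show ?thesis .
qed

lemma bounded_coord_cball: "\<exists>m. \<forall>x\<in>cball 0 R. \<forall>i. \<bar>coord (x - a) $ i\<bar> \<le> real m"
proof -
  have "compact ((\<lambda>x. coord (x - a)) ` cball 0 R)"
    by (rule compact_continuous_image[OF continuous_on_compose2[OF continuous_on_coord] compact_cball])
      (auto intro!: continuous_intros)
  then have "bounded ((\<lambda>x. coord (x - a)) ` cball 0 R)" by (rule compact_imp_bounded)
  then obtain B where B: "\<And>x. x \<in> cball 0 R \<Longrightarrow> norm (coord (x - a)) \<le> B" unfolding bounded_iff by blast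
  obtain m where "B \<le> real m" using real_arch_simple by blast
  then have "\<bar>coord (x - a) $ i\<bar> \<le> real m" if "x \<in> cball 0 R" for x i
    using B[OF that] component_le_norm_cart[of "coord (x - a)" i] by linarith
  then show ?thesis by blast
qed

text \<open>A ball meets finitely many tiles, and over each of them a periodic function has the same
  integral. One number serves all periodic \<open>f\<close>.\<close>

lemma nn_integral_cball_le:
  obtains N :: nat where "\<And>f :: real^'n \<Rightarrow> ennreal. f \<in> borel_measurable borel \<Longrightarrow> lat_periodic f \<Longrightarrow>
    (\<integral>\<^sup>+x. f x * indicator (cball 0 R) x \<partial>lborel) \<le> of_nat N * (\<integral>\<^sup>+x. f x * indicator cell x \<partial>lborel)"
proof -
  obtain m where m: "\<And>x i. x \<in> cball 0 R \<Longrightarrow> \<bar>coord (x - a) $ i\<bar> \<le> real m"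
    using bounded_coord_cball by blast
  define F where "F = (PiE UNIV (\<lambda>_. {- int m - 1..int m}) :: ('n \<Rightarrow> int) set)"
  have fin: "finite F" unfolding F_def by (intro finite_PiE) auto
  have idx: "index x \<in> F" if "x \<in> cball 0 R" for x
  proof -
    have "- int m - 1 \<le> index x i \<and> index x i \<le> int m" for i
      using m[OF that, of i] unfolding index_def by (auto simp: le_floor_iff floor_le_iff abs_le_iff)
    then show ?thesis by (auto simp: F_def)
  qed
  show thesis
  proof (rule that[of "card F"])
    fix f :: "real^'n \<Rightarrow> ennreal"
    assume f[measurable]: "f \<in> borel_measurable borel" and per: "lat_periodic f"
    have "(\<integral>\<^sup>+x. f x * indicator (cball 0 R) x \<partial>lborel)
        \<le> (\<integral>\<^sup>+x. (\<Sum>k\<in>F. f x * indicator cell (x - lat k)) \<partial>lborel)"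
    proof (rule nn_integral_mono)
      fix x
      show "f x * indicator (cball 0 R) x \<le> (\<Sum>k\<in>F. f x * indicator cell (x - lat k))"
      proof (cases "x \<in> cball 0 R")
        case True
        have "x - lat (index x) \<in> cell" using fold_in_cell[of x] by (simp add: fold_def lat_uminus)
        then have "f x * indicator (cball 0 R) x = f x * indicator cell (x - lat (index x))" using True by simp
        also have "\<dots> \<le> (\<Sum>k\<in>F. f x * indicator cell (x - lat k))"
          using idx[OF True] fin by (intro member_le_sum) auto
        finally show ?thesis .
      qed simp
    qed
    also have "\<dots> = (\<Sum>k\<in>F. \<integral>\<^sup>+x. f x * indicator cell (x - lat k) \<partial>lborel)"
      by (rule nn_integral_sum) measurable
    also have "\<dots> = (\<Sum>k\<in>F. \<integral>\<^sup>+x. f x * indicator cell x \<partial>lborel)"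
    proof (rule sum.cong[OF refl])
      fix k
      have "(\<integral>\<^sup>+x. f x * indicator cell (x - lat k) \<partial>lborel)
          = (\<integral>\<^sup>+x. f (x + lat k) * indicator cell (x + lat k - lat k) \<partial>lborel)"
        by (rule lborel_nn_translation[symmetric]) measurable
      then show "(\<integral>\<^sup>+x. f x * indicator cell (x - lat k) \<partial>lborel) = (\<integral>\<^sup>+x. f x * indicator cell x \<partial>lborel)"
        by (simp add: lat_periodicD[OF per])
    qed
    finally show "(\<integral>\<^sup>+x. f x * indicator (cball 0 R) x \<partial>lborel)
        \<le> of_nat (card F) * (\<integral>\<^sup>+x. f x * indicator cell x \<partial>lborel)" by simp
  qed
qed

end

section \<open>Differences of weakly differentiable functions\<close>

lemma loc_integrable_integral_le:
  fixes f :: "real^'n \<Rightarrow> real" and g :: "real^'n \<Rightarrow> real"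
  assumes f: "loc_integrable f" and g: "g \<in> borel_measurable borel"
    and le: "\<And>x. \<bar>g x\<bar> \<le> K * \<bar>f x\<bar>" and 0: "\<And>x. R < norm x \<Longrightarrow> g x = 0"
  shows "(\<integral>x. \<bar>g x\<bar> \<partial>lborel) \<le> (\<integral>x. \<bar>K\<bar> * \<bar>indicator (cball 0 R) x * f x\<bar> \<partial>lborel)"
proof (rule integral_mono)
  show "integrable lborel (\<lambda>x. \<bar>g x\<bar>)"
    using loc_integrable_dominated[OF f g, of K R] le 0 by (intro integrable_abs) auto
  have "integrable lborel (\<lambda>x. indicator (cball 0 R) x *\<^sub>R f x)" using f by (simp add: loc_integrable_def)
  then show "integrable lborel (\<lambda>x. \<bar>K\<bar> * \<bar>indicator (cball 0 R) x * f x\<bar>)" by simp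
  fix x :: "real^'n"
  show "\<bar>g x\<bar> \<le> \<bar>K\<bar> * \<bar>indicator (cball 0 R) x * f x\<bar>"
  proof (cases "norm x \<le> R")
    case True
    have "\<bar>g x\<bar> \<le> \<bar>K\<bar> * \<bar>f x\<bar>"
      using le[of x] by (rule order_trans) (intro mult_right_mono, auto)
    then show ?thesis using True by simp
  qed (use 0[of x] in simp)
qed

text \<open>Translation invariance moves the shift from \<open>f\<close> to the bounded, compactly
  supported \<open>\<psi>\<close>, and Fubini exchanges the average over t with the integral. For t
  in the unit interval all supports stay in one ball, which gives the uniform bound.\<close>

lemma slide_Fubini:
  fixes f \<psi> :: "real^'n \<Rightarrow> real"
  assumes f: "loc_integrable f" and \<psi>[measurable]: "\<psi> \<in> borel_measurable borel"
    and K: "\<And>x. \<bar>\<psi> x\<bar> \<le> K" and 0: "\<And>x. R < norm x \<Longrightarrow> \<psi> x = 0"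
  shows "(\<integral>x. f x * (\<integral>t. \<psi> (x - t *\<^sub>R h) \<partial>unit_interval) \<partial>lborel)
      = (\<integral>t. (\<integral>x. f x * \<psi> (x - t *\<^sub>R h) \<partial>lborel) \<partial>unit_interval)"
    and "(\<integral>x. \<psi> x * (\<integral>t. f (x + t *\<^sub>R h) \<partial>unit_interval) \<partial>lborel)
      = (\<integral>t. (\<integral>x. f x * \<psi> (x - t *\<^sub>R h) \<partial>lborel) \<partial>unit_interval)"
    and "integrable lborel (\<lambda>x. \<psi> x * (\<integral>t. f (x + t *\<^sub>R h) \<partial>unit_interval))"
    and "integrable lborel (\<lambda>x. f x * (\<integral>t. \<psi> (x - t *\<^sub>R h) \<partial>unit_interval))"
proof -
  have [measurable]: "f \<in> borel_measurable borel" using f by (rule loc_integrable_measurable)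
  note [measurable] = unit_interval_id
  have K0: "0 \<le> K" using K[of 0] by linarith
  have le: "\<bar>f x * \<psi> (x - t *\<^sub>R h)\<bar> \<le> K * \<bar>f x\<bar>" for x t
    using mult_right_mono[OF K[of "x - t *\<^sub>R h"], of "\<bar>f x\<bar>"] by (simp add: abs_mult mult.commute)
  have z: "f x * \<psi> (x - t *\<^sub>R h) = 0" if "R + \<bar>t\<bar> * norm h < norm x" for x t
  proof -
    have "norm x \<le> norm (x - t *\<^sub>R h) + norm (t *\<^sub>R h)"
      using norm_triangle_ineq[of "x - t *\<^sub>R h" "t *\<^sub>R h"] by simp
    then have "R < norm (x - t *\<^sub>R h)" using that by simp
    then show ?thesis by (simp add: 0)
  qed
  have int: "integrable lborel (\<lambda>x. f x * \<psi> (x - t *\<^sub>R h))" for t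
    by (rule loc_integrable_dominated[OF f, of _ K "R + \<bar>t\<bar> * norm h"]) (use le z in auto)
  define B where "B = (\<integral>x. \<bar>K\<bar> * \<bar>indicator (cball 0 (R + norm h)) x * f x\<bar> \<partial>lborel)"
  have bd: "(\<integral>x. \<bar>f x * \<psi> (x - t *\<^sub>R h)\<bar> \<partial>lborel) \<le> B" if "t \<in> {0..1}" for t
    unfolding B_def
  proof (rule loc_integrable_integral_le[OF f _ le])
    fix x :: "real^'n" assume x: "R + norm h < norm x"
    have "\<bar>t\<bar> * norm h \<le> 1 * norm h" using that by (intro mult_right_mono) auto
    then show "f x * \<psi> (x - t *\<^sub>R h) = 0" using z x by simp
  qed measurable
  have "(\<lambda>(t, x). f x * \<psi> (x - t *\<^sub>R h)) \<in> borel_measurable (unit_interval \<Otimes>\<^sub>M lborel)" by measurable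
  note A = segment_Fubini[OF this int bd]
  from A(2) show "(\<integral>x. f x * (\<integral>t. \<psi> (x - t *\<^sub>R h) \<partial>unit_interval) \<partial>lborel)
      = (\<integral>t. (\<integral>x. f x * \<psi> (x - t *\<^sub>R h) \<partial>lborel) \<partial>unit_interval)" by simp
  from A(1) show "integrable lborel (\<lambda>x. f x * (\<integral>t. \<psi> (x - t *\<^sub>R h) \<partial>unit_interval))" by simp
  have shift: "(\<integral>x. g (\<psi> x * f (x + t *\<^sub>R h)) \<partial>lborel) = (\<integral>x. g (f x * \<psi> (x - t *\<^sub>R h)) \<partial>lborel)"
    if [measurable]: "g \<in> borel_measurable borel" for g :: "real \<Rightarrow> real" and t
  proof -
    have "(\<integral>x. g (f (x + t *\<^sub>R h) * \<psi> (x + t *\<^sub>R h - t *\<^sub>R h)) \<partial>lborel) = (\<integral>x. g (f x * \<psi> (x - t *\<^sub>R h)) \<partial>lborel)"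
      by (rule lborel_translation(1)) measurable
    then show ?thesis by (simp add: mult.commute)
  qed
  have int': "integrable lborel (\<lambda>x. \<psi> x * f (x + t *\<^sub>R h))" for t
  proof -
    have "integrable lborel (\<lambda>x. f (x + t *\<^sub>R h) * \<psi> (x + t *\<^sub>R h - t *\<^sub>R h))"
      using int[of t] by (subst lborel_translation(2)) auto
    then show ?thesis by (simp add: mult.commute)
  qed
  have bd': "(\<integral>x. \<bar>\<psi> x * f (x + t *\<^sub>R h)\<bar> \<partial>lborel) \<le> B" if "t \<in> {0..1}" for t
    using bd[OF that] shift[of abs t] by simp
  have "(\<lambda>(t, x). \<psi> x * f (x + t *\<^sub>R h)) \<in> borel_measurable (unit_interval \<Otimes>\<^sub>M lborel)" by measurable
  note A' = segment_Fubini[OF this int' bd']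
  from A'(2) show "(\<integral>x. \<psi> x * (\<integral>t. f (x + t *\<^sub>R h) \<partial>unit_interval) \<partial>lborel)
      = (\<integral>t. (\<integral>x. f x * \<psi> (x - t *\<^sub>R h) \<partial>lborel) \<partial>unit_interval)"
    using shift[of "\<lambda>y. y"] by simp
  from A'(1) show "integrable lborel (\<lambda>x. \<psi> x * (\<integral>t. f (x + t *\<^sub>R h) \<partial>unit_interval))" by simp
qed

lemma loc_integrable_translate:
  fixes f :: "real^'n \<Rightarrow> 'b::euclidean_space"
  assumes f: "loc_integrable f"
  shows "loc_integrable (\<lambda>x. f (x + h))"
  unfolding loc_integrable_def
proof (intro conjI allI)
  have [measurable]: "f \<in> borel_measurable borel" using f by (rule loc_integrable_measurable)
  show "(\<lambda>x. f (x + h)) \<in> borel_measurable borel" by measurable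
  fix R
  have [measurable]: "(\<lambda>x. indicator (cball 0 R) (x - h) :: real) \<in> borel_measurable borel"
    by (rule measurable_compose[OF _ borel_measurable_indicator[of "cball 0 R" borel]]) auto
  have "integrable lborel (\<lambda>x. indicator (cball 0 R) (x - h) *\<^sub>R f x)"
  proof (rule loc_integrable_dominated[OF f, of _ 1 "R + norm h"])
    show "norm (indicator (cball 0 R) (x - h) *\<^sub>R f x) \<le> 1 * norm (f x)" for x
      by (simp add: indicator_def)
    show "indicator (cball 0 R) (x - h) *\<^sub>R f x = 0" if "R + norm h < norm x" for x
      using that norm_triangle_ineq[of "x - h" h] by (simp add: indicator_def)
  qed measurable
  then have "integrable lborel (\<lambda>x. indicator (cball 0 R) (x + h - h) *\<^sub>R f (x + h))"
    by (subst lborel_translation(2)) measurable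
  then show "integrable lborel (\<lambda>x. indicator (cball 0 R) x *\<^sub>R f (x + h))" by simp
qed

lemma test_function_difference:
  fixes \<phi> :: "real^'n \<Rightarrow> real"
  assumes "test_function \<phi> D"
  shows "(\<integral>t. inner (D (x - t *\<^sub>R h)) h \<partial>unit_interval) = \<phi> x - \<phi> (x - h)"
proof -
  have D: "continuous_on UNIV D" and der: "\<And>x. GDERIV \<phi> x :> D x"
    using assms by (auto simp: test_function_def)
  have "(\<integral>t. inner (D (x - t *\<^sub>R h)) h \<partial>unit_interval)
      = (\<integral>t. indicator {0..1} t *\<^sub>R inner (D (x - t *\<^sub>R h)) h \<partial>lborel)"
    unfolding unit_interval_def by (rule integral_restrict_space) simp
  also have "\<dots> = - \<phi> (x - 1 *\<^sub>R h) - - \<phi> (x - 0 *\<^sub>R h)"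
  proof (rule integral_FTC_Icc)
    fix t :: real
    have "((\<lambda>t. x - t *\<^sub>R h) has_derivative (\<lambda>s. - (s *\<^sub>R h))) (at t within {0..1})"
      by (auto intro!: derivative_eq_intros)
    from has_derivative_minus[OF has_derivative_compose[OF this der[of "x - t *\<^sub>R h", unfolded gderiv_def]]]
    have "((\<lambda>t. - \<phi> (x - t *\<^sub>R h)) has_derivative (\<lambda>s. - inner (- (s *\<^sub>R h)) (D (x - t *\<^sub>R h)))) (at t within {0..1})" .
    then show "((\<lambda>t. - \<phi> (x - t *\<^sub>R h)) has_vector_derivative inner (D (x - t *\<^sub>R h)) h) (at t within {0..1})"
      unfolding has_vector_derivative_def by (rule has_derivative_eq_rhs) (simp add: fun_eq_iff inner_commute)
  next
    show "continuous_on {0..1} (\<lambda>t. inner (D (x - t *\<^sub>R h)) h)"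
      by (intro continuous_intros continuous_on_compose2[OF D]) auto
  qed simp
  finally show ?thesis by simp
qed

text \<open>The Borel form of \<open>has_weak_gradient\<close>, with \<open>lborel\<close> as the
  measure; \<open>has_weak_gradient_iff\<close> relates the two.\<close>

definition weak_gradient :: "(real^'n \<Rightarrow> real) \<Rightarrow> (real^'n \<Rightarrow> real^'n) \<Rightarrow> bool" where
  "weak_gradient u G \<longleftrightarrow> loc_integrable u \<and> loc_integrable G \<and>
     (\<forall>\<phi> D. test_function \<phi> D \<longrightarrow> (\<integral>x. u x *\<^sub>R D x \<partial>lborel) = - (\<integral>x. \<phi> x *\<^sub>R G x \<partial>lborel))"

lemma test_function_integrable:
  fixes u :: "real^'n \<Rightarrow> real" and G :: "real^'n \<Rightarrow> 'b::euclidean_space"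
  assumes \<phi>: "test_function \<phi> D"
  shows "loc_integrable u \<Longrightarrow> integrable lborel (\<lambda>x. u x *\<^sub>R D x)"
    and "loc_integrable G \<Longrightarrow> integrable lborel (\<lambda>x. \<phi> x *\<^sub>R G x)"
proof -
  obtain R K where c: "continuous_on UNIV \<phi>" "continuous_on UNIV D" and 0: "\<And>x. R < norm x \<Longrightarrow> \<phi> x = 0" "\<And>x. R < norm x \<Longrightarrow> D x = 0"
    and K: "\<And>x. \<bar>\<phi> x\<bar> \<le> K" "\<And>x. norm (D x) \<le> K"
    using test_function_bounds[OF \<phi>] by metis
  have [measurable]: "\<phi> \<in> borel_measurable borel" "D \<in> borel_measurable borel"
    using c by (auto intro: borel_measurable_continuous_onI)
  show "integrable lborel (\<lambda>x. u x *\<^sub>R D x)" if u: "loc_integrable u"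
  proof (rule loc_integrable_dominated[OF u, of _ K R])
    have [measurable]: "u \<in> borel_measurable borel" using u by (rule loc_integrable_measurable)
    show "(\<lambda>x. u x *\<^sub>R D x) \<in> borel_measurable borel" by measurable
    show "norm (u x *\<^sub>R D x) \<le> K * norm (u x)" for x
      using mult_right_mono[OF K(2)[of x], of "\<bar>u x\<bar>"] by (simp add: mult.commute)
  qed (simp add: 0)
  show "integrable lborel (\<lambda>x. \<phi> x *\<^sub>R G x)" if G: "loc_integrable G"
  proof (rule loc_integrable_dominated[OF G, of _ K R])
    have [measurable]: "G \<in> borel_measurable borel" using G by (rule loc_integrable_measurable)
    show "(\<lambda>x. \<phi> x *\<^sub>R G x) \<in> borel_measurable borel" by measurable
    show "norm (\<phi> x *\<^sub>R G x) \<le> K * norm (G x)" for x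
      using mult_right_mono[OF K(1)[of x], of "norm (G x)"] by simp
  qed (simp add: 0)
qed

text \<open>The difference is moved onto the test function, where the fundamental theorem of
  calculus holds; the weak definition is applied to each translate along the segment, and the shift
  is moved back to \<open>G\<close>.\<close>

lemma weak_gradient_difference:
  fixes u :: "real^'n \<Rightarrow> real"
  assumes ug: "weak_gradient u G"
  shows "AE x in lborel. u (x + h) - u x = (\<integral>t. inner (G (x + t *\<^sub>R h)) h \<partial>unit_interval)"
proof -
  have u: "loc_integrable u" and G: "loc_integrable G"
    and weak: "\<And>\<phi> D. test_function \<phi> D \<Longrightarrow> (\<integral>x. u x *\<^sub>R D x \<partial>lborel) = - (\<integral>x. \<phi> x *\<^sub>R G x \<partial>lborel)"
    using ug by (auto simp: weak_gradient_def)
  define g where "g x = inner (G x) h" for x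
  have g: "loc_integrable g" unfolding g_def[abs_def] by (rule loc_integrable_inner[OF G])
  have [measurable]: "u \<in> borel_measurable borel" "g \<in> borel_measurable borel"
    using u g by (auto dest: loc_integrable_measurable)
  define A where "A x = (\<integral>t. g (x + t *\<^sub>R h) \<partial>unit_interval)" for x
  have Am[measurable]: "A \<in> borel_measurable borel"
  proof -
    note [measurable] = unit_interval_id
    have "A \<in> borel_measurable lborel"
      unfolding A_def[abs_def] by (intro unit_interval.borel_measurable_lebesgue_integral) measurable
    then show ?thesis by simp
  qed
  define d where "d x = u (x + h) - u x - A x" for x
  have uh: "loc_integrable (\<lambda>x. u (x + h))" by (rule loc_integrable_translate[OF u])
  have A: "loc_integrable A"
    unfolding loc_integrable_def
  proof (intro conjI allI Am)
    fix R
    show "integrable lborel (\<lambda>x. indicator (cball 0 R) x *\<^sub>R A x)"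
      unfolding A_def real_scaleR_def by (rule slide_Fubini(3)[OF g, of _ 1 R]) (auto simp: indicator_def)
  qed
  have d: "loc_integrable d"
    unfolding loc_integrable_def d_def[abs_def] scaleR_diff_right
    using u uh A unfolding loc_integrable_def by (intro conjI allI Bochner_Integration.integrable_diff) auto
  have "AE x in lborel. d x = 0"
  proof (rule loc_integrable_eq_0_AE[OF d])
    fix \<phi> :: "real^'n \<Rightarrow> real" and D assume \<phi>: "test_function \<phi> D"
    obtain R K where c: "continuous_on UNIV \<phi>" "continuous_on UNIV D" "0 \<le> K"
      and 0: "\<And>x. R < norm x \<Longrightarrow> \<phi> x = 0" "\<And>x. R < norm x \<Longrightarrow> D x = 0"
      and K: "\<And>x. \<bar>\<phi> x\<bar> \<le> K" "\<And>x. norm (D x) \<le> K"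
      using test_function_bounds[OF \<phi>] by metis
    have [measurable]: "\<phi> \<in> borel_measurable borel" "D \<in> borel_measurable borel"
      using c by (auto intro: borel_measurable_continuous_onI)
    have Dh: "\<bar>inner (D x) h\<bar> \<le> K * norm h" for x
      using Cauchy_Schwarz_ineq2[of "D x" h] mult_right_mono[OF K(2)[of x] norm_ge_zero[of h]] by linarith
    note \<phi>h = test_function_translate[OF \<phi>, of h]
    have i: "integrable lborel (\<lambda>x. \<phi> x * u x)" "integrable lborel (\<lambda>x. \<phi> (x - h) * u x)"
      "integrable lborel (\<lambda>x. \<phi> x * u (x + h))" "integrable lborel (\<lambda>x. \<phi> x * A x)"
      using test_function_integrable(2)[OF \<phi> u] test_function_integrable(2)[OF \<phi>h u]
        test_function_integrable(2)[OF \<phi> uh] test_function_integrable(2)[OF \<phi> A] by simp_all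
    have "(\<integral>x. \<phi> (x + h - h) * u (x + h) \<partial>lborel) = (\<integral>x. \<phi> (x - h) * u x \<partial>lborel)"
      by (rule lborel_translation(1)) measurable
    then have "(\<integral>x. \<phi> x * u (x + h) \<partial>lborel) - (\<integral>x. \<phi> x * u x \<partial>lborel)
        = - (\<integral>x. u x * (\<phi> x - \<phi> (x - h)) \<partial>lborel)"
      using i by (simp add: algebra_simps)
    also have "\<dots> = - (\<integral>x. u x * (\<integral>t. inner (D (x - t *\<^sub>R h)) h \<partial>unit_interval) \<partial>lborel)"
      by (simp only: test_function_difference[OF \<phi>])
    also have "\<dots> = - (\<integral>t. (\<integral>x. u x * inner (D (x - t *\<^sub>R h)) h \<partial>lborel) \<partial>unit_interval)"
      by (subst slide_Fubini(1)[OF u, of "\<lambda>x. inner (D x) h" "K * norm h" R]) (use Dh 0 in auto)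
    also have "\<dots> = (\<integral>t. (\<integral>x. g x * \<phi> (x - t *\<^sub>R h) \<partial>lborel) \<partial>unit_interval)"
    proof -
      have "(\<integral>x. u x * inner (D (x - t *\<^sub>R h)) h \<partial>lborel) = - (\<integral>x. g x * \<phi> (x - t *\<^sub>R h) \<partial>lborel)" for t
      proof -
        note \<phi>t = test_function_translate[OF \<phi>, of "t *\<^sub>R h"]
        have "(\<integral>x. u x * inner (D (x - t *\<^sub>R h)) h \<partial>lborel) = inner (\<integral>x. u x *\<^sub>R D (x - t *\<^sub>R h) \<partial>lborel) h"
          using integral_inner_left[OF test_function_integrable(1)[OF \<phi>t u], of h] by simp
        also have "\<dots> = - inner (\<integral>x. \<phi> (x - t *\<^sub>R h) *\<^sub>R G x \<partial>lborel) h" by (simp add: weak[OF \<phi>t])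
        also have "inner (\<integral>x. \<phi> (x - t *\<^sub>R h) *\<^sub>R G x \<partial>lborel) h = (\<integral>x. g x * \<phi> (x - t *\<^sub>R h) \<partial>lborel)"
          using integral_inner_left[OF test_function_integrable(2)[OF \<phi>t G], of h]
          by (simp add: g_def mult.commute)
        finally show ?thesis .
      qed
      then show ?thesis by simp
    qed
    also have "\<dots> = (\<integral>x. \<phi> x * A x \<partial>lborel)"
      unfolding A_def by (rule slide_Fubini(2)[OF g _ K(1), symmetric]) (use 0 in auto)
    finally show "(\<integral>x. \<phi> x * d x \<partial>lborel) = 0"
      using i by (simp add: d_def right_diff_distrib)
  qed
  then show ?thesis by eventually_elim (simp add: d_def A_def g_def)
qed

section \<open>Jensen's inequality for powers\<close>

text \<open>The subgradient inequality at the mean, integrated. Values in \<open>ennreal\<close>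
  allow Fubini afterwards for nonnegative functions.\<close>

lemma (in finite_measure) Jensen_powr:
  fixes f :: "'a \<Rightarrow> real"
  assumes p: "1 < p" and [measurable]: "f \<in> borel_measurable M" and m: "0 < measure M (space M)"
  shows "ennreal (measure M (space M) * \<bar>(1 / measure M (space M)) * (\<integral>x. f x \<partial>M)\<bar> powr p)
    \<le> (\<integral>\<^sup>+x. ennreal (\<bar>f x\<bar> powr p) \<partial>M)"
proof (cases "integrable M f \<and> (\<integral>\<^sup>+x. ennreal (\<bar>f x\<bar> powr p) \<partial>M) < \<infinity>")
  \<comment> \<open>Either the right side is infinite, or \<open>f\<close> is not integrable and its
    Bochner integral is 0 by convention.\<close>
  case False
  then show ?thesis by (auto simp: not_integrable_integral_eq less_top[symmetric])
next
  case True
  then have f: "integrable M f" and i: "integrable M (\<lambda>x. \<bar>f x\<bar> powr p)"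
    by (auto intro: integrableI_nonneg)
  define m where "m = measure M (space M)"
  define c where "c = (1 / m) * (\<integral>x. f x \<partial>M)"
  have m0: "0 < m" using m by (simp add: m_def)
  have c': "(\<integral>x. f x \<partial>M) = m * c" using m0 by (simp add: c_def)
  have "(\<integral>x. \<bar>c\<bar> powr p + p * (duality_map p c * (f x - c)) \<partial>M) \<le> (\<integral>x. \<bar>f x\<bar> powr p \<partial>M)"
  proof (rule integral_mono)
    show "integrable M (\<lambda>x. \<bar>c\<bar> powr p + p * (duality_map p c * (f x - c)))" using f by auto
    show "\<bar>c\<bar> powr p + p * (duality_map p c * (f x - c)) \<le> \<bar>f x\<bar> powr p" for x
      using norm_powr_subgradient[OF p, of c "f x"] by simp
  qed (rule i)
  then have "m * \<bar>c\<bar> powr p \<le> (\<integral>x. \<bar>f x\<bar> powr p \<partial>M)"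
    using f c' by (simp add: m_def[symmetric])
  then show ?thesis
    using nn_integral_eq_integral[OF i] by (simp add: c_def m_def)
qed

context parallelepiped_lattice
begin

section \<open>Integrals over a cell\<close>

abbreviation "Q \<equiv> parallelepiped a v"

text \<open>Three changes at once: from the completed to the Borel measure, from a restricted
  measure to an indicator, and from the open to the half open cell.\<close>

lemma nn_integral_Q:
  fixes f :: "real^'n \<Rightarrow> ennreal"
  assumes [measurable]: "f \<in> borel_measurable borel"
  shows "(\<integral>\<^sup>+x. f x \<partial>lebesgue_on Q) = (\<integral>\<^sup>+x. f x * indicator cell x \<partial>lborel)"
proof -
  have Q[measurable]: "Q \<in> sets borel" using open_parallelepiped by simp
  have "(\<integral>\<^sup>+x. f x \<partial>lebesgue_on Q) = (\<integral>\<^sup>+x. f x * indicator Q x \<partial>lebesgue)"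
    using Q by (intro nn_integral_restrict_space) auto
  also have "\<dots> = (\<integral>\<^sup>+x. f x * indicator Q x \<partial>lborel)"
    by (rule nn_integral_completion)
  also have "\<dots> = (\<integral>\<^sup>+x. f x * indicator cell x \<partial>lborel)"
    using AE_cell by (intro nn_integral_cong_AE) (auto simp: indicator_def elim!: eventually_mono)
  finally show ?thesis .
qed

lemma
  fixes f :: "real^'n \<Rightarrow> 'b::euclidean_space"
  assumes [measurable]: "f \<in> borel_measurable borel"
  shows integrable_Q: "integrable (lebesgue_on Q) f \<longleftrightarrow> integrable lborel (\<lambda>x. indicator cell x *\<^sub>R f x)"
    and integral_Q: "(\<integral>x. f x \<partial>lebesgue_on Q) = (\<integral>x. indicator cell x *\<^sub>R f x \<partial>lborel)"
proof -
  have Q[measurable]: "Q \<in> sets borel" using open_parallelepiped by simp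
  have ae: "AE x in lborel. indicator Q x *\<^sub>R f x = indicator cell x *\<^sub>R f x"
    using AE_cell by eventually_elim (simp add: indicator_def)
  have "integrable (lebesgue_on Q) f \<longleftrightarrow> integrable lebesgue (\<lambda>x. indicator Q x *\<^sub>R f x)"
    using Q by (intro integrable_restrict_space) auto
  also have "\<dots> \<longleftrightarrow> integrable lborel (\<lambda>x. indicator Q x *\<^sub>R f x)" by (rule integrable_completion) measurable
  also have "\<dots> \<longleftrightarrow> integrable lborel (\<lambda>x. indicator cell x *\<^sub>R f x)"
    by (rule integrable_cong_AE[OF _ _ ae]) measurable
  finally show "integrable (lebesgue_on Q) f \<longleftrightarrow> integrable lborel (\<lambda>x. indicator cell x *\<^sub>R f x)" .
  have "(\<integral>x. f x \<partial>lebesgue_on Q) = (\<integral>x. indicator Q x *\<^sub>R f x \<partial>lebesgue)"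
    using Q by (intro integral_restrict_space) auto
  also have "\<dots> = (\<integral>x. indicator Q x *\<^sub>R f x \<partial>lborel)" by (rule integral_completion) measurable
  also have "\<dots> = (\<integral>x. indicator cell x *\<^sub>R f x \<partial>lborel)"
    by (rule integral_cong_AE[OF _ _ ae]) measurable
  finally show "(\<integral>x. f x \<partial>lebesgue_on Q) = (\<integral>x. indicator cell x *\<^sub>R f x \<partial>lborel)" .
qed

lemma borel_measurable_Q: "f \<in> borel_measurable borel \<Longrightarrow> f \<in> borel_measurable (lebesgue_on Q)"
  by (intro measurable_restrict_space1 measurable_completion) simp

text \<open>Bounds the points of the cell, and thereby the displacements in the Poincare inequality;
  the summand 1 makes it positive.\<close>

definition radius :: real where
  "radius = norm a + (\<Sum>i\<in>UNIV. norm (v i)) + 1"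

lemma radius_pos: "0 < radius"
  unfolding radius_def by (intro add_nonneg_pos add_nonneg_nonneg sum_nonneg) auto

lemma cell_bound: "x \<in> cell \<Longrightarrow> norm x \<le> radius"
proof -
  assume x: "x \<in> cell"
  have "x = a + combination (coord (x - a))" by simp
  then have "norm x \<le> norm a + norm (combination (coord (x - a)))" by (metis norm_triangle_ineq)
  also have "norm (combination (coord (x - a))) \<le> (\<Sum>i\<in>UNIV. norm (v i))"
    unfolding combination_def
  proof (rule sum_norm_le)
    fix i
    have "\<bar>coord (x - a) $ i\<bar> * norm (v i) \<le> 1 * norm (v i)"
      using x by (intro mult_right_mono) (auto simp: cell_def abs_le_iff less_imp_le intro: order_trans[of _ 0])
    then show "norm (coord (x - a) $ i *\<^sub>R v i) \<le> norm (v i)" by simp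
  qed
  finally show ?thesis by (simp add: radius_def)
qed

lemma emeasure_cell: "emeasure lborel cell < \<infinity>"
proof -
  have "emeasure lborel cell \<le> emeasure lborel (cball (0 :: real^'n) radius)"
    using cell_bound by (intro emeasure_mono) auto
  also have "\<dots> < \<infinity>" using emeasure_lborel_cball_finite[of "0 :: real^'n" radius] by simp
  finally show ?thesis .
qed

lemma emeasure_Q: "emeasure (lebesgue_on Q) Q = emeasure lborel cell"
proof -
  have "emeasure (lebesgue_on Q) (space (lebesgue_on Q)) = (\<integral>\<^sup>+x. 1 \<partial>lebesgue_on Q)" by simp
  also have "\<dots> = emeasure lborel cell" by (subst nn_integral_Q) auto
  finally show ?thesis by simp
qed

lemma measure_Q: "measure (lebesgue_on Q) Q = measure lborel cell" "measure lebesgue Q = measure lborel cell"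
proof -
  show m: "measure (lebesgue_on Q) Q = measure lborel cell" using emeasure_Q by (simp add: measure_def)
  have "Q \<in> sets lebesgue" using open_parallelepiped by simp
  then have "measure (lebesgue_on Q) Q = measure lebesgue Q" by (subst measure_restrict_space) auto
  then show "measure lebesgue Q = measure lborel cell" using m by simp
qed

lemma finite_measure_Q: "finite_measure (lebesgue_on Q)"
  by standard (use emeasure_Q emeasure_cell in \<open>auto simp: less_top\<close>)

lemma measure_cell_pos: "0 < measure lborel cell"
proof (rule ccontr)
  assume "\<not> 0 < measure lborel cell"
  then have "emeasure lborel cell = 0"
    using emeasure_cell by (simp add: measure_def enn2real_positive_iff zero_less_measure_iff less_top)
  then have "cell \<in> null_sets lborel" by auto
  then have "AE x in lborel. x \<notin> cell" by (rule AE_not_in)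
  then have "AE x in lborel. x \<notin> Q" using AE_cell by eventually_elim simp
  moreover have Q: "Q \<in> sets lborel" using open_parallelepiped by simp
  ultimately have "Q \<in> null_sets lborel" by (subst (asm) AE_iff_null) (auto simp: open_parallelepiped)
  then have "negligible Q" by (simp add: negligible_iff_null_sets null_sets_completionI)
  moreover have "a + combination (\<chi> i. 1/2) \<in> Q" by (simp add: parallelepiped_eq)
  ultimately show False using open_not_negligible[OF open_parallelepiped] by blast
qed

text \<open>Positive and negative parts are handled separately by
  \<open>nn_integral_translated_cell\<close>.\<close>

lemma cell_translate_integral:
  fixes g :: "real^'n \<Rightarrow> real"
  assumes [measurable]: "g \<in> borel_measurable borel" and per: "lat_periodic g"
    and i: "integrable lborel (\<lambda>x. indicator cell x * g x)"
  shows "integrable lborel (\<lambda>x. indicator cell x * g (x + h))"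
    and "(\<integral>x. indicator cell x * g (x + h) \<partial>lborel) = (\<integral>x. indicator cell x * g x \<partial>lborel)"
proof -
  have nn: "(\<integral>\<^sup>+x. ennreal (indicator cell x * \<phi> (g (x + h))) \<partial>lborel) = (\<integral>\<^sup>+x. ennreal (indicator cell x * \<phi> (g x)) \<partial>lborel)"
    if [measurable]: "\<phi> \<in> borel_measurable borel" for \<phi> :: "real \<Rightarrow> real"
  proof -
    have "(\<integral>\<^sup>+x. ennreal (\<phi> (g (x + h))) * indicator cell x \<partial>lborel) = (\<integral>\<^sup>+x. ennreal (\<phi> (g x)) * indicator cell x \<partial>lborel)"
      by (rule nn_integral_translated_cell) (use per in \<open>auto simp: lat_periodic_def\<close>)
    moreover have "ennreal (indicator cell x * y) = ennreal y * indicator cell x" for x y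
      by (simp add: indicator_def)
    ultimately show ?thesis by simp
  qed
  show i': "integrable lborel (\<lambda>x. indicator cell x * g (x + h))"
    unfolding integrable_iff_bounded
  proof
    have "(\<integral>\<^sup>+x. ennreal (norm (indicator cell x * g (x + h))) \<partial>lborel) = (\<integral>\<^sup>+x. ennreal (norm (indicator cell x * g x)) \<partial>lborel)"
      using nn[of abs] by (simp add: abs_mult)
    then show "(\<integral>\<^sup>+x. ennreal (norm (indicator cell x * g (x + h))) \<partial>lborel) < \<infinity>"
      using i by (simp add: integrable_iff_bounded)
  qed measurable
  have m: "indicator cell x * (- y) = - (indicator cell x * y)" for x and y :: real by simp
  show "(\<integral>x. indicator cell x * g (x + h) \<partial>lborel) = (\<integral>x. indicator cell x * g x \<partial>lborel)"
    unfolding real_lebesgue_integral_def[OF i] real_lebesgue_integral_def[OF i']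
    using nn[of "\<lambda>y. y"] nn[of uminus] by (simp add: m)
qed

lemma loc_integrable_periodic:
  fixes f :: "real^'n \<Rightarrow> 'b::euclidean_space"
  assumes [measurable]: "f \<in> borel_measurable borel" and per: "lat_periodic f"
    and i: "integrable lborel (\<lambda>x. indicator cell x *\<^sub>R f x)"
  shows "loc_integrable f"
  unfolding loc_integrable_def
proof (intro conjI allI)
  fix R
  obtain N :: nat where N: "\<And>f :: real^'n \<Rightarrow> ennreal. f \<in> borel_measurable borel \<Longrightarrow> lat_periodic f \<Longrightarrow>
    (\<integral>\<^sup>+x. f x * indicator (cball 0 R) x \<partial>lborel) \<le> of_nat N * (\<integral>\<^sup>+x. f x * indicator cell x \<partial>lborel)"
    using nn_integral_cball_le by blast
  have e: "ennreal (norm (indicator S x *\<^sub>R f x)) = ennreal (norm (f x)) * indicator S x" for S x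
    by (simp add: indicator_def)
  show "integrable lborel (\<lambda>x. indicator (cball 0 R) x *\<^sub>R f x)"
    unfolding integrable_iff_bounded e
  proof
    have "(\<integral>\<^sup>+x. ennreal (norm (f x)) * indicator (cball 0 R) x \<partial>lborel)
        \<le> of_nat N * (\<integral>\<^sup>+x. ennreal (norm (f x)) * indicator cell x \<partial>lborel)"
      by (rule N) (use per in \<open>auto simp: lat_periodic_def\<close>)
    also have "\<dots> < \<infinity>" using i unfolding integrable_iff_bounded e
      by (auto simp: ennreal_mult_less_top ennreal_of_nat_eq_real_of_nat)
    finally show "(\<integral>\<^sup>+x. ennreal (norm (f x)) * indicator (cball 0 R) x \<partial>lborel) < \<infinity>" .
  qed (use assms(1) in \<open>auto intro!: borel_measurable_scaleR borel_measurable_indicator\<close>)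
qed (rule assms(1))

section \<open>Periodic weak gradients\<close>

definition periodic_gradient :: "(real^'n \<Rightarrow> real) \<Rightarrow> (real^'n \<Rightarrow> real^'n) \<Rightarrow> bool" where
  "periodic_gradient u G \<longleftrightarrow> weak_gradient u G \<and> lat_periodic u \<and> lat_periodic G"

lemma loc_integrable_cell:
  fixes f :: "real^'n \<Rightarrow> 'b::euclidean_space"
  assumes f: "loc_integrable f"
  shows "integrable lborel (\<lambda>x. indicator cell x *\<^sub>R f x)"
proof (rule loc_integrable_dominated[OF f, of _ 1 radius])
  have [measurable]: "f \<in> borel_measurable borel" using f by (rule loc_integrable_measurable)
  show "(\<lambda>x. indicator cell x *\<^sub>R f x) \<in> borel_measurable borel" by measurable
  show "norm (indicator cell x *\<^sub>R f x) \<le> 1 * norm (f x)" for x by (simp add: indicator_def)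
  show "indicator cell x *\<^sub>R f x = 0" if "radius < norm x" for x
    using cell_bound[of x] that by (auto simp: indicator_def)
qed

lemma periodic_gradient_mean:
  assumes ug: "periodic_gradient u G"
  shows "(\<integral>x. indicator cell x *\<^sub>R G x \<partial>lborel) = 0"
proof -
  have wg: "weak_gradient u G" and pu: "lat_periodic u" and pG: "lat_periodic G"
    and G: "loc_integrable G"
    using ug by (auto simp: periodic_gradient_def weak_gradient_def)
  have iG: "integrable lborel (\<lambda>x. indicator cell x *\<^sub>R G x)" by (rule loc_integrable_cell[OF G])
  define w where "w = (\<integral>x. indicator cell x *\<^sub>R G x \<partial>lborel)"
  have wv: "inner w (v i) = 0" for i
  proof -
    define g where "g x = inner (G x) (v i)" for x
    have g: "loc_integrable g" unfolding g_def[abs_def] by (rule loc_integrable_inner[OF G])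
    have gm: "g \<in> borel_measurable borel" by (rule loc_integrable_measurable[OF g])
    have pg: "lat_periodic g" using pG by (simp add: lat_periodic_def g_def)
    have gi: "integrable lborel (\<lambda>x. indicator cell x * g x)" using loc_integrable_cell[OF g] by simp
    have "periodic_wrt v u" using pu by (simp add: periodic_wrt_iff_lat_periodic)
    then have "u (x + v i) = u x" for x by (simp add: periodic_wrt_def)
    then have ae: "AE x in lborel. (\<integral>t. g (x + t *\<^sub>R v i) \<partial>unit_interval) = 0"
      using weak_gradient_difference[OF wg, of "v i"] by (simp add: g_def)
    have "0 = (\<integral>x. indicator cell x * (\<integral>t. g (x + t *\<^sub>R v i) \<partial>unit_interval) \<partial>lborel)"
    proof -
      have "AE x in lborel. indicator cell x * (\<integral>t. g (x + t *\<^sub>R v i) \<partial>unit_interval) = 0"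
        using ae by eventually_elim simp
      from integral_eq_zero_AE[OF this] show ?thesis by simp
    qed
    also have "\<dots> = (\<integral>t. (\<integral>x. g x * indicator cell (x - t *\<^sub>R v i) \<partial>lborel) \<partial>unit_interval)"
      by (rule slide_Fubini(2)[OF g, of _ 1 radius]) (use cell_bound in \<open>force simp: indicator_def\<close>)+
    \<comment> \<open>By periodicity the integral over a translate of the cell does not depend on
      t.\<close>
    also have "\<dots> = (\<integral>t. (\<integral>x. indicator cell x * g x \<partial>lborel) \<partial>unit_interval)"
    proof (rule Bochner_Integration.integral_cong[OF refl])
      fix t
      have [measurable]: "g \<in> borel_measurable borel" by (rule gm)
      have "(\<integral>x. g (x + t *\<^sub>R v i) * indicator cell (x + t *\<^sub>R v i - t *\<^sub>R v i) \<partial>lborel)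
          = (\<integral>x. g x * indicator cell (x - t *\<^sub>R v i) \<partial>lborel)"
        by (rule lborel_translation(1)) measurable
      then show "(\<integral>x. g x * indicator cell (x - t *\<^sub>R v i) \<partial>lborel) = (\<integral>x. indicator cell x * g x \<partial>lborel)"
        using cell_translate_integral(2)[OF gm pg gi, of "t *\<^sub>R v i"] by (simp add: mult.commute)
    qed
    also have "\<dots> = (\<integral>x. indicator cell x * g x \<partial>lborel)" by simp
    also have "\<dots> = inner w (v i)"
      unfolding w_def using integral_inner_left[OF iG, of "v i"] by (simp add: g_def)
    finally show ?thesis by simp
  qed
  \<comment> \<open>The edges span the space, so \<open>w\<close> is a combination of vectors
    orthogonal to it.\<close>
  have "inner w (combination (coord w)) = 0" unfolding combination_def by (simp add: inner_sum_right wv)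
  then show ?thesis by (simp add: w_def)
qed

section \<open>The Poincare inequality\<close>

lemma difference_power_le:
  assumes ug: "periodic_gradient u G" and p: "1 < p" and h: "norm h \<le> radius"
  shows "(\<integral>\<^sup>+x. ennreal (\<bar>u (x + h) - u x\<bar> powr p) * indicator cell x \<partial>lborel)
    \<le> ennreal (radius powr p) * (\<integral>\<^sup>+x. ennreal (norm (G x) powr p) * indicator cell x \<partial>lborel)"
proof -
  have wg: "weak_gradient u G" and pG: "lat_periodic G" and G: "loc_integrable G"
    using ug by (auto simp: periodic_gradient_def weak_gradient_def)
  have [measurable]: "G \<in> borel_measurable borel" using G by (rule loc_integrable_measurable)
  note [measurable] = unit_interval_id
  have [measurable]: "(\<lambda>t. inner (G (x + t *\<^sub>R h)) h) \<in> borel_measurable unit_interval" for x by measurable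
  define X where "X = (\<integral>\<^sup>+x. ennreal (norm (G x) powr p) * indicator cell x \<partial>lborel)"
  have "(\<integral>\<^sup>+x. ennreal (\<bar>u (x + h) - u x\<bar> powr p) * indicator cell x \<partial>lborel)
      \<le> (\<integral>\<^sup>+x. (\<integral>\<^sup>+t. ennreal (radius powr p) * (ennreal (norm (G (x + t *\<^sub>R h)) powr p) * indicator cell x) \<partial>unit_interval) \<partial>lborel)"
  proof (rule nn_integral_mono_AE)
    show "AE x in lborel. ennreal (\<bar>u (x + h) - u x\<bar> powr p) * indicator cell x
        \<le> (\<integral>\<^sup>+t. ennreal (radius powr p) * (ennreal (norm (G (x + t *\<^sub>R h)) powr p) * indicator cell x) \<partial>unit_interval)"
      using weak_gradient_difference[OF wg, of h]
    proof eventually_elim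
      case (elim x)
      have "ennreal (\<bar>u (x + h) - u x\<bar> powr p) \<le> (\<integral>\<^sup>+t. ennreal (\<bar>inner (G (x + t *\<^sub>R h)) h\<bar> powr p) \<partial>unit_interval)"
        using unit_interval.Jensen_powr[OF p, of "\<lambda>t. inner (G (x + t *\<^sub>R h)) h"] unfolding elim by simp
      also have "\<dots> \<le> (\<integral>\<^sup>+t. ennreal (radius powr p * norm (G (x + t *\<^sub>R h)) powr p) \<partial>unit_interval)"
      proof (intro nn_integral_mono ennreal_leI)
        fix t
        have "\<bar>inner (G (x + t *\<^sub>R h)) h\<bar> \<le> radius * norm (G (x + t *\<^sub>R h))"
          using Cauchy_Schwarz_ineq2[of "G (x + t *\<^sub>R h)" h] mult_left_mono[OF h norm_ge_zero[of "G (x + t *\<^sub>R h)"]]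
          by (simp add: mult.commute)
        then have "\<bar>inner (G (x + t *\<^sub>R h)) h\<bar> powr p \<le> (radius * norm (G (x + t *\<^sub>R h))) powr p"
          using p by (intro powr_mono2) auto
        then show "\<bar>inner (G (x + t *\<^sub>R h)) h\<bar> powr p \<le> radius powr p * norm (G (x + t *\<^sub>R h)) powr p"
          using radius_pos by (simp add: powr_mult)
      qed
      finally show ?case by (cases "x \<in> cell") (auto simp: ennreal_mult)
    qed
  qed
  also have "\<dots> = (\<integral>\<^sup>+t. (\<integral>\<^sup>+x. ennreal (radius powr p) * (ennreal (norm (G (x + t *\<^sub>R h)) powr p) * indicator cell x) \<partial>lborel) \<partial>unit_interval)"
    by (rule unit_interval_lborel.Fubini') measurable
  also have "\<dots> = (\<integral>\<^sup>+t. ennreal (radius powr p) * X \<partial>unit_interval)"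
  proof (rule nn_integral_cong)
    fix t
    have "(\<integral>\<^sup>+x. ennreal (norm (G (x + t *\<^sub>R h)) powr p) * indicator cell x \<partial>lborel) = X"
      unfolding X_def
      by (rule nn_integral_translated_cell[of "\<lambda>x. ennreal (norm (G x) powr p)"])
        (use pG in \<open>auto simp: lat_periodic_def\<close>)
    then show "(\<integral>\<^sup>+x. ennreal (radius powr p) * (ennreal (norm (G (x + t *\<^sub>R h)) powr p) * indicator cell x) \<partial>lborel)
        = ennreal (radius powr p) * X"
      by (subst nn_integral_cmult) auto
  qed
  also have "\<dots> = ennreal (radius powr p) * X" using emeasure_unit_interval by simp
  finally show ?thesis unfolding X_def .
qed

text \<open>As \<open>u\<close> has mean zero, - u(x) is the average of u(x + h) - u(x) over h in
  the cell. Jensen's inequality in h and Fubini reduce the claim to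
  \<open>difference_power_le\<close>; the cell may serve as the set of displacements because it lies
  in the ball of radius \<open>radius\<close>.\<close>

proposition Poincare_nn:
  assumes ug: "periodic_gradient u G" and p: "1 < p" and mean: "(\<integral>x. indicator cell x * u x \<partial>lborel) = 0"
  shows "(\<integral>\<^sup>+x. ennreal (\<bar>u x\<bar> powr p) * indicator cell x \<partial>lborel)
    \<le> ennreal (radius powr p) * (\<integral>\<^sup>+x. ennreal (norm (G x) powr p) * indicator cell x \<partial>lborel)"
proof -
  have pu: "lat_periodic u" and u: "loc_integrable u"
    using ug by (auto simp: periodic_gradient_def weak_gradient_def)
  have um[measurable]: "u \<in> borel_measurable borel" using u by (rule loc_integrable_measurable)
  define m where "m = measure lborel cell"
  have m0: "0 < m" using measure_cell_pos by (simp add: m_def)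
  have em: "emeasure lborel cell = ennreal m"
    using emeasure_cell by (simp add: m_def emeasure_eq_ennreal_measure less_top)
  define Y where "Y = ennreal (radius powr p) * (\<integral>\<^sup>+x. ennreal (norm (G x) powr p) * indicator cell x \<partial>lborel)"
  define cellM :: "(real^'n) measure" where "cellM = restrict_space lborel cell"
  have sp: "space cellM = cell" by (simp add: cellM_def)
  have em': "emeasure cellM cell = ennreal m" unfolding cellM_def by (subst emeasure_restrict_space) (auto simp: em)
  interpret cellM: finite_measure cellM by standard (simp add: sp em')
  have mm: "measure cellM (space cellM) = m" using em' m0 by (simp add: sp measure_def)
  have ui: "integrable lborel (\<lambda>x. indicator cell x * u x)" using loc_integrable_cell[OF u] by simp
  have each: "ennreal m * ennreal (\<bar>u x\<bar> powr p)
      \<le> (\<integral>\<^sup>+h. ennreal (\<bar>u (x + h) - u x\<bar> powr p) * indicator cell h \<partial>lborel)" for x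
  proof -
    define f where "f h = u (x + h) - u x" for h
    have [measurable]: "f \<in> borel_measurable borel" unfolding f_def by measurable
    have fm: "f \<in> borel_measurable cellM"
      unfolding cellM_def by (intro measurable_restrict_space1) simp
    have c: "integrable lborel (\<lambda>h. indicator cell h * u x)"
    proof -
      have "integrable lborel (indicator cell :: real^'n \<Rightarrow> real)" using emeasure_cell by (intro integrable_real_indicator) auto
      then show ?thesis by simp
    qed
    have "(\<integral>h. f h \<partial>cellM) = (\<integral>h. indicator cell h *\<^sub>R f h \<partial>lborel)"
      unfolding cellM_def by (rule integral_restrict_space) simp
    also have "\<dots> = (\<integral>h. indicator cell h * u (h + x) - indicator cell h * u x \<partial>lborel)"
      by (intro Bochner_Integration.integral_cong) (auto simp: f_def algebra_simps)
    also have "\<dots> = - (m * u x)"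
      using cell_translate_integral[OF um pu ui, of x] c mean by (simp add: m_def)
    finally have "(1 / m) * (\<integral>h. f h \<partial>cellM) = - u x" using m0 by simp
    then have "ennreal (m * \<bar>u x\<bar> powr p) \<le> (\<integral>\<^sup>+h. ennreal (\<bar>f h\<bar> powr p) \<partial>cellM)"
      using cellM.Jensen_powr[OF p fm] m0 by (simp add: mm)
    also have "\<dots> = (\<integral>\<^sup>+h. ennreal (\<bar>f h\<bar> powr p) * indicator cell h \<partial>lborel)"
      unfolding cellM_def by (rule nn_integral_restrict_space) simp
    finally show ?thesis using m0 by (simp add: f_def ennreal_mult)
  qed
  have "ennreal m * (\<integral>\<^sup>+x. ennreal (\<bar>u x\<bar> powr p) * indicator cell x \<partial>lborel)
      = (\<integral>\<^sup>+x. ennreal m * (ennreal (\<bar>u x\<bar> powr p) * indicator cell x) \<partial>lborel)"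
    by (rule nn_integral_cmult[symmetric]) measurable
  also have "\<dots> \<le> (\<integral>\<^sup>+x. (\<integral>\<^sup>+h. ennreal (\<bar>u (x + h) - u x\<bar> powr p) * indicator cell h * indicator cell x \<partial>lborel) \<partial>lborel)"
    by (rule nn_integral_mono) (use each in \<open>auto simp: indicator_def\<close>)
  also have "\<dots> = (\<integral>\<^sup>+h. (\<integral>\<^sup>+x. ennreal (\<bar>u (x + h) - u x\<bar> powr p) * indicator cell h * indicator cell x \<partial>lborel) \<partial>lborel)"
    by (rule lborel_pair.Fubini') measurable
  also have "\<dots> \<le> (\<integral>\<^sup>+h. Y * indicator cell h \<partial>(lborel :: (real^'n) measure))"
  proof (rule nn_integral_mono)
    fix h :: "real^'n"
    show "(\<integral>\<^sup>+x. ennreal (\<bar>u (x + h) - u x\<bar> powr p) * indicator cell h * indicator cell x \<partial>lborel) \<le> Y * indicator cell h"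
      using difference_power_le[OF ug p cell_bound, of h] by (cases "h \<in> cell") (auto simp: Y_def)
  qed
  also have "\<dots> = ennreal m * Y" by (simp add: nn_integral_cmult_indicator em mult.commute)
  finally show ?thesis
    using m0 unfolding Y_def[symmetric] by (subst (asm) ennreal_mult_le_mult_iff) auto
qed

end

section \<open>Borel representatives of weakly differentiable functions\<close>

text \<open>Each coordinate has a Borel version for the completed measure; the versions are
  recombined over \<open>Basis\<close>.\<close>

lemma borel_representative:
  fixes f :: "real^'n \<Rightarrow> 'b::euclidean_space"
  assumes f: "f \<in> borel_measurable lebesgue"
  obtains f' where "f' \<in> borel_measurable borel" "AE x in lborel. f x = f' x"
proof -
  have "\<exists>g\<in>borel_measurable lborel. AE x in lborel. inner (f x) b = g x" for b
    by (intro completion_ex_borel_measurable_real borel_measurable_inner f borel_measurable_const)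
  then obtain g where g: "\<And>b. g b \<in> borel_measurable lborel" "\<And>b. AE x in lborel. inner (f x) b = g b x"
    by metis
  show thesis
  proof (rule that)
    show "(\<lambda>x. \<Sum>b\<in>Basis. g b x *\<^sub>R b) \<in> borel_measurable borel" using g(1) by simp
    have "AE x in lborel. \<forall>b\<in>Basis. inner (f x) b = g b x" using g(2) by (intro AE_finite_allI) auto
    then show "AE x in lborel. f x = (\<Sum>b\<in>Basis. g b x *\<^sub>R b)"
      by eventually_elim (metis (no_types, lifting) euclidean_representation sum.cong)
  qed
qed

lemma lebesgue_measurable_AE:
  fixes f g :: "real^'n \<Rightarrow> 'b::euclidean_space"
  assumes "g \<in> borel_measurable borel" "AE x in lborel. f x = g x"
  shows "f \<in> borel_measurable lebesgue"
proof (rule borel_measurable_AE)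
  show "g \<in> borel_measurable lebesgue" using assms(1) by (intro measurable_completion) simp
  show "AE x in lebesgue. g x = f x" using assms(2) by (intro AE_completion) (auto elim: eventually_mono)
qed

lemma locally_integrable_measurable:
  fixes f :: "real^'n \<Rightarrow> 'b::euclidean_space"
  assumes "locally_integrable f"
  shows "f \<in> borel_measurable lebesgue"
proof (rule borel_measurable_LIMSEQ_metric)
  show "(\<lambda>x. indicator (cball 0 (real n)) x *\<^sub>R f x) \<in> borel_measurable lebesgue" for n
  proof -
    have "set_integrable lebesgue (cball 0 (real n)) f" using assms by (simp add: locally_integrable_def)
    then show ?thesis unfolding set_integrable_def by (rule borel_measurable_integrable)
  qed
  fix x :: "real^'n"
  obtain N where N: "norm x \<le> real N" using real_arch_simple by blast
  have "indicator (cball 0 (real n)) x *\<^sub>R f x = f x" if "N \<le> n" for n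
    using N that by (simp add: indicator_def)
  then have "\<forall>\<^sub>F n in sequentially. indicator (cball 0 (real n)) x *\<^sub>R f x = f x"
    by (auto simp: eventually_sequentially)
  then show "(\<lambda>n. indicator (cball 0 (real n)) x *\<^sub>R f x) \<longlonglongrightarrow> f x" by (rule tendsto_eventually)
qed

lemma locally_integrable_iff_loc_integrable:
  fixes f f' :: "real^'n \<Rightarrow> 'b::euclidean_space"
  assumes f'[measurable]: "f' \<in> borel_measurable borel" and ae: "AE x in lborel. f x = f' x"
  shows "locally_integrable f \<longleftrightarrow> loc_integrable f'"
proof -
  have [measurable]: "f \<in> borel_measurable lebesgue" "f' \<in> borel_measurable lebesgue"
    using lebesgue_measurable_AE[OF f' ae] lebesgue_measurable_AE[OF f', of f'] by auto
  have ball: "set_integrable lebesgue (cball 0 R) f \<longleftrightarrow> integrable lborel (\<lambda>x. indicator (cball 0 R) x *\<^sub>R f' x)" for R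
  proof -
    have "set_integrable lebesgue (cball 0 R) f \<longleftrightarrow> integrable lebesgue (\<lambda>x. indicator (cball 0 R) x *\<^sub>R f' x)"
      unfolding set_integrable_def
      by (rule integrable_cong_AE)
        (use AE_completion[OF ae] in \<open>auto intro!: borel_measurable_scaleR borel_measurable_indicator elim: eventually_mono\<close>)
    also have "\<dots> \<longleftrightarrow> integrable lborel (\<lambda>x. indicator (cball 0 R) x *\<^sub>R f' x)"
      by (rule integrable_completion) (auto intro!: borel_measurable_scaleR borel_measurable_indicator)
    finally show ?thesis .
  qed
  have "set_integrable lebesgue K f" if K: "compact K" and i: "\<And>R. set_integrable lebesgue (cball 0 R) f" for K
  proof -
    obtain R where "\<forall>x\<in>K. norm x \<le> R" using compact_imp_bounded[OF K] unfolding bounded_iff by blast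
    then have "K \<subseteq> cball 0 R" by auto
    then show ?thesis using i[of R] K by (intro set_integrable_subset[of lebesgue "cball 0 R" f K]) (auto simp: compact_imp_closed)
  qed
  then have "locally_integrable f \<longleftrightarrow> (\<forall>R. set_integrable lebesgue (cball 0 R) f)"
    unfolding locally_integrable_def by (metis compact_cball)
  then show ?thesis using f' by (simp add: loc_integrable_def ball)
qed

text \<open>Both formulations consist of integrals, tested with Borel functions, and these are
  unchanged by completion and by modification on null sets.\<close>

lemma has_weak_gradient_iff:
  assumes u'[measurable]: "u' \<in> borel_measurable borel" and G'[measurable]: "G' \<in> borel_measurable borel"
    and ae: "AE x in lborel. u x = u' x" "AE x in lborel. G x = G' x"
  shows "has_weak_gradient u G \<longleftrightarrow> weak_gradient u' G'"
proof -
  have lm[measurable]: "u \<in> borel_measurable lebesgue" "G \<in> borel_measurable lebesgue"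
    "u' \<in> borel_measurable lebesgue" "G' \<in> borel_measurable lebesgue"
    using lebesgue_measurable_AE[OF u' ae(1)] lebesgue_measurable_AE[OF G' ae(2)]
      lebesgue_measurable_AE[OF u', of u'] lebesgue_measurable_AE[OF G', of G'] by auto
  have "((LINT x|lebesgue. u x *\<^sub>R D x) = - (LINT x|lebesgue. \<phi> x *\<^sub>R G x))
    \<longleftrightarrow> ((\<integral>x. u' x *\<^sub>R D x \<partial>lborel) = - (\<integral>x. \<phi> x *\<^sub>R G' x \<partial>lborel))" if \<phi>: "test_function \<phi> D" for \<phi> D
  proof -
    have [measurable]: "\<phi> \<in> borel_measurable borel" "D \<in> borel_measurable borel"
      using \<phi> by (auto elim!: test_function_bounds intro: borel_measurable_continuous_onI)
    have l: "\<phi> \<in> borel_measurable lebesgue" "D \<in> borel_measurable lebesgue"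
      by (intro measurable_completion; simp)+
    have "(LINT x|lebesgue. u x *\<^sub>R D x) = (LINT x|lebesgue. u' x *\<^sub>R D x)"
      by (rule integral_cong_AE)
        (use AE_completion[OF ae(1)] l lm in \<open>auto intro!: borel_measurable_scaleR elim: eventually_mono\<close>)
    also have "\<dots> = (\<integral>x. u' x *\<^sub>R D x \<partial>lborel)" by (rule integral_completion) measurable
    finally have 1: "(LINT x|lebesgue. u x *\<^sub>R D x) = (\<integral>x. u' x *\<^sub>R D x \<partial>lborel)" .
    have "(LINT x|lebesgue. \<phi> x *\<^sub>R G x) = (LINT x|lebesgue. \<phi> x *\<^sub>R G' x)"
      by (rule integral_cong_AE)
        (use AE_completion[OF ae(2)] l lm in \<open>auto intro!: borel_measurable_scaleR elim: eventually_mono\<close>)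
    also have "\<dots> = (\<integral>x. \<phi> x *\<^sub>R G' x \<partial>lborel)" by (rule integral_completion) measurable
    finally show ?thesis using 1 by simp
  qed
  then show ?thesis
    unfolding has_weak_gradient_def weak_gradient_def test_function_def[symmetric]
      locally_integrable_iff_loc_integrable[OF u' ae(1)] locally_integrable_iff_loc_integrable[OF G' ae(2)]
    by blast
qed

lemma has_weak_gradient_representative:
  assumes "has_weak_gradient u G"
  obtains u' G' where "weak_gradient u' G'" "u' \<in> borel_measurable borel" "G' \<in> borel_measurable borel"
    "AE x in lborel. u x = u' x" "AE x in lborel. G x = G' x"
proof -
  have m: "u \<in> borel_measurable lebesgue" "G \<in> borel_measurable lebesgue"
    using assms locally_integrable_measurable by (auto simp: has_weak_gradient_def)
  obtain u' where u': "u' \<in> borel_measurable borel" "AE x in lborel. u x = u' x"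
    by (rule borel_representative[OF m(1)])
  obtain G' where G': "G' \<in> borel_measurable borel" "AE x in lborel. G x = G' x"
    by (rule borel_representative[OF m(2)])
  have "weak_gradient u' G'" using assms has_weak_gradient_iff[OF u'(1) G'(1) u'(2) G'(2)] by simp
  then show thesis by (rule that[OF _ u'(1) G'(1) u'(2) G'(2)])
qed

lemma weak_gradient_measurable:
  assumes "weak_gradient u G"
  shows "u \<in> borel_measurable borel" "G \<in> borel_measurable borel"
  using assms by (auto simp: weak_gradient_def loc_integrable_measurable)

lemma weak_gradient_cong_AE:
  assumes "weak_gradient u G" "u' \<in> borel_measurable borel" "G' \<in> borel_measurable borel"
    "AE x in lborel. u x = u' x" "AE x in lborel. G x = G' x"
  shows "weak_gradient u' G'"
proof -
  have "has_weak_gradient u G"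
    using has_weak_gradient_iff[of u G u G] weak_gradient_measurable[OF assms(1)] assms(1) by simp
  then show ?thesis using has_weak_gradient_iff[OF assms(2-5)] by simp
qed

lemma loc_integrable_diff:
  fixes f g :: "real^'n \<Rightarrow> 'b::euclidean_space"
  assumes "loc_integrable f" "loc_integrable g"
  shows "loc_integrable (\<lambda>x. f x - g x)"
  unfolding loc_integrable_def
proof (intro conjI allI)
  have [measurable]: "f \<in> borel_measurable borel" "g \<in> borel_measurable borel"
    using assms by (auto dest: loc_integrable_measurable)
  show "(\<lambda>x. f x - g x) \<in> borel_measurable borel" by measurable
  fix R
  show "integrable lborel (\<lambda>x. indicator (cball 0 R) x *\<^sub>R (f x - g x))"
    unfolding scaleR_diff_right
    by (rule Bochner_Integration.integrable_diff) (use assms in \<open>simp_all add: loc_integrable_def\<close>)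
qed

lemma weak_gradient_lincomb:
  fixes c d :: real
  assumes "weak_gradient u G" "weak_gradient w H"
  shows "weak_gradient (\<lambda>x. c * u x + d * w x) (\<lambda>x. c *\<^sub>R G x + d *\<^sub>R H x)"
proof -
  have l: "loc_integrable u" "loc_integrable G" "loc_integrable w" "loc_integrable H"
    using assms by (auto simp: weak_gradient_def)
  have lin: "loc_integrable (\<lambda>x. c *\<^sub>R f x + d *\<^sub>R g x)"
    if "loc_integrable f" "loc_integrable g" for f g :: "real^'n \<Rightarrow> 'b::euclidean_space"
    unfolding loc_integrable_def
  proof (intro conjI allI)
    have [measurable]: "f \<in> borel_measurable borel" "g \<in> borel_measurable borel"
      using that by (auto dest: loc_integrable_measurable)
    show "(\<lambda>x. c *\<^sub>R f x + d *\<^sub>R g x) \<in> borel_measurable borel" by measurable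
    fix R
    have "integrable lborel (\<lambda>x. c *\<^sub>R (indicator (cball 0 R) x *\<^sub>R f x) + d *\<^sub>R (indicator (cball 0 R) x *\<^sub>R g x))"
      using that unfolding loc_integrable_def
      by (intro Bochner_Integration.integrable_add integrable_scaleR_right) auto
    moreover have "c *\<^sub>R (r *\<^sub>R y) + d *\<^sub>R (r *\<^sub>R z) = r *\<^sub>R (c *\<^sub>R y + d *\<^sub>R z)" for r and y z :: 'b
      by (simp add: scaleR_add_right mult.commute)
    ultimately show "integrable lborel (\<lambda>x. indicator (cball 0 R) x *\<^sub>R (c *\<^sub>R f x + d *\<^sub>R g x))" by simp
  qed
  have "(\<integral>x. (c * u x + d * w x) *\<^sub>R D x \<partial>lborel) = - (\<integral>x. \<phi> x *\<^sub>R (c *\<^sub>R G x + d *\<^sub>R H x) \<partial>lborel)"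
    if \<phi>: "test_function \<phi> D" for \<phi> D
  proof -
    note i = test_function_integrable[OF \<phi>]
    have "(\<integral>x. (c * u x + d * w x) *\<^sub>R D x \<partial>lborel) = (\<integral>x. c *\<^sub>R (u x *\<^sub>R D x) + d *\<^sub>R (w x *\<^sub>R D x) \<partial>lborel)"
      by (simp add: scaleR_add_left)
    also have "\<dots> = c *\<^sub>R (\<integral>x. u x *\<^sub>R D x \<partial>lborel) + d *\<^sub>R (\<integral>x. w x *\<^sub>R D x \<partial>lborel)"
      using i(1)[OF l(1)] i(1)[OF l(3)]
      by (subst Bochner_Integration.integral_add) (auto simp del: scaleR_scaleR)
    also have "\<dots> = - (c *\<^sub>R (\<integral>x. \<phi> x *\<^sub>R G x \<partial>lborel) + d *\<^sub>R (\<integral>x. \<phi> x *\<^sub>R H x \<partial>lborel))"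
      using assms \<phi> by (simp add: weak_gradient_def)
    also have "c *\<^sub>R (\<integral>x. \<phi> x *\<^sub>R G x \<partial>lborel) + d *\<^sub>R (\<integral>x. \<phi> x *\<^sub>R H x \<partial>lborel)
        = (\<integral>x. c *\<^sub>R (\<phi> x *\<^sub>R G x) + d *\<^sub>R (\<phi> x *\<^sub>R H x) \<partial>lborel)"
      using i(2)[OF l(2)] i(2)[OF l(4)]
      by (subst Bochner_Integration.integral_add) (auto simp del: scaleR_scaleR)
    also have "\<dots> = (\<integral>x. \<phi> x *\<^sub>R (c *\<^sub>R G x + d *\<^sub>R H x) \<partial>lborel)"
      by (simp add: scaleR_add_right mult.commute)
    finally show ?thesis .
  qed
  then show ?thesis unfolding weak_gradient_def using lin[OF l(1,3)] lin[OF l(2,4)] by simp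
qed

lemma has_weak_gradient_lincomb:
  fixes c d :: real
  assumes "has_weak_gradient u G" "has_weak_gradient w H"
  shows "has_weak_gradient (\<lambda>x. c * u x + d * w x) (\<lambda>x. c *\<^sub>R G x + d *\<^sub>R H x)"
proof -
  obtain u' G' where u': "weak_gradient u' G'" "u' \<in> borel_measurable borel" "G' \<in> borel_measurable borel"
    "AE x in lborel. u x = u' x" "AE x in lborel. G x = G' x"
    by (rule has_weak_gradient_representative[OF assms(1)])
  obtain w' H' where w': "weak_gradient w' H'" "w' \<in> borel_measurable borel" "H' \<in> borel_measurable borel"
    "AE x in lborel. w x = w' x" "AE x in lborel. H x = H' x"
    by (rule has_weak_gradient_representative[OF assms(2)])
  note wg = weak_gradient_lincomb[OF u'(1) w'(1), of c d]
  show ?thesis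
  proof (subst has_weak_gradient_iff[OF weak_gradient_measurable[OF wg]])
    show "AE x in lborel. c * u x + d * w x = c * u' x + d * w' x"
      using u'(4) w'(4) by eventually_elim simp
    show "AE x in lborel. c *\<^sub>R G x + d *\<^sub>R H x = c *\<^sub>R G' x + d *\<^sub>R H' x"
      using u'(5) w'(5) by eventually_elim simp
  qed (rule wg)
qed

text \<open>Every component of the difference integrates to zero against all test functions.\<close>

lemma weak_gradient_unique:
  fixes u :: "real^'n \<Rightarrow> real"
  assumes "weak_gradient u G" "weak_gradient u H"
  shows "AE x in lborel. G x = H x"
proof -
  have l: "loc_integrable G" "loc_integrable H" using assms by (auto simp: weak_gradient_def)
  have "AE x in lborel. inner (G x - H x) (axis i 1) = 0" for i
  proof (rule loc_integrable_eq_0_AE)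
    show "loc_integrable (\<lambda>x. inner (G x - H x) (axis i 1))"
      by (rule loc_integrable_inner) (rule loc_integrable_diff[OF l])
    fix \<phi> :: "real^'n \<Rightarrow> real" and D assume \<phi>: "test_function \<phi> D"
    note i = test_function_integrable(2)[OF \<phi> l(1)] test_function_integrable(2)[OF \<phi> l(2)]
    have "(\<integral>x. \<phi> x *\<^sub>R G x \<partial>lborel) = (\<integral>x. \<phi> x *\<^sub>R H x \<partial>lborel)"
    proof -
      have "(\<integral>x. u x *\<^sub>R D x \<partial>lborel) = - (\<integral>x. \<phi> x *\<^sub>R G x \<partial>lborel)"
        "(\<integral>x. u x *\<^sub>R D x \<partial>lborel) = - (\<integral>x. \<phi> x *\<^sub>R H x \<partial>lborel)"
        using assms \<phi> unfolding weak_gradient_def by blast+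
      then show ?thesis by simp
    qed
    moreover have eq: "(\<lambda>x. \<phi> x *\<^sub>R (G x - H x)) = (\<lambda>x. \<phi> x *\<^sub>R G x - \<phi> x *\<^sub>R H x)"
      by (rule ext) (rule scaleR_diff_right)
    ultimately have 0: "(\<integral>x. \<phi> x *\<^sub>R (G x - H x) \<partial>lborel) = 0"
      unfolding eq Bochner_Integration.integral_diff[OF i] by simp
    have "integrable lborel (\<lambda>x. \<phi> x *\<^sub>R (G x - H x))"
      unfolding eq using i by (rule Bochner_Integration.integrable_diff)
    from integral_inner_left[OF this, of "axis i 1"]
    have "(\<integral>x. inner (\<phi> x *\<^sub>R (G x - H x)) (axis i 1) \<partial>lborel) = 0"
      unfolding 0 by (simp only: inner_zero_left)
    then show "(\<integral>x. \<phi> x * inner (G x - H x) (axis i 1) \<partial>lborel) = 0"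
      by (simp only: inner_scaleR_left)
  qed
  then have "AE x in lborel. \<forall>i\<in>UNIV. inner (G x - H x) (axis i 1) = 0" by (intro AE_finite_allI) auto
  then show ?thesis by eventually_elim (simp add: inner_axis vec_eq_iff)
qed

lemma AE_lborel_translate:
  fixes h :: "real^'n"
  assumes "AE x in lborel. P x"
  shows "AE x in lborel. P (x + h)"
proof -
  have "AE x in distr lborel borel ((+) h). P x" using assms by (simp only: lborel_distr_plus)
  then have "AE x in lborel. P (h + x)" by (rule AE_distrD[rotated]) simp
  then show ?thesis by (simp add: add.commute)
qed

lemma weak_gradient_translate:
  fixes u :: "real^'n \<Rightarrow> real"
  assumes ug: "weak_gradient u G"
  shows "weak_gradient (\<lambda>x. u (x + h)) (\<lambda>x. G (x + h))"
proof -
  have l: "loc_integrable u" "loc_integrable G" using ug by (auto simp: weak_gradient_def)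
  have [measurable]: "u \<in> borel_measurable borel" "G \<in> borel_measurable borel"
    using weak_gradient_measurable[OF ug] by auto
  have "(\<integral>x. u (x + h) *\<^sub>R D x \<partial>lborel) = - (\<integral>x. \<phi> x *\<^sub>R G (x + h) \<partial>lborel)"
    if \<phi>: "test_function \<phi> D" for \<phi> D
  proof -
    have [measurable]: "\<phi> \<in> borel_measurable borel" "D \<in> borel_measurable borel"
      using \<phi> by (auto elim!: test_function_bounds intro: borel_measurable_continuous_onI)
    have "(\<integral>x. u (x + h) *\<^sub>R D (x + h - h) \<partial>lborel) = (\<integral>x. u x *\<^sub>R D (x - h) \<partial>lborel)"
      by (rule lborel_translation(1)) measurable
    also have "\<dots> = - (\<integral>x. \<phi> (x - h) *\<^sub>R G x \<partial>lborel)"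
      using ug test_function_translate[OF \<phi>, of h] by (auto simp: weak_gradient_def)
    also have "(\<integral>x. \<phi> (x - h) *\<^sub>R G x \<partial>lborel) = (\<integral>x. \<phi> (x + h - h) *\<^sub>R G (x + h) \<partial>lborel)"
      by (rule lborel_translation(1)[symmetric]) measurable
    finally show ?thesis by simp
  qed
  then show ?thesis
    unfolding weak_gradient_def using loc_integrable_translate[OF l(1)] loc_integrable_translate[OF l(2)] by blast
qed

context parallelepiped_lattice
begin

lemma AE_Q:
  assumes "AE x in lborel. P x"
  shows "AE x in lebesgue_on Q. P x"
proof -
  have "AE x in lebesgue. x \<in> Q \<longrightarrow> P x"
    using AE_completion[OF assms] by eventually_elim simp
  moreover have "Q \<inter> space lebesgue \<in> sets lebesgue" using open_parallelepiped by simp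
  ultimately show ?thesis by (simp add: AE_restrict_space_iff)
qed

text \<open>A Borel representative of \<open>u\<close> is periodic only almost everywhere. There are
  countably many lattice vectors, so composition with \<open>fold\<close> changes it on a null set
  and makes it exactly periodic. Periodicity of the gradient comes from uniqueness: a lattice
  translate of it is a gradient of the same function up to a null set.\<close>

lemma periodic_gradient_representative:
  assumes u: "lat_periodic u" and ug: "has_weak_gradient u G"
  obtains u' G' where "periodic_gradient u' G'" "AE x in lborel. u x = u' x" "AE x in lborel. G x = G' x"
proof -
  obtain u0 G0 where w0: "weak_gradient u0 G0" "u0 \<in> borel_measurable borel" "G0 \<in> borel_measurable borel"
    "AE x in lborel. u x = u0 x" "AE x in lborel. G x = G0 x"
    by (rule has_weak_gradient_representative[OF ug])
  note [measurable] = w0(2,3)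
  have u0k: "AE x in lborel. u0 (x + lat k) = u0 x" for k
    using w0(4) AE_lborel_translate[OF w0(4), of "lat k"]
    by eventually_elim (metis lat_periodicD[OF u])
  have G0k: "AE x in lborel. G0 (x + lat k) = G0 x" for k
  proof (rule weak_gradient_unique[OF _ w0(1)])
    show "weak_gradient u0 (\<lambda>x. G0 (x + lat k))"
      by (rule weak_gradient_cong_AE[OF weak_gradient_translate[OF w0(1), of "lat k"]]) (use u0k in auto)
  qed
  have "AE x in lborel. \<forall>k. u0 (x + lat k) = u0 x" "AE x in lborel. \<forall>k. G0 (x + lat k) = G0 x"
    unfolding AE_all_countable using u0k G0k by blast+
  then have fu: "AE x in lborel. u0 x = u0 (fold x)" and fG: "AE x in lborel. G0 x = G0 (fold x)"
    by (eventually_elim, simp add: fold_def)+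
  have "weak_gradient (\<lambda>x. u0 (fold x)) (\<lambda>x. G0 (fold x))"
    by (rule weak_gradient_cong_AE[OF w0(1) _ _ fu fG]) measurable
  then have "periodic_gradient (\<lambda>x. u0 (fold x)) (\<lambda>x. G0 (fold x))"
    by (simp add: periodic_gradient_def lat_periodic_comp_fold)
  moreover have "AE x in lborel. u x = u0 (fold x)" using w0(4) fu by eventually_elim simp
  moreover have "AE x in lborel. G x = G0 (fold x)" using w0(5) fG by eventually_elim simp
  ultimately show thesis by (rule that)
qed

end

context parallelepiped_lattice
begin

section \<open>The space of periodic gradients\<close>

abbreviation "cellM \<equiv> lebesgue_on Q"

definition gradients :: "real \<Rightarrow> (real^'n \<Rightarrow> real^'n) set" where
  "gradients p = {G. \<exists>\<phi>\<in>W1p_per p Q v. has_weak_gradient \<phi> G}"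

lemma Lp_on_eq: "Lp_on p Q = Lebesgue_space cellM p"
  by (simp add: Lp_on_def Lebesgue_space_def)

lemma W1p_perI:
  assumes "lat_periodic u" "u \<in> Lebesgue_space cellM p" "has_weak_gradient u G"
    "G \<in> Lebesgue_space cellM p" "(\<integral>x. u x \<partial>cellM) = 0"
  shows "u \<in> W1p_per p Q v"
  using assms by (auto simp: W1p_per_def periodic_wrt_iff_lat_periodic Lp_on_eq)

lemma W1p_per_gradient:
  assumes \<phi>: "\<phi> \<in> W1p_per p Q v" and G: "has_weak_gradient \<phi> G"
  obtains u G' where "periodic_gradient u G'" "AE x in lborel. \<phi> x = u x" "AE x in lborel. G x = G' x"
    "AE x in cellM. \<phi> x = u x" "AE x in cellM. G x = G' x"
    "\<phi> \<in> Lebesgue_space cellM p" "G \<in> Lebesgue_space cellM p" "lat_periodic \<phi>" "(\<integral>x. \<phi> x \<partial>cellM) = 0"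
    "(\<integral>x. indicator cell x * u x \<partial>lborel) = 0" "(\<integral>x. G x \<partial>cellM) = 0"
proof -
  have per: "lat_periodic \<phi>" and \<phi>L: "\<phi> \<in> Lebesgue_space cellM p" and m0: "(\<integral>x. \<phi> x \<partial>cellM) = 0"
    using \<phi> by (auto simp: W1p_per_def periodic_wrt_iff_lat_periodic Lp_on_eq)
  obtain H where H: "has_weak_gradient \<phi> H" "H \<in> Lebesgue_space cellM p"
    using \<phi> by (auto simp: W1p_per_def Lp_on_eq)
  obtain u G' where ug: "periodic_gradient u G'" "AE x in lborel. \<phi> x = u x" "AE x in lborel. G x = G' x"
    by (rule periodic_gradient_representative[OF per G])
  have wg: "weak_gradient u G'" using ug(1) by (simp add: periodic_gradient_def)
  have um[measurable]: "u \<in> borel_measurable borel" and Gm[measurable]: "G' \<in> borel_measurable borel"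
    using weak_gradient_measurable[OF wg] by auto
  obtain w H' where w: "weak_gradient w H'" "w \<in> borel_measurable borel" "H' \<in> borel_measurable borel"
    "AE x in lborel. \<phi> x = w x" "AE x in lborel. H x = H' x"
    by (rule has_weak_gradient_representative[OF H(1)])
  have "AE x in lborel. w x = u x" using w(4) ug(2) by eventually_elim simp
  then have "weak_gradient u H'" using w(3) um by (intro weak_gradient_cong_AE[OF w(1)]) auto
  then have "AE x in lborel. G' x = H' x" by (rule weak_gradient_unique[OF wg])
  then have "AE x in lborel. H x = G x" using w(5) ug(3) by eventually_elim simp
  then have HG: "AE x in cellM. H x = G x" by (rule AE_Q)
  have mG: "G \<in> borel_measurable lebesgue" by (rule lebesgue_measurable_AE[OF Gm ug(3)])
  then have mGQ: "G \<in> borel_measurable cellM" by (rule measurable_restrict_space1)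
  have GL: "G \<in> Lebesgue_space cellM p" by (rule Lebesgue_space_cong_AE[OF H(2) mGQ HG])
  note aeQ = AE_Q[OF ug(2)] AE_Q[OF ug(3)]
  have "(\<integral>x. \<phi> x \<partial>cellM) = (\<integral>x. u x \<partial>cellM)"
    by (rule integral_cong_AE[OF Lebesgue_space_measurable[OF \<phi>L] borel_measurable_Q[OF um] aeQ(1)])
  then have mu: "(\<integral>x. indicator cell x * u x \<partial>lborel) = 0" using m0 integral_Q[OF um] by simp
  have "(\<integral>x. G x \<partial>cellM) = (\<integral>x. G' x \<partial>cellM)"
    by (rule integral_cong_AE[OF mGQ borel_measurable_Q[OF Gm] aeQ(2)])
  also have "\<dots> = 0" using integral_Q[OF Gm] periodic_gradient_mean[OF ug(1)] by simp
  finally have "(\<integral>x. G x \<partial>cellM) = 0" .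
  then show thesis by (rule that[OF ug aeQ \<phi>L GL per m0 mu])
qed

lemma W1p_perD:
  assumes "\<phi> \<in> W1p_per p Q v" "has_weak_gradient \<phi> G"
  shows "\<phi> \<in> Lebesgue_space cellM p" "G \<in> Lebesgue_space cellM p" "lat_periodic \<phi>"
    "(\<integral>x. \<phi> x \<partial>cellM) = 0" "(\<integral>x. G x \<partial>cellM) = 0"
  by (rule W1p_per_gradient[OF assms], assumption)+

lemma gradientsE:
  assumes "G \<in> gradients p"
  obtains \<phi> where "\<phi> \<in> W1p_per p Q v" "has_weak_gradient \<phi> G"
  using assms unfolding gradients_def by blast

lemma gradientsI: "\<phi> \<in> W1p_per p Q v \<Longrightarrow> has_weak_gradient \<phi> G \<Longrightarrow> G \<in> gradients p"
  unfolding gradients_def by blast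

lemma gradients_subset: "gradients p \<subseteq> Lebesgue_space cellM p"
  by (auto elim!: gradientsE intro: W1p_perD(2))

lemma gradients_mean: "G \<in> gradients p \<Longrightarrow> (\<integral>x. G x \<partial>cellM) = 0"
  by (auto elim!: gradientsE intro: W1p_perD(5))

lemma Poincare:
  assumes p: "1 < p" and \<phi>: "\<phi> \<in> W1p_per p Q v" and G: "has_weak_gradient \<phi> G"
  shows "power_mass cellM p \<phi> \<le> radius powr p * power_mass cellM p G"
proof -
  obtain u G' where ug: "periodic_gradient u G'" and "AE x in lborel. \<phi> x = u x" "AE x in lborel. G x = G' x"
    and ae: "AE x in cellM. \<phi> x = u x" "AE x in cellM. G x = G' x"
    and \<phi>L: "\<phi> \<in> Lebesgue_space cellM p" and GL: "G \<in> Lebesgue_space cellM p"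
    and "lat_periodic \<phi>" "(\<integral>x. \<phi> x \<partial>cellM) = 0"
    and mu: "(\<integral>x. indicator cell x * u x \<partial>lborel) = 0" and "(\<integral>x. G x \<partial>cellM) = 0"
    by (rule W1p_per_gradient[OF \<phi> G])
  have wg: "weak_gradient u G'" using ug by (simp add: periodic_gradient_def)
  have [measurable]: "u \<in> borel_measurable borel" "G' \<in> borel_measurable borel"
    using weak_gradient_measurable[OF wg] by auto
  have e: "ennreal (power_mass cellM p f) = (\<integral>\<^sup>+x. ennreal (norm (f' x) powr p) * indicator cell x \<partial>lborel)"
    if "f \<in> Lebesgue_space cellM p" and [measurable]: "f' \<in> borel_measurable borel" and "AE x in cellM. f x = f' x"
    for f f' :: "real^'n \<Rightarrow> 'c::euclidean_space"
  proof -
    have "ennreal (power_mass cellM p f) = (\<integral>\<^sup>+x. ennreal (norm (f x) powr p) \<partial>cellM)"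
      unfolding power_mass_def
      using nn_integral_eq_integral[OF Lebesgue_space_integrable[OF that(1)]] by simp
    also have "\<dots> = (\<integral>\<^sup>+x. ennreal (norm (f' x) powr p) \<partial>cellM)"
      using that(3) by (intro nn_integral_cong_AE) (auto elim: eventually_mono)
    also have "\<dots> = (\<integral>\<^sup>+x. ennreal (norm (f' x) powr p) * indicator cell x \<partial>lborel)"
      by (rule nn_integral_Q) measurable
    finally show ?thesis .
  qed
  have "ennreal (power_mass cellM p \<phi>) \<le> ennreal (radius powr p) * ennreal (power_mass cellM p G)"
    using Poincare_nn[OF ug p mu] e[OF \<phi>L _ ae(1)] e[OF GL _ ae(2)] by simp
  also have "\<dots> = ennreal (radius powr p * power_mass cellM p G)"
    by (simp add: ennreal_mult power_mass_nonneg)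
  finally show ?thesis by (simp add: power_mass_nonneg)
qed

lemma W1p_per_lincomb:
  assumes p: "1 < p" and \<phi>: "\<phi> \<in> W1p_per p Q v" "has_weak_gradient \<phi> G"
    and \<psi>: "\<psi> \<in> W1p_per p Q v" "has_weak_gradient \<psi> H"
  shows "(\<lambda>x. c * \<phi> x + d * \<psi> x) \<in> W1p_per p Q v"
    and "has_weak_gradient (\<lambda>x. c * \<phi> x + d * \<psi> x) (\<lambda>x. c *\<^sub>R G x + d *\<^sub>R H x)"
proof -
  interpret finite_measure cellM by (rule finite_measure_Q)
  have p0: "0 < p" using p by simp
  note \<phi>' = W1p_perD(3,1,2,4)[OF \<phi>] and \<psi>' = W1p_perD(3,1,2,4)[OF \<psi>]
  show w: "has_weak_gradient (\<lambda>x. c * \<phi> x + d * \<psi> x) (\<lambda>x. c *\<^sub>R G x + d *\<^sub>R H x)"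
    by (rule has_weak_gradient_lincomb[OF \<phi>(2) \<psi>(2)])
  show "(\<lambda>x. c * \<phi> x + d * \<psi> x) \<in> W1p_per p Q v"
  proof (rule W1p_perI[OF _ _ w])
    show "lat_periodic (\<lambda>x. c * \<phi> x + d * \<psi> x)" using \<phi>'(1) \<psi>'(1) by (simp add: lat_periodic_def)
    show "(\<lambda>x. c * \<phi> x + d * \<psi> x) \<in> Lebesgue_space cellM p"
      using Lebesgue_space_add[OF p0 Lebesgue_space_scaleR[OF \<phi>'(2), of c] Lebesgue_space_scaleR[OF \<psi>'(2), of d]] by simp
    show "(\<lambda>x. c *\<^sub>R G x + d *\<^sub>R H x) \<in> Lebesgue_space cellM p"
      by (intro Lebesgue_space_add Lebesgue_space_scaleR p0 \<phi>' \<psi>')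
    show "(\<integral>x. c * \<phi> x + d * \<psi> x \<partial>cellM) = 0"
      using Lebesgue_space_integrable_norm(2)[OF p \<phi>'(2)] Lebesgue_space_integrable_norm(2)[OF p \<psi>'(2)] \<phi>'(4) \<psi>'(4)
      by simp
  qed
qed

lemma W1p_per_zero: "(\<lambda>x. 0) \<in> W1p_per p Q v" "has_weak_gradient (\<lambda>x. 0) (\<lambda>x. 0)"
proof -
  show w: "has_weak_gradient (\<lambda>x. 0) (\<lambda>x. 0)"
    by (simp add: has_weak_gradient_def locally_integrable_def)
  show "(\<lambda>x. 0) \<in> W1p_per p Q v"
    by (rule W1p_perI[OF _ _ w]) (auto simp: lat_periodic_def Lebesgue_space_zero)
qed

text \<open>The support of the test function meets finitely many tiles, so the error is at most a
  multiple of the L^1 distance on one cell. The operation \<open>prod\<close> covers both products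
  in the weak definition, a scalar times a vector and the reverse.\<close>

lemma periodic_L1_limit:
  fixes f :: "nat \<Rightarrow> real^'n \<Rightarrow> 'b::euclidean_space" and \<psi> :: "real^'n \<Rightarrow> 'c::euclidean_space"
    and prod :: "'b \<Rightarrow> 'c \<Rightarrow> real^'n"
  assumes f: "\<And>n. loc_integrable (f n)" "\<And>n. lat_periodic (f n)"
    and g: "loc_integrable g" "lat_periodic g"
    and lim: "(\<lambda>n. \<integral>x. norm (f n x - g x) \<partial>cellM) \<longlonglongrightarrow> 0"
    and \<psi>: "\<And>x. norm (\<psi> x) \<le> K" "\<And>x. R < norm x \<Longrightarrow> \<psi> x = 0"
    and prod: "\<And>x y z. prod (x - y) z = prod x z - prod y z" "\<And>x z. norm (prod x z) \<le> norm x * norm z" "\<And>x. prod x 0 = 0"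
    and int: "\<And>n. integrable lborel (\<lambda>x. prod (f n x) (\<psi> x))" "integrable lborel (\<lambda>x. prod (g x) (\<psi> x))"
  shows "(\<lambda>n. \<integral>x. prod (f n x) (\<psi> x) \<partial>lborel) \<longlonglongrightarrow> (\<integral>x. prod (g x) (\<psi> x) \<partial>lborel)"
proof -
  obtain N :: nat where N: "\<And>f :: real^'n \<Rightarrow> ennreal. f \<in> borel_measurable borel \<Longrightarrow> lat_periodic f \<Longrightarrow>
    (\<integral>\<^sup>+x. f x * indicator (cball 0 R) x \<partial>lborel) \<le> of_nat N * (\<integral>\<^sup>+x. f x * indicator cell x \<partial>lborel)"
    using nn_integral_cball_le by blast
  have K0: "0 \<le> K" using \<psi>(1)[of 0] norm_ge_zero[of "\<psi> 0"] by linarith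
  have bound: "norm ((\<integral>x. prod (f n x) (\<psi> x) \<partial>lborel) - (\<integral>x. prod (g x) (\<psi> x) \<partial>lborel))
      \<le> K * real N * (\<integral>x. norm (f n x - g x) \<partial>cellM)" for n
  proof -
    define d where "d x = f n x - g x" for x
    have dl: "loc_integrable d" unfolding d_def[abs_def] by (rule loc_integrable_diff[OF f(1) g(1)])
    have [measurable]: "d \<in> borel_measurable borel" by (rule loc_integrable_measurable[OF dl])
    have per: "lat_periodic (\<lambda>x. ennreal (norm (d x)))" using f(2) g(2) by (simp add: lat_periodic_def d_def)
    have id: "integrable cellM (\<lambda>x. norm (d x))"
      using loc_integrable_cell[OF dl] integrable_Q[of d] by simp
    have i: "integrable lborel (\<lambda>x. prod (d x) (\<psi> x))" using int by (simp add: d_def prod(1))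
    have "(\<integral>x. prod (f n x) (\<psi> x) \<partial>lborel) - (\<integral>x. prod (g x) (\<psi> x) \<partial>lborel) = (\<integral>x. prod (d x) (\<psi> x) \<partial>lborel)"
      using int by (simp add: d_def prod(1))
    then have "ennreal (norm ((\<integral>x. prod (f n x) (\<psi> x) \<partial>lborel) - (\<integral>x. prod (g x) (\<psi> x) \<partial>lborel)))
        \<le> ennreal (\<integral>x. norm (prod (d x) (\<psi> x)) \<partial>lborel)"
      using integral_norm_bound[of lborel "\<lambda>x. prod (d x) (\<psi> x)"] by (simp add: ennreal_leI)
    also have "\<dots> = (\<integral>\<^sup>+x. ennreal (norm (prod (d x) (\<psi> x))) \<partial>lborel)"
      using nn_integral_eq_integral[OF integrable_norm[OF i]] by simp
    also have "\<dots> \<le> (\<integral>\<^sup>+x. ennreal K * (ennreal (norm (d x)) * indicator (cball 0 R) x) \<partial>lborel)"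
    proof (rule nn_integral_mono)
      fix x
      show "ennreal (norm (prod (d x) (\<psi> x))) \<le> ennreal K * (ennreal (norm (d x)) * indicator (cball 0 R) x)"
      proof (cases "norm x \<le> R")
        case True
        have "norm (prod (d x) (\<psi> x)) \<le> K * norm (d x)"
          using prod(2)[of "d x" "\<psi> x"] mult_left_mono[OF \<psi>(1)[of x] norm_ge_zero[of "d x"]] by (simp add: mult.commute)
        then show ?thesis using True K0 by (simp add: ennreal_leI flip: ennreal_mult)
      qed (simp add: \<psi>(2) prod(3))
    qed
    also have "\<dots> = ennreal K * (\<integral>\<^sup>+x. ennreal (norm (d x)) * indicator (cball 0 R) x \<partial>lborel)"
      by (rule nn_integral_cmult, intro borel_measurable_times_ennreal borel_measurable_indicator) auto
    also have "\<dots> \<le> ennreal K * (of_nat N * (\<integral>\<^sup>+x. ennreal (norm (d x)) * indicator cell x \<partial>lborel))"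
      using per by (intro mult_left_mono N) auto
    also have "(\<integral>\<^sup>+x. ennreal (norm (d x)) * indicator cell x \<partial>lborel) = (\<integral>\<^sup>+x. ennreal (norm (d x)) \<partial>cellM)"
      by (rule nn_integral_Q[symmetric]) measurable
    also have "\<dots> = ennreal (\<integral>x. norm (d x) \<partial>cellM)" by (rule nn_integral_eq_integral[OF id]) simp
    also have "ennreal K * (of_nat N * ennreal (\<integral>x. norm (d x) \<partial>cellM)) = ennreal (K * real N * (\<integral>x. norm (d x) \<partial>cellM))"
      using K0 by (simp add: ennreal_mult ennreal_of_nat_eq_real_of_nat mult.assoc)
    finally show ?thesis
      using K0 by (subst (asm) ennreal_le_iff) (auto simp: d_def)
  qed
  have "(\<lambda>n. (\<integral>x. prod (f n x) (\<psi> x) \<partial>lborel) - (\<integral>x. prod (g x) (\<psi> x) \<partial>lborel)) \<longlonglongrightarrow> 0"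
  proof (rule Lim_null_comparison[OF always_eventually])
    show "\<forall>n. norm ((\<integral>x. prod (f n x) (\<psi> x) \<partial>lborel) - (\<integral>x. prod (g x) (\<psi> x) \<partial>lborel))
      \<le> K * real N * (\<integral>x. norm (f n x - g x) \<partial>cellM)" using bound by blast
    show "(\<lambda>n. K * real N * (\<integral>x. norm (f n x - g x) \<partial>cellM)) \<longlonglongrightarrow> 0"
      using tendsto_mult[OF tendsto_const[of "K * real N"] lim] by simp
  qed
  then show ?thesis by (simp add: LIM_zero_iff)
qed

text \<open>Extended by zero, replaced by a Borel version and composed with \<open>fold\<close>,
  which is the identity on the cell.\<close>

lemma periodic_Borel_extension:
  fixes f :: "real^'n \<Rightarrow> 'b::euclidean_space"
  assumes "f \<in> borel_measurable cellM"
  obtains f' where "f' \<in> borel_measurable borel" "lat_periodic f'" "AE x in cellM. f x = f' x"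
proof -
  have Q: "Q \<inter> space lebesgue \<in> sets lebesgue" using open_parallelepiped by simp
  have "(\<lambda>x. indicator Q x *\<^sub>R f x) \<in> borel_measurable lebesgue"
    using assms borel_measurable_restrict_space_iff[OF Q, of f] by simp
  then obtain h where h: "h \<in> borel_measurable borel" "AE x in lborel. indicator Q x *\<^sub>R f x = h x"
    by (rule borel_representative)
  note [measurable] = h(1)
  show thesis
  proof (rule that[of "\<lambda>x. h (fold x)"])
    show "(\<lambda>x. h (fold x)) \<in> borel_measurable borel" by measurable
    show "lat_periodic (\<lambda>x. h (fold x))" by (rule lat_periodic_comp_fold)
    show "AE x in cellM. f x = h (fold x)"
    proof (rule AE_mp[OF AE_Q[OF h(2)]], rule AE_I2, rule impI)
      fix x assume x: "x \<in> space cellM" and e: "indicator Q x *\<^sub>R f x = h x"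
      then have "x \<in> Q" by simp
      then have "x \<in> cell" by (auto simp: cell_def parallelepiped_eq less_imp_le)
      then show "f x = h (fold x)" using e \<open>x \<in> Q\<close> by (simp add: fold_cell)
    qed
  qed
qed

text \<open>The gradients converge by assumption, their primitives need not. The Poincare inequality
  bounds the primitives, so \<open>convex_extraction\<close> yields pairs of a primitive and its
  gradient in which the primitives converge as well. L^1 convergence on the cell then carries the
  weak definition to the limit.\<close>

proposition closed_subspace_gradients:
  assumes p: "1 < p"
  shows "closed_subspace cellM p (gradients p)"
proof -
  interpret finite_measure cellM by (rule finite_measure_Q)
  have p0: "0 < p" using p by simp
  show ?thesis
    unfolding closed_subspace_def
  proof (intro conjI ballI allI impI)
    show "gradients p \<subseteq> Lebesgue_space cellM p" by (rule gradients_subset)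
    show "(\<lambda>x. 0) \<in> gradients p" by (rule gradientsI[OF W1p_per_zero])
    show "(\<lambda>x. F x + G x) \<in> gradients p" if F: "F \<in> gradients p" and G: "G \<in> gradients p" for F G
    proof -
      obtain \<phi> where \<phi>: "\<phi> \<in> W1p_per p Q v" "has_weak_gradient \<phi> F" by (rule gradientsE[OF F])
      obtain \<psi> where \<psi>: "\<psi> \<in> W1p_per p Q v" "has_weak_gradient \<psi> G" by (rule gradientsE[OF G])
      show ?thesis using gradientsI[OF W1p_per_lincomb[OF p \<phi> \<psi>, of 1 1]] by simp
    qed
    show "(\<lambda>x. c *\<^sub>R F x) \<in> gradients p" if F: "F \<in> gradients p" for c F
    proof -
      obtain \<phi> where \<phi>: "\<phi> \<in> W1p_per p Q v" "has_weak_gradient \<phi> F" by (rule gradientsE[OF F])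
      show ?thesis using gradientsI[OF W1p_per_lincomb[OF p \<phi> \<phi>, of c 0]] by simp
    qed
    fix F and G :: "real^'n \<Rightarrow> real^'n" and C
    assume F: "\<forall>n. F n \<in> gradients p \<and> power_mass cellM p (F n) \<le> C"
      and Gm: "G \<in> borel_measurable cellM" and lim: "AE x in cellM. (\<lambda>n. F n x) \<longlonglongrightarrow> G x"
    have FL: "F n \<in> Lebesgue_space cellM p" and FC: "power_mass cellM p (F n) \<le> C" for n
      using F gradients_subset by blast+
    have GL: "G \<in> Lebesgue_space cellM p"
      by (rule Lebesgue_space_Fatou(1)[OF p0 FL _ tendsto_const Gm lim]) (use FC in \<open>simp add: power_mass_def\<close>)
    note iG = Lebesgue_space_integrable_norm(2)[OF p GL]
    have L1: "(\<lambda>n. \<integral>x. norm (F n x - G x) \<partial>cellM) \<longlonglongrightarrow> 0"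
      by (rule bounded_in_Lp_integral_tendsto(1)[OF p FL FC GL lim])
    \<comment> \<open>Convex sets of pairs; the shrinking L^1 distance to \<open>G\<close> keeps
      \<open>G\<close> as the limit of the new gradients.\<close>
    define X where "X n = {(\<phi>, H). \<phi> \<in> W1p_per p Q v \<and> has_weak_gradient \<phi> H \<and> power_mass cellM p H \<le> C \<and>
        (\<integral>x. norm (H x - G x) \<partial>cellM) \<le> 1 / real (Suc n)}" for n
    have XL: "fst s \<in> W1p_per p Q v" "has_weak_gradient (fst s) (snd s)" "power_mass cellM p (snd s) \<le> C"
      "fst s \<in> Lebesgue_space cellM p" "snd s \<in> Lebesgue_space cellM p"
      "power_mass cellM p (fst s) \<le> radius powr p * C"
      "(\<integral>x. norm (snd s x - G x) \<partial>cellM) \<le> 1 / real (Suc n)" if "s \<in> X n" for s n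
    proof -
      show *: "fst s \<in> W1p_per p Q v" "has_weak_gradient (fst s) (snd s)" "power_mass cellM p (snd s) \<le> C"
        "(\<integral>x. norm (snd s x - G x) \<partial>cellM) \<le> 1 / real (Suc n)"
        using that by (auto simp: X_def)
      show "fst s \<in> Lebesgue_space cellM p" "snd s \<in> Lebesgue_space cellM p"
        by (rule W1p_perD(1,2)[OF *(1,2)])+
      have "radius powr p * power_mass cellM p (snd s) \<le> radius powr p * C" using *(3) by (intro mult_left_mono) auto
      then show "power_mass cellM p (fst s) \<le> radius powr p * C" using Poincare[OF p *(1,2)] by linarith
    qed
    define ev where "ev s x = (fst s x, snd s x)" for s :: "(real^'n \<Rightarrow> real) \<times> (real^'n \<Rightarrow> real^'n)" and x
    obtain s g where sX: "\<And>n. s n \<in> X n" and g: "g \<in> borel_measurable cellM"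
      and evlim: "AE x in cellM. (\<lambda>n. ev (s n) x) \<longlonglongrightarrow> g x"
    proof (rule convex_extraction[of X ev "(radius powr p * C + measure cellM (space cellM)) + (C + measure cellM (space cellM))"])
      fix n
      have "eventually (\<lambda>k. (\<integral>x. norm (F k x - G x) \<partial>cellM) < 1 / real (Suc n)) sequentially"
        using L1 by (rule order_tendstoD) simp
      then obtain k where k: "(\<integral>x. norm (F k x - G x) \<partial>cellM) < 1 / real (Suc n)"
        by (auto simp: eventually_sequentially)
      obtain \<phi> where "\<phi> \<in> W1p_per p Q v" "has_weak_gradient \<phi> (F k)" using F by (blast elim: gradientsE)
      then have "(\<phi>, F k) \<in> X n" using k FC by (auto simp: X_def)
      then show "X n \<noteq> {}" by blast
      have "1 / real (Suc (Suc n)) \<le> 1 / real (Suc n)" by (simp add: field_simps)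
      then show "X (Suc n) \<subseteq> X n" unfolding X_def by auto
    next
      fix s assume s: "s \<in> X 0"
      note i = Lebesgue_space_integrable_norm(2)[OF p XL(4)[OF s]] Lebesgue_space_integrable_norm(2)[OF p XL(5)[OF s]]
      show iev: "integrable cellM (ev s)" unfolding ev_def[abs_def] by (rule integrable_Pair[OF i])
      have "(\<integral>x. norm (ev s x) \<partial>cellM) \<le> (\<integral>x. norm (fst s x) + norm (snd s x) \<partial>cellM)"
      proof (rule integral_mono)
        show "integrable cellM (\<lambda>x. norm (ev s x))" using iev by (rule integrable_norm)
        show "norm (ev s x) \<le> norm (fst s x) + norm (snd s x)" for x unfolding ev_def by (rule norm_Pair_le)
      qed (use i in auto)
      also have "\<dots> = (\<integral>x. norm (fst s x) \<partial>cellM) + (\<integral>x. norm (snd s x) \<partial>cellM)" using i by simp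
      also have "\<dots> \<le> (radius powr p * C + measure cellM (space cellM)) + (C + measure cellM (space cellM))"
        using integral_norm_le_power_mass[OF p XL(4)[OF s]] integral_norm_le_power_mass[OF p XL(5)[OF s]]
          XL(3)[OF s] XL(6)[OF s] by linarith
      finally show "(\<integral>x. norm (ev s x) \<partial>cellM)
          \<le> (radius powr p * C + measure cellM (space cellM)) + (C + measure cellM (space cellM))" .
    next
      fix n i j assume i: "i \<in> X n" and j: "j \<in> X n"
      define k where "k = ((\<lambda>x. (1/2) * fst i x + (1/2) * fst j x), (\<lambda>x. (1/2) *\<^sub>R snd i x + (1/2) *\<^sub>R snd j x))"
      have pm: "power_mass cellM p (\<lambda>x. (1/2) *\<^sub>R snd i x + (1/2) *\<^sub>R snd j x) \<le> C"
        using power_mass_midpoint_le[OF p XL(5)[OF i] XL(5)[OF j]] XL(3)[OF i] XL(3)[OF j]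
        by (simp add: scaleR_add_right)
      have "(\<integral>x. norm (((1/2) *\<^sub>R snd i x + (1/2) *\<^sub>R snd j x) - G x) \<partial>cellM)
          \<le> (\<integral>x. (1/2) * norm (snd i x - G x) + (1/2) * norm (snd j x - G x) \<partial>cellM)"
      proof (rule integral_mono)
        note ij = Lebesgue_space_integrable_norm(2)[OF p XL(5)[OF i]] Lebesgue_space_integrable_norm(2)[OF p XL(5)[OF j]]
        show "integrable cellM (\<lambda>x. norm (((1/2) *\<^sub>R snd i x + (1/2) *\<^sub>R snd j x) - G x))"
          "integrable cellM (\<lambda>x. (1/2) * norm (snd i x - G x) + (1/2) * norm (snd j x - G x))"
          using ij iG by auto
        fix x
        have "((1/2) *\<^sub>R snd i x + (1/2) *\<^sub>R snd j x) - G x = (1/2) *\<^sub>R (snd i x - G x) + (1/2) *\<^sub>R (snd j x - G x)"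
          by (simp add: algebra_simps flip: scaleR_add_left)
        then show "norm (((1/2) *\<^sub>R snd i x + (1/2) *\<^sub>R snd j x) - G x) \<le> (1/2) * norm (snd i x - G x) + (1/2) * norm (snd j x - G x)"
          using norm_triangle_ineq[of "(1/2) *\<^sub>R (snd i x - G x)" "(1/2) *\<^sub>R (snd j x - G x)"] by simp
      qed
      also have "\<dots> = (1/2) * (\<integral>x. norm (snd i x - G x) \<partial>cellM) + (1/2) * (\<integral>x. norm (snd j x - G x) \<partial>cellM)"
        using Lebesgue_space_integrable_norm(2)[OF p XL(5)[OF i]] Lebesgue_space_integrable_norm(2)[OF p XL(5)[OF j]] iG
        by simp
      also have "\<dots> \<le> 1 / real (Suc n)" using XL(7)[OF i] XL(7)[OF j] by simp
      finally have "k \<in> X n"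
        unfolding X_def k_def using pm W1p_per_lincomb[OF p XL(1,2)[OF i] XL(1,2)[OF j], of "1/2" "1/2"] by simp
      moreover have "ev k x = (1/2) *\<^sub>R (ev i x + ev j x)" for x
        by (simp add: ev_def k_def scaleR_add_right)
      ultimately show "\<exists>k\<in>X n. \<forall>x\<in>space cellM. ev k x = (1/2) *\<^sub>R (ev i x + ev j x)" by blast
    qed (rule that)
    define \<phi> where "\<phi> n = fst (s n)" for n
    define H where "H n = snd (s n)" for n
    have W: "\<phi> n \<in> W1p_per p Q v" "has_weak_gradient (\<phi> n) (H n)" "power_mass cellM p (H n) \<le> C"
      "\<phi> n \<in> Lebesgue_space cellM p" "H n \<in> Lebesgue_space cellM p"
      "power_mass cellM p (\<phi> n) \<le> radius powr p * C"
      "(\<integral>x. norm (H n x - G x) \<partial>cellM) \<le> 1 / real (Suc n)" for n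
      using XL[OF sX[of n]] by (auto simp: \<phi>_def H_def)
    have HG0: "(\<lambda>n. \<integral>x. norm (H n x - G x) \<partial>cellM) \<longlonglongrightarrow> 0"
    proof (rule Lim_null_comparison[OF always_eventually])
      show "\<forall>n. norm (\<integral>x. norm (H n x - G x) \<partial>cellM) \<le> 1 / real (Suc n)" using W(7) by simp
      show "(\<lambda>n. 1 / real (Suc n)) \<longlonglongrightarrow> 0"
        using LIMSEQ_inverse_real_of_nat by (simp add: inverse_eq_divide)
    qed
    have fm: "(\<lambda>x. fst (g x)) \<in> borel_measurable cellM"
      by (rule measurable_compose[OF g], intro borel_measurable_continuous_onI continuous_intros)
    have \<phi>lim: "AE x in cellM. (\<lambda>n. \<phi> n x) \<longlonglongrightarrow> fst (g x)"
      using evlim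
    proof eventually_elim
      case (elim x)
      show ?case using tendsto_fst[OF elim] by (simp add: ev_def \<phi>_def)
    qed
    \<comment> \<open>The limit lives on the open cell; its periodic Borel extension is the
      candidate primitive on the whole space, where weak gradients are tested.\<close>
    obtain u where u: "u \<in> borel_measurable borel" "lat_periodic u" "AE x in cellM. fst (g x) = u x"
      by (rule periodic_Borel_extension[OF fm])
    obtain G' where G': "G' \<in> borel_measurable borel" "lat_periodic G'" "AE x in cellM. G x = G' x"
      by (rule periodic_Borel_extension[OF Gm])
    have ulim: "AE x in cellM. (\<lambda>n. \<phi> n x) \<longlonglongrightarrow> u x" using \<phi>lim u(3) by eventually_elim simp
    have uL: "u \<in> Lebesgue_space cellM p"
      by (rule Lebesgue_space_Fatou(1)[OF p0 W(4) _ tendsto_const borel_measurable_Q[OF u(1)] ulim])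
        (use W(6) in \<open>simp add: power_mass_def\<close>)
    have G'L: "G' \<in> Lebesgue_space cellM p"
      by (rule Lebesgue_space_cong_AE[OF GL borel_measurable_Q[OF G'(1)] G'(3)])
    have lu: "loc_integrable u" and lG': "loc_integrable G'"
      using loc_integrable_periodic[OF u(1,2)] loc_integrable_periodic[OF G'(1,2)]
        integrable_Q[OF u(1)] integrable_Q[OF G'(1)]
        Lebesgue_space_integrable_norm(2)[OF p uL] Lebesgue_space_integrable_norm(2)[OF p G'L] by auto
    have u0: "(\<lambda>n. \<integral>x. norm (\<phi> n x - u x) \<partial>cellM) \<longlonglongrightarrow> 0"
      and um: "(\<lambda>n. \<integral>x. \<phi> n x \<partial>cellM) \<longlonglongrightarrow> (\<integral>x. u x \<partial>cellM)"
      using bounded_in_Lp_integral_tendsto[OF p W(4) W(6) uL ulim] by auto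
    have "\<exists>P. periodic_gradient (fst P) (snd P) \<and> (AE x in cellM. \<phi> n x = fst P x) \<and> (AE x in cellM. H n x = snd P x)" for n
      by (rule W1p_per_gradient[OF W(1,2)[of n]]) auto
    then have "\<forall>n. \<exists>P. periodic_gradient (fst P) (snd P) \<and> (AE x in cellM. \<phi> n x = fst P x) \<and> (AE x in cellM. H n x = snd P x)"
      by blast
    from choice[OF this] obtain P where P: "\<forall>n. periodic_gradient (fst (P n)) (snd (P n)) \<and>
        (AE x in cellM. \<phi> n x = fst (P n) x) \<and> (AE x in cellM. H n x = snd (P n) x)" by blast
    define w where "w n = fst (P n)" for n
    define K where "K n = snd (P n)" for n
    have wK: "periodic_gradient (w n) (K n)" "AE x in cellM. \<phi> n x = w n x" "AE x in cellM. H n x = K n x" for n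
      using P by (auto simp: w_def K_def)
    have lw: "loc_integrable (w n)" "loc_integrable (K n)" "lat_periodic (w n)" "lat_periodic (K n)"
      and weak: "\<And>\<phi> D. test_function \<phi> D \<Longrightarrow> (\<integral>x. w n x *\<^sub>R D x \<partial>lborel) = - (\<integral>x. \<phi> x *\<^sub>R K n x \<partial>lborel)" for n
      using wK(1)[of n] by (auto simp: periodic_gradient_def weak_gradient_def)
    have w0: "(\<lambda>n. \<integral>x. norm (w n x - u x) \<partial>cellM) \<longlonglongrightarrow> 0"
    proof -
      have "(\<integral>x. norm (\<phi> n x - u x) \<partial>cellM) = (\<integral>x. norm (w n x - u x) \<partial>cellM)" for n
      proof (rule integral_cong_AE)
        show "(\<lambda>x. norm (\<phi> n x - u x)) \<in> borel_measurable cellM" "(\<lambda>x. norm (w n x - u x)) \<in> borel_measurable cellM"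
          using Lebesgue_space_measurable[OF W(4)] borel_measurable_Q[OF u(1)]
            borel_measurable_Q[OF loc_integrable_measurable[OF lw(1)]] by auto
        show "AE x in cellM. norm (\<phi> n x - u x) = norm (w n x - u x)" using wK(2)[of n] by eventually_elim simp
      qed
      then show ?thesis using u0 by simp
    qed
    have K0: "(\<lambda>n. \<integral>x. norm (K n x - G' x) \<partial>cellM) \<longlonglongrightarrow> 0"
    proof -
      have "(\<integral>x. norm (H n x - G x) \<partial>cellM) = (\<integral>x. norm (K n x - G' x) \<partial>cellM)" for n
      proof (rule integral_cong_AE)
        show "(\<lambda>x. norm (H n x - G x)) \<in> borel_measurable cellM" "(\<lambda>x. norm (K n x - G' x)) \<in> borel_measurable cellM"
          using Lebesgue_space_measurable[OF W(5)] Gm borel_measurable_Q[OF G'(1)]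
            borel_measurable_Q[OF loc_integrable_measurable[OF lw(2)]] by auto
        show "AE x in cellM. norm (H n x - G x) = norm (K n x - G' x)"
          using wK(3)[of n] G'(3) by eventually_elim simp
      qed
      then show ?thesis using HG0 by simp
    qed
    have "(\<integral>x. u x *\<^sub>R D x \<partial>lborel) = - (\<integral>x. \<psi> x *\<^sub>R G' x \<partial>lborel)" if \<psi>: "test_function \<psi> D" for \<psi> D
    proof -
      obtain R B where 0: "\<And>x. R < norm x \<Longrightarrow> \<psi> x = 0" "\<And>x. R < norm x \<Longrightarrow> D x = 0"
        and B: "\<And>x. \<bar>\<psi> x\<bar> \<le> B" "\<And>x. norm (D x) \<le> B"
        using test_function_bounds[OF \<psi>] by metis
      note i = test_function_integrable[OF \<psi>]
      have "(\<lambda>n. \<integral>x. w n x *\<^sub>R D x \<partial>lborel) \<longlonglongrightarrow> (\<integral>x. u x *\<^sub>R D x \<partial>lborel)"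
        by (rule periodic_L1_limit[where prod = "\<lambda>x y. x *\<^sub>R y", OF lw(1) lw(3) lu u(2) w0 B(2) 0(2)])
          (auto simp: scaleR_diff_left i lw lu)
      moreover have "(\<lambda>n. \<integral>x. \<psi> x *\<^sub>R K n x \<partial>lborel) \<longlonglongrightarrow> (\<integral>x. \<psi> x *\<^sub>R G' x \<partial>lborel)"
        by (rule periodic_L1_limit[where prod = "\<lambda>x y. y *\<^sub>R x" and \<psi> = \<psi> and K = B and R = R, OF lw(2) lw(4) lG' G'(2) K0])
          (use B 0 in \<open>auto simp: scaleR_diff_right i lw lG'\<close>)
      then have "(\<lambda>n. - (\<integral>x. \<psi> x *\<^sub>R K n x \<partial>lborel)) \<longlonglongrightarrow> - (\<integral>x. \<psi> x *\<^sub>R G' x \<partial>lborel)"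
        by (rule tendsto_minus)
      ultimately show ?thesis unfolding weak[OF \<psi>] by (rule LIMSEQ_unique)
    qed
    then have wg: "weak_gradient u G'" using lu lG' by (simp add: weak_gradient_def)
    have hwg: "has_weak_gradient u G'"
      using has_weak_gradient_iff[OF u(1) G'(1), of u G'] wg by simp
    have "(\<integral>x. u x \<partial>cellM) = 0" using um W1p_perD(4)[OF W(1,2)] by (simp add: LIMSEQ_const_iff)
    then have "u \<in> W1p_per p Q v" by (rule W1p_perI[OF u(2) uL hwg G'L])
    then have "G' \<in> gradients p" using hwg by (rule gradientsI)
    with G'(3) show "\<exists>G'\<in>gradients p. AE x in cellM. G x = G' x" by blast
  qed
qed

end

theorem theorem3p2:
  fixes a :: "real^'n"
    and v :: "'n \<Rightarrow> real^'n"
    and Q :: "(real^'n) set"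
    and p q :: real
    and \<beta> :: "real^'n \<Rightarrow> real^'n \<Rightarrow> (real^'n) set"
    and L :: "real^'n \<Rightarrow> (real^'n) \<times> (real^'n) \<Rightarrow> real"
  assumes "inj v" and "independent (range v)"
    and "Q = parallelepiped a v"
    and "p > 1" and "1 / p + 1 / q = 1"
    and "class_M p q \<beta>" and "periodic_wrt v \<beta>"
    and "(\<lambda>(x, z). L x z) \<in> borel_measurable (lebesgue \<Otimes>\<^sub>M borel)"
    and "\<And>x. selfdual_Lagrangian (\<lambda>z. ereal (L x z))"
    and "periodic_wrt v L"
    and "growth_condition p q Q v L"
    and "AE x in lebesgue. \<beta> x = selfdual_subdiff (\<lambda>z. ereal (L x z))"
  shows "(\<forall>\<xi> \<eta>. L_hom p q Q v L (\<xi>, \<eta>) \<in> ereal ` hom_energies p q Q v L \<xi> \<eta>) \<and>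
         selfdual_Lagrangian (L_hom p q Q v L) \<and>
         beta_hom p q Q v \<beta> = selfdual_subdiff (L_hom p q Q v L)"
proof -
  interpret parallelepiped_lattice a v by (rule parallelepiped_lattice.intro) fact+
  have Q: "Q = parallelepiped a v" by fact
  have Qs: "parallelepiped a v \<inter> space lebesgue \<in> sets lebesgue" using open_parallelepiped by simp
  have AE_on_Q: "AE x in cellM. P x" if "AE x in lebesgue. P x" for P
  proof -
    have "AE x in lebesgue. x \<in> parallelepiped a v \<longrightarrow> P x" using that by eventually_elim simp
    then show ?thesis by (simp only: AE_restrict_space_iff[OF Qs])
  qed
  obtain C0 C1 n0 n1 where C: "0 < C0" "0 < C1" and n: "integrable cellM n0" "integrable cellM n1"
    and gr: "AE x in lebesgue. \<forall>a b. C0 * (norm a powr p + norm b powr q - n0 x) \<le> L x (a, b) \<and>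
           L x (a, b) \<le> C1 * (norm a powr p + norm b powr q + n1 x)"
    using assms(11) unfolding growth_condition_def Q by blast
  interpret fm: finite_measure cellM by (rule finite_measure_Q)
  \<comment> \<open>The abstract space \<open>V\<close> becomes the space of periodic gradients on
    the open cell.\<close>
  interpret selfdual_cell_problem cellM p q L "gradients p" C0 C1 n0 n1
  proof unfold_locales
    have "fst \<in> cellM \<Otimes>\<^sub>M borel \<rightarrow>\<^sub>M lebesgue"
      by (rule measurable_compose[OF measurable_fst measurable_restrict_space1[OF measurable_ident, unfolded id_def]])
    then have "(\<lambda>z. (fst z, snd z)) \<in> cellM \<Otimes>\<^sub>M borel \<rightarrow>\<^sub>M lebesgue \<Otimes>\<^sub>M borel"
      by (intro measurable_Pair measurable_snd)
    from measurable_compose[OF this assms(8)]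
    show "(\<lambda>(x, z). L x z) \<in> borel_measurable (cellM \<Otimes>\<^sub>M borel)" by (simp add: case_prod_unfold)
    show "0 < measure cellM (space cellM)" using measure_Q(1) measure_cell_pos by simp
    show "closed_subspace cellM p (gradients p)" by (rule closed_subspace_gradients[OF assms(4)])
  qed (use assms C n AE_on_Q[OF gr] gradients_mean in auto)
  have mass: "measure lebesgue Q = measure cellM (space cellM)" unfolding Q using measure_Q by simp
  have sol: "Lq_sol p q Q v = annihilator cellM q (gradients p)"
    unfolding Lq_sol_def annihilator_def gradients_def Q Lp_on_eq by blast
  have en: "hom_energies p q Q v L \<xi> \<eta> = energies \<xi> \<eta>" for \<xi> \<eta>
    unfolding hom_energies_def energies_def Lq_sharp_def sol mass unfolding Q gradients_def by blast
  have L_hom_eq: "L_hom p q Q v L (\<xi>, \<eta>) = ereal (hom (\<xi>, \<eta>))" for \<xi> \<eta>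
    unfolding L_hom_def prod.case en
  proof (rule antisym)
    have h: "hom (\<xi>, \<eta>) \<in> energies \<xi> \<eta>" "\<And>e. e \<in> energies \<xi> \<eta> \<Longrightarrow> hom (\<xi>, \<eta>) \<le> e"
      by (rule hom_minimum[of \<xi> \<eta>]; blast)+
    show "(INF e\<in>energies \<xi> \<eta>. ereal e) \<le> ereal (hom (\<xi>, \<eta>))" using h(1) by (rule INF_lower)
    show "ereal (hom (\<xi>, \<eta>)) \<le> (INF e\<in>energies \<xi> \<eta>. ereal e)" using h(2) by (intro INF_greatest) simp
  qed
  then have L_hom: "L_hom p q Q v L = (\<lambda>z. ereal (hom z))" by (auto simp: fun_eq_iff)
  have sub: "AE x in cellM. \<beta> x = selfdual_subdiff (\<lambda>z. ereal (L x z))" by (rule AE_on_Q) fact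
  \<comment> \<open>The identity for \<open>\<beta>\<close> holds at almost every y for all
    arguments simultaneously, so it may be used at the varying point \<xi> + G y.\<close>
  have "(AE y in cellM. g y \<in> \<beta> y (\<xi> + G y)) \<longleftrightarrow> (AE y in cellM. L y (\<xi> + G y, g y) = inner (\<xi> + G y) (g y))" for g G \<xi>
  proof
    show "AE y in cellM. L y (\<xi> + G y, g y) = inner (\<xi> + G y) (g y)" if "AE y in cellM. g y \<in> \<beta> y (\<xi> + G y)"
      using that sub by eventually_elim (simp add: selfdual_subdiff_def)
    show "AE y in cellM. g y \<in> \<beta> y (\<xi> + G y)" if "AE y in cellM. L y (\<xi> + G y, g y) = inner (\<xi> + G y) (g y)"
      using that sub by eventually_elim (simp add: selfdual_subdiff_def)
  qed
  then have "beta_hom p q Q v \<beta> \<xi> = selfdual_subdiff (\<lambda>z. ereal (hom z)) \<xi>" for \<xi>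
    unfolding hom_subdiff beta_hom_def sol mass unfolding Q gradients_def by blast
  then show ?thesis
    unfolding L_hom en using hom_selfdual by (auto intro: hom_minimum)
qed

end
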